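(* Let $s>3/2$, let $p\ge1$ be an integer, $\gamma\in\{1,-1\}$, let $a\in H^s(\mathbb{R}^2)$ and $u_0\in X^s$. Then there exists $T>0$ such that the initial-value problem $$u_t+u_x+u^pu_x-u_{xxt}+\gamma\,\partial_x^{-1}u_{yy}+a(x,y)u=0,\qquad u(\cdot,\cdot,0)=u_0,$$ has a unique solution $u\in C([0,T];X^s)\cap C^1([0,T];H^{s-2}(\mathbb{R}^2))$. In particular $u\in C([0,T];H^s(\mathbb{R}^2))$ and $\partial_x^{-1}u_y\in C([0,T];H^{s-1}(\mathbb{R}^2))$, and the solution depends continuously in these function classes on $u_0\in X^s$.
   Context: Fourier transform is taken in $(x,y)$ with dual variables $(\xi,\eta)$; $\partial_x^{-1}$ denotes the Fourier multiplier $1/(i\xi)$, so $\partial_x^{-1}f_y$ has symbol $\eta/\xi$. $X^s=\{f\in H^s(\mathbb{R}^2):\partial_x^{-1}f_y\in H^{s-1}(\mathbb{R}^2)\}$ with norm $\|f\|_{X^s}^2=\|f\|_{H^s}^2+\|\partial_x^{-1}f_y\|_{H^{s-1}}^2$. A solution means a function in the stated class satisfying the equation in the sense of distributions (equivalently, the associated Duhamel integral formula with the free group $\widehat{K_tf}=e^{-it(\xi^2+\gamma\eta^2)/(\xi(1+\xi^2))}\hat f$). *)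

theory Defs
  imports "HOL-Analysis.Analysis"
begin

text \<open>Points of the plane are pairs (x,y); frequencies are pairs (xi,eta).
  The Fourier transform of an L2 function is defined by Plancherel's construction:
  the L2-limit of the Fourier integrals of the truncations to balls.\<close>

definition sq_integrable :: "(real \<times> real \<Rightarrow> real) \<Rightarrow> bool" where
  "sq_integrable f \<longleftrightarrow> f \<in> borel_measurable lborel \<and>
     (\<integral>\<^sup>+ x. ennreal ((f x)\<^sup>2) \<partial>lborel) < \<infinity>"

definition trunc_ft :: "(real \<times> real \<Rightarrow> real) \<Rightarrow> real \<Rightarrow> real \<times> real \<Rightarrow> complex" where
  "trunc_ft f R \<zeta> = (\<integral> x. indicator (ball 0 R) x *\<^sub>R (complex_of_real (f x) * cis (- (x \<bullet> \<zeta>))) \<partial>lborel)"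

definition is_l2_ft :: "(real \<times> real \<Rightarrow> real) \<Rightarrow> (real \<times> real \<Rightarrow> complex) \<Rightarrow> bool" where
  "is_l2_ft f F \<longleftrightarrow> sq_integrable f \<and> F \<in> borel_measurable lborel \<and>
     (\<integral>\<^sup>+ \<zeta>. ennreal ((cmod (F \<zeta>))\<^sup>2) \<partial>lborel) < \<infinity> \<and>
     ((\<lambda>R. \<integral>\<^sup>+ \<zeta>. ennreal ((cmod (F \<zeta> - trunc_ft f R \<zeta>))\<^sup>2) \<partial>lborel) \<longlongrightarrow> 0) at_top"

definition ft :: "(real \<times> real \<Rightarrow> real) \<Rightarrow> real \<times> real \<Rightarrow> complex" where
  "ft f = (SOME F. is_l2_ft f F)"

definition sob_weight :: "real \<Rightarrow> real \<times> real \<Rightarrow> real" where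
  "sob_weight s \<zeta> = (1 + (fst \<zeta>)\<^sup>2 + (snd \<zeta>)\<^sup>2) powr s"

definition wdist2 :: "real \<Rightarrow> (real \<times> real \<Rightarrow> complex) \<Rightarrow> (real \<times> real \<Rightarrow> complex) \<Rightarrow> ennreal" where
  "wdist2 s F G = (\<integral>\<^sup>+ \<zeta>. ennreal (sob_weight s \<zeta> * (cmod (F \<zeta> - G \<zeta>))\<^sup>2) \<partial>lborel)"

definition wL2 :: "real \<Rightarrow> (real \<times> real \<Rightarrow> complex) \<Rightarrow> bool" where
  "wL2 s F \<longleftrightarrow> F \<in> borel_measurable lborel \<and> wdist2 s F (\<lambda>_. 0) < \<infinity>"

definition dxinv_dy :: "(real \<times> real \<Rightarrow> complex) \<Rightarrow> real \<times> real \<Rightarrow> complex" where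
  "dxinv_dy F \<zeta> = complex_of_real (snd \<zeta> / fst \<zeta>) * F \<zeta>"

definition in_Hs :: "real \<Rightarrow> (real \<times> real \<Rightarrow> real) \<Rightarrow> bool" where
  "in_Hs s f \<longleftrightarrow> sq_integrable f \<and> wL2 s (ft f)"

definition in_Xs :: "real \<Rightarrow> (real \<times> real \<Rightarrow> real) \<Rightarrow> bool" where
  "in_Xs s f \<longleftrightarrow> sq_integrable f \<and> wL2 s (ft f) \<and> wL2 (s - 1) (dxinv_dy (ft f))"

definition xs_dist2 :: "real \<Rightarrow> (real \<times> real \<Rightarrow> real) \<Rightarrow> (real \<times> real \<Rightarrow> real) \<Rightarrow> ennreal" where
  "xs_dist2 s f g = wdist2 s (ft f) (ft g) + wdist2 (s - 1) (dxinv_dy (ft f)) (dxinv_dy (ft g))"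

text \<open>Fourier side of the right-hand side of
  u_t = -(1-\<partial>_x^2)^{-1}[u_x + u^p u_x + \<gamma> \<partial>_x^{-1}u_yy + a u],
  using u^p u_x = \<partial>_x(u^{p+1})/(p+1), with ft f(\<xi>,\<eta>) = \<integral> f(x) e^{-i x\<cdot>\<zeta>}.\<close>
definition eq_rhs :: "nat \<Rightarrow> real \<Rightarrow> (real \<times> real \<Rightarrow> real) \<Rightarrow> (real \<times> real \<Rightarrow> real)
    \<Rightarrow> real \<times> real \<Rightarrow> complex" where
  "eq_rhs p \<gamma> a w \<zeta> =
     (let \<xi> = fst \<zeta>; \<eta> = snd \<zeta> in
       - \<i> * complex_of_real ((\<xi>\<^sup>2 + \<gamma> * \<eta>\<^sup>2) / (\<xi> * (1 + \<xi>\<^sup>2))) * ft w \<zeta>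
       - \<i> * complex_of_real (\<xi> / ((real p + 1) * (1 + \<xi>\<^sup>2))) * ft (\<lambda>x. (w x) ^ (p + 1)) \<zeta>
       - ft (\<lambda>x. a x * w x) \<zeta> / complex_of_real (1 + \<xi>\<^sup>2))"

text \<open>u is a solution on [0,T] in C([0,T];X^s) \<inter> C^1([0,T];H^{s-2}), with V t the
  Fourier transform of the time derivative u_t(t) \<in> H^{s-2}.\<close>
definition is_sol :: "real \<Rightarrow> nat \<Rightarrow> real \<Rightarrow> (real \<times> real \<Rightarrow> real) \<Rightarrow> (real \<times> real \<Rightarrow> real)
    \<Rightarrow> real \<Rightarrow> (real \<Rightarrow> real \<times> real \<Rightarrow> real) \<Rightarrow> (real \<Rightarrow> real \<times> real \<Rightarrow> complex) \<Rightarrow> bool" where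
  "is_sol s p \<gamma> a u0 T u V \<longleftrightarrow>
     (\<forall>t\<in>{0..T}. in_Xs s (u t)) \<and>
     (\<forall>t\<in>{0..T}. ((\<lambda>\<tau>. xs_dist2 s (u \<tau>) (u t)) \<longlongrightarrow> 0) (at t within {0..T})) \<and>
     (\<forall>t\<in>{0..T}. wL2 (s - 2) (V t)) \<and>
     (\<forall>t\<in>{0..T}. ((\<lambda>\<tau>. wdist2 (s - 2) (V \<tau>) (V t)) \<longlongrightarrow> 0) (at t within {0..T})) \<and>
     (\<forall>t\<in>{0..T}. ((\<lambda>\<tau>. wdist2 (s - 2)
          (\<lambda>\<zeta>. (ft (u \<tau>) \<zeta> - ft (u t) \<zeta>) / complex_of_real (\<tau> - t)) (V t)) \<longlongrightarrow> 0)
        (at t within {0..T})) \<and>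
     (AE x in lborel. u 0 x = u0 x) \<and>
     (\<forall>t\<in>{0..T}. AE \<zeta> in lborel. V t \<zeta> = eq_rhs p \<gamma> a (u t) \<zeta>)"

end

theory Submission
  imports Defs "HOL-Probability.Characteristic_Functions"
begin

text \<open>Everything is done on the Fourier side. There \<open>u\<close> solves, for each frequency, the scalar
  equation \<open>z' = - i c z + g\<close> with real \<open>c\<close>, whose forcing \<open>g\<close> is built from convolution powers of
  \<open>u\<close> and from the convolution with the transform of \<open>a\<close>. As \<open>H\<^sup>s\<close> is a convolution algebra, Picard
  iteration converges, in the norm of the supremum over time taken frequency by frequency; this
  supremum also serves as the majorant for every limit in time.

  The difficulty is \<open>\<eta>/\<xi>\<close> times the transform of \<open>a u\<close>, which need not vanish at \<open>\<xi> = 0\<close>. There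
  \<open>c\<close> is as large as \<open>\<eta>\<^sup>2/\<xi>\<close>, so the forcing oscillates against \<open>exp (- i c t)\<close>: integrating by
  parts in time trades the factor \<open>\<eta>/\<xi>\<close> for \<open>1/\<eta>\<close> at the price of \<open>u\<^sub>t\<close>, which lies in
  \<open>H\<close> of order \<open>s - 2\<close>. Where \<open>\<xi>\<close> and \<open>\<eta>\<close> are both small, interpolating between the two bounds
  leaves a square-integrable singularity.

  Uniqueness is an energy argument in \<open>L\<^sup>2\<close>, where the dispersive term is skew; it is localised to
  balls of frequencies, on which the difference quotients converge in \<open>L\<^sup>2\<close>.\<close>

section \<open>Weighted norms and convolutions\<close>

text \<open>The condition s > 3/2 comes from the product with \<open>a\<close> at the order s - 2 of
  u_t: it is bounded when |s - 2| + 1 < s, which for s below 2 says exactly s > 3/2. The nonlinear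
  term does no harm to the singular quotient, as its multiplier carries a factor xi. Bounding the
  quotient by u_t and u_t by the quotient is circular. The circle closes because u_t enters the
  first bound with a factor T^2 (norms are squared throughout), so a small T makes the product of
  the two constants at most 1/2. The contraction itself runs at order s alone; the quotient and u_t
  are merely kept bounded along the iterates. A given solution is continuous in norm, but nothing
  controls its supremum over time at each frequency, so the contraction does not apply to it and
  uniqueness needs its own proof. There the difference of the forcing terms is not local in
  frequency, and the full L^2 energy is not known to be differentiable. Therefore a bound for the
  full energy is fed into the localised energies and comes back halved, again and again.\<close>

type_synonym plane = "real \<times> real"

abbreviation Borel :: "('a::topological_space \<Rightarrow> 'b::topological_space) \<Rightarrow> bool"
  where "Borel f \<equiv> f \<in> borel_measurable borel"

section \<open>Reflections and translations of Lebesgue measure\<close>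

lemma distr_reflect_lborel:
  "distr lborel borel (\<lambda>z. c - z) = (lborel :: 'a::euclidean_space measure)"
  using lborel_affine[of "-1" c] by (simp add: density_1)

lemma nn_integral_lborel_reflect:
  fixes f :: "'a::euclidean_space \<Rightarrow> ennreal"
  assumes [measurable]: "Borel f"
  shows "(\<integral>\<^sup>+z. f (c - z) \<partial>lborel) = (\<integral>\<^sup>+z. f z \<partial>lborel)"
  by (subst (2) distr_reflect_lborel[of c, symmetric]) (simp add: nn_integral_distr)

lemma nn_integral_lborel_translate:
  fixes f :: "'a::euclidean_space \<Rightarrow> ennreal"
  assumes [measurable]: "Borel f"
  shows "(\<integral>\<^sup>+z. f (z - c) \<partial>lborel) = (\<integral>\<^sup>+z. f z \<partial>lborel)"
  by (subst (2) lborel_distr_plus[of "-c", symmetric]) (simp add: nn_integral_distr)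

lemma ennreal_add_square_le:
  fixes a b :: ennreal
  shows "(a + b)\<^sup>2 \<le> 2 * a\<^sup>2 + 2 * b\<^sup>2"
proof -
  have "(a + b)\<^sup>2 = a\<^sup>2 + b\<^sup>2 + 2 * a * b"
    by (rule power2_sum)
  also have "\<dots> \<le> a\<^sup>2 + b\<^sup>2 + (a\<^sup>2 + b\<^sup>2)"
    by (intro add_left_mono sum_of_squares_ge_ennreal)
  finally show ?thesis by (simp add: mult_2 ac_simps)
qed

lemma ennreal_square_mono: "a \<le> b \<Longrightarrow> a\<^sup>2 \<le> (b::ennreal)\<^sup>2"
  by (intro power_mono) auto

text \<open>Values in \<open>ennreal\<close> allow convolution estimates to be stated before any
  integrability is known; finiteness is read off from them afterwards.\<close>

definition econv :: "(plane \<Rightarrow> ennreal) \<Rightarrow> (plane \<Rightarrow> ennreal) \<Rightarrow> plane \<Rightarrow> ennreal" where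
  "econv A B \<z> = (\<integral>\<^sup>+z. A (\<z> - z) * B z \<partial>lborel)"

text \<open>This is the square of the norm.\<close>

definition nrm :: "real \<Rightarrow> (plane \<Rightarrow> ennreal) \<Rightarrow> ennreal" where
  "nrm s A = (\<integral>\<^sup>+\<z>. (ennreal (sob_weight (s/2) \<z>) * A \<z>)\<^sup>2 \<partial>lborel)"

lemma sob_weight_pos [simp]: "0 < sob_weight s \<z>"
proof -
  have "0 < 1 + (fst \<z>)\<^sup>2 + (snd \<z>)\<^sup>2" by (smt (verit) zero_le_power2)
  then show ?thesis unfolding sob_weight_def by (subst powr_gt_zero) linarith
qed

lemma sob_weight_nonneg [simp]: "0 \<le> sob_weight s \<z>"
  using sob_weight_pos[of s \<z>] by linarith

lemma sob_weight_measurable [measurable]: "Borel (sob_weight s)"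
  unfolding sob_weight_def by (subst borel_prod[symmetric]) measurable

lemma sob_weight_0 [simp]: "sob_weight 0 \<z> = 1"
proof -
  have "0 < 1 + (fst \<z>)\<^sup>2 + (snd \<z>)\<^sup>2" by (smt (verit) zero_le_power2)
  then show ?thesis by (simp add: sob_weight_def)
qed

lemma sob_weight_add: "sob_weight (s + r) \<z> = sob_weight s \<z> * sob_weight r \<z>"
  by (simp add: sob_weight_def powr_add)

lemma sob_weight_half_square: "(sob_weight (s/2) \<z>)\<^sup>2 = sob_weight s \<z>"
  by (simp add: power2_eq_square sob_weight_add[symmetric])

lemma sob_weight_base_ge_1: "1 \<le> 1 + (x::real)\<^sup>2 + y\<^sup>2"
  by (smt (verit) zero_le_power2)

lemma sob_weight_mono: "s \<le> r \<Longrightarrow> sob_weight s \<z> \<le> sob_weight r \<z>"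
  unfolding sob_weight_def by (intro powr_mono sob_weight_base_ge_1)

lemma nrm_alt:
  assumes "\<And>\<z>. F \<z> = ennreal (f \<z>)" "\<And>\<z>. 0 \<le> f \<z>"
  shows "nrm s F = (\<integral>\<^sup>+\<z>. ennreal (sob_weight s \<z> * (f \<z>)\<^sup>2) \<partial>lborel)"
  unfolding nrm_def assms(1)
  by (intro nn_integral_cong)
     (simp add: ennreal_mult[symmetric] ennreal_power power_mult_distrib sob_weight_half_square assms)

lemma nrm_0: "nrm 0 A = (\<integral>\<^sup>+\<z>. (A \<z>)\<^sup>2 \<partial>lborel)"
  by (simp add: nrm_def)

lemma nrm_weight: "nrm s A = nrm 0 (\<lambda>\<z>. ennreal (sob_weight (s/2) \<z>) * A \<z>)"
  by (simp add: nrm_def)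

lemma wdist2_eq_nrm: "wdist2 s F G = nrm s (\<lambda>\<z>. ennreal (cmod (F \<z> - G \<z>)))"
  unfolding wdist2_def by (subst nrm_alt[where f="\<lambda>\<z>. cmod (F \<z> - G \<z>)"]) auto

lemma nrm_mono: "(\<And>\<z>. A \<z> \<le> B \<z>) \<Longrightarrow> nrm s A \<le> nrm s B"
  unfolding nrm_def by (intro nn_integral_mono power_mono mult_left_mono) auto

lemma nrm_mono_AE: "(AE \<z> in lborel. A \<z> \<le> B \<z>) \<Longrightarrow> nrm s A \<le> nrm s B"
  unfolding nrm_def
  by (intro nn_integral_mono_AE) (auto elim!: eventually_mono intro!: power_mono mult_left_mono)

lemma nrm_cong_AE: "(AE \<z> in lborel. A \<z> = B \<z>) \<Longrightarrow> nrm s A = nrm s B"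
  unfolding nrm_def
  by (intro nn_integral_cong_AE) (auto elim!: eventually_mono)

lemma nrm_mono_weight: "s \<le> r \<Longrightarrow> nrm s A \<le> nrm r A"
  unfolding nrm_def
  by (intro nn_integral_mono power_mono mult_right_mono) (auto intro!: ennreal_leI sob_weight_mono)

lemma nrm_cmult:
  assumes [measurable]: "Borel A"
  shows "nrm s (\<lambda>\<z>. c * A \<z>) = c\<^sup>2 * nrm s A"
  unfolding nrm_def
  by (subst nn_integral_cmult[symmetric]) (auto intro!: nn_integral_cong simp: power_mult_distrib ac_simps)

lemma nrm_add:
  assumes [measurable]: "Borel A" "Borel B"
  shows "nrm s (\<lambda>\<z>. A \<z> + B \<z>) \<le> 2 * nrm s A + 2 * nrm s B"
proof -
  have "nrm s (\<lambda>\<z>. A \<z> + B \<z>)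
     \<le> (\<integral>\<^sup>+\<z>. 2 * (ennreal (sob_weight (s/2) \<z>) * A \<z>)\<^sup>2 + 2 * (ennreal (sob_weight (s/2) \<z>) * B \<z>)\<^sup>2 \<partial>lborel)"
    unfolding nrm_def distrib_left by (intro nn_integral_mono ennreal_add_square_le)
  also have "\<dots> = 2 * nrm s A + 2 * nrm s B"
    unfolding nrm_def by (subst nn_integral_add) (auto simp: nn_integral_cmult)
  finally show ?thesis .
qed

lemma econv_measurable [measurable]:
  assumes [measurable]: "Borel A" "Borel B"
  shows "Borel (econv A B)"
proof -
  have "Borel (\<lambda>\<z>. \<integral>\<^sup>+z. A (\<z> - z) * B z \<partial>lborel)"
    by measurable
  then show ?thesis by (simp add: econv_def[abs_def])
qed

lemma econv_mono: "(\<And>z. A z \<le> A' z) \<Longrightarrow> (\<And>z. B z \<le> B' z) \<Longrightarrow> econv A B \<z> \<le> econv A' B' \<z>"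
  unfolding econv_def by (intro nn_integral_mono mult_mono) auto

lemma econv_commute:
  assumes [measurable]: "Borel A" "Borel B"
  shows "econv A B \<z> = econv B A \<z>"
  unfolding econv_def
  by (subst nn_integral_lborel_reflect[where c=\<z>, symmetric]) (auto simp: mult.commute)

text \<open>Whatever inequality relates a weight at a frequency to weights at its two summands moves
  the weight inside the convolution. Peetre's inequality is the case of interest.\<close>

lemma econv_weight:
  assumes "\<And>z. w \<z> \<le> a (\<z> - z) * b z"
    and [measurable]: "Borel A" "Borel B"
  shows "w \<z> * econv A B \<z> \<le> econv (\<lambda>z. a z * A z) (\<lambda>z. b z * B z) \<z>"
proof -
  have "w \<z> * econv A B \<z> = (\<integral>\<^sup>+z. w \<z> * (A (\<z> - z) * B z) \<partial>lborel)"
    unfolding econv_def by (subst nn_integral_cmult) auto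
  also have "\<dots> \<le> (\<integral>\<^sup>+z. (a (\<z> - z) * A (\<z> - z)) * (b z * B z) \<partial>lborel)"
  proof (rule nn_integral_mono)
    fix z
    have "w \<z> * (A (\<z> - z) * B z) \<le> (a (\<z> - z) * b z) * (A (\<z> - z) * B z)"
      using assms(1) by (intro mult_right_mono) auto
    then show "w \<z> * (A (\<z> - z) * B z) \<le> (a (\<z> - z) * A (\<z> - z)) * (b z * B z)"
      by (simp add: ac_simps)
  qed
  finally show ?thesis by (simp add: econv_def)
qed

text \<open>Cauchy-Schwarz at a single frequency. The Picard limits are taken frequency by
  frequency, so bounds at each point are wanted next to bounds in norm.\<close>

lemma econv_sup:
  assumes [measurable]: "Borel A" "Borel B"
  shows "(econv A B \<z>)\<^sup>2 \<le> nrm 0 A * nrm 0 B"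
proof -
  have "(econv A B \<z>)\<^sup>2 \<le> (\<integral>\<^sup>+z. (A (\<z> - z))\<^sup>2 \<partial>lborel) * (\<integral>\<^sup>+z. (B z)\<^sup>2 \<partial>lborel)"
    unfolding econv_def by (rule Cauchy_Schwarz_nn_integral) auto
  also have "(\<integral>\<^sup>+z. (A (\<z> - z))\<^sup>2 \<partial>lborel) = (\<integral>\<^sup>+z. (A z)\<^sup>2 \<partial>lborel)"
    by (rule nn_integral_lborel_reflect[of "\<lambda>z. (A z)\<^sup>2"]) auto
  finally show ?thesis by (simp add: nrm_0)
qed

text \<open>Cauchy-Schwarz with the factor \<open>A\<close> split into two square roots, followed by
  Tonelli.\<close>

lemma Young_L1_L2:
  assumes [measurable]: "Borel A" "Borel B"
  shows "nrm 0 (econv A B) \<le> (\<integral>\<^sup>+z. A z \<partial>lborel)\<^sup>2 * nrm 0 B"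
proof (cases "(\<integral>\<^sup>+z. A z \<partial>lborel) = \<infinity>")
  case True
  \<comment> \<open>Infinity times 0 is 0 in \<open>ennreal\<close>, so the right-hand side is
    infinite only if \<open>nrm 0 B\<close> is nonzero. Otherwise \<open>B\<close> vanishes almost
    everywhere and the convolution is 0.\<close>
  show ?thesis
  proof (cases "nrm 0 B = 0")
    case True
    then have "AE z in lborel. B z = 0"
      unfolding nrm_0 by (subst (asm) nn_integral_0_iff_AE) auto
    then have "econv A B \<z> = 0" for \<z>
      unfolding econv_def by (subst nn_integral_0_iff_AE) (auto elim!: eventually_mono)
    then show ?thesis by (simp add: nrm_0)
  next
    case False
    with True \<open>integral\<^sup>N lborel A = \<infinity>\<close> show ?thesis
      by (simp add: ennreal_top_mult power2_eq_square ennreal_mult_top)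
  qed
next
  case fin: False
  define S where "S = (\<integral>\<^sup>+z. A z \<partial>lborel)"
  have pt: "(econv A B \<z>)\<^sup>2 \<le> S * (\<integral>\<^sup>+z. A (\<z> - z) * (B z)\<^sup>2 \<partial>lborel)" for \<z>
  proof -
    \<comment> \<open>The square root of \<open>A\<close>, except that \<open>enn2real\<close> sends
      infinity to 0; this changes only a null set, as the integral of \<open>A\<close> is
      finite.\<close>
    define r where "r z = ennreal (sqrt (enn2real (A z)))" for z
    have [measurable]: "Borel r" unfolding r_def by measurable
    have ae: "AE z in lborel. A z \<noteq> \<infinity>"
      using fin by (intro nn_integral_PInf_AE) auto
    have "AE z in lborel. (r z)\<^sup>2 = A z"
      using ae
    proof eventually_elim
      case (elim z)
      then show ?case unfolding r_def
        by (cases "A z") (auto simp: ennreal_power)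
    qed
    then have "AE z in distr lborel borel (\<lambda>z. \<z> - z). (r z)\<^sup>2 = A z"
      by (subst distr_reflect_lborel)
    then have ae2: "AE z in lborel. (r (\<z> - z))\<^sup>2 = A (\<z> - z)"
      by (subst (asm) AE_distr_iff) auto
    have "econv A B \<z> = (\<integral>\<^sup>+z. r (\<z> - z) * (r (\<z> - z) * B z) \<partial>lborel)"
      unfolding econv_def using ae2
      by (intro nn_integral_cong_AE) (auto elim!: eventually_mono simp: power2_eq_square mult.assoc[symmetric])
    also have "\<dots>\<^sup>2 \<le> (\<integral>\<^sup>+z. (r (\<z> - z))\<^sup>2 \<partial>lborel) * (\<integral>\<^sup>+z. (r (\<z> - z) * B z)\<^sup>2 \<partial>lborel)"
      by (rule Cauchy_Schwarz_nn_integral) auto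
    also have "(\<integral>\<^sup>+z. (r (\<z> - z))\<^sup>2 \<partial>lborel) = (\<integral>\<^sup>+z. A (\<z> - z) \<partial>lborel)"
      using ae2 by (intro nn_integral_cong_AE)
    also have "\<dots> = S" unfolding S_def by (rule nn_integral_lborel_reflect) auto
    also have "(\<integral>\<^sup>+z. (r (\<z> - z) * B z)\<^sup>2 \<partial>lborel) = (\<integral>\<^sup>+z. A (\<z> - z) * (B z)\<^sup>2 \<partial>lborel)"
      using ae2 by (intro nn_integral_cong_AE) (auto elim!: eventually_mono simp: power_mult_distrib)
    finally show ?thesis .
  qed
  have "nrm 0 (econv A B) \<le> (\<integral>\<^sup>+\<z>. S * (\<integral>\<^sup>+z. A (\<z> - z) * (B z)\<^sup>2 \<partial>lborel) \<partial>lborel)"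
    unfolding nrm_0 by (intro nn_integral_mono pt)
  also have "\<dots> = S * (\<integral>\<^sup>+\<z>. (\<integral>\<^sup>+z. A (\<z> - z) * (B z)\<^sup>2 \<partial>lborel) \<partial>lborel)"
    by (subst nn_integral_cmult) auto
  also have "(\<integral>\<^sup>+\<z>. (\<integral>\<^sup>+z. A (\<z> - z) * (B z)\<^sup>2 \<partial>lborel) \<partial>lborel)
     = (\<integral>\<^sup>+z. (\<integral>\<^sup>+\<z>. A (\<z> - z) * (B z)\<^sup>2 \<partial>lborel) \<partial>lborel)"
    by (rule lborel_pair.Fubini'[symmetric]) measurable
  also have "\<dots> = (\<integral>\<^sup>+z. S * (B z)\<^sup>2 \<partial>lborel)"
    by (intro nn_integral_cong)
       (simp add: nn_integral_multc S_def nn_integral_lborel_translate[of A])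
  also have "\<dots> = S * nrm 0 B" by (simp add: nn_integral_cmult nrm_0)
  finally show ?thesis by (simp add: S_def power2_eq_square mult.assoc)
qed

section \<open>Weights at sums of frequencies\<close>

lemma quadratic_weight_le:
  fixes \<z> z :: "plane"
  shows "1 + (fst \<z>)\<^sup>2 + (snd \<z>)\<^sup>2 \<le>
    2 * ((1 + (fst (\<z> - z))\<^sup>2 + (snd (\<z> - z))\<^sup>2) + (1 + (fst z)\<^sup>2 + (snd z)\<^sup>2))"
proof -
  have *: "x\<^sup>2 \<le> 2 * (x - y)\<^sup>2 + 2 * y\<^sup>2" for x y :: real
    using zero_le_power2[of "x - 2 * y"] by (simp add: power2_eq_square algebra_simps)
  show ?thesis using *[of "fst \<z>" "fst z"] *[of "snd \<z>" "snd z"] by simp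
qed

lemma Peetre_base:
  fixes \<z> z :: "plane"
  shows "1 + (fst \<z>)\<^sup>2 + (snd \<z>)\<^sup>2 \<le>
    4 * (1 + (fst (\<z> - z))\<^sup>2 + (snd (\<z> - z))\<^sup>2) * (1 + (fst z)\<^sup>2 + (snd z)\<^sup>2)"
proof -
  have "2 * (a + b) \<le> 4 * a * b" if "1 \<le> a" "1 \<le> b" for a b :: real
  proof -
    have "0 \<le> (a - 1) * b" "0 \<le> (b - 1) * a" using that by auto
    then show ?thesis by (simp add: algebra_simps)
  qed
  from this[OF sob_weight_base_ge_1[of "fst (\<z> - z)" "snd (\<z> - z)"] sob_weight_base_ge_1[of "fst z" "snd z"]]
  show ?thesis using quadratic_weight_le[of \<z> z] by simp
qed

text \<open>The base inequality raised to the power \<open>r\<close>. For negative \<open>r\<close>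
  the base inequality with the roles of \<open>\<z>\<close> and \<open>z\<close> exchanged is raised
  to \<open>-r\<close>, and multiplication by \<open>a powr r * c powr r\<close> turns it
  around.\<close>

lemma Peetre:
  "sob_weight r \<z> \<le> 4 powr \<bar>r\<bar> * sob_weight \<bar>r\<bar> (\<z> - z) * sob_weight r z"
proof -
  define a b c where "a = 1 + (fst \<z>)\<^sup>2 + (snd \<z>)\<^sup>2" and "b = 1 + (fst (\<z> - z))\<^sup>2 + (snd (\<z> - z))\<^sup>2"
    and "c = 1 + (fst z)\<^sup>2 + (snd z)\<^sup>2"
  have pos: "1 \<le> a" "1 \<le> b" "1 \<le> c" unfolding a_def b_def c_def by (auto intro: sob_weight_base_ge_1)
  have 1: "a \<le> 4 * b * c" using Peetre_base[of \<z> z] by (simp add: a_def b_def c_def)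
  have 2: "c \<le> 4 * b * a" using Peetre_base[of z \<z>]
    by (simp add: a_def b_def c_def power2_commute)
  have "a powr r \<le> 4 powr \<bar>r\<bar> * b powr \<bar>r\<bar> * c powr r"
  proof (cases "0 \<le> r")
    case True
    have "a powr r \<le> (4 * b * c) powr r" using 1 pos True by (intro powr_mono2) auto
    then show ?thesis using True pos by (simp add: powr_mult)
  next
    case False
    have "c powr (-r) \<le> (4 * b * a) powr (-r)" using 2 pos False by (intro powr_mono2) auto
    then have "c powr (-r) \<le> 4 powr (-r) * b powr (-r) * a powr (-r)" using pos by (simp add: powr_mult)
    then have "c powr (-r) * (a powr r * c powr r) \<le> 4 powr (-r) * b powr (-r) * a powr (-r) * (a powr r * c powr r)"
      by (intro mult_right_mono) auto
    moreover have 1: "c powr (-r) * c powr r = 1" and 2: "a powr (-r) * a powr r = 1"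
      using pos by (auto simp: powr_add[symmetric])
    moreover have "c powr (-r) * (a powr r * c powr r) = a powr r"
      using 1 by (metis mult.left_commute mult.right_neutral)
    moreover have "4 powr (-r) * b powr (-r) * a powr (-r) * (a powr r * c powr r)
        = 4 powr (-r) * b powr (-r) * c powr r"
      using 2 by (metis mult.assoc mult.left_neutral)
    ultimately show ?thesis using False by simp
  qed
  then show ?thesis by (simp add: sob_weight_def a_def b_def c_def)
qed

text \<open>In contrast to Peetre's inequality, each summand weighs one frequency only. This leaves
  the other factor of a convolution without weight, as the algebra property requires.\<close>

lemma sob_weight_subadd:
  assumes "0 \<le> r"
  shows "sob_weight r \<z> \<le> 4 powr r * (sob_weight r (\<z> - z) + sob_weight r z)"
proof -
  define a b c where "a = 1 + (fst \<z>)\<^sup>2 + (snd \<z>)\<^sup>2" and "b = 1 + (fst (\<z> - z))\<^sup>2 + (snd (\<z> - z))\<^sup>2"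
    and "c = 1 + (fst z)\<^sup>2 + (snd z)\<^sup>2"
  have pos: "1 \<le> a" "1 \<le> b" "1 \<le> c" unfolding a_def b_def c_def by (auto intro: sob_weight_base_ge_1)
  have "a \<le> 2 * (b + c)" using quadratic_weight_le[of \<z> z] by (simp add: a_def b_def c_def)
  then have "a \<le> 4 * max b c" by (simp add: max_def split: if_splits)
  then have "a powr r \<le> (4 * max b c) powr r" using pos assms by (intro powr_mono2) auto
  also have "\<dots> = 4 powr r * max b c powr r" using pos by (simp add: powr_mult)
  also have "max b c powr r \<le> b powr r + c powr r" by (simp add: max_def)
  finally show ?thesis by (simp add: sob_weight_def a_def b_def c_def)
qed

section \<open>Integrable weights and Sobolev embedding\<close>

lemma nn_integral_japanese_1d:
  assumes "1 < q"
  shows "(\<integral>\<^sup>+x. ennreal ((1 + (x::real)\<^sup>2) powr (- q/2)) \<partial>lborel) < \<infinity>"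
proof -
  let ?f = "\<lambda>x::real. (1 + x\<^sup>2) powr (- q/2)"
  let ?P = "\<lambda>x::real. ennreal (x powr (-q)) * indicator {1..} x"
  have I: "(\<integral>\<^sup>+x. ?P x \<partial>lborel) = ennreal (-(1 powr (-q+1)) / (-q+1))"
    by (intro nn_integral_has_integral_lebesgue' has_integral_powr_to_inf) (use assms in auto)
  have I2: "(\<integral>\<^sup>+x. ?P (-x) \<partial>lborel) = (\<integral>\<^sup>+x. ?P x \<partial>lborel)"
    using nn_integral_lborel_reflect[of ?P 0] by simp
  have "(\<integral>\<^sup>+x. ennreal (?f x) \<partial>lborel) \<le> (\<integral>\<^sup>+x. indicator {-1..1} x + (?P x + ?P (-x)) \<partial>lborel)"
  proof (rule nn_integral_mono)
    fix x :: real
    have *: "?f y \<le> y powr (-q)" if "1 \<le> y" for y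
    proof -
      have "(y\<^sup>2) powr (q/2) \<le> (1 + y\<^sup>2) powr (q/2)" using assms by (intro powr_mono2) auto
      moreover have "(y\<^sup>2) powr (q/2) = y powr q"
        using that by (simp add: powr_powr flip: powr_numeral)
      ultimately have "y powr q \<le> (1 + y\<^sup>2) powr (q/2)" by simp
      moreover have "0 < y powr q" using that by simp
      ultimately show ?thesis using that
        by (simp add: powr_minus le_imp_inverse_le)
    qed
    have one: "?f x \<le> 1" using assms powr_mono[of "-q/2" 0 "1+x\<^sup>2"] by (simp add: add_nonneg_eq_0_iff)
    consider "\<bar>x\<bar> \<le> 1" | "1 < x" | "x < -1" by linarith
    then show "ennreal (?f x) \<le> indicator {-1..1} x + (?P x + ?P (-x))"
    proof cases
      case 1
      then have "ennreal (?f x) \<le> indicator {-1..1} x" using ennreal_leI[OF one] by (auto simp: abs_le_iff)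
      then show ?thesis by (rule order_trans) (rule add_increasing2, auto)
    next
      case 2
      then show ?thesis using *[of x] by (simp add: ennreal_leI)
    next
      case 3
      then show ?thesis using *[of "-x"] by (simp add: ennreal_leI)
    qed
  qed
  also have "\<dots> = 2 + (\<integral>\<^sup>+x. ?P x \<partial>lborel) + (\<integral>\<^sup>+x. ?P x \<partial>lborel)"
    by (simp add: nn_integral_add I2 add.assoc)
  also have "\<dots> < \<infinity>" unfolding I by (simp add: ennreal_add_eq_top less_top)
  finally show ?thesis .
qed

lemma nn_integral_plane_product:
  fixes f g :: "real \<Rightarrow> ennreal"
  assumes [measurable]: "Borel f" "Borel g"
  shows "(\<integral>\<^sup>+\<z>. f (fst \<z>) * g (snd \<z>) \<partial>lborel) = (\<integral>\<^sup>+x. f x \<partial>lborel) * (\<integral>\<^sup>+x. g x \<partial>lborel)"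
proof -
  have "(\<integral>\<^sup>+\<z>. f (fst \<z>) * g (snd \<z>) \<partial>lborel)
     = (\<integral>\<^sup>+\<z>. f (fst \<z>) * g (snd \<z>) \<partial>(lborel \<Otimes>\<^sub>M lborel))" by (simp add: lborel_prod)
  also have "\<dots> = (\<integral>\<^sup>+x. \<integral>\<^sup>+y. f x * g y \<partial>lborel \<partial>lborel)"
    by (subst lborel.nn_integral_fst[symmetric]) auto
  also have "\<dots> = (\<integral>\<^sup>+x. f x \<partial>lborel) * (\<integral>\<^sup>+x. g x \<partial>lborel)"
    by (simp add: nn_integral_cmult nn_integral_multc)
  finally show ?thesis .
qed

text \<open>\<open>(1 + x) * (1 + y) \<le> (1 + x + y)\<^sup>2\<close> reduces the weight to a
  product of one-dimensional weights with half the exponent. The weight is a power of 1 + |zeta|^2,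
  so the threshold in the plane is 1.\<close>

lemma nn_integral_sob_weight:
  assumes "1 < q"
  shows "(\<integral>\<^sup>+\<z>. ennreal (sob_weight (-q) \<z>) \<partial>lborel) < \<infinity>"
proof -
  let ?f = "\<lambda>x::real. ennreal ((1 + x\<^sup>2) powr (- q/2))"
  have "(\<integral>\<^sup>+\<z>. ennreal (sob_weight (-q) \<z>) \<partial>lborel) \<le> (\<integral>\<^sup>+\<z>. ?f (fst \<z>) * ?f (snd \<z>) \<partial>lborel)"
  proof (rule nn_integral_mono)
    fix \<z> :: "plane"
    define x y where "x = (fst \<z>)\<^sup>2" and "y = (snd \<z>)\<^sup>2"
    have nn: "0 \<le> x" "0 \<le> y" by (auto simp: x_def y_def)
    have "(1 + x) * (1 + y) \<le> (1 + x + y)\<^sup>2" using nn by (simp add: power2_eq_square algebra_simps)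
    then have "((1 + x) * (1 + y)) powr (q/2) \<le> ((1 + x + y)\<^sup>2) powr (q/2)"
      using nn assms by (intro powr_mono2) auto
    moreover have "((1 + x + y)\<^sup>2) powr (q/2) = (1 + x + y) powr q"
      using nn by (simp add: powr_powr flip: powr_numeral)
    moreover have "0 < ((1 + x) * (1 + y)) powr (q/2)" using nn by simp
    ultimately have "inverse ((1 + x + y) powr q) \<le> inverse (((1 + x) * (1 + y)) powr (q/2))"
      by (intro le_imp_inverse_le) auto
    then have "(1 + x + y) powr (-q) \<le> (1 + x) powr (-q/2) * (1 + y) powr (-q/2)"
      using nn by (simp add: powr_minus powr_mult)
    then show "ennreal (sob_weight (-q) \<z>) \<le> ?f (fst \<z>) * ?f (snd \<z>)"
      by (simp add: sob_weight_def x_def y_def ennreal_mult[symmetric] ennreal_leI)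
  qed
  also have "\<dots> = (\<integral>\<^sup>+x. ?f x \<partial>lborel) * (\<integral>\<^sup>+x. ?f x \<partial>lborel)"
    by (rule nn_integral_plane_product) auto
  also have "\<dots> < \<infinity>" using nn_integral_japanese_1d[OF assms] by (simp add: ennreal_mult_less_top)
  finally show ?thesis .
qed

lemma L1_weighted_bound:
  assumes [measurable]: "Borel A"
  shows "(\<integral>\<^sup>+z. ennreal (sob_weight (r/2) z) * A z \<partial>lborel)\<^sup>2
    \<le> (\<integral>\<^sup>+\<z>. ennreal (sob_weight (r - s) \<z>) \<partial>lborel) * nrm s A"
proof -
  have "(\<integral>\<^sup>+z. ennreal (sob_weight (r/2) z) * A z \<partial>lborel)
     = (\<integral>\<^sup>+z. ennreal (sob_weight ((r-s)/2) z) * (ennreal (sob_weight (s/2) z) * A z) \<partial>lborel)"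
  proof (intro nn_integral_cong)
    fix z
    have "sob_weight (r/2) z = sob_weight ((r-s)/2) z * sob_weight (s/2) z"
      by (simp add: sob_weight_add[symmetric] field_simps)
    then show "ennreal (sob_weight (r/2) z) * A z
        = ennreal (sob_weight ((r-s)/2) z) * (ennreal (sob_weight (s/2) z) * A z)"
      by (simp add: ennreal_mult mult.assoc)
  qed
  also have "\<dots>\<^sup>2 \<le> (\<integral>\<^sup>+z. (ennreal (sob_weight ((r-s)/2) z))\<^sup>2 \<partial>lborel) * nrm s A"
    unfolding nrm_def by (rule Cauchy_Schwarz_nn_integral) auto
  also have "(\<integral>\<^sup>+z. (ennreal (sob_weight ((r-s)/2) z))\<^sup>2 \<partial>lborel) = (\<integral>\<^sup>+\<z>. ennreal (sob_weight (r - s) \<z>) \<partial>lborel)"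
    by (simp add: ennreal_power sob_weight_half_square)
  finally show ?thesis .
qed

text \<open>Sobolev embedding on the Fourier side: more than one order of regularity beyond
  \<open>r\<close> buys weighted integrability of the transform, by Cauchy-Schwarz against an
  integrable weight.\<close>

lemma L1_bound_ex:
  assumes "1 < s - r"
  obtains K :: real where "0 < K"
    "\<And>A. Borel A \<Longrightarrow>
      (\<integral>\<^sup>+z. ennreal (sob_weight (r/2) z) * A z \<partial>lborel)\<^sup>2 \<le> ennreal K * nrm s A"
proof -
  define K where "K = (\<integral>\<^sup>+\<z>. ennreal (sob_weight (r - s) \<z>) \<partial>lborel)"
  have "K < \<infinity>" using nn_integral_sob_weight[OF assms] by (simp add: K_def)
  then have K: "K \<le> ennreal (enn2real K + 1)" by (cases K) (auto simp: ennreal_leI)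
  show ?thesis
  proof (rule that[of "enn2real K + 1"])
    show "0 < enn2real K + 1" by (simp add: add_nonneg_pos)
    fix A :: "plane \<Rightarrow> ennreal" assume "Borel A"
    from L1_weighted_bound[OF this, of r s]
    have "(\<integral>\<^sup>+z. ennreal (sob_weight (r/2) z) * A z \<partial>lborel)\<^sup>2 \<le> K * nrm s A" by (simp add: K_def)
    also have "\<dots> \<le> ennreal (enn2real K + 1) * nrm s A" by (intro mult_right_mono K) auto
    finally show "(\<integral>\<^sup>+z. ennreal (sob_weight (r/2) z) * A z \<partial>lborel)\<^sup>2 \<le> ennreal (enn2real K + 1) * nrm s A" .
  qed
qed

section \<open>Products in Sobolev spaces\<close>

lemma econv_Peetre:
  assumes [measurable]: "Borel A" "Borel B"
  shows "ennreal (sob_weight (r/2) \<z>) * econv A B \<z> \<le>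
     econv (\<lambda>z. ennreal (4 powr \<bar>r/2\<bar>) * (ennreal (sob_weight (\<bar>r\<bar>/2) z) * A z)) (\<lambda>z. ennreal (sob_weight (r/2) z) * B z) \<z>"
proof -
  have "ennreal (sob_weight (r/2) \<z>) * econv A B \<z> \<le>
     econv (\<lambda>z. (ennreal (4 powr \<bar>r/2\<bar>) * ennreal (sob_weight (\<bar>r\<bar>/2) z)) * A z) (\<lambda>z. ennreal (sob_weight (r/2) z) * B z) \<z>"
    by (rule econv_weight) (use Peetre[of "r/2" \<z>] in \<open>auto simp: ennreal_mult[symmetric] intro!: ennreal_leI\<close>)
  then show ?thesis by (simp add: mult.assoc)
qed

text \<open>Peetre's inequality loads \<open>A\<close> with the order |r| and leaves
  \<open>B\<close> at the order \<open>r\<close>. The estimate therefore also serves negative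
  orders, which occur as s - 2 when s < 2.\<close>

lemma econv_product_nrm:
  assumes [measurable]: "Borel A" "Borel B"
  shows "nrm r (econv A B) \<le> ennreal (4 powr \<bar>r\<bar>) * (\<integral>\<^sup>+z. ennreal (sob_weight (\<bar>r\<bar>/2) z) * A z \<partial>lborel)\<^sup>2 * nrm r B"
proof -
  let ?A = "\<lambda>z. ennreal (4 powr \<bar>r/2\<bar>) * (ennreal (sob_weight (\<bar>r\<bar>/2) z) * A z)"
  let ?B = "\<lambda>z. ennreal (sob_weight (r/2) z) * B z"
  have "nrm r (econv A B) \<le> nrm 0 (econv ?A ?B)"
    by (subst nrm_weight) (intro nrm_mono econv_Peetre; simp)
  also have "\<dots> \<le> (\<integral>\<^sup>+z. ?A z \<partial>lborel)\<^sup>2 * nrm 0 ?B" by (intro Young_L1_L2) auto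
  also have "(\<integral>\<^sup>+z. ?A z \<partial>lborel)\<^sup>2 = ennreal (4 powr \<bar>r\<bar>) * (\<integral>\<^sup>+z. ennreal (sob_weight (\<bar>r\<bar>/2) z) * A z \<partial>lborel)\<^sup>2"
  proof -
    have "(4 powr \<bar>r/2\<bar>)\<^sup>2 = 4 powr \<bar>r\<bar>"
      by (simp only: power2_eq_square powr_add[symmetric]) simp
    then have "(ennreal (4 powr \<bar>r/2\<bar>))\<^sup>2 = ennreal (4 powr \<bar>r\<bar>)"
      by (subst ennreal_power) auto
    then show ?thesis by (simp add: nn_integral_cmult power_mult_distrib)
  qed
  also have "nrm 0 ?B = nrm r B" by (simp add: nrm_weight[of r])
  finally show ?thesis .
qed

text \<open>The companion at one frequency, with Cauchy-Schwarz in place of Young. It lets a norm of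
  order s - 2 control a product at low frequencies.\<close>

lemma econv_product_sup:
  assumes [measurable]: "Borel A" "Borel B"
  shows "(ennreal (sob_weight (r/2) \<z>) * econv A B \<z>)\<^sup>2 \<le> ennreal (4 powr \<bar>r\<bar>) * nrm \<bar>r\<bar> A * nrm r B"
proof -
  let ?A = "\<lambda>z. ennreal (4 powr \<bar>r/2\<bar>) * (ennreal (sob_weight (\<bar>r\<bar>/2) z) * A z)"
  let ?B = "\<lambda>z. ennreal (sob_weight (r/2) z) * B z"
  have "(ennreal (sob_weight (r/2) \<z>) * econv A B \<z>)\<^sup>2 \<le> (econv ?A ?B \<z>)\<^sup>2"
    by (intro ennreal_square_mono econv_Peetre) auto
  also have "\<dots> \<le> nrm 0 ?A * nrm 0 ?B" by (intro econv_sup) auto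
  also have "nrm 0 ?A = ennreal (4 powr \<bar>r\<bar>) * nrm \<bar>r\<bar> A"
  proof -
    have "(4 powr \<bar>r/2\<bar>)\<^sup>2 = 4 powr \<bar>r\<bar>"
      by (simp only: power2_eq_square powr_add[symmetric]) simp
    then have "(ennreal (4 powr \<bar>r/2\<bar>))\<^sup>2 = ennreal (4 powr \<bar>r\<bar>)"
      by (subst ennreal_power) auto
    then show ?thesis by (subst nrm_cmult) (auto simp: nrm_weight[of "\<bar>r\<bar>"])
  qed
  also have "nrm 0 ?B = nrm r B" by (simp add: nrm_weight[of r])
  finally show ?thesis .
qed

text \<open>The weight splits additively over the two frequencies. Whichever factor remains without
  weight is integrable because s > 1, so Young's inequality applies to each part.\<close>

lemma econv_algebra_ex:
  assumes "1 < s"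
  obtains K :: real where "0 < K"
    "\<And>A B. Borel A \<Longrightarrow> Borel B \<Longrightarrow>
      nrm s (econv A B) \<le> ennreal K * nrm s A * nrm s B"
proof -
  obtain K where K: "0 < K"
    "\<And>A. Borel A \<Longrightarrow> (\<integral>\<^sup>+z. A z \<partial>lborel)\<^sup>2 \<le> ennreal K * nrm s A"
    using L1_bound_ex[of s 0] assms by auto
  let ?c = "ennreal (4 powr (s/2))"
  let ?w = "\<lambda>z. ennreal (sob_weight (s/2) z)"
  show ?thesis
  proof (rule that[of "4 * 4 powr s * K"])
    show "0 < 4 * 4 powr s * K" using K by simp
    fix A B :: "plane \<Rightarrow> ennreal"
    assume [measurable]: "Borel A" "Borel B"
    have pt: "?w \<z> * econv A B \<z> \<le> ?c * (econv (\<lambda>z. ?w z * A z) B \<z> + econv A (\<lambda>z. ?w z * B z) \<z>)" for \<z>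
    proof -
      have "?w \<z> * econv A B \<z> = (\<integral>\<^sup>+z. ?w \<z> * (A (\<z> - z) * B z) \<partial>lborel)"
        unfolding econv_def by (subst nn_integral_cmult) auto
      also have "\<dots> \<le> (\<integral>\<^sup>+z. ?c * ((?w (\<z> - z) * A (\<z> - z)) * B z + A (\<z> - z) * (?w z * B z)) \<partial>lborel)"
      proof (rule nn_integral_mono)
        fix z
        have "?w \<z> \<le> ?c * (?w (\<z> - z) + ?w z)"
          using sob_weight_subadd[of "s/2" \<z> z] assms
          by (simp add: ennreal_plus[symmetric] ennreal_mult[symmetric] ennreal_leI del: ennreal_plus)
        then have "?w \<z> * (A (\<z> - z) * B z) \<le> ?c * (?w (\<z> - z) + ?w z) * (A (\<z> - z) * B z)"
          by (intro mult_right_mono) auto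
        then show "?w \<z> * (A (\<z> - z) * B z) \<le> ?c * ((?w (\<z> - z) * A (\<z> - z)) * B z + A (\<z> - z) * (?w z * B z))"
          by (simp add: algebra_simps)
      qed
      also have "\<dots> = ?c * (econv (\<lambda>z. ?w z * A z) B \<z> + econv A (\<lambda>z. ?w z * B z) \<z>)"
        unfolding econv_def by (subst nn_integral_cmult) (auto simp: nn_integral_add)
      finally show ?thesis .
    qed
    have "nrm s (econv A B) \<le> nrm 0 (\<lambda>\<z>. ?c * (econv (\<lambda>z. ?w z * A z) B \<z> + econv A (\<lambda>z. ?w z * B z) \<z>))"
      by (subst nrm_weight) (intro nrm_mono pt)
    also have "\<dots> = ?c\<^sup>2 * nrm 0 (\<lambda>\<z>. econv (\<lambda>z. ?w z * A z) B \<z> + econv A (\<lambda>z. ?w z * B z) \<z>)"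
      by (intro nrm_cmult) measurable
    also have "\<dots> \<le> ?c\<^sup>2 * (2 * nrm 0 (econv (\<lambda>z. ?w z * A z) B) + 2 * nrm 0 (econv A (\<lambda>z. ?w z * B z)))"
      by (intro mult_left_mono nrm_add) auto
    also have "econv (\<lambda>z. ?w z * A z) B = econv B (\<lambda>z. ?w z * A z)"
      by (rule ext) (rule econv_commute; simp)
    also have "?c\<^sup>2 * (2 * nrm 0 (econv B (\<lambda>z. ?w z * A z)) + 2 * nrm 0 (econv A (\<lambda>z. ?w z * B z)))
       \<le> ?c\<^sup>2 * (2 * (ennreal K * nrm s B * nrm s A) + 2 * (ennreal K * nrm s A * nrm s B))"
    proof (intro mult_left_mono add_mono)
      have "nrm 0 (econv B (\<lambda>z. ?w z * A z)) \<le> (\<integral>\<^sup>+z. B z \<partial>lborel)\<^sup>2 * nrm 0 (\<lambda>z. ?w z * A z)"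
        by (intro Young_L1_L2) auto
      also have "\<dots> \<le> ennreal K * nrm s B * nrm s A"
        unfolding nrm_weight[of s A, symmetric] by (intro mult_right_mono K) auto
      finally show "nrm 0 (econv B (\<lambda>z. ?w z * A z)) \<le> ennreal K * nrm s B * nrm s A" .
      have "nrm 0 (econv A (\<lambda>z. ?w z * B z)) \<le> (\<integral>\<^sup>+z. A z \<partial>lborel)\<^sup>2 * nrm 0 (\<lambda>z. ?w z * B z)"
        by (intro Young_L1_L2) auto
      also have "\<dots> \<le> ennreal K * nrm s A * nrm s B"
        unfolding nrm_weight[of s B, symmetric] by (intro mult_right_mono K) auto
      finally show "nrm 0 (econv A (\<lambda>z. ?w z * B z)) \<le> ennreal K * nrm s A * nrm s B" .
    qed auto
    also have "\<dots> = ?c\<^sup>2 * (4 * (ennreal K * nrm s A * nrm s B))"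
    proof -
      have "ennreal K * nrm s B * nrm s A = ennreal K * nrm s A * nrm s B" by (simp add: ac_simps)
      then show ?thesis by (simp only: distrib_right[symmetric]) simp
    qed
    also have "?c\<^sup>2 * (4 * (ennreal K * nrm s A * nrm s B)) = ennreal (4 * 4 powr s * K) * nrm s A * nrm s B"
    proof -
      have "(4 powr (s/2))\<^sup>2 = 4 powr s"
        by (simp only: power2_eq_square powr_add[symmetric]) simp
      then have "?c\<^sup>2 = ennreal (4 powr s)" by (subst ennreal_power) auto
      then show ?thesis using K by (simp add: ennreal_mult ac_simps)
    qed
    finally show "nrm s (econv A B) \<le> ennreal (4 * 4 powr s * K) * nrm s A * nrm s B" .
  qed
qed

lemma cis_measurable [measurable (raw)]:
  assumes "f \<in> borel_measurable M" shows "(\<lambda>x. cis (f x)) \<in> borel_measurable M"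
proof -
  have "continuous_on UNIV cis" by (intro continuous_intros)
  then have "Borel cis" by (rule borel_measurable_continuous_onI)
  from measurable_compose[OF assms this] show ?thesis .
qed

lemma cnj_measurable [measurable (raw)]:
  assumes "f \<in> borel_measurable M" shows "(\<lambda>x. cnj (f x)) \<in> borel_measurable M"
proof -
  have "continuous_on UNIV cnj" by (intro continuous_intros)
  then have "Borel cnj" by (rule borel_measurable_continuous_onI)
  from measurable_compose[OF assms this] show ?thesis .
qed

section \<open>The Fourier transform on the plane\<close>

definition fint :: "(plane \<Rightarrow> complex) \<Rightarrow> plane \<Rightarrow> complex" where
  "fint f \<z> = (\<integral>x. f x * cis (- (x \<bullet> \<z>)) \<partial>lborel)"

lemma fint_measurable [measurable]:
  assumes [measurable]: "Borel f"
  shows "Borel (fint f)"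
proof -
  have "Borel (\<lambda>\<z>. \<integral>x. f x * cis (- (x \<bullet> \<z>)) \<partial>lborel)" by measurable
  then show ?thesis by (simp add: fint_def[abs_def])
qed

lemma integrable_mult_cis:
  fixes f :: "'a::euclidean_space \<Rightarrow> complex"
  assumes f: "integrable lborel f" and [measurable]: "Borel g"
  shows "integrable lborel (\<lambda>x. f x * cis (g x))"
  using f by (rule Bochner_Integration.integrable_bound)
    (use borel_measurable_integrable[OF f] in \<open>auto simp: norm_mult\<close>)

lemma fint_bound:
  assumes "integrable lborel f"
  shows "cmod (fint f \<z>) \<le> (\<integral>x. cmod (f x) \<partial>lborel)"
proof -
  have "cmod (fint f \<z>) \<le> (\<integral>x. cmod (f x * cis (- (x \<bullet> \<z>))) \<partial>lborel)"
    unfolding fint_def by (rule integral_norm_bound)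
  then show ?thesis by (simp add: norm_mult)
qed

lemma fint_diff:
  assumes "integrable lborel f" "integrable lborel g"
  shows "fint (\<lambda>x. f x - g x) \<z> = fint f \<z> - fint g \<z>"
  unfolding fint_def left_diff_distrib
  by (rule Bochner_Integration.integral_diff) (auto intro!: integrable_mult_cis assms)

lemma integral_lborel_reflect:
  fixes f :: "'a::euclidean_space \<Rightarrow> 'b::{banach, second_countable_topology}"
  assumes [measurable]: "Borel f"
  shows "(\<integral>z. f (c - z) \<partial>lborel) = (\<integral>z. f z \<partial>lborel)"
  by (subst (2) distr_reflect_lborel[of c, symmetric]) (simp add: integral_distr)

lemma integrable_lborel_reflect:
  fixes f :: "'a::euclidean_space \<Rightarrow> 'b::{banach, second_countable_topology}"
  assumes "integrable lborel f"
  shows "integrable lborel (\<lambda>z. f (c - z))"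
  using integrable_distr[of "\<lambda>z. c - z" lborel borel f] assms
  by (simp add: distr_reflect_lborel)

lemma integrable_lborel_prod:
  fixes f g :: "plane \<Rightarrow> complex"
  assumes "integrable lborel f" "integrable lborel g"
  shows "integrable (lborel \<Otimes>\<^sub>M lborel) (\<lambda>(x, y). f x * g y)"
proof -
  have [measurable]: "Borel f" "Borel g"
    using assms by auto
  have "(\<integral>\<^sup>+z. ennreal (cmod ((\<lambda>(x, y). f x * g y) z)) \<partial>(lborel \<Otimes>\<^sub>M lborel))
    = (\<integral>\<^sup>+x. \<integral>\<^sup>+y. ennreal (cmod (f x)) * ennreal (cmod (g y)) \<partial>lborel \<partial>lborel)"
    by (subst lborel.nn_integral_fst[symmetric]) (auto simp: norm_mult ennreal_mult)
  also have "\<dots> = (\<integral>\<^sup>+x. ennreal (cmod (f x)) \<partial>lborel) * (\<integral>\<^sup>+y. ennreal (cmod (g y)) \<partial>lborel)"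
    by (simp add: nn_integral_cmult nn_integral_multc)
  also have "\<dots> < \<infinity>" using assms unfolding integrable_iff_bounded by (simp add: ennreal_mult_less_top)
  finally show ?thesis by (intro integrableI_bounded) auto
qed

text \<open>Fubini's theorem for a symmetric kernel. This duality takes the place of Parseval's
  identity: the L^2 bound, injectivity and inversion are all derived from it.\<close>

lemma fint_multiplication:
  assumes f: "integrable lborel f" and g: "integrable lborel g"
  shows "(\<integral>\<z>. fint f \<z> * g \<z> \<partial>lborel) = (\<integral>x. f x * fint g x \<partial>lborel)"
proof -
  have [measurable]: "Borel f" "Borel g"
    using assms by auto
  let ?h = "\<lambda>(x, y). f x * g y * cis (- (x \<bullet> y))"
  have I: "integrable (lborel \<Otimes>\<^sub>M lborel) ?h"
    using integrable_lborel_prod[OF f g]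
    by (rule Bochner_Integration.integrable_bound) (auto simp: norm_mult)
  have "(\<integral>\<z>. fint f \<z> * g \<z> \<partial>lborel) = (\<integral>y. \<integral>x. f x * g y * cis (- (x \<bullet> y)) \<partial>lborel \<partial>lborel)"
    unfolding fint_def by (subst integral_mult_left_zero[symmetric]) (simp add: ac_simps)
  also have "\<dots> = (\<integral>x. \<integral>y. f x * g y * cis (- (x \<bullet> y)) \<partial>lborel \<partial>lborel)"
    by (rule lborel_pair.Fubini_integral[OF I])
  also have "\<dots> = (\<integral>x. f x * fint g x \<partial>lborel)"
    unfolding fint_def by (subst integral_mult_right_zero[symmetric]) (simp add: ac_simps inner_commute)
  finally show ?thesis .
qed

text \<open>\<open>k\<close> is the inverse width, so that the Fourier integral of
  \<open>gauss k\<close> is a multiple of \<open>gauss (1/k)\<close>.\<close>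

definition gauss :: "real \<Rightarrow> plane \<Rightarrow> real" where
  "gauss k x = exp (- ((k\<^sup>2 * (x \<bullet> x)) / 2))"

lemma gauss_measurable [measurable]: "Borel (gauss k)"
  unfolding gauss_def by measurable

lemma gauss_pos [simp]: "0 < gauss k x" and gauss_nonneg [simp]: "0 \<le> gauss k x"
  and gauss_le_1: "gauss k x \<le> 1"
  by (auto simp: gauss_def)

lemma gauss_minus [simp]: "gauss k (- x) = gauss k x"
  by (simp add: gauss_def)

lemma gauss_diff_commute: "gauss k (x - y) = gauss k (y - x)"
  by (metis gauss_minus minus_diff_eq)

text \<open>A rescaling of the characteristic function of the standard normal distribution;
  \<open>sqrt (2 * pi)\<close> undoes the normalisation of its density.\<close>

lemma gaussian_1d:
  fixes k t :: real
  assumes "0 < k"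
  shows "has_bochner_integral lborel (\<lambda>x. complex_of_real (exp (- ((k * x)\<^sup>2 / 2))) * cis (x * t))
    (complex_of_real (sqrt (2 * pi) / k * exp (- ((t / k)\<^sup>2 / 2))))"
proof -
  let ?F = "\<lambda>x. std_normal_density x *\<^sub>R iexp ((t / k) * x)"
  have i1: "integrable lborel (\<lambda>x. std_normal_density x)"
    using integrable_std_normal_moment[of 0] by simp
  have i2: "integrable lborel ?F"
    using i1 by (rule Bochner_Integration.integrable_bound) (auto simp: norm_exp_i_times)
  have "(\<integral>x. ?F x \<partial>lborel) = char std_normal_distribution (t / k)"
    unfolding char_def by (subst integral_density) auto
  also have "\<dots> = complex_of_real (exp (- ((t / k)\<^sup>2 / 2)))"
    by (simp add: char_std_normal_distribution)
  finally have "has_bochner_integral lborel ?F (complex_of_real (exp (- ((t / k)\<^sup>2 / 2))))"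
    using i2 by (simp add: has_bochner_integral_iff)
  then have "has_bochner_integral lborel (\<lambda>x. ?F (0 + k * x)) (complex_of_real (exp (- ((t / k)\<^sup>2 / 2))) /\<^sub>R \<bar>k\<bar>)"
    using assms by (subst (asm) lborel_has_bochner_integral_real_affine_iff[of k _ _ 0]) auto
  then have "has_bochner_integral lborel (\<lambda>x. complex_of_real (sqrt (2 * pi)) * ?F (0 + k * x))
     (complex_of_real (sqrt (2 * pi)) * (complex_of_real (exp (- ((t / k)\<^sup>2 / 2))) /\<^sub>R \<bar>k\<bar>))"
    by (rule has_bochner_integral_mult_right)
  moreover have "complex_of_real (sqrt (2 * pi)) * ?F (0 + k * x) =
      complex_of_real (exp (- ((k * x)\<^sup>2 / 2))) * cis (x * t)" for x
  proof -
    have "t / k * (k * x) = x * t" using assms by simp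
    then have "iexp ((t / k) * (0 + k * x)) = cis (x * t)" by (simp add: cis_conv_exp)
    then show ?thesis by (simp add: std_normal_density_def scaleR_conv_of_real)
  qed
  moreover have "complex_of_real (sqrt (2 * pi)) * (complex_of_real (exp (- ((t / k)\<^sup>2 / 2))) /\<^sub>R \<bar>k\<bar>)
    = complex_of_real (sqrt (2 * pi) / k * exp (- ((t / k)\<^sup>2 / 2)))"
    using assms by (simp add: scaleR_conv_of_real field_simps)
  ultimately show ?thesis by simp
qed

lemma gaussian_2d:
  assumes "0 < k"
  shows "has_bochner_integral lborel (\<lambda>x. complex_of_real (gauss k x) * cis (x \<bullet> \<z>))
    (complex_of_real ((2 * pi) / k\<^sup>2 * gauss (1/k) \<z>))"
proof -
  define e where "e t x = complex_of_real (exp (- ((k * x)\<^sup>2 / 2))) * cis (x * t)" for t x :: real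
  obtain \<xi> \<eta> where z: "\<z> = (\<xi>, \<eta>)" by (cases \<z>)
  have e: "integrable lborel (e t)" "integral\<^sup>L lborel (e t) = complex_of_real (sqrt (2 * pi) / k * exp (- ((t / k)\<^sup>2 / 2)))" for t
    using gaussian_1d[OF assms, of t] unfolding e_def[abs_def] has_bochner_integral_iff by auto
  have [measurable]: "Borel (e t)" for t using e(1)[of t] by simp
  have eq: "complex_of_real (gauss k x) * cis (x \<bullet> \<z>) = e \<xi> (fst x) * e \<eta> (snd x)" for x
  proof -
    have "gauss k x = exp (- ((k * fst x)\<^sup>2 / 2)) * exp (- ((k * snd x)\<^sup>2 / 2))"
      unfolding gauss_def
      by (subst exp_add[symmetric]) (simp add: inner_prod_def power2_eq_square algebra_simps add_divide_distrib)
    moreover have "cis (x \<bullet> \<z>) = cis (fst x * \<xi>) * cis (snd x * \<eta>)"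
      by (simp add: z cis_mult inner_prod_def)
    ultimately show ?thesis by (simp add: e_def ac_simps)
  qed
  have I: "integrable (lborel \<Otimes>\<^sub>M lborel) (\<lambda>(x, y). e \<xi> x * e \<eta> y)"
  proof (rule integrableI_bounded)
    have "(\<integral>\<^sup>+z. ennreal (cmod ((\<lambda>(x, y). e \<xi> x * e \<eta> y) z)) \<partial>(lborel \<Otimes>\<^sub>M lborel))
      = (\<integral>\<^sup>+x. \<integral>\<^sup>+y. ennreal (cmod (e \<xi> x)) * ennreal (cmod (e \<eta> y)) \<partial>lborel \<partial>lborel)"
      by (subst lborel.nn_integral_fst[symmetric]) (auto simp: norm_mult ennreal_mult)
    also have "\<dots> = (\<integral>\<^sup>+x. ennreal (cmod (e \<xi> x)) \<partial>lborel) * (\<integral>\<^sup>+y. ennreal (cmod (e \<eta> y)) \<partial>lborel)"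
      by (simp add: nn_integral_cmult nn_integral_multc)
    also have "\<dots> < \<infinity>" using e(1) unfolding integrable_iff_bounded by (simp add: ennreal_mult_less_top)
    finally show "(\<integral>\<^sup>+z. ennreal (cmod ((\<lambda>(x, y). e \<xi> x * e \<eta> y) z)) \<partial>(lborel \<Otimes>\<^sub>M lborel)) < \<infinity>" .
  qed auto
  have "integral\<^sup>L (lborel \<Otimes>\<^sub>M lborel) (\<lambda>(x, y). e \<xi> x * e \<eta> y) = (\<integral>x. \<integral>y. e \<xi> x * e \<eta> y \<partial>lborel \<partial>lborel)"
    by (subst lborel_pair.integral_fst'[OF I, symmetric]) simp
  also have "\<dots> = integral\<^sup>L lborel (e \<xi>) * integral\<^sup>L lborel (e \<eta>)"
    by simp
  also have "\<dots> = complex_of_real ((2 * pi) / k\<^sup>2 * gauss (1/k) \<z>)"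
  proof -
    have "gauss (1/k) \<z> = exp (- ((\<xi> / k)\<^sup>2 / 2)) * exp (- ((\<eta> / k)\<^sup>2 / 2))"
      unfolding gauss_def z
      by (subst exp_add[symmetric]) (simp add: inner_prod_def power2_eq_square algebra_simps add_divide_distrib)
    then have "sqrt (2 * pi) / k * exp (- ((\<xi> / k)\<^sup>2 / 2)) * (sqrt (2 * pi) / k * exp (- ((\<eta> / k)\<^sup>2 / 2)))
       = (2 * pi) / k\<^sup>2 * gauss (1/k) \<z>"
      by (simp add: power2_eq_square mult.assoc[symmetric])
    then show ?thesis unfolding e(2) by (metis of_real_mult)
  qed
  finally have "has_bochner_integral lborel (\<lambda>z. (case z of (x, y) \<Rightarrow> e \<xi> x * e \<eta> y)) (complex_of_real ((2 * pi) / k\<^sup>2 * gauss (1/k) \<z>))"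
    using I by (simp add: has_bochner_integral_iff lborel_prod)
  then show ?thesis unfolding eq by (simp add: case_prod_beta)
qed

lemma gauss_integrable_cis:
  assumes "0 < k" and [measurable]: "Borel g"
  shows "integrable lborel (\<lambda>x. complex_of_real (gauss k x) * cis (g x))"
proof -
  have "integrable lborel (\<lambda>x. complex_of_real (gauss k x) * cis (x \<bullet> 0))"
    using gaussian_2d[OF assms(1), of 0] by (simp only: has_bochner_integral_iff)
  then show ?thesis by (intro integrable_mult_cis) auto
qed

lemma gauss_integrable: "0 < k \<Longrightarrow> integrable lborel (\<lambda>x. complex_of_real (gauss k x))"
  using gauss_integrable_cis[of k "\<lambda>_. 0"] by simp

lemma fint_gauss:
  assumes "0 < k"
  shows "fint (\<lambda>x. complex_of_real (gauss k x) * cis (x \<bullet> c)) \<z>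
    = complex_of_real ((2 * pi) / k\<^sup>2 * gauss (1/k) (\<z> - c))"
proof -
  have "fint (\<lambda>x. complex_of_real (gauss k x) * cis (x \<bullet> c)) \<z>
     = (\<integral>x. complex_of_real (gauss k x) * cis (x \<bullet> (c - \<z>)) \<partial>lborel)"
    unfolding fint_def mult.assoc cis_mult by (simp add: inner_diff_right)
  also have "\<dots> = complex_of_real ((2 * pi) / k\<^sup>2 * gauss (1/k) (c - \<z>))"
    using gaussian_2d[OF assms] by (simp add: has_bochner_integral_iff)
  finally show ?thesis by (simp only: gauss_diff_commute)
qed

lemma nn_integral_gauss:
  assumes "0 < k"
  shows "(\<integral>\<^sup>+x. ennreal (gauss k x) \<partial>lborel) = ennreal (2 * pi / k\<^sup>2)"
proof -
  have "has_bochner_integral lborel (\<lambda>x. complex_of_real (gauss k x)) (complex_of_real (2 * pi / k\<^sup>2))"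
    using gaussian_2d[OF assms, of 0] by (simp add: gauss_def)
  from has_bochner_integral_bounded_linear[OF bounded_linear_Re this]
  have "has_bochner_integral lborel (gauss k) (2 * pi / k\<^sup>2)"
    by (simp only: Re_complex_of_real)
  then show ?thesis by (simp add: has_bochner_integral_iff nn_integral_eq_integral)
qed

lemma ennreal_square_le_imp_le:
  fixes a b :: ennreal
  assumes "a\<^sup>2 \<le> b\<^sup>2" shows "a \<le> b"
proof (cases b)
  case (real y)
  show ?thesis
  proof (cases a)
    case (real x)
    with \<open>b = ennreal y\<close> \<open>0 \<le> y\<close> assms have "x\<^sup>2 \<le> y\<^sup>2" by (simp add: ennreal_power)
    then have "x \<le> y" using \<open>0 \<le> y\<close> by (rule power2_le_imp_le)
    then show ?thesis using real \<open>b = ennreal y\<close> by (simp add: ennreal_leI)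
  next
    case top
    with assms \<open>b = ennreal y\<close> \<open>0 \<le> y\<close> show ?thesis by (simp add: ennreal_power power2_eq_square top_unique ennreal_mult_eq_top_iff)
  qed
qed simp

text \<open>Damped by a Gaussian, the square of the transform becomes a pairing to which the
  multiplication formula applies. The other side pairs \<open>f\<close> with a Gaussian average of
  it, which Young's inequality bounds uniformly in \<open>k\<close>; Fatou's lemma then removes the
  damping.\<close>

lemma fint_L2:
  assumes f: "integrable lborel f"
  shows "nrm 0 (\<lambda>\<z>. ennreal (cmod (fint f \<z>))) \<le> ennreal ((2 * pi)\<^sup>2) * nrm 0 (\<lambda>x. ennreal (cmod (f x)))"
proof -
  have [measurable]: "Borel f" using f by auto
  let ?N = "nrm 0 (\<lambda>x. ennreal (cmod (f x)))"
  define F where "F = fint f"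
  have [measurable]: "Borel F" unfolding F_def by measurable
  have damped: "(\<integral>\<^sup>+\<z>. ennreal ((cmod (F \<z>))\<^sup>2 * gauss k \<z>) \<partial>lborel) \<le> ennreal ((2 * pi)\<^sup>2) * ?N" if k: "0 < k" for k
  proof -
    \<comment> \<open>The conjugate makes \<open>F \<z> * \<psi> \<z>\<close> the damped square of
      the modulus, while the damping makes \<open>\<psi>\<close> integrable.\<close>
    define \<psi> where "\<psi> \<z> = cnj (F \<z>) * complex_of_real (gauss k \<z>)" for \<z>
    define Gh where "Gh x = ennreal (2 * pi / k\<^sup>2 * gauss (1/k) x)" for x
    have [measurable]: "Borel \<psi>" unfolding \<psi>_def by measurable
    have [measurable]: "Borel Gh" unfolding Gh_def by measurable
    have cf: "integrable lborel (\<lambda>x. cnj (f x))" using f by simp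
    have \<psi>: "integrable lborel \<psi>"
    proof (rule Bochner_Integration.integrable_bound)
      show "integrable lborel (\<lambda>x. complex_of_real (\<integral>x. cmod (f x) \<partial>lborel) * complex_of_real (gauss k x))"
        using gauss_integrable[OF k] by (intro integrable_mult_right) auto
      show "AE x in lborel. cmod (\<psi> x) \<le> cmod (complex_of_real (\<integral>x. cmod (f x) \<partial>lborel) * complex_of_real (gauss k x))"
        using fint_bound[OF f] by (auto simp: \<psi>_def norm_mult F_def abs_of_nonneg intro!: AE_I2 mult_right_mono intro: order_trans[OF _ abs_ge_self])
    qed measurable
    have cF: "cnj (F \<z>) = fint (\<lambda>x. cnj (f x)) (0 - \<z>)" for \<z>
      unfolding F_def fint_def by (subst Bochner_Integration.integral_cnj[symmetric]) (simp add: cis_cnj del: Bochner_Integration.integral_cnj)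
    have fint\<psi>: "fint \<psi> x = (\<integral>y. cnj (f y) * complex_of_real (2 * pi / k\<^sup>2 * gauss (1/k) (y - x)) \<partial>lborel)" for x
    proof -
      let ?h = "\<lambda>\<z>. complex_of_real (gauss k \<z>) * cis (\<z> \<bullet> x)"
      have "fint \<psi> x = (\<integral>\<z>. fint (\<lambda>x. cnj (f x)) (0 - \<z>) * ?h (0 - \<z>) \<partial>lborel)"
        unfolding fint_def[of \<psi>] \<psi>_def cF by (simp add: ac_simps)
      also have "\<dots> = (\<integral>\<z>. fint (\<lambda>x. cnj (f x)) \<z> * ?h \<z> \<partial>lborel)"
        by (rule integral_lborel_reflect[of "\<lambda>\<z>. fint (\<lambda>x. cnj (f x)) \<z> * ?h \<z>"]) measurable
      also have "\<dots> = (\<integral>y. cnj (f y) * fint ?h y \<partial>lborel)"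
        by (rule fint_multiplication[OF cf]) (intro gauss_integrable_cis k, measurable)
      finally show ?thesis by (simp add: fint_gauss[OF k])
    qed
    have fint\<psi>_le: "ennreal (cmod (fint \<psi> x)) \<le> econv Gh (\<lambda>y. ennreal (cmod (f y))) x" for x
    proof -
      have "integrable lborel (\<lambda>y. cnj (f y) * complex_of_real (2 * pi / k\<^sup>2 * gauss (1/k) (y - x)))"
      proof (rule Bochner_Integration.integrable_bound)
        show "integrable lborel (\<lambda>y. complex_of_real (2 * pi / k\<^sup>2) * cnj (f y))" using f by simp
      qed (use k in \<open>auto simp: norm_mult norm_divide gauss_le_1 intro!: AE_I2 mult_right_le_one_le divide_right_mono\<close>)
      then have "ennreal (cmod (fint \<psi> x)) \<le> (\<integral>\<^sup>+y. ennreal (cmod (cnj (f y) * complex_of_real (2 * pi / k\<^sup>2 * gauss (1/k) (y - x)))) \<partial>lborel)"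
        unfolding fint\<psi> by (rule integral_norm_bound_ennreal)
      also have "\<dots> = (\<integral>\<^sup>+y. Gh (x - y) * ennreal (cmod (f y)) \<partial>lborel)"
      proof (intro nn_integral_cong)
        fix y
        have e: "cmod (cnj (f y) * complex_of_real (2 * pi / k\<^sup>2 * gauss (1/k) (y - x))) = (2 * pi / k\<^sup>2 * gauss (1/k) (x - y)) * cmod (f y)"
          unfolding norm_mult norm_of_real complex_mod_cnj by (subst abs_of_nonneg) (auto simp: gauss_diff_commute)
        show "ennreal (cmod (cnj (f y) * complex_of_real (2 * pi / k\<^sup>2 * gauss (1/k) (y - x)))) = Gh (x - y) * ennreal (cmod (f y))"
          unfolding Gh_def e by (rule ennreal_mult) auto
      qed
      finally show ?thesis by (simp add: econv_def)
    qed
    define J where "J = (\<integral>\<^sup>+\<z>. ennreal ((cmod (F \<z>))\<^sup>2 * gauss k \<z>) \<partial>lborel)"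
    have F\<psi>: "F \<z> * \<psi> \<z> = complex_of_real ((cmod (F \<z>))\<^sup>2 * gauss k \<z>)" for \<z>
      unfolding \<psi>_def by (simp add: complex_norm_square mult.assoc[symmetric] del: of_real_power)
    have intF\<psi>: "integrable lborel (\<lambda>\<z>. F \<z> * \<psi> \<z>)"
    proof (rule Bochner_Integration.integrable_bound)
      show "integrable lborel (\<lambda>x. complex_of_real (\<integral>x. cmod (f x) \<partial>lborel) * \<psi> x)"
        using \<psi> by simp
      show "AE x in lborel. cmod (F x * \<psi> x) \<le> cmod (complex_of_real (\<integral>x. cmod (f x) \<partial>lborel) * \<psi> x)"
        using fint_bound[OF f] by (auto simp: norm_mult F_def intro!: AE_I2 mult_right_mono intro: order_trans[OF _ abs_ge_self])
    qed measurable
    then have iR: "integrable lborel (\<lambda>\<z>. (cmod (F \<z>))\<^sup>2 * gauss k \<z>)"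
      unfolding F\<psi> by (simp only: complex_of_real_integrable_eq)
    have "J = ennreal (\<integral>\<z>. (cmod (F \<z>))\<^sup>2 * gauss k \<z> \<partial>lborel)"
      unfolding J_def by (rule nn_integral_eq_integral[OF iR]) auto
    also have "\<dots> = ennreal (cmod (\<integral>\<z>. F \<z> * \<psi> \<z> \<partial>lborel))"
      unfolding F\<psi> integral_complex_of_real by (simp add: integral_nonneg_AE)
    also have "(\<integral>\<z>. F \<z> * \<psi> \<z> \<partial>lborel) = (\<integral>x. f x * fint \<psi> x \<partial>lborel)"
      unfolding F_def by (rule fint_multiplication[OF f \<psi>])
    also have "ennreal (cmod \<dots>) \<le> (\<integral>\<^sup>+x. ennreal (cmod (f x * fint \<psi> x)) \<partial>lborel)"
    proof (rule integral_norm_bound_ennreal)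
      show "integrable lborel (\<lambda>x. f x * fint \<psi> x)"
      proof (rule Bochner_Integration.integrable_bound)
        show "integrable lborel (\<lambda>x. f x * complex_of_real (\<integral>x. cmod (\<psi> x) \<partial>lborel))"
          using f by simp
        show "AE x in lborel. cmod (f x * fint \<psi> x) \<le> cmod (f x * complex_of_real (\<integral>x. cmod (\<psi> x) \<partial>lborel))"
          using fint_bound[OF \<psi>] by (auto simp: norm_mult intro!: AE_I2 mult_left_mono intro: order_trans[OF _ abs_ge_self])
      qed measurable
    qed
    also have "\<dots> \<le> (\<integral>\<^sup>+x. ennreal (cmod (f x)) * econv Gh (\<lambda>y. ennreal (cmod (f y))) x \<partial>lborel)"
      by (intro nn_integral_mono) (auto simp: norm_mult ennreal_mult intro!: mult_left_mono fint\<psi>_le)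
    finally have "J\<^sup>2 \<le> (\<integral>\<^sup>+x. ennreal (cmod (f x)) * econv Gh (\<lambda>y. ennreal (cmod (f y))) x \<partial>lborel)\<^sup>2"
      by (rule ennreal_square_mono)
    also have "\<dots> \<le> ?N * nrm 0 (econv Gh (\<lambda>y. ennreal (cmod (f y))))"
      unfolding nrm_0 by (rule Cauchy_Schwarz_nn_integral) auto
    also have "\<dots> \<le> ?N * ((\<integral>\<^sup>+x. Gh x \<partial>lborel)\<^sup>2 * ?N)"
      by (intro mult_left_mono Young_L1_L2) auto
    \<comment> \<open>The Gaussian of inverse width 1/k has integral
      \<open>2 * pi * k\<^sup>2\<close>, so the powers of \<open>k\<close> cancel and the bound is
      uniform in the damping.\<close>
    also have "(\<integral>\<^sup>+x. Gh x \<partial>lborel) = ennreal ((2 * pi)\<^sup>2)"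
    proof -
      have "(\<integral>\<^sup>+x. Gh x \<partial>lborel) = ennreal (2 * pi / k\<^sup>2) * ennreal (2 * pi / (1/k)\<^sup>2)"
      proof -
        have "(\<integral>\<^sup>+x. Gh x \<partial>lborel) = (\<integral>\<^sup>+x. ennreal (2 * pi / k\<^sup>2) * ennreal (gauss (1/k) x) \<partial>lborel)"
          unfolding Gh_def by (intro nn_integral_cong ennreal_mult) auto
        also have "\<dots> = ennreal (2 * pi / k\<^sup>2) * ennreal (2 * pi / (1/k)\<^sup>2)"
          using k by (subst nn_integral_cmult) (auto simp: nn_integral_gauss)
        finally show ?thesis .
      qed
      also have "\<dots> = ennreal ((2 * pi / k\<^sup>2) * (2 * pi / (1/k)\<^sup>2))" by (rule ennreal_mult[symmetric]) auto
      also have "(2 * pi / k\<^sup>2) * (2 * pi / (1/k)\<^sup>2) = (2 * pi)\<^sup>2" using k by (simp add: power2_eq_square)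
      finally show ?thesis .
    qed
    also have "?N * ((ennreal ((2 * pi)\<^sup>2))\<^sup>2 * ?N) = (ennreal ((2 * pi)\<^sup>2) * ?N)\<^sup>2"
      by (simp add: power2_eq_square ac_simps)
    finally show ?thesis unfolding J_def by (rule ennreal_square_le_imp_le)
  qed
  have lim: "(\<lambda>n. ennreal ((cmod (F \<z>))\<^sup>2 * gauss (1 / real (Suc n)) \<z>)) \<longlonglongrightarrow> (ennreal (cmod (F \<z>)))\<^sup>2" for \<z>
  proof -
    have "(\<lambda>n. (cmod (F \<z>))\<^sup>2 * gauss (1 / real (Suc n)) \<z>) \<longlonglongrightarrow> (cmod (F \<z>))\<^sup>2 * exp (- ((0\<^sup>2 * (\<z> \<bullet> \<z>)) / 2))"
      unfolding gauss_def
      by (intro tendsto_intros LIMSEQ_Suc[OF lim_1_over_n]) simp_all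
    then show ?thesis by (simp add: ennreal_power)
  qed
  have "nrm 0 (\<lambda>\<z>. ennreal (cmod (F \<z>))) = (\<integral>\<^sup>+\<z>. liminf (\<lambda>n. ennreal ((cmod (F \<z>))\<^sup>2 * gauss (1 / real (Suc n)) \<z>)) \<partial>lborel)"
    unfolding nrm_0 by (intro nn_integral_cong lim_imp_Liminf[symmetric] lim) simp
  also have "\<dots> \<le> liminf (\<lambda>n. \<integral>\<^sup>+\<z>. ennreal ((cmod (F \<z>))\<^sup>2 * gauss (1 / real (Suc n)) \<z>) \<partial>lborel)"
    by (rule nn_integral_liminf) measurable
  also have "\<dots> \<le> ennreal ((2 * pi)\<^sup>2) * ?N"
    by (intro Liminf_le always_eventually allI damped) auto
  finally show ?thesis by (simp add: F_def)
qed

section \<open>Completeness of L^2 and existence of the transform\<close>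

lemma ennreal_twice_add_finite:
  fixes a b :: ennreal
  assumes "a < \<infinity>" "b < \<infinity>" shows "2 * a + 2 * b < \<infinity>"
proof -
  have "2 * a < \<infinity>" "2 * b < \<infinity>" using assms by (auto simp: ennreal_mult_less_top)
  then show ?thesis by simp
qed

lemma wdist2_0: "wdist2 0 F G = (\<integral>\<^sup>+\<z>. ennreal ((cmod (F \<z> - G \<z>))\<^sup>2) \<partial>lborel)"
  by (simp add: wdist2_def)

lemma wdist2_commute: "wdist2 s F G = wdist2 s G F"
  by (simp add: wdist2_def norm_minus_commute)

lemma wdist2_triangle:
  assumes [measurable]: "Borel F" "Borel G" "Borel H"
  shows "wdist2 s F H \<le> 2 * wdist2 s F G + 2 * wdist2 s G H"
proof -
  have "wdist2 s F H \<le> nrm s (\<lambda>\<z>. ennreal (cmod (F \<z> - G \<z>)) + ennreal (cmod (G \<z> - H \<z>)))"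
    unfolding wdist2_eq_nrm
  proof (rule nrm_mono)
    fix \<z>
    have "cmod (F \<z> - H \<z>) \<le> cmod (F \<z> - G \<z>) + cmod (G \<z> - H \<z>)"
      using norm_triangle_ineq[of "F \<z> - G \<z>" "G \<z> - H \<z>"] by simp
    then show "ennreal (cmod (F \<z> - H \<z>)) \<le> ennreal (cmod (F \<z> - G \<z>)) + ennreal (cmod (G \<z> - H \<z>))"
      by (simp add: ennreal_plus[symmetric] ennreal_leI del: ennreal_plus)
  qed
  also have "\<dots> \<le> 2 * wdist2 s F G + 2 * wdist2 s G H"
    unfolding wdist2_eq_nrm by (rule nrm_add) auto
  finally show ?thesis .
qed

lemma wdist2_eq_0:
  assumes [measurable]: "Borel F" "Borel G"
    and "wdist2 s F G = 0"
  shows "AE \<z> in lborel. F \<z> = G \<z>"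
proof -
  have "AE \<z> in lborel. ennreal (sob_weight s \<z> * (cmod (F \<z> - G \<z>))\<^sup>2) = 0"
    using assms(3) unfolding wdist2_def by (subst (asm) nn_integral_0_iff_AE) auto
  then show ?thesis
  proof eventually_elim
    case (elim \<z>)
    then have "sob_weight s \<z> * (cmod (F \<z> - G \<z>))\<^sup>2 \<le> 0" by (simp add: ennreal_eq_0_iff)
    then have "(cmod (F \<z> - G \<z>))\<^sup>2 \<le> 0" by (simp add: mult_le_0_iff) (use sob_weight_pos[of s \<z>] in linarith)
    then show ?case by simp
  qed
qed

lemma wdist2_limit_unique:
  fixes F G :: "plane \<Rightarrow> complex"
  assumes F: "Borel F" and G: "Borel G"
    and X: "\<And>n. Borel (X n)"
    and lF: "(\<lambda>n. wdist2 s F (X n)) \<longlonglongrightarrow> 0" and lG: "(\<lambda>n. wdist2 s G (X n)) \<longlonglongrightarrow> 0"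
  shows "AE \<z> in lborel. F \<z> = G \<z>"
proof -
  have a: "(\<lambda>n. 2 * wdist2 s F (X n)) \<longlonglongrightarrow> 2 * 0"
    by (rule ennreal_tendsto_cmult[OF _ lF]) simp
  have b: "(\<lambda>n. 2 * wdist2 s G (X n)) \<longlonglongrightarrow> 2 * 0"
    by (rule ennreal_tendsto_cmult[OF _ lG]) simp
  have lim: "(\<lambda>n. 2 * wdist2 s F (X n) + 2 * wdist2 s G (X n)) \<longlonglongrightarrow> 0"
    using tendsto_add[OF a b] by simp
  have "wdist2 s F G \<le> 2 * wdist2 s F (X n) + 2 * wdist2 s G (X n)" for n
    using wdist2_triangle[OF F X G, of s n] wdist2_commute[of s G "X n"] by metis
  then have "wdist2 s F G \<le> 0" using LIMSEQ_le_const[OF lim, of "wdist2 s F G"] by blast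
  then have "wdist2 s F G = 0" by simp
  with F G show ?thesis by (rule wdist2_eq_0)
qed

lemma Riesz_Fischer:
  fixes F :: "nat \<Rightarrow> plane \<Rightarrow> complex"
  assumes [measurable]: "\<And>n. Borel (F n)"
    and cauchy: "\<And>e::real. 0 < e \<Longrightarrow> \<exists>N. \<forall>m\<ge>N. \<forall>n\<ge>N. wdist2 0 (F m) (F n) \<le> ennreal e"
  obtains G where "Borel G" "(\<lambda>n. wdist2 0 G (F n)) \<longlonglongrightarrow> 0"
proof -
  \<comment> \<open>Squared distances of size 8^-k remain summable after multiplication by 4^k, and
    this bounds the increments at almost every point by a constant times 2^-k.\<close>
  have "\<exists>N. \<forall>m\<ge>N. \<forall>n\<ge>N. wdist2 0 (F m) (F n) \<le> ennreal ((1/8) ^ k)" for k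
    by (rule cauchy) simp
  then obtain r0 where r0: "\<And>k m n. r0 k \<le> m \<Longrightarrow> r0 k \<le> n \<Longrightarrow> wdist2 0 (F m) (F n) \<le> ennreal ((1/8) ^ k)"
    by metis
  \<comment> \<open>Partial sums make \<open>r\<close> monotone, while it still dominates
    \<open>r0\<close> and the identity.\<close>
  define r where "r k = (\<Sum>i\<le>k. r0 i) + k" for k
  have r_ge: "r0 k \<le> r k" "k \<le> r k" for k
    unfolding r_def using member_le_sum[of k "{..k}" r0] by auto
  have r_Suc: "r k \<le> r (Suc k)" for k unfolding r_def by simp
  define D where "D k \<z> = (cmod (F (r (Suc k)) \<z> - F (r k) \<z>))\<^sup>2" for k \<z>
  have [measurable]: "Borel (D k)" for k unfolding D_def by measurable
  have D: "(\<integral>\<^sup>+\<z>. ennreal (D k \<z>) \<partial>lborel) \<le> ennreal ((1/8) ^ k)" for k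
    unfolding D_def wdist2_0[symmetric] using r_ge(1)[of k] r_Suc[of k] by (intro r0) auto
  have "(\<integral>\<^sup>+\<z>. (\<Sum>k. ennreal (4 ^ k * D k \<z>)) \<partial>lborel) = (\<Sum>k. \<integral>\<^sup>+\<z>. ennreal (4 ^ k * D k \<z>) \<partial>lborel)"
    by (rule nn_integral_suminf) measurable
  also have "\<dots> \<le> (\<Sum>k. ennreal ((1/2) ^ k))"
  proof (rule suminf_le)
    fix k
    have "(\<integral>\<^sup>+\<z>. ennreal (4 ^ k * D k \<z>) \<partial>lborel) = ennreal (4 ^ k) * (\<integral>\<^sup>+\<z>. ennreal (D k \<z>) \<partial>lborel)"
      by (subst nn_integral_cmult[symmetric]) (auto simp: ennreal_mult D_def)
    also have "\<dots> \<le> ennreal (4 ^ k) * ennreal ((1/8) ^ k)" by (intro mult_left_mono D) auto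
    also have "\<dots> = ennreal ((1/2) ^ k)"
      by (simp add: ennreal_mult[symmetric] power_mult_distrib[symmetric])
    finally show "(\<integral>\<^sup>+\<z>. ennreal (4 ^ k * D k \<z>) \<partial>lborel) \<le> ennreal ((1/2) ^ k)" .
  qed auto
  also have "\<dots> = ennreal (\<Sum>k. (1/2) ^ k)" by (rule suminf_ennreal2) (auto intro: summable_geometric)
  also have "\<dots> < \<infinity>" by simp
  finally have "AE \<z> in lborel. (\<Sum>k. ennreal (4 ^ k * D k \<z>)) \<noteq> \<infinity>"
    by (intro nn_integral_PInf_AE) auto
  then have conv: "AE \<z> in lborel. convergent (\<lambda>k. F (r k) \<z>)"
  proof eventually_elim
    case (elim \<z>)
    then obtain S where S: "(\<Sum>k. ennreal (4 ^ k * D k \<z>)) = ennreal S" "0 \<le> S"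
      by (cases "\<Sum>k. ennreal (4 ^ k * D k \<z>)") auto
    have le: "4 ^ k * D k \<z> \<le> S" for k
    proof -
      have "ennreal (4 ^ k * D k \<z>) \<le> (\<Sum>k. ennreal (4 ^ k * D k \<z>))"
        using sum_le_suminf[of "\<lambda>k. ennreal (4 ^ k * D k \<z>)" "{k}"] by simp
      then show ?thesis using S by (simp add: D_def)
    qed
    have le2: "cmod (F (r (Suc k)) \<z> - F (r k) \<z>) \<le> sqrt S * (1/2) ^ k" for k
    proof (rule power2_le_imp_le)
      have "(cmod (F (r (Suc k)) \<z> - F (r k) \<z>))\<^sup>2 \<le> S * (1/4)^k"
        using le[of k] unfolding D_def by (simp add: field_simps power_divide)
      also have "\<dots> = (sqrt S * (1/2) ^ k)\<^sup>2"
      proof -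
        have "((1/2::real) ^ k)\<^sup>2 = (1/4) ^ k"
          by (simp only: power_mult[symmetric] mult.commute[of k 2]) (simp add: power_mult power2_eq_square)
        then show ?thesis using S by (simp add: power_mult_distrib)
      qed
      finally show "(cmod (F (r (Suc k)) \<z> - F (r k) \<z>))\<^sup>2 \<le> (sqrt S * (1/2) ^ k)\<^sup>2" .
    qed (use S in auto)
    have "summable (\<lambda>k. F (r (Suc k)) \<z> - F (r k) \<z>)"
      by (rule summable_comparison_test[of _ "\<lambda>k. sqrt S * (1/2) ^ k"])
         (use le2 in \<open>auto intro!: summable_mult summable_geometric\<close>)
    then have "convergent (\<lambda>n. F (r n) \<z> - F (r 0) \<z>)"
      using summable_iff_convergent[of "\<lambda>k. F (r (Suc k)) \<z> - F (r k) \<z>"]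
      by (simp only: sum_lessThan_telescope[of "\<lambda>n. F (r n) \<z>"])
    then show ?case using convergent_diff_const_right_iff by blast
  qed
  define G where "G \<z> = lim (\<lambda>k. F (r k) \<z>)" for \<z>
  have [measurable]: "Borel G" unfolding G_def by measurable
  have lim: "AE \<z> in lborel. (\<lambda>k. F (r k) \<z>) \<longlonglongrightarrow> G \<z>"
    using conv by eventually_elim (simp add: G_def convergent_LIMSEQ_iff)
  have bound: "\<exists>N. \<forall>n\<ge>N. wdist2 0 G (F n) \<le> ennreal e" if e: "0 < e" for e :: real
  proof -
    obtain N where N: "\<And>m n. N \<le> m \<Longrightarrow> N \<le> n \<Longrightarrow> wdist2 0 (F m) (F n) \<le> ennreal e"
      using cauchy[OF e] by metis
    have "wdist2 0 G (F n) \<le> ennreal e" if n: "N \<le> n" for n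
    proof -
      \<comment> \<open>Fatou along the subsequence bounds the distance of the limit to every late
        member of the full sequence.\<close>
      have "wdist2 0 G (F n) = (\<integral>\<^sup>+\<z>. liminf (\<lambda>k. ennreal ((cmod (F (r k) \<z> - F n \<z>))\<^sup>2)) \<partial>lborel)"
        unfolding wdist2_0
      proof (rule nn_integral_cong_AE)
        show "AE \<z> in lborel. ennreal ((cmod (G \<z> - F n \<z>))\<^sup>2) = liminf (\<lambda>k. ennreal ((cmod (F (r k) \<z> - F n \<z>))\<^sup>2))"
          using lim by eventually_elim
            (intro lim_imp_Liminf[symmetric] tendsto_ennrealI tendsto_intros; simp)
      qed
      also have "\<dots> \<le> liminf (\<lambda>k. \<integral>\<^sup>+\<z>. ennreal ((cmod (F (r k) \<z> - F n \<z>))\<^sup>2) \<partial>lborel)"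
        by (rule nn_integral_liminf) measurable
      also have "\<dots> \<le> ennreal e"
      proof (rule Liminf_le)
        show "\<forall>\<^sub>F k in sequentially. (\<integral>\<^sup>+\<z>. ennreal ((cmod (F (r k) \<z> - F n \<z>))\<^sup>2) \<partial>lborel) \<le> ennreal e"
          unfolding wdist2_0[symmetric] using eventually_ge_at_top[of N]
        proof eventually_elim
          case (elim k)
          then show ?case using N[of "r k" n] r_ge(2)[of k] n by auto
        qed
      qed auto
      finally show ?thesis .
    qed
    then show ?thesis by blast
  qed
  have "(\<lambda>n. wdist2 0 G (F n)) \<longlonglongrightarrow> 0"
  proof (rule order_tendstoI)
    fix a :: ennreal assume "0 < a"
    then obtain e where e: "0 < e" "e < a" using dense by blast
    then obtain e' where e': "e = ennreal e'" "0 < e'"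
      by (cases e) auto
    from bound[OF e'(2)] obtain N where "\<forall>n\<ge>N. wdist2 0 G (F n) \<le> ennreal e'" by blast
    then show "\<forall>\<^sub>F n in sequentially. wdist2 0 G (F n) < a"
      unfolding eventually_sequentially using e e' by (metis le_less_trans)
  qed auto
  then show ?thesis using that[of G] by simp
qed

lemma trunc_ft_eq_fint:
  "trunc_ft f R = fint (\<lambda>x. indicator (ball 0 R) x *\<^sub>R complex_of_real (f x))"
  by (rule ext) (simp add: trunc_ft_def fint_def)

lemma sq_integrable_truncation:
  assumes f: "sq_integrable f"
  shows "integrable lborel (\<lambda>x. indicator (ball 0 R) x *\<^sub>R complex_of_real (f x))"
proof -
  have [measurable]: "Borel f" using f by (simp add: sq_integrable_def)
  have "(\<integral>\<^sup>+x. ennreal (cmod (indicator (ball 0 R) x *\<^sub>R complex_of_real (f x))) \<partial>lborel)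
    \<le> (\<integral>\<^sup>+x. indicator (ball 0 R) x + ennreal ((f x)\<^sup>2) \<partial>lborel)"
  proof (rule nn_integral_mono)
    fix x
    have "\<bar>f x\<bar> \<le> 1 + (f x)\<^sup>2"
      using zero_le_power2[of "\<bar>f x\<bar> - 1"] by (simp add: power2_diff)
    then have "ennreal \<bar>f x\<bar> \<le> 1 + ennreal ((f x)\<^sup>2)"
      by (metis ennreal_1 ennreal_leI ennreal_plus zero_le_one zero_le_power2)
    then show "ennreal (cmod (indicator (ball 0 R) x *\<^sub>R complex_of_real (f x))) \<le> indicator (ball 0 R) x + ennreal ((f x)\<^sup>2)"
      by (auto simp: indicator_def)
  qed
  also have "\<dots> = emeasure lborel (ball 0 R :: plane set) + (\<integral>\<^sup>+x. ennreal ((f x)\<^sup>2) \<partial>lborel)"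
    by (subst nn_integral_add) (auto intro!: borel_measurable_indicator)
  also have "\<dots> < \<infinity>"
    using f emeasure_lborel_ball_finite[of 0 R] by (simp add: sq_integrable_def less_top)
  finally have fin: "(\<integral>\<^sup>+x. ennreal (cmod (indicator (ball 0 R) x *\<^sub>R complex_of_real (f x))) \<partial>lborel) < \<infinity>" .
  have [measurable]: "indicat_real (ball 0 R) \<in> borel_measurable (borel :: plane measure)"
    by (rule borel_measurable_indicator) simp
  show ?thesis by (rule integrableI_bounded[OF _ fin]) measurable
qed

lemma trunc_ft_measurable [measurable]:
  assumes "sq_integrable f" shows "Borel (trunc_ft f R)"
  unfolding trunc_ft_eq_fint using borel_measurable_integrable[OF sq_integrable_truncation[OF assms]]
  by (intro fint_measurable) simp

lemma trunc_ft_tail: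
  assumes f: "sq_integrable f" and R: "0 \<le> r" "r \<le> R"
  shows "wdist2 0 (trunc_ft f R) (trunc_ft f r) \<le>
    ennreal ((2 * pi)\<^sup>2) * (\<integral>\<^sup>+x. ennreal ((f x)\<^sup>2) * indicator (- ball 0 r) x \<partial>lborel)"
proof -
  let ?g = "\<lambda>x. indicator (ball 0 R) x *\<^sub>R complex_of_real (f x) - indicator (ball 0 r) x *\<^sub>R complex_of_real (f x)"
  have "wdist2 0 (trunc_ft f R) (trunc_ft f r) = nrm 0 (\<lambda>\<z>. ennreal (cmod (fint ?g \<z>)))"
    unfolding wdist2_eq_nrm trunc_ft_eq_fint by (simp add: fint_diff sq_integrable_truncation[OF f])
  also have "\<dots> \<le> ennreal ((2 * pi)\<^sup>2) * nrm 0 (\<lambda>x. ennreal (cmod (?g x)))"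
    by (intro fint_L2 Bochner_Integration.integrable_diff sq_integrable_truncation f)
  also have "\<dots> \<le> ennreal ((2 * pi)\<^sup>2) * (\<integral>\<^sup>+x. ennreal ((f x)\<^sup>2) * indicator (- ball 0 r) x \<partial>lborel)"
    unfolding nrm_0 using R
    by (intro mult_left_mono nn_integral_mono) (auto simp: indicator_def ennreal_power)
  finally show ?thesis .
qed

lemma sq_integrable_tail:
  assumes f: "sq_integrable f" and "0 < e"
  obtains N :: nat where "(\<integral>\<^sup>+x. ennreal ((f x)\<^sup>2) * indicator (- ball 0 (real N)) x \<partial>lborel) < ennreal e"
proof -
  have [measurable]: "Borel f" using f by (simp add: sq_integrable_def)
  have "(\<lambda>n. \<integral>\<^sup>+x. ennreal ((f x)\<^sup>2) * indicator (- ball 0 (real n)) x \<partial>lborel) \<longlonglongrightarrow> (\<integral>\<^sup>+x. 0 \<partial>(lborel :: plane measure))"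
  proof (rule nn_integral_dominated_convergence[where w="\<lambda>x. ennreal ((f x)\<^sup>2)"])
    show "AE x in lborel. (\<lambda>n. ennreal ((f x)\<^sup>2) * indicator (- ball 0 (real n)) x) \<longlonglongrightarrow> 0"
    proof (rule AE_I2)
      fix x :: "plane"
      obtain N where "norm x < real N" using reals_Archimedean2 by blast
      then have "\<forall>n\<ge>N. ennreal ((f x)\<^sup>2) * indicator (- ball 0 (real n)) x = 0"
        by (auto simp: indicator_def)
      then show "(\<lambda>n. ennreal ((f x)\<^sup>2) * indicator (- ball 0 (real n)) x) \<longlonglongrightarrow> 0"
        by (intro tendsto_eventually) (auto simp: eventually_sequentially)
    qed
  qed (use f in \<open>auto simp: sq_integrable_def indicator_def\<close>)
  then have "\<forall>\<^sub>F n in sequentially. (\<integral>\<^sup>+x. ennreal ((f x)\<^sup>2) * indicator (- ball 0 (real n)) x \<partial>lborel) < ennreal e"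
    using \<open>0 < e\<close> by (intro order_tendstoD) auto
  then show ?thesis using that by (auto simp: eventually_sequentially)
qed

text \<open>This gives meaning to the choice in \<open>ft\<close>. The truncations form a Cauchy
  family, since the Fourier integral over an annulus is bounded in L^2 by the square integral of
  \<open>f\<close> outside the smaller ball.\<close>

lemma is_l2_ft_ex:
  assumes f: "sq_integrable f"
  shows "\<exists>F. is_l2_ft f F"
proof -
  let ?\<tau> = "\<lambda>r. \<integral>\<^sup>+x. ennreal ((f x)\<^sup>2) * indicator (- ball 0 r) x \<partial>lborel"
  have tail: "\<exists>N::nat. \<forall>R\<ge>N. wdist2 0 (trunc_ft f R) (trunc_ft f N) \<le> ennreal e" if "0 < e" for e :: real
  proof -
    have "0 < e / (2 * pi)\<^sup>2" using that by simp
    from sq_integrable_tail[OF f this] obtain N where N: "?\<tau> (real N) < ennreal (e / (2 * pi)\<^sup>2)" .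
    have "wdist2 0 (trunc_ft f R) (trunc_ft f N) \<le> ennreal e" if "real N \<le> R" for R
    proof -
      have "wdist2 0 (trunc_ft f R) (trunc_ft f N) \<le> ennreal ((2 * pi)\<^sup>2) * ?\<tau> (real N)"
        using that by (intro trunc_ft_tail f) auto
      also have "\<dots> \<le> ennreal ((2 * pi)\<^sup>2) * ennreal (e / (2 * pi)\<^sup>2)" using N by (intro mult_left_mono) auto
      also have "\<dots> = ennreal e" using \<open>0 < e\<close> by (simp add: ennreal_mult[symmetric] del: power_mult_distrib)
      finally show ?thesis .
    qed
    then show ?thesis by blast
  qed
  have [measurable]: "Borel (trunc_ft f R)" for R using trunc_ft_measurable[OF f] .
  obtain F where F[measurable]: "Borel F" and lim: "(\<lambda>n. wdist2 0 F (trunc_ft f (real n))) \<longlonglongrightarrow> 0"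
  proof (rule Riesz_Fischer[of "\<lambda>n. trunc_ft f (real n)"])
    fix e :: real assume "0 < e"
    then obtain N :: nat where N: "\<And>R. real N \<le> R \<Longrightarrow> wdist2 0 (trunc_ft f R) (trunc_ft f N) \<le> ennreal (e/4)"
      using tail[of "e/4"] by auto
    have "wdist2 0 (trunc_ft f (real m)) (trunc_ft f (real n)) \<le> ennreal e" if "N \<le> m" "N \<le> n" for m n
    proof -
      have "wdist2 0 (trunc_ft f (real m)) (trunc_ft f (real n)) \<le>
         2 * wdist2 0 (trunc_ft f (real m)) (trunc_ft f N) + 2 * wdist2 0 (trunc_ft f N) (trunc_ft f (real n))"
        by (rule wdist2_triangle) auto
      also have "\<dots> \<le> 2 * ennreal (e/4) + 2 * ennreal (e/4)"
        using N[of "real m"] N[of "real n"] that wdist2_commute[of 0 "trunc_ft f N"]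
        by (intro add_mono mult_left_mono) auto
      also have "\<dots> = ennreal 2 * ennreal (e/4) + ennreal 2 * ennreal (e/4)" by simp
      also have "\<dots> = ennreal e" using \<open>0 < e\<close>
        by (simp only: ennreal_mult[symmetric] ennreal_plus[symmetric]) (simp add: ennreal_mult[symmetric] ennreal_plus[symmetric] del: ennreal_plus ennreal_numeral)
      finally show ?thesis .
    qed
    then show "\<exists>N. \<forall>m\<ge>N. \<forall>n\<ge>N. wdist2 0 (trunc_ft f (real m)) (trunc_ft f (real n)) \<le> ennreal e" by blast
  qed auto
  \<comment> \<open>The limit was taken along integer radii, but \<open>is_l2_ft\<close> speaks of
    all real radii. Two uses of the squared triangle inequality cost 2 + 2 * (2 + 2) = 10, which the
    fraction 1/16 absorbs.\<close>
  have ev: "\<forall>\<^sub>F R in at_top. wdist2 0 F (trunc_ft f R) < a" if "0 < a" for a :: ennreal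
  proof -
    obtain e where "0 < e" "e < a" using \<open>0 < a\<close> dense by blast
    then obtain e' where e': "0 < e'" "ennreal e' < a" by (cases e) auto
    then obtain N :: nat where N: "\<And>R. real N \<le> R \<Longrightarrow> wdist2 0 (trunc_ft f R) (trunc_ft f N) \<le> ennreal (e'/16)"
      using tail[of "e'/16"] by auto
    have "\<forall>\<^sub>F n in sequentially. wdist2 0 F (trunc_ft f (real n)) < ennreal (e'/16)"
      using e' by (intro order_tendstoD[OF lim]) auto
    with eventually_ge_at_top[of N] have "\<forall>\<^sub>F n in sequentially. wdist2 0 F (trunc_ft f (real n)) < ennreal (e'/16) \<and> N \<le> n"
      by eventually_elim auto
    then obtain n where n: "wdist2 0 F (trunc_ft f (real n)) < ennreal (e'/16)" "N \<le> n"
      by (auto simp: eventually_sequentially)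
    have "wdist2 0 F (trunc_ft f R) < a" if "real N \<le> R" for R
    proof -
      have "wdist2 0 F (trunc_ft f R) \<le> 2 * wdist2 0 F (trunc_ft f (real n)) + 2 * wdist2 0 (trunc_ft f (real n)) (trunc_ft f R)"
        by (rule wdist2_triangle) auto
      also have "\<dots> \<le> 2 * wdist2 0 F (trunc_ft f (real n)) + 2 * (2 * wdist2 0 (trunc_ft f (real n)) (trunc_ft f N) + 2 * wdist2 0 (trunc_ft f N) (trunc_ft f R))"
        by (intro add_left_mono mult_left_mono wdist2_triangle) auto
      also have "\<dots> \<le> 2 * ennreal (e'/16) + 2 * (2 * ennreal (e'/16) + 2 * ennreal (e'/16))"
        using N[of R] N[of "real n"] that n wdist2_commute[of 0 "trunc_ft f N"]
        by (intro add_mono mult_left_mono) auto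
      also have "\<dots> = 10 * ennreal (e'/16)" by (simp add: distrib_left[symmetric] distrib_right[symmetric] mult.assoc[symmetric] flip: mult_2)
      also have "\<dots> = ennreal (10 * (e'/16))" using e' by (subst ennreal_mult) auto
      also have "\<dots> \<le> ennreal e'" using e' by (intro ennreal_leI) auto
      also have "\<dots> < a" using e' by simp
      finally show ?thesis .
    qed
    then show ?thesis by (auto simp: eventually_at_top_linorder)
  qed
  have conv: "((\<lambda>R. wdist2 0 F (trunc_ft f R)) \<longlongrightarrow> 0) at_top"
    by (rule order_tendstoI) (auto intro: ev)
  have fin: "(\<integral>\<^sup>+\<z>. ennreal ((cmod (F \<z>))\<^sup>2) \<partial>lborel) < \<infinity>"
  proof -
    obtain R where R: "wdist2 0 F (trunc_ft f R) < 1"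
      using ev[of 1] by (auto simp: eventually_at_top_linorder)
    have "(\<integral>\<^sup>+\<z>. ennreal ((cmod (F \<z>))\<^sup>2) \<partial>lborel) = wdist2 0 F (\<lambda>_. 0)" by (simp add: wdist2_0)
    also have "\<dots> \<le> 2 * wdist2 0 F (trunc_ft f R) + 2 * wdist2 0 (trunc_ft f R) (\<lambda>_. 0)"
      by (rule wdist2_triangle) auto
    also have "wdist2 0 (trunc_ft f R) (\<lambda>_. 0) \<le> ennreal ((2*pi)\<^sup>2) * nrm 0 (\<lambda>x. ennreal (cmod (indicator (ball 0 R) x *\<^sub>R complex_of_real (f x))))"
      unfolding trunc_ft_eq_fint wdist2_eq_nrm diff_zero by (intro fint_L2 sq_integrable_truncation f)
    also have "\<dots> \<le> ennreal ((2*pi)\<^sup>2) * (\<integral>\<^sup>+x. ennreal ((f x)\<^sup>2) \<partial>lborel)"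
      unfolding nrm_0 by (intro mult_left_mono nn_integral_mono) (auto simp: indicator_def ennreal_power)
    also have "2 * wdist2 0 F (trunc_ft f R) + 2 * \<dots> < \<infinity>"
      using R f by (intro ennreal_twice_add_finite) (auto simp: sq_integrable_def ennreal_mult_less_top intro: order.strict_trans)
    finally show ?thesis by (simp add: mult_left_mono add_mono)
  qed
  show ?thesis
    using conv fin f by (intro exI[of _ F]) (simp add: is_l2_ft_def wdist2_0)
qed

lemma ft_is_l2_ft: "sq_integrable f \<Longrightarrow> is_l2_ft f (ft f)"
  using someI_ex[OF is_l2_ft_ex[of f]] by (simp add: ft_def)

lemma is_l2_ft_tendsto:
  assumes "is_l2_ft f F" shows "(\<lambda>n. wdist2 0 F (trunc_ft f (real n))) \<longlonglongrightarrow> 0"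
  using assms unfolding is_l2_ft_def wdist2_0
  by (auto intro: filterlim_compose filterlim_real_sequentially)

lemma is_l2_ft_measurable: "is_l2_ft f F \<Longrightarrow> Borel F"
  by (simp add: is_l2_ft_def)

lemma is_l2_ft_unique:
  assumes "is_l2_ft f F" "is_l2_ft f G"
  shows "AE \<z> in lborel. F \<z> = G \<z>"
  using assms
  by (intro wdist2_limit_unique[OF _ _ _ is_l2_ft_tendsto is_l2_ft_tendsto] trunc_ft_measurable)
     (auto simp: is_l2_ft_def)

lemma ft_unique: "is_l2_ft f F \<Longrightarrow> AE \<z> in lborel. ft f \<z> = F \<z>"
  using is_l2_ft_unique ft_is_l2_ft unfolding is_l2_ft_def by blast

abbreviation cabs :: "('a \<Rightarrow> complex) \<Rightarrow> 'a \<Rightarrow> ennreal" where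
  "cabs F \<equiv> (\<lambda>\<z>. ennreal (cmod (F \<z>)))"

lemma nrm_0_cabs: "nrm 0 (cabs F) = (\<integral>\<^sup>+\<z>. ennreal ((cmod (F \<z>))\<^sup>2) \<partial>lborel)"
  by (simp add: nrm_0 ennreal_power)

lemma L2_pairing:
  assumes [measurable]: "Borel F" "Borel G"
    and fin: "nrm 0 (cabs F) < \<infinity>" "nrm 0 (cabs G) < \<infinity>"
  shows "integrable lborel (\<lambda>x. F x * G x)"
    and "(ennreal (cmod (\<integral>x. F x * G x \<partial>lborel)))\<^sup>2 \<le> nrm 0 (cabs F) * nrm 0 (cabs G)"
proof -
  have CS: "(\<integral>\<^sup>+x. ennreal (cmod (F x * G x)) \<partial>lborel)\<^sup>2 \<le> nrm 0 (cabs F) * nrm 0 (cabs G)"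
    unfolding nrm_0 norm_mult using Cauchy_Schwarz_nn_integral[of "cabs F" lborel "cabs G"]
    by (simp add: ennreal_mult)
  also have "\<dots> < \<infinity>" using fin by (simp add: ennreal_mult_less_top)
  finally have "(\<integral>\<^sup>+x. ennreal (cmod (F x * G x)) \<partial>lborel) < \<infinity>"
    by (simp add: power_less_top_ennreal)
  then show int: "integrable lborel (\<lambda>x. F x * G x)" by (intro integrableI_bounded) auto
  have "(ennreal (cmod (\<integral>x. F x * G x \<partial>lborel)))\<^sup>2 \<le> (\<integral>\<^sup>+x. ennreal (cmod (F x * G x)) \<partial>lborel)\<^sup>2"
    by (intro ennreal_square_mono integral_norm_bound_ennreal int)
  with CS show "(ennreal (cmod (\<integral>x. F x * G x \<partial>lborel)))\<^sup>2 \<le> nrm 0 (cabs F) * nrm 0 (cabs G)"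
    by (rule order_trans[rotated])
qed

lemma nrm_cabs_diff_finite:
  assumes [measurable]: "Borel F" "Borel G"
    and "nrm s (cabs F) < \<infinity>" "nrm s (cabs G) < \<infinity>"
  shows "nrm s (cabs (\<lambda>\<z>. F \<z> - G \<z>)) < \<infinity>"
proof -
  have "nrm s (cabs (\<lambda>\<z>. F \<z> - G \<z>)) \<le> nrm s (\<lambda>\<z>. cabs F \<z> + cabs G \<z>)"
    by (intro nrm_mono) (simp add: ennreal_plus[symmetric] ennreal_leI norm_triangle_ineq4 del: ennreal_plus)
  also have "\<dots> \<le> 2 * nrm s (cabs F) + 2 * nrm s (cabs G)" by (rule nrm_add) auto
  also have "\<dots> < \<infinity>" by (intro ennreal_twice_add_finite assms)
  finally show ?thesis .
qed

lemma ennreal_tendsto_0_le: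
  fixes f g :: "'a \<Rightarrow> ennreal"
  assumes "(g \<longlongrightarrow> 0) F" "\<forall>\<^sub>F x in F. f x \<le> g x"
  shows "(f \<longlongrightarrow> 0) F"
  by (rule tendsto_sandwich[OF _ assms(2) tendsto_const assms(1)]) simp

lemma L2_pairing_tendsto:
  assumes [measurable]: "\<And>n. Borel (X n)" "Borel F" "Borel G"
    and fin: "\<And>n. nrm 0 (cabs (X n)) < \<infinity>" "nrm 0 (cabs F) < \<infinity>" "nrm 0 (cabs G) < \<infinity>"
    and lim: "(\<lambda>n. wdist2 0 F (X n)) \<longlonglongrightarrow> 0"
  shows "(\<lambda>n. \<integral>x. X n x * G x \<partial>lborel) \<longlonglongrightarrow> (\<integral>x. F x * G x \<partial>lborel)"
proof -
  let ?I = "\<lambda>n. \<integral>x. (F x - X n x) * G x \<partial>lborel"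
  have le: "ennreal ((cmod (?I n))\<^sup>2) \<le> nrm 0 (cabs G) * wdist2 0 F (X n)" for n
    using L2_pairing(2)[of "\<lambda>x. F x - X n x" G] nrm_cabs_diff_finite[of F "X n" 0] fin
    by (simp add: wdist2_eq_nrm mult.commute ennreal_power)
  have "(\<lambda>n. nrm 0 (cabs G) * wdist2 0 F (X n)) \<longlonglongrightarrow> nrm 0 (cabs G) * 0"
    by (rule ennreal_tendsto_cmult[OF _ lim]) (use fin in auto)
  then have "(\<lambda>n. nrm 0 (cabs G) * wdist2 0 F (X n)) \<longlonglongrightarrow> 0" by simp
  then have "(\<lambda>n. ennreal ((cmod (?I n))\<^sup>2)) \<longlonglongrightarrow> 0"
    by (rule ennreal_tendsto_0_le) (intro always_eventually allI le)
  then have "(\<lambda>n. ennreal ((cmod (?I n))\<^sup>2)) \<longlonglongrightarrow> ennreal 0" by simp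
  then have "(\<lambda>n. (cmod (?I n))\<^sup>2) \<longlonglongrightarrow> 0" by (subst (asm) tendsto_ennreal_iff) auto
  then have "(\<lambda>n. sqrt ((cmod (?I n))\<^sup>2)) \<longlonglongrightarrow> sqrt 0" by (intro tendsto_intros)
  then have "?I \<longlonglongrightarrow> 0" by (simp add: tendsto_norm_zero_iff)
  moreover have "?I n = (\<integral>x. F x * G x \<partial>lborel) - (\<integral>x. X n x * G x \<partial>lborel)" for n
    unfolding left_diff_distrib using L2_pairing(1)[of F G] L2_pairing(1)[of "X n" G] fin
    by (intro Bochner_Integration.integral_diff) auto
  ultimately have "(\<lambda>n. (\<integral>x. F x * G x \<partial>lborel) - (\<integral>x. X n x * G x \<partial>lborel)) \<longlonglongrightarrow> 0" by simp
  from tendsto_diff[OF tendsto_const[of "\<integral>x. F x * G x \<partial>lborel"] this] show ?thesis by simp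
qed

lemma is_l2_ft_nrm_finite: "is_l2_ft f F \<Longrightarrow> nrm 0 (cabs F) < \<infinity>"
  by (simp add: is_l2_ft_def nrm_0_cabs)

text \<open>Both sides are limits of the formula for truncations: the left one by convergence in
  L^2, the right one by dominated convergence.\<close>

lemma l2_ft_multiplication:
  assumes f: "is_l2_ft f F" and \<psi>: "integrable lborel \<psi>" "nrm 0 (cabs \<psi>) < \<infinity>"
  shows "(\<integral>\<z>. F \<z> * \<psi> \<z> \<partial>lborel) = (\<integral>x. complex_of_real (f x) * fint \<psi> x \<partial>lborel)"
proof -
  have sq: "sq_integrable f" using f by (simp add: is_l2_ft_def)
  have [measurable]: "Borel f" "Borel F" "Borel \<psi>"
    using f \<psi> by (auto simp: is_l2_ft_def sq_integrable_def)
  have [measurable]: "Borel (trunc_ft f R)" for R using trunc_ft_measurable[OF sq] .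
  have ffin: "nrm 0 (cabs (\<lambda>x. complex_of_real (f x))) < \<infinity>"
    unfolding nrm_0_cabs using sq by (simp add: sq_integrable_def)
  have tfin: "nrm 0 (cabs (trunc_ft f R)) < \<infinity>" for R
  proof -
    have "nrm 0 (cabs (trunc_ft f R)) \<le> ennreal ((2*pi)\<^sup>2) * nrm 0 (cabs (\<lambda>x. indicator (ball 0 R) x *\<^sub>R complex_of_real (f x)))"
      unfolding trunc_ft_eq_fint by (intro fint_L2 sq_integrable_truncation sq)
    also have "\<dots> \<le> ennreal ((2*pi)\<^sup>2) * nrm 0 (cabs (\<lambda>x. complex_of_real (f x)))"
      by (intro mult_left_mono nrm_mono) (auto simp: indicator_def)
    also have "\<dots> < \<infinity>" using ffin by (simp add: ennreal_mult_less_top)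
    finally show ?thesis .
  qed
  have \<psi>fin: "nrm 0 (cabs (fint \<psi>)) < \<infinity>"
    using order.strict_trans1[OF fint_L2[OF \<psi>(1)]] \<psi>(2) by (simp add: ennreal_mult_less_top)
  have lim1: "(\<lambda>n. \<integral>\<z>. trunc_ft f (real n) \<z> * \<psi> \<z> \<partial>lborel) \<longlonglongrightarrow> (\<integral>\<z>. F \<z> * \<psi> \<z> \<partial>lborel)"
    by (rule L2_pairing_tendsto[OF _ _ _ tfin is_l2_ft_nrm_finite[OF f] \<psi>(2) is_l2_ft_tendsto[OF f]]) measurable
  have int: "integrable lborel (\<lambda>x. complex_of_real (f x) * fint \<psi> x)"
    by (rule L2_pairing(1)) (use ffin \<psi>fin in auto)
  have "(\<lambda>n. \<integral>x. (indicator (ball 0 (real n)) x *\<^sub>R complex_of_real (f x)) * fint \<psi> x \<partial>lborel)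
     \<longlonglongrightarrow> (\<integral>x. complex_of_real (f x) * fint \<psi> x \<partial>lborel)"
  proof (rule integral_dominated_convergence[where w="\<lambda>x. cmod (complex_of_real (f x) * fint \<psi> x)"])
    show "integrable lborel (\<lambda>x. cmod (complex_of_real (f x) * fint \<psi> x))" using int by (rule integrable_norm)
    have [measurable]: "indicat_real (ball 0 r) \<in> borel_measurable (borel :: plane measure)" for r
      by (rule borel_measurable_indicator) simp
    show "(\<lambda>x. (indicator (ball 0 (real n)) x *\<^sub>R complex_of_real (f x)) * fint \<psi> x) \<in> borel_measurable lborel" for n
      by measurable
    show "AE x in lborel. (\<lambda>n. (indicator (ball 0 (real n)) x *\<^sub>R complex_of_real (f x)) * fint \<psi> x)
        \<longlonglongrightarrow> complex_of_real (f x) * fint \<psi> x"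
    proof (rule AE_I2)
      fix x :: "plane"
      obtain N where "norm x < real N" using reals_Archimedean2 by blast
      then have "\<forall>n\<ge>N. (indicator (ball 0 (real n)) x *\<^sub>R complex_of_real (f x)) * fint \<psi> x = complex_of_real (f x) * fint \<psi> x"
        by (auto simp: indicator_def)
      then show "(\<lambda>n. (indicator (ball 0 (real n)) x *\<^sub>R complex_of_real (f x)) * fint \<psi> x) \<longlonglongrightarrow> complex_of_real (f x) * fint \<psi> x"
        by (intro tendsto_eventually) (auto simp: eventually_sequentially)
    qed
    show "AE x in lborel. cmod ((indicator (ball 0 (real n)) x *\<^sub>R complex_of_real (f x)) * fint \<psi> x)
        \<le> cmod (complex_of_real (f x) * fint \<psi> x)" for n
      by (intro AE_I2) (auto simp: indicator_def norm_mult)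
  qed measurable
  moreover have "(\<integral>x. (indicator (ball 0 (real n)) x *\<^sub>R complex_of_real (f x)) * fint \<psi> x \<partial>lborel) = (\<integral>\<z>. trunc_ft f (real n) \<z> * \<psi> \<z> \<partial>lborel)" for n
    unfolding trunc_ft_eq_fint by (rule fint_multiplication[symmetric]) (intro sq_integrable_truncation sq \<psi>)+
  ultimately have "(\<lambda>n. \<integral>\<z>. trunc_ft f (real n) \<z> * \<psi> \<z> \<partial>lborel) \<longlonglongrightarrow> (\<integral>x. complex_of_real (f x) * fint \<psi> x \<partial>lborel)"
    by simp
  from LIMSEQ_unique[OF lim1 this] show ?thesis .
qed

lemma nn_integral_econv:
  assumes [measurable]: "Borel A" "Borel B"
  shows "(\<integral>\<^sup>+\<z>. econv A B \<z> \<partial>lborel) = (\<integral>\<^sup>+z. A z \<partial>lborel) * (\<integral>\<^sup>+z. B z \<partial>lborel)"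
proof -
  have "(\<integral>\<^sup>+\<z>. econv A B \<z> \<partial>lborel) = (\<integral>\<^sup>+z. (\<integral>\<^sup>+\<z>. A (\<z> - z) * B z \<partial>lborel) \<partial>lborel)"
    unfolding econv_def by (rule lborel_pair.Fubini'[symmetric]) measurable
  also have "\<dots> = (\<integral>\<^sup>+z. (\<integral>\<^sup>+z. A z \<partial>lborel) * B z \<partial>lborel)"
    by (intro nn_integral_cong) (simp add: nn_integral_multc nn_integral_lborel_translate[of A])
  finally show ?thesis by (simp add: nn_integral_cmult)
qed

section \<open>Gaussians separate square-integrable functions\<close>

definition heat :: "real \<Rightarrow> plane \<Rightarrow> real" where
  "heat k y = k\<^sup>2 / (2 * pi) * gauss k y"

lemma heat_measurable [measurable]: "Borel (heat k)"
  unfolding heat_def by measurable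

lemma heat_nonneg [simp]: "0 \<le> heat k y"
  by (simp add: heat_def)

lemma nn_integral_heat: "0 < k \<Longrightarrow> (\<integral>\<^sup>+y. ennreal (heat k y) \<partial>lborel) = 1"
proof -
  assume k: "0 < k"
  have "(\<integral>\<^sup>+y. ennreal (heat k y) \<partial>lborel) = (\<integral>\<^sup>+y. ennreal (k\<^sup>2 / (2 * pi)) * ennreal (gauss k y) \<partial>lborel)"
    unfolding heat_def by (intro nn_integral_cong ennreal_mult) auto
  also have "\<dots> = ennreal (k\<^sup>2 / (2 * pi)) * ennreal (2 * pi / k\<^sup>2)"
    by (subst nn_integral_cmult) (auto simp: nn_integral_gauss k)
  also have "\<dots> = ennreal ((k\<^sup>2 / (2 * pi)) * (2 * pi / k\<^sup>2))" by (rule ennreal_mult[symmetric]) auto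
  also have "\<dots> = 1" using k by simp
  finally show ?thesis .
qed

text \<open>Half of the exponent supplies the decay, and the other half is again a heat kernel, with
  parameter \<open>k / sqrt 2\<close>; the factor 2 is the ratio of the normalisations.\<close>

lemma heat_tail:
  assumes "0 < k" "0 \<le> \<delta>"
  shows "(\<integral>\<^sup>+y. ennreal (heat k y) * indicator {y. \<delta> \<le> norm y} y \<partial>lborel) \<le> ennreal (2 * exp (- (k\<^sup>2 * \<delta>\<^sup>2 / 4)))"
proof -
  let ?e = "exp (- (k\<^sup>2 * \<delta>\<^sup>2 / 4))"
  have "(\<integral>\<^sup>+y. ennreal (heat k y) * indicator {y. \<delta> \<le> norm y} y \<partial>lborel) \<le> (\<integral>\<^sup>+y. ennreal (2 * ?e) * ennreal (heat (k / sqrt 2) y) \<partial>lborel)"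
  proof (rule nn_integral_mono)
    fix y :: "plane"
    have "heat k y \<le> 2 * ?e * heat (k / sqrt 2) y" if "\<delta> \<le> norm y"
    proof -
      have "\<delta>\<^sup>2 \<le> y \<bullet> y" using that assms power_mono[of \<delta> "norm y" 2] by (simp add: power2_norm_eq_inner)
      then have "exp (- (k\<^sup>2 * (y \<bullet> y)) / 4) \<le> ?e" by (simp add: mult_left_mono divide_right_mono)
      moreover have "gauss k y = exp (- (k\<^sup>2 * (y \<bullet> y)) / 4) * gauss (k / sqrt 2) y"
        unfolding gauss_def by (subst exp_add[symmetric]) (simp add: power_divide field_simps)
      ultimately have "gauss k y \<le> ?e * gauss (k / sqrt 2) y" by (simp add: mult_right_mono)
      then have "k\<^sup>2 / (2 * pi) * gauss k y \<le> k\<^sup>2 / (2 * pi) * (?e * gauss (k / sqrt 2) y)"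
        by (intro mult_left_mono) auto
      then show ?thesis by (simp add: heat_def power_divide field_simps)
    qed
    then show "ennreal (heat k y) * indicator {y. \<delta> \<le> norm y} y \<le> ennreal (2 * ?e) * ennreal (heat (k / sqrt 2) y)"
      by (auto simp: indicator_def ennreal_mult[symmetric] intro!: ennreal_leI)
  qed
  also have "\<dots> = ennreal (2 * ?e)" using assms by (subst nn_integral_cmult) (auto simp: nn_integral_heat)
  finally show ?thesis .
qed

text \<open>Heat-kernel averages of the indicator of an open set with null boundary converge to the
  indicator almost everywhere, hence in the mean by Scheffe's lemma.\<close>

lemma heat_average_tendsto:
  fixes S :: "plane set"
  assumes S: "open S" "emeasure lborel S < \<infinity>" "AE x in lborel. x \<notin> frontier S"
  defines "p \<equiv> \<lambda>n x. \<integral>c. heat (real (Suc n)) (x - c) * indicator S c \<partial>lborel"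
  shows "\<And>n x. ennreal (p n x) = econv (\<lambda>y. ennreal (heat (real (Suc n)) y)) (indicator S) x"
    and "\<And>n. Borel (p n)"
    and "(\<lambda>n. \<integral>\<^sup>+x. ennreal ((p n x - indicator S x)\<^sup>2) \<partial>lborel) \<longlonglongrightarrow> 0"
proof -
  have [measurable]: "S \<in> sets borel" using S(1) by (rule borel_open)
  let ?g = "\<lambda>n y. ennreal (heat (real (Suc n)) y)"
  have g1: "(\<integral>\<^sup>+y. ?g n y \<partial>lborel) = 1" for n by (rule nn_integral_heat) simp
  have g2: "(\<integral>\<^sup>+c. ?g n (x - c) \<partial>lborel) = 1" for n x
    using nn_integral_lborel_reflect[of "?g n" x] g1 by simp
  have conv_le: "econv (?g n) (indicator S) x \<le> 1" for n x
  proof -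
    have "econv (?g n) (indicator S) x \<le> (\<integral>\<^sup>+c. ?g n (x - c) \<partial>lborel)"
      unfolding econv_def by (intro nn_integral_mono) (auto simp: indicator_def)
    then show ?thesis unfolding g2 .
  qed
  have int: "integrable lborel (\<lambda>c. heat (real (Suc n)) (x - c) * indicator S c)" for n x
  proof (rule integrableI_bounded)
    have "(\<integral>\<^sup>+c. ennreal (norm (heat (real (Suc n)) (x - c) * indicator S c)) \<partial>lborel) = econv (?g n) (indicator S) x"
      unfolding econv_def by (intro nn_integral_cong) (auto simp: indicator_def)
    then show "(\<integral>\<^sup>+c. ennreal (norm (heat (real (Suc n)) (x - c) * indicator S c)) \<partial>lborel) < \<infinity>"
      using conv_le[of n x] by (auto intro: order.strict_trans1)
  qed measurable
  show p: "ennreal (p n x) = econv (?g n) (indicator S) x" for n x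
  proof -
    have "ennreal (p n x) = (\<integral>\<^sup>+c. ennreal (heat (real (Suc n)) (x - c) * indicator S c) \<partial>lborel)"
      unfolding p_def by (rule nn_integral_eq_integral[OF int, symmetric]) (auto simp: indicator_def)
    also have "\<dots> = econv (?g n) (indicator S) x"
      unfolding econv_def by (intro nn_integral_cong) (auto simp: indicator_def)
    finally show ?thesis .
  qed
  show pm: "Borel (p n)" for n unfolding p_def by measurable
  note pm[measurable]
  have p0: "0 \<le> p n x" for n x unfolding p_def by (intro integral_nonneg_AE AE_I2) (auto simp: indicator_def)
  have p1: "p n x \<le> 1" for n x using conv_le[of n x] unfolding p[symmetric] by simp
  have pt: "(\<lambda>n. p n x) \<longlonglongrightarrow> indicator S x" if x: "x \<notin> frontier S" for x
  proof -
    have "x \<in> S \<or> x \<in> interior (- S)" using x S(1) by (auto simp: frontier_def interior_open closure_interior)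
    then obtain \<delta> where \<delta>: "0 < \<delta>" "(x \<in> S \<and> ball x \<delta> \<subseteq> S) \<or> (x \<notin> S \<and> ball x \<delta> \<subseteq> - S)"
      using S(1) by (metis open_contains_ball mem_interior centre_in_ball subsetD ComplD)
    let ?T = "\<lambda>n. 2 * exp (- ((real (Suc n))\<^sup>2 * \<delta>\<^sup>2 / 4))"
    have tail: "(\<integral>\<^sup>+c. ?g n (x - c) * indicator {c. \<delta> \<le> norm (x - c)} c \<partial>lborel) \<le> ennreal (?T n)" for n
    proof -
      have "(\<integral>\<^sup>+c. ?g n (x - c) * indicator {c. \<delta> \<le> norm (x - c)} c \<partial>lborel)
          = (\<integral>\<^sup>+y. ?g n y * indicator {y. \<delta> \<le> norm y} y \<partial>lborel)"
        by (subst nn_integral_lborel_reflect[where c=x, symmetric]) (auto simp: indicator_def)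
      also have "\<dots> \<le> ennreal (?T n)" using \<delta> by (intro heat_tail) auto
      finally show ?thesis .
    qed
    have "\<bar>p n x - indicator S x\<bar> \<le> ?T n" for n
    proof (cases "x \<in> S")
      case True
      then have sub: "ball x \<delta> \<subseteq> S" using \<delta> by auto
      have "1 \<le> (\<integral>\<^sup>+c. ?g n (x - c) * indicator S c + ?g n (x - c) * indicator {c. \<delta> \<le> norm (x - c)} c \<partial>lborel)"
        unfolding g2[of n x, symmetric]
        using sub by (intro nn_integral_mono) (auto simp: indicator_def dist_norm subset_iff not_le[symmetric])
      also have "\<dots> = econv (?g n) (indicator S) x + (\<integral>\<^sup>+c. ?g n (x - c) * indicator {c. \<delta> \<le> norm (x - c)} c \<partial>lborel)"
        unfolding econv_def by (subst nn_integral_add) auto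
      also have "\<dots> \<le> ennreal (p n x) + ennreal (?T n)" unfolding p by (intro add_left_mono tail)
      finally have "1 \<le> p n x + ?T n" using p0[of n x] by (simp add: ennreal_plus[symmetric] del: ennreal_plus)
      then show ?thesis using True p1[of n x] by simp
    next
      case False
      then have sub: "ball x \<delta> \<subseteq> - S" using \<delta> by auto
      have "ennreal (p n x) \<le> (\<integral>\<^sup>+c. ?g n (x - c) * indicator {c. \<delta> \<le> norm (x - c)} c \<partial>lborel)"
        unfolding p econv_def using sub
        by (intro nn_integral_mono) (auto simp: indicator_def dist_norm subset_iff not_le[symmetric])
      also note tail[of n]
      finally have "p n x \<le> ?T n" by simp
      then show ?thesis using False p0[of n x] by simp
    qed
    then have le: "\<forall>\<^sub>F n in sequentially. norm (p n x - indicator S x) \<le> ?T n" by simp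
    have "(\<lambda>n. 2 / ((\<delta>\<^sup>2 / 4) * real (Suc n))) \<longlonglongrightarrow> 0"
      using tendsto_mult_right[OF LIMSEQ_Suc[OF lim_1_over_n], of "2 / (\<delta>\<^sup>2 / 4)"] by (simp add: mult.commute)
    then have T: "?T \<longlonglongrightarrow> 0"
    proof (rule tendsto_sandwich[OF _ _ tendsto_const, rotated 2])
      show "\<forall>\<^sub>F n in sequentially. ?T n \<le> 2 / ((\<delta>\<^sup>2 / 4) * real (Suc n))"
      proof (intro always_eventually allI)
        fix n
        let ?a = "(\<delta>\<^sup>2 / 4) * real (Suc n)"
        have "?a * 1 \<le> ?a * real (Suc n)" by (intro mult_left_mono) auto
        then have "?a \<le> (real (Suc n))\<^sup>2 * \<delta>\<^sup>2 / 4" by (simp add: power2_eq_square ac_simps)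
        then have "?a \<le> exp ((real (Suc n))\<^sup>2 * \<delta>\<^sup>2 / 4)"
          using exp_ge_add_one_self[of "(real (Suc n))\<^sup>2 * \<delta>\<^sup>2 / 4"] by linarith
        moreover have "0 < ?a" using \<delta> by simp
        ultimately have "2 / exp ((real (Suc n))\<^sup>2 * \<delta>\<^sup>2 / 4) \<le> 2 / ?a" by (intro divide_left_mono) auto
        then show "?T n \<le> 2 / ?a" by (simp only: exp_minus divide_inverse[symmetric])
      qed
    qed auto
    have "(\<lambda>n. p n x - indicator S x) \<longlonglongrightarrow> 0"
      by (rule Lim_null_comparison[OF le T])
    then show ?thesis by (rule LIM_zero_cancel)
  qed
  have "(\<lambda>n. \<integral>\<^sup>+x. ennreal (norm (p n x - indicat_real S x)) \<partial>lborel) \<longlonglongrightarrow> 0"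
  proof (rule Scheffe_lemma2)
    show "integrable lborel (indicat_real S)" using S(2) by (intro integrable_real_indicator) auto
    show "AE x in lborel. (\<lambda>n. p n x) \<longlonglongrightarrow> indicat_real S x" using S(3) by eventually_elim (rule pt)
    show "(\<integral>\<^sup>+x. ennreal (norm (p n x)) \<partial>lborel) \<le> (\<integral>\<^sup>+x. ennreal (norm (indicat_real S x)) \<partial>lborel)" for n
    proof -
      have "(\<integral>\<^sup>+x. ennreal (norm (p n x)) \<partial>lborel) = (\<integral>\<^sup>+x. econv (?g n) (indicator S) x \<partial>lborel)"
        using p0 by (intro nn_integral_cong) (simp only: p[symmetric] real_norm_def abs_of_nonneg)
      also have "\<dots> = (\<integral>\<^sup>+x. indicator S x \<partial>lborel)" by (subst nn_integral_econv) (measurable, simp only: g1 mult_1)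
      also have "\<dots> = (\<integral>\<^sup>+x. ennreal (norm (indicat_real S x)) \<partial>lborel)"
        by (intro nn_integral_cong) (auto simp: indicator_def)
      finally show ?thesis by simp
    qed
  qed measurable
  \<comment> \<open>The two functions differ by at most 1, so squared differences are dominated by
    the differences, and L^1 convergence becomes L^2 convergence.\<close>
  then show "(\<lambda>n. \<integral>\<^sup>+x. ennreal ((p n x - indicator S x)\<^sup>2) \<partial>lborel) \<longlonglongrightarrow> 0"
  proof (rule tendsto_sandwich[OF _ _ tendsto_const, rotated 2])
    show "\<forall>\<^sub>F n in sequentially. (\<integral>\<^sup>+x. ennreal ((p n x - indicator S x)\<^sup>2) \<partial>lborel) \<le> (\<integral>\<^sup>+x. ennreal (norm (p n x - indicat_real S x)) \<partial>lborel)"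
    proof (intro always_eventually allI nn_integral_mono ennreal_leI)
      fix n x
      have "\<bar>p n x - indicator S x\<bar> \<le> 1" using p0[of n x] p1[of n x] by (auto simp: indicator_def)
      then have "\<bar>p n x - indicator S x\<bar> * \<bar>p n x - indicator S x\<bar> \<le> \<bar>p n x - indicator S x\<bar> * 1"
        by (intro mult_left_mono) auto
      then have "\<bar>p n x - indicator S x\<bar>\<^sup>2 \<le> \<bar>p n x - indicator S x\<bar>"
        by (simp only: power2_eq_square mult_1_right)
      then show "(p n x - indicator S x)\<^sup>2 \<le> norm (p n x - indicat_real S x)" by simp
    qed
  qed auto
qed

text \<open>Integrating the vanishing pairings over centres in \<open>S\<close> shows, by Fubini,
  that the heat averages of \<open>S\<close> pair to zero with \<open>H\<close>. These averages tend
  to the indicator of \<open>S\<close> in L^2.\<close>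

lemma heat_test_box:
  assumes [measurable]: "Borel H" and fin: "nrm 0 (cabs H) < \<infinity>"
    and S: "open S" "emeasure lborel S < \<infinity>" "AE x in lborel. x \<notin> frontier S"
    and z: "\<And>k c. 0 < k \<Longrightarrow> (\<integral>x. H x * complex_of_real (gauss k (x - c)) \<partial>lborel) = 0"
  shows "(\<integral>x. H x * indicator S x \<partial>lborel) = 0"
proof -
  have [measurable]: "S \<in> sets borel" using S(1) by (rule borel_open)
  define p where "p n x = (\<integral>c. heat (real (Suc n)) (x - c) * indicator S c \<partial>lborel)" for n x
  let ?g = "\<lambda>n y. ennreal (heat (real (Suc n)) y)"
  note P = heat_average_tendsto[OF S, folded p_def]
  have [measurable]: "Borel (p n)" for n by (rule P(2))
  have p0: "0 \<le> p n x" for n x unfolding p_def by (intro integral_nonneg_AE AE_I2) (auto simp: indicator_def)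
  have Sfin: "nrm 0 (cabs (\<lambda>x. complex_of_real (indicator S x))) < \<infinity>"
  proof -
    have "nrm 0 (cabs (\<lambda>x. complex_of_real (indicator S x))) = (\<integral>\<^sup>+x. indicator S x \<partial>lborel)"
      unfolding nrm_0_cabs by (intro nn_integral_cong) (auto simp: indicator_def)
    then show ?thesis using S(2) by simp
  qed
  have eS: "nrm 0 (indicator S) < \<infinity>"
  proof -
    have "nrm 0 (indicator S) = (\<integral>\<^sup>+x. indicator S x \<partial>lborel)"
      unfolding nrm_0 by (intro nn_integral_cong) (auto simp: indicator_def)
    then show ?thesis using S(2) by simp
  qed
  have econvfin: "nrm 0 (econv (?g n) (indicator S)) < \<infinity>" for n
  proof -
    have "nrm 0 (econv (?g n) (indicator S)) \<le> (\<integral>\<^sup>+y. ?g n y \<partial>lborel)\<^sup>2 * nrm 0 (indicator S)"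
      by (rule Young_L1_L2) auto
    also have "\<dots> < \<infinity>" using eS by (simp add: nn_integral_heat)
    finally show ?thesis .
  qed
  have pfin: "nrm 0 (cabs (\<lambda>x. complex_of_real (p n x))) < \<infinity>" for n
  proof -
    have "cabs (\<lambda>x. complex_of_real (p n x)) = econv (?g n) (indicator S)"
      using p0 P(1) by (intro ext) (simp only: norm_of_real abs_of_nonneg)
    then show ?thesis using econvfin[of n] by simp
  qed
  have lim: "(\<lambda>n. \<integral>x. complex_of_real (p n x) * H x \<partial>lborel) \<longlonglongrightarrow> (\<integral>x. complex_of_real (indicator S x) * H x \<partial>lborel)"
  proof (rule L2_pairing_tendsto)
    have "wdist2 0 (\<lambda>x. complex_of_real (indicator S x)) (\<lambda>x. complex_of_real (p n x))
       = (\<integral>\<^sup>+x. ennreal ((p n x - indicator S x)\<^sup>2) \<partial>lborel)" for n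
      unfolding wdist2_0 of_real_diff[symmetric] norm_of_real by (simp add: power2_commute)
    then show "(\<lambda>n. wdist2 0 (\<lambda>x. complex_of_real (indicator S x)) (\<lambda>x. complex_of_real (p n x))) \<longlonglongrightarrow> 0"
      using P(3) by simp
    show "nrm 0 (cabs (\<lambda>x. complex_of_real (indicator S x))) < \<infinity>"
      by (rule Sfin)
  qed (use pfin fin in auto)
  have zero: "(\<integral>x. complex_of_real (p n x) * H x \<partial>lborel) = 0" for n
  proof -
    let ?k = "real (Suc n)"
    let ?F = "\<lambda>(x, c). H x * complex_of_real (heat ?k (x - c) * indicator S c)"
    have F: "integrable (lborel \<Otimes>\<^sub>M lborel) ?F"
    proof (rule integrableI_bounded)
      have "(\<integral>\<^sup>+z. ennreal (cmod (?F z)) \<partial>(lborel \<Otimes>\<^sub>M lborel))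
        = (\<integral>\<^sup>+x. \<integral>\<^sup>+c. ennreal (cmod (H x)) * (?g n (x - c) * indicator S c) \<partial>lborel \<partial>lborel)"
        by (subst lborel.nn_integral_fst[symmetric])
           (auto simp: norm_mult ennreal_mult indicator_def intro!: nn_integral_cong)
      also have "\<dots> = (\<integral>\<^sup>+x. cabs H x * econv (?g n) (indicator S) x \<partial>lborel)"
        unfolding econv_def by (intro nn_integral_cong nn_integral_cmult) auto
      finally have "(\<integral>\<^sup>+z. ennreal (cmod (?F z)) \<partial>(lborel \<Otimes>\<^sub>M lborel))\<^sup>2 \<le> nrm 0 (cabs H) * nrm 0 (econv (?g n) (indicator S))"
        using Cauchy_Schwarz_nn_integral[of "cabs H" lborel "econv (?g n) (indicator S)"] by (simp add: nrm_0)
      also have "\<dots> < \<infinity>" using fin econvfin[of n] by (simp add: ennreal_mult_less_top)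
      finally show "(\<integral>\<^sup>+z. ennreal (cmod (?F z)) \<partial>(lborel \<Otimes>\<^sub>M lborel)) < \<infinity>"
        by (simp add: power_less_top_ennreal)
    qed measurable
    have "(\<integral>x. complex_of_real (p n x) * H x \<partial>lborel) = (\<integral>x. (\<integral>c. H x * complex_of_real (heat ?k (x - c) * indicator S c) \<partial>lborel) \<partial>lborel)"
    proof (intro Bochner_Integration.integral_cong refl)
      fix x
      have "(\<integral>c. H x * complex_of_real (heat ?k (x - c) * indicator S c) \<partial>lborel) = H x * complex_of_real (p n x)"
        unfolding p_def integral_complex_of_real[symmetric] by (rule integral_mult_right_zero)
      then show "complex_of_real (p n x) * H x = (\<integral>c. H x * complex_of_real (heat ?k (x - c) * indicator S c) \<partial>lborel)"
        by (simp only: mult.commute[of "H x" "complex_of_real (p n x)"])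
    qed
    also have "\<dots> = (\<integral>c. (\<integral>x. H x * complex_of_real (heat ?k (x - c) * indicator S c) \<partial>lborel) \<partial>lborel)"
      by (rule lborel_pair.Fubini_integral[OF F, symmetric])
    also have "\<dots> = (\<integral>c. 0 \<partial>(lborel :: plane measure))"
    proof (intro Bochner_Integration.integral_cong refl)
      fix c
      have "(\<integral>x. H x * complex_of_real (heat ?k (x - c) * indicator S c) \<partial>lborel)
         = (\<integral>x. (complex_of_real (?k\<^sup>2 / (2 * pi) * indicator S c)) * (H x * complex_of_real (gauss ?k (x - c))) \<partial>lborel)"
        unfolding heat_def by (intro Bochner_Integration.integral_cong refl) (simp add: ac_simps)
      also have "\<dots> = 0" by (subst integral_mult_right_zero) (simp add: z)
      finally show "(\<integral>x. H x * complex_of_real (heat ?k (x - c) * indicator S c) \<partial>lborel) = 0" .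
    qed
    finally show ?thesis by simp
  qed
  have "(\<integral>x. complex_of_real (indicator S x) * H x \<partial>lborel) = 0"
    using lim unfolding zero by (simp add: LIMSEQ_const_iff)
  moreover have "complex_of_real (indicator S x) * H x = H x * indicator S x" for x by (auto simp: indicator_def)
  ultimately show ?thesis by simp
qed

lemma AE_not_frontier_box: "AE x in lborel. x \<notin> frontier (box a (b :: plane))"
proof -
  have "negligible (frontier (box a b))" by (intro negligible_convex_frontier convex_box)
  then have "frontier (box a b) \<in> null_sets lborel"
    by (simp add: negligible_iff_null_sets null_sets_completion_iff borel_closed)
  then show ?thesis by (rule AE_not_in)
qed

text \<open>Gaussian pairings determine the integrals over boxes. Boxes generate the Borel sets and
  are stable under intersection, so these integrals determine the function.\<close>

lemma gauss_test_zero: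
  assumes Hm[measurable]: "Borel H" and fin: "nrm 0 (cabs H) < \<infinity>"
    and z: "\<And>k c. 0 < k \<Longrightarrow> (\<integral>x. H x * complex_of_real (gauss k (x - c)) \<partial>lborel) = 0"
  shows "AE x in lborel. H x = 0"
proof -
  have box0: "(\<integral>x. H x * indicator (box a b) x \<partial>lborel) = 0" for a b
    by (rule heat_test_box[OF Hm fin _ _ AE_not_frontier_box z]) (use emeasure_bounded_finite[OF bounded_box] in auto)
  have on_box: "AE x in lborel. x \<in> box a b \<longrightarrow> H x = 0" for a b
  proof -
    \<comment> \<open>Cut off to a box, the square-integrable \<open>H\<close> becomes integrable,
      so that its integral over every Borel set makes sense.\<close>
    define Q where "Q x = indicator (box a b) x *\<^sub>R H x" for x
    have Q: "Q x = H x * indicator (box a b) x" for x by (auto simp: Q_def indicator_def)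
    have int: "integrable lborel Q"
      unfolding Q
    proof (rule L2_pairing(1)[OF Hm _ fin])
      have "nrm 0 (cabs (\<lambda>x. indicator (box a b) x)) = (\<integral>\<^sup>+x. indicator (box a b) x \<partial>lborel)"
        unfolding nrm_0_cabs by (intro nn_integral_cong) (auto simp: indicator_def)
      then show "nrm 0 (cabs (\<lambda>x. indicator (box a b) x)) < \<infinity>" using emeasure_bounded_finite[OF bounded_box, of a b] by simp
    qed measurable
    have "set_lebesgue_integral lborel A Q = 0" if A: "A \<in> sets lborel" for A
    proof -
      have st: "Int_stable (range (\<lambda>(a, b). box a (b :: plane)))"
        by (auto simp: Int_stable_def box_Int_box)
      have sub: "range (\<lambda>(a, b). box a (b :: plane)) \<subseteq> Pow UNIV" by auto
      have si: "set_integrable lborel B Q" if "B \<in> sets borel" for B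
        using integrable_mult_indicator[OF _ int, of B] that by (simp add: set_integrable_def)
      have "A \<in> sigma_sets UNIV (range (\<lambda>(a, b). box a b))"
        using A by (simp add: borel_eq_box)
      with st sub show ?thesis
      proof (induction rule: sigma_sets_induct_disjoint)
        case (basic A)
        then obtain c d where "A = box c d" by auto
        then obtain e f where "A \<inter> box a b = box e f" by (simp add: box_Int_box)
        then have "indicator A x *\<^sub>R Q x = H x * indicator (box e f) x" for x
          by (auto simp: Q_def indicator_def)
        then show ?case by (simp add: set_lebesgue_integral_def box0)
      next
        case empty
        show ?case by (simp add: set_lebesgue_integral_def)
      next
        case (compl A)
        then have Am: "A \<in> sets borel" by (simp add: borel_eq_box)
        have "set_lebesgue_integral lborel ((UNIV - A) \<union> A) Q
            = set_lebesgue_integral lborel (UNIV - A) Q + set_lebesgue_integral lborel A Q"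
          by (rule set_integral_Un) (use Am in \<open>auto intro!: si\<close>)
        moreover have "set_lebesgue_integral lborel ((UNIV - A) \<union> A) Q = 0"
          using box0[of a b] by (simp add: set_lebesgue_integral_def Q)
        ultimately show ?case using compl by simp
      next
        case (union A)
        then have Am: "A i \<in> sets borel" for i by (auto simp: borel_eq_box)
        have "set_lebesgue_integral lborel (\<Union>i. A i) Q = (\<Sum>i. set_lebesgue_integral lborel (A i) Q)"
          using union(1) Am by (intro lebesgue_integral_countable_add) (auto simp: disjoint_family_on_def intro!: si)
        then show ?case using union by simp
      qed
    qed
    then have "AE x in lborel. Q x = 0" by (intro sigma_finite_measure.density_zero[OF sigma_finite_lborel] int)
    then show ?thesis by eventually_elim (auto simp: Q_def)
  qed
  have "AE x in lborel. \<forall>n::nat. x \<in> box (- real n, - real n) (real n, real n) \<longrightarrow> H x = 0"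
    unfolding AE_all_countable using on_box by auto
  then show ?thesis
  proof eventually_elim
    case (elim x)
    obtain n :: nat where "max \<bar>fst x\<bar> \<bar>snd x\<bar> < real n" using reals_Archimedean2 by blast
    then have "x \<in> box (- real n, - real n) (real n, real n)"
      by (cases x) (auto simp: mem_box Basis_prod_def)
    with elim show ?case by blast
  qed
qed

section \<open>Inversion, products and real-valued functions\<close>

text \<open>Translated Gaussians are transforms of modulated ones; the multiplication formula thus
  turns \<open>F = 0\<close> into the vanishing of all Gaussian pairings of
  \<open>f\<close>.\<close>

lemma l2_ft_injective:
  assumes f: "is_l2_ft f F" and F0: "AE \<z> in lborel. F \<z> = 0"
  shows "AE x in lborel. f x = 0"
proof -
  have sq: "sq_integrable f" using f by (simp add: is_l2_ft_def)
  have [measurable]: "Borel f" "Borel F"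
    using f by (auto simp: is_l2_ft_def sq_integrable_def)
  have "AE x in lborel. complex_of_real (f x) = 0"
  proof (rule gauss_test_zero)
    show "nrm 0 (cabs (\<lambda>x. complex_of_real (f x))) < \<infinity>"
      unfolding nrm_0_cabs using sq by (simp add: sq_integrable_def)
    fix k :: real and c :: "plane" assume k: "0 < k"
    define \<psi> where "\<psi> x = complex_of_real (gauss (1/k) x) * cis (x \<bullet> c)" for x
    have \<psi>: "integrable lborel \<psi>" unfolding \<psi>_def using k by (intro gauss_integrable_cis) auto
    have \<psi>2: "nrm 0 (cabs \<psi>) < \<infinity>"
    proof -
      have "nrm 0 (cabs \<psi>) \<le> (\<integral>\<^sup>+x. ennreal (gauss (1/k) x) \<partial>lborel)"
        unfolding nrm_0_cabs \<psi>_def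
        by (intro nn_integral_mono ennreal_leI) (auto simp: norm_mult power2_eq_square intro: mult_left_le gauss_le_1)
      also have "\<dots> < \<infinity>" using k by (simp add: nn_integral_gauss)
      finally show ?thesis .
    qed
    have "(\<integral>x. complex_of_real (f x) * fint \<psi> x \<partial>lborel) = (\<integral>\<z>. F \<z> * \<psi> \<z> \<partial>lborel)"
      by (rule l2_ft_multiplication[OF f \<psi> \<psi>2, symmetric])
    also have "\<dots> = 0"
      using F0 by (intro integral_eq_zero_AE) (auto elim: eventually_mono)
    finally have z: "(\<integral>x. complex_of_real (f x) * fint \<psi> x \<partial>lborel) = 0" .
    have "fint \<psi> x = complex_of_real (2 * pi / (1/k)\<^sup>2 * gauss k (x - c))" for x
      unfolding \<psi>_def using k by (subst fint_gauss) auto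
    then have "complex_of_real (f x) * fint \<psi> x = complex_of_real (2 * pi / (1/k)\<^sup>2) * (complex_of_real (f x) * complex_of_real (gauss k (x - c)))" for x
      by (simp add: ac_simps)
    with z have "(\<integral>x. complex_of_real (2 * pi / (1/k)\<^sup>2) * (complex_of_real (f x) * complex_of_real (gauss k (x - c))) \<partial>lborel) = 0"
      by (simp only:)
    then show "(\<integral>x. complex_of_real (f x) * complex_of_real (gauss k (x - c)) \<partial>lborel) = 0"
      using k by simp
  qed measurable
  then show ?thesis by simp
qed

text \<open>No factor of \<open>2 pi\<close> appears in \<open>ft\<close>, so the convolution theorem and inversion both carry this one.\<close>

definition cF :: real where "cF = 1 / (2 * pi)\<^sup>2"

lemma cF_pos [simp]: "0 < cF" by (simp add: cF_def)

lemma nrm_0_reflect: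
  assumes [measurable]: "Borel A"
  shows "nrm 0 (\<lambda>x. A (- x)) = nrm 0 A"
  unfolding nrm_0 using nn_integral_lborel_reflect[of "\<lambda>x. (A x)\<^sup>2" 0] by simp

text \<open>Here the inverse integral defines \<open>u\<close>, and the transform of
  \<open>u\<close> has to be recognised as \<open>g\<close>. The multiplication formula, used once
  for \<open>u\<close> and once for \<open>g\<close>, gives both the same pairing with every
  translated Gaussian; the reflection arises because a Gaussian is transformed twice.\<close>

lemma Fourier_inversion:
  assumes g: "integrable lborel g" and g2: "nrm 0 (cabs g) < \<infinity>"
    and [measurable]: "Borel u"
    and u: "AE x in lborel. complex_of_real (u x) = complex_of_real cF * fint g (- x)"
  shows "is_l2_ft u g"
proof -
  have [measurable]: "Borel g" using g by auto
  have sq: "sq_integrable u"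
  proof -
    have "(\<integral>\<^sup>+x. ennreal ((u x)\<^sup>2) \<partial>lborel) = nrm 0 (cabs (\<lambda>x. complex_of_real cF * fint g (- x)))"
      unfolding nrm_0_cabs
    proof (rule nn_integral_cong_AE)
      show "AE x in lborel. ennreal ((u x)\<^sup>2) = ennreal ((cmod (complex_of_real cF * fint g (- x)))\<^sup>2)"
        using u
      proof eventually_elim
        case (elim x)
        show ?case unfolding elim[symmetric] by simp
      qed
    qed
    also have "\<dots> \<le> nrm 0 (\<lambda>x. ennreal cF * cabs (fint g) (- x))"
      by (intro nrm_mono) (simp add: norm_mult ennreal_mult abs_of_nonneg less_imp_le)
    also have "\<dots> = (ennreal cF)\<^sup>2 * nrm 0 (cabs (fint g))"
      by (subst nrm_cmult) (auto simp: nrm_0_reflect[of "cabs (fint g)"])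
    also have "\<dots> \<le> (ennreal cF)\<^sup>2 * (ennreal ((2 * pi)\<^sup>2) * nrm 0 (cabs g))"
      by (intro mult_left_mono fint_L2 g) auto
    also have "\<dots> < \<infinity>" using g2 by (simp add: ennreal_mult_less_top power_less_top_ennreal)
    finally show ?thesis by (simp add: sq_integrable_def)
  qed
  have F: "is_l2_ft u (ft u)" using sq by (rule ft_is_l2_ft)
  have [measurable]: "Borel (ft u)" using F by (rule is_l2_ft_measurable)
  have "AE \<z> in lborel. ft u \<z> - g \<z> = 0"
  proof (rule gauss_test_zero)
    show "nrm 0 (cabs (\<lambda>\<z>. ft u \<z> - g \<z>)) < \<infinity>"
      by (intro nrm_cabs_diff_finite is_l2_ft_nrm_finite[OF F] g2) measurable
    fix k :: real and c :: "plane" assume k: "0 < k"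
    \<comment> \<open>The Fourier integral of \<open>h\<close> is a multiple of the Gaussian of
      inverse width \<open>k\<close> centred at \<open>c\<close>, and transforming that Gaussian
      returns a multiple of the reflected \<open>h\<close>.\<close>
    define h where "h x = complex_of_real (gauss (1/k) x) * cis (x \<bullet> c)" for x
    have hint: "integrable lborel h" unfolding h_def using k by (intro gauss_integrable_cis) auto
    have h2int: "integrable lborel (\<lambda>x. h (0 - x))" by (rule integrable_lborel_reflect[OF hint])
    have fh: "fint h \<z> = complex_of_real (2 * pi / (1/k)\<^sup>2 * gauss k (\<z> - c))" for \<z>
      unfolding h_def using k by (subst fint_gauss) auto
    have gs: "nrm 0 (cabs (\<lambda>x. complex_of_real (gauss k (x - c)))) < \<infinity>"
    proof -
      have "nrm 0 (cabs (\<lambda>x. complex_of_real (gauss k (x - c)))) \<le> (\<integral>\<^sup>+x. ennreal (gauss k (x - c)) \<partial>lborel)"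
        unfolding nrm_0_cabs
        by (intro nn_integral_mono ennreal_leI) (auto simp: power2_eq_square intro: mult_left_le gauss_le_1)
      also have "\<dots> < \<infinity>" using k nn_integral_lborel_translate[of "\<lambda>x. ennreal (gauss k x)" c]
        by (simp add: nn_integral_gauss)
      finally show ?thesis .
    qed
    have gsint: "integrable lborel (\<lambda>x. complex_of_real (gauss k (x - c)))"
      using integrable_lborel_reflect[OF gauss_integrable[OF k], of c] by (simp add: gauss_diff_commute)
    have fgs: "fint (\<lambda>x. complex_of_real (gauss k (x - c))) x = complex_of_real (2 * pi / k\<^sup>2) * h (- x)" for x
    proof -
      have "(\<integral>y. complex_of_real (gauss k (y - c)) * cis (- (y \<bullet> x)) \<partial>lborel)
         = (\<integral>y. complex_of_real (gauss k y) * cis (- ((c - y) \<bullet> x)) \<partial>lborel)"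
        by (subst integral_lborel_reflect[where c=c, symmetric]) (auto simp: gauss_diff_commute)
      also have "\<dots> = (\<integral>y. cis (- (c \<bullet> x)) * (complex_of_real (gauss k y) * cis (y \<bullet> x)) \<partial>lborel)"
        by (intro Bochner_Integration.integral_cong refl)
           (simp add: cis_mult inner_diff_left mult.left_commute[of "cis _"])
      also have "\<dots> = cis (- (c \<bullet> x)) * complex_of_real ((2 * pi) / k\<^sup>2 * gauss (1/k) x)"
        using gaussian_2d[OF k, of x] by (subst integral_mult_right_zero) (simp add: has_bochner_integral_iff)
      finally show ?thesis by (simp add: fint_def h_def inner_commute)
    qed
    have 1: "(\<integral>\<z>. ft u \<z> * complex_of_real (gauss k (\<z> - c)) \<partial>lborel) = (\<integral>x. complex_of_real (u x) * (complex_of_real (2 * pi / k\<^sup>2) * h (- x)) \<partial>lborel)"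
      unfolding fgs[symmetric] by (rule l2_ft_multiplication[OF F gsint gs])
    also have "\<dots> = (\<integral>x. complex_of_real (cF * (2 * pi / k\<^sup>2)) * (fint g (0 - x) * h (0 - x)) \<partial>lborel)"
    proof (rule integral_cong_AE)
      have [measurable]: "Borel h" using hint by auto
      show "(\<lambda>x. complex_of_real (u x) * (complex_of_real (2 * pi / k\<^sup>2) * h (- x))) \<in> borel_measurable lborel"
        "(\<lambda>x. complex_of_real (cF * (2 * pi / k\<^sup>2)) * (fint g (0 - x) * h (0 - x))) \<in> borel_measurable lborel"
        by measurable
      show "AE x in lborel. complex_of_real (u x) * (complex_of_real (2 * pi / k\<^sup>2) * h (- x)) =
          complex_of_real (cF * (2 * pi / k\<^sup>2)) * (fint g (0 - x) * h (0 - x))"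
        using u by eventually_elim simp
    qed
    also have "\<dots> = complex_of_real (cF * (2 * pi / k\<^sup>2)) * (\<integral>x. fint g (0 - x) * h (0 - x) \<partial>lborel)"
      by (rule integral_mult_right_zero)
    also have "(\<integral>x. fint g (0 - x) * h (0 - x) \<partial>lborel) = (\<integral>x. fint g x * h x \<partial>lborel)"
      by (rule integral_lborel_reflect[of "\<lambda>x. fint g x * h x"]) (use hint in measurable)
    also have "\<dots> = (\<integral>\<z>. g \<z> * fint h \<z> \<partial>lborel)" by (rule fint_multiplication[OF g hint])
    also have "\<dots> = (\<integral>\<z>. complex_of_real (2 * pi / (1/k)\<^sup>2) * (g \<z> * complex_of_real (gauss k (\<z> - c))) \<partial>lborel)"
      unfolding fh by (intro Bochner_Integration.integral_cong refl) (simp add: ac_simps)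
    also have "\<dots> = complex_of_real (2 * pi / (1/k)\<^sup>2) * (\<integral>\<z>. g \<z> * complex_of_real (gauss k (\<z> - c)) \<partial>lborel)"
      by (rule integral_mult_right_zero)
    also have "complex_of_real (cF * (2 * pi / k\<^sup>2)) * \<dots> = (\<integral>\<z>. g \<z> * complex_of_real (gauss k (\<z> - c)) \<partial>lborel)"
    proof -
      \<comment> \<open>The normalisations of the two Gaussians multiply to
        \<open>(2 * pi)\<^sup>2\<close>, which \<open>cF\<close> cancels.\<close>
      have "cF * (2 * pi / k\<^sup>2) * (2 * pi / (1/k)\<^sup>2) = 1" using k by (simp add: cF_def power2_eq_square)
      then have e: "complex_of_real (cF * (2 * pi / k\<^sup>2)) * complex_of_real (2 * pi / (1/k)\<^sup>2) = 1"
        by (metis of_real_1 of_real_mult)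
      show ?thesis by (simp only: mult.assoc[symmetric] e mult_1)
    qed
    finally have eq: "(\<integral>\<z>. ft u \<z> * complex_of_real (gauss k (\<z> - c)) \<partial>lborel) = (\<integral>\<z>. g \<z> * complex_of_real (gauss k (\<z> - c)) \<partial>lborel)" .
    have "(\<integral>\<z>. (ft u \<z> - g \<z>) * complex_of_real (gauss k (\<z> - c)) \<partial>lborel)
      = (\<integral>\<z>. ft u \<z> * complex_of_real (gauss k (\<z> - c)) \<partial>lborel) - (\<integral>\<z>. g \<z> * complex_of_real (gauss k (\<z> - c)) \<partial>lborel)"
      unfolding left_diff_distrib
      by (intro Bochner_Integration.integral_diff L2_pairing(1) gs g2 is_l2_ft_nrm_finite[OF F]) measurable
    then show "(\<integral>\<z>. (ft u \<z> - g \<z>) * complex_of_real (gauss k (\<z> - c)) \<partial>lborel) = 0" using eq by simp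
  qed measurable
  then have AE: "AE \<z> in lborel. ft u \<z> = g \<z>" by eventually_elim simp
  have "(\<integral>\<^sup>+\<z>. ennreal ((cmod (g \<z> - trunc_ft u R \<z>))\<^sup>2) \<partial>lborel) = (\<integral>\<^sup>+\<z>. ennreal ((cmod (ft u \<z> - trunc_ft u R \<z>))\<^sup>2) \<partial>lborel)" for R
    using AE by (intro nn_integral_cong_AE) (auto elim!: eventually_mono)
  then show ?thesis using F g2 unfolding is_l2_ft_def nrm_0_cabs by simp
qed

lemma is_l2_ft_diff:
  assumes f: "is_l2_ft f F" and g: "is_l2_ft g G"
  shows "is_l2_ft (\<lambda>x. f x - g x) (\<lambda>\<z>. F \<z> - G \<z>)"
proof -
  have [measurable]: "Borel F" "Borel G" "Borel f" "Borel g"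
    using f g by (auto simp: is_l2_ft_def sq_integrable_def)
  have sqf: "sq_integrable f" and sqg: "sq_integrable g" using f g by (auto simp: is_l2_ft_def)
  have [measurable]: "Borel (trunc_ft f R)" "Borel (trunc_ft g R)" for R
    using trunc_ft_measurable sqf sqg by auto
  have sq: "sq_integrable (\<lambda>x. f x - g x)"
  proof -
    have "nrm 0 (cabs (\<lambda>x. complex_of_real (f x) - complex_of_real (g x))) < \<infinity>"
    proof (rule nrm_cabs_diff_finite)
      show "nrm 0 (cabs (\<lambda>x. complex_of_real (f x))) < \<infinity>" "nrm 0 (cabs (\<lambda>x. complex_of_real (g x))) < \<infinity>"
        unfolding nrm_0_cabs using sqf sqg by (simp_all add: sq_integrable_def)
    qed measurable
    then show ?thesis
      by (subst (asm) nrm_0_cabs) (simp add: sq_integrable_def of_real_diff[symmetric] del: of_real_diff)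
  qed
  have tr: "trunc_ft (\<lambda>x. f x - g x) R \<z> = trunc_ft f R \<z> - trunc_ft g R \<z>" for R \<z>
  proof -
    have "(\<lambda>x. indicator (ball 0 R) x *\<^sub>R complex_of_real (f x - g x)) =
       (\<lambda>x. indicator (ball 0 R) x *\<^sub>R complex_of_real (f x) - indicator (ball 0 R) x *\<^sub>R complex_of_real (g x))"
      by (simp add: fun_eq_iff scaleR_diff_right)
    then show ?thesis unfolding trunc_ft_eq_fint by (simp add: fint_diff sq_integrable_truncation sqf sqg)
  qed
  have le: "wdist2 0 (\<lambda>\<z>. F \<z> - G \<z>) (trunc_ft (\<lambda>x. f x - g x) R)
    \<le> 2 * wdist2 0 F (trunc_ft f R) + 2 * wdist2 0 G (trunc_ft g R)" for R
  proof -
    have "wdist2 0 (\<lambda>\<z>. F \<z> - G \<z>) (trunc_ft (\<lambda>x. f x - g x) R)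
       \<le> nrm 0 (\<lambda>\<z>. cabs (\<lambda>\<z>. F \<z> - trunc_ft f R \<z>) \<z> + cabs (\<lambda>\<z>. G \<z> - trunc_ft g R \<z>) \<z>)"
      unfolding wdist2_eq_nrm tr
    proof (rule nrm_mono)
      fix \<z>
      have "cmod (F \<z> - G \<z> - (trunc_ft f R \<z> - trunc_ft g R \<z>)) \<le> cmod (F \<z> - trunc_ft f R \<z>) + cmod (G \<z> - trunc_ft g R \<z>)"
        using norm_triangle_ineq4[of "F \<z> - trunc_ft f R \<z>" "G \<z> - trunc_ft g R \<z>"] by (simp add: algebra_simps)
      then show "ennreal (cmod (F \<z> - G \<z> - (trunc_ft f R \<z> - trunc_ft g R \<z>))) \<le> ennreal (cmod (F \<z> - trunc_ft f R \<z>)) + ennreal (cmod (G \<z> - trunc_ft g R \<z>))"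
        by (simp add: ennreal_plus[symmetric] ennreal_leI del: ennreal_plus)
    qed
    also have "\<dots> \<le> 2 * wdist2 0 F (trunc_ft f R) + 2 * wdist2 0 G (trunc_ft g R)"
      unfolding wdist2_eq_nrm by (rule nrm_add) measurable
    finally show ?thesis .
  qed
  have lF: "((\<lambda>R. wdist2 0 F (trunc_ft f R)) \<longlongrightarrow> 0) at_top" and lG: "((\<lambda>R. wdist2 0 G (trunc_ft g R)) \<longlongrightarrow> 0) at_top"
    using f g unfolding is_l2_ft_def wdist2_0 by auto
  have "((\<lambda>R. 2 * wdist2 0 F (trunc_ft f R) + 2 * wdist2 0 G (trunc_ft g R)) \<longlongrightarrow> 2 * 0 + 2 * 0) at_top"
    by (rule tendsto_add[OF ennreal_tendsto_cmult[OF _ lF] ennreal_tendsto_cmult[OF _ lG]]) simp_all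
  then have "((\<lambda>R. wdist2 0 (\<lambda>\<z>. F \<z> - G \<z>) (trunc_ft (\<lambda>x. f x - g x) R)) \<longlongrightarrow> 0) at_top"
    by (intro ennreal_tendsto_0_le[OF _ always_eventually[OF allI[OF le]]]) simp
  moreover have "nrm 0 (cabs (\<lambda>\<z>. F \<z> - G \<z>)) < \<infinity>"
    by (intro nrm_cabs_diff_finite is_l2_ft_nrm_finite[OF f] is_l2_ft_nrm_finite[OF g]) measurable
  ultimately show ?thesis using sq unfolding is_l2_ft_def wdist2_0 nrm_0_cabs by simp
qed

lemma ft_eq_imp_AE_eq:
  assumes "is_l2_ft f F" "is_l2_ft g G" "AE \<z> in lborel. F \<z> = G \<z>"
  shows "AE x in lborel. f x = g x"
  using l2_ft_injective[OF is_l2_ft_diff[OF assms(1,2)]] assms(3) by simp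

text \<open>The truncated transforms are integrals, so \<open>is_l2_ft\<close> is the same predicate
  for both functions and the choice operator returns the same representative. Hence equality at
  every frequency, although transforms are determined only almost everywhere.\<close>

lemma ft_cong_AE:
  assumes [measurable]: "Borel f" "Borel g"
    and ae: "AE x in lborel. f x = g x"
  shows "ft f = ft g"
proof -
  have "trunc_ft f = trunc_ft g"
  proof (intro ext)
    fix R \<z>
    have [measurable]: "indicat_real (ball 0 r) \<in> borel_measurable (borel :: plane measure)" for r
      by (rule borel_measurable_indicator) simp
    show "trunc_ft f R \<z> = trunc_ft g R \<z>"
      unfolding trunc_ft_def using ae by (intro integral_cong_AE) (auto elim!: eventually_mono)
  qed
  moreover have "sq_integrable f = sq_integrable g"
  proof -
    have "(\<integral>\<^sup>+x. ennreal ((f x)\<^sup>2) \<partial>lborel) = (\<integral>\<^sup>+x. ennreal ((g x)\<^sup>2) \<partial>lborel)"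
      using ae by (intro nn_integral_cong_AE) (auto elim!: eventually_mono)
    then show ?thesis by (simp add: sq_integrable_def)
  qed
  ultimately have "is_l2_ft f = is_l2_ft g" by (intro ext) (simp only: is_l2_ft_def)
  then show ?thesis by (simp add: ft_def)
qed

lemma trunc_ft_minus: "trunc_ft f R (- \<z>) = cnj (trunc_ft f R \<z>)"
  unfolding trunc_ft_def
  by (subst Bochner_Integration.integral_cnj[symmetric]) (simp add: cis_cnj del: Bochner_Integration.integral_cnj)

text \<open>Truncated transforms of a real function are Hermitian, and conjugation with reflection
  preserves the L^2 distance, so the limit may be replaced by its Hermitian mirror image.\<close>

lemma is_l2_ft_hermitian:
  assumes f: "is_l2_ft f F"
  shows "is_l2_ft f (\<lambda>\<z>. cnj (F (- \<z>)))"
proof -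
  have sq: "sq_integrable f" and [measurable]: "Borel F" using f by (auto simp: is_l2_ft_def)
  have [measurable]: "Borel (trunc_ft f R)" for R using trunc_ft_measurable[OF sq] .
  have 1: "(\<integral>\<^sup>+\<z>. ennreal ((cmod (cnj (F (- \<z>)) - trunc_ft f R \<z>))\<^sup>2) \<partial>lborel) = (\<integral>\<^sup>+\<z>. ennreal ((cmod (F \<z> - trunc_ft f R \<z>))\<^sup>2) \<partial>lborel)" for R
  proof -
    have "cmod (cnj (F (- \<z>)) - trunc_ft f R \<z>) = cmod (F (0 - \<z>) - trunc_ft f R (0 - \<z>))" for \<z>
      using complex_mod_cnj[of "F (- \<z>) - trunc_ft f R (- \<z>)"] by (simp add: trunc_ft_minus)
    then show ?thesis
      using nn_integral_lborel_reflect[of "\<lambda>\<z>. ennreal ((cmod (F \<z> - trunc_ft f R \<z>))\<^sup>2)" 0] by simp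
  qed
  have 2: "(\<integral>\<^sup>+\<z>. ennreal ((cmod (cnj (F (- \<z>))))\<^sup>2) \<partial>lborel) = (\<integral>\<^sup>+\<z>. ennreal ((cmod (F \<z>))\<^sup>2) \<partial>lborel)"
    using nn_integral_lborel_reflect[of "\<lambda>\<z>. ennreal ((cmod (F \<z>))\<^sup>2)" 0] by simp
  show ?thesis using f unfolding is_l2_ft_def 1 2 by auto
qed

text \<open>\<open>ft f\<close> is determined only almost everywhere; this representative is Hermitian at every point.\<close>

definition sym_ft :: "(plane \<Rightarrow> real) \<Rightarrow> plane \<Rightarrow> complex" where
  "sym_ft f \<z> = (ft f \<z> + cnj (ft f (- \<z>))) / 2"

lemma sym_ft_hermitian: "sym_ft f (- \<z>) = cnj (sym_ft f \<z>)"
  by (simp add: sym_ft_def add.commute)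

lemma sym_ft_AE:
  assumes "sq_integrable f" shows "AE \<z> in lborel. sym_ft f \<z> = ft f \<z>"
  using is_l2_ft_unique[OF ft_is_l2_ft[OF assms] is_l2_ft_hermitian[OF ft_is_l2_ft[OF assms]]]
  by eventually_elim (simp add: sym_ft_def)

lemma sym_ft_measurable [measurable]:
  assumes "sq_integrable f" shows "Borel (sym_ft f)"
proof -
  have [measurable]: "Borel (ft f)" by (rule is_l2_ft_measurable[OF ft_is_l2_ft[OF assms]])
  show ?thesis unfolding sym_ft_def by measurable
qed

definition inv_ft :: "(plane \<Rightarrow> complex) \<Rightarrow> plane \<Rightarrow> real" where
  "inv_ft g x = Re (complex_of_real cF * fint g (- x))"

lemma inv_ft_is_l2_ft:
  assumes g: "integrable lborel g" and g2: "nrm 0 (cabs g) < \<infinity>"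
    and herm: "\<And>\<z>. g (- \<z>) = cnj (g \<z>)"
  shows "is_l2_ft (inv_ft g) g" and "complex_of_real (inv_ft g x) = complex_of_real cF * fint g (- x)"
proof -
  have [measurable]: "Borel g" using g by auto
  have "cnj (fint g (- x)) = fint g (- x)" for x
  proof -
    have "cnj (fint g (- x)) = (\<integral>\<z>. g (0 - \<z>) * cis (- ((0 - \<z>) \<bullet> (- x))) \<partial>lborel)"
      unfolding fint_def by (subst Bochner_Integration.integral_cnj[symmetric]) (simp add: cis_cnj herm del: Bochner_Integration.integral_cnj)
    also have "\<dots> = fint g (- x)"
      unfolding fint_def by (rule integral_lborel_reflect[of "\<lambda>\<z>. g \<z> * cis (- (\<z> \<bullet> (- x)))"]) measurable
    finally show ?thesis .
  qed
  then have "fint g (- x) \<in> \<real>" for x by (simp add: Reals_cnj_iff)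
  then show eq: "complex_of_real (inv_ft g x) = complex_of_real cF * fint g (- x)" for x
    unfolding inv_ft_def by (simp add: of_real_Re)
  show "is_l2_ft (inv_ft g) g"
  proof (rule Fourier_inversion[OF g g2])
    show "Borel (inv_ft g)" unfolding inv_ft_def by measurable
  qed (simp add: eq)
qed

text \<open>The detour through \<open>sym_ft f\<close> supplies the symmetry at every point on which
  \<open>inv_ft_is_l2_ft\<close> relies; the integral \<open>fint\<close> does not distinguish the
  two representatives.\<close>

lemma inversion_AE:
  assumes f: "sq_integrable f" and int: "integrable lborel (ft f)"
  shows "AE x in lborel. complex_of_real (f x) = complex_of_real cF * fint (ft f) (- x)"
proof -
  have F: "is_l2_ft f (ft f)" by (rule ft_is_l2_ft[OF f])
  have [measurable]: "Borel (ft f)" "Borel (sym_ft f)"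
    using is_l2_ft_measurable[OF F] sym_ft_measurable[OF f] by auto
  note ae = sym_ft_AE[OF f]
  have i: "integrable lborel (sym_ft f)"
    using int by (rule integrable_cong_AE_imp) (use ae in \<open>auto elim: eventually_mono\<close>)
  have n: "nrm 0 (cabs (sym_ft f)) < \<infinity>"
  proof -
    have "nrm 0 (cabs (sym_ft f)) = nrm 0 (cabs (ft f))"
      using ae by (intro nrm_cong_AE) (auto elim: eventually_mono)
    then show ?thesis using is_l2_ft_nrm_finite[OF F] by simp
  qed
  note I = inv_ft_is_l2_ft[OF i n sym_ft_hermitian]
  have "AE x in lborel. f x = inv_ft (sym_ft f) x"
    by (rule ft_eq_imp_AE_eq[OF F I(1)]) (use ae in \<open>auto elim: eventually_mono\<close>)
  moreover have "fint (sym_ft f) = fint (ft f)"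
    unfolding fint_def using ae by (intro ext integral_cong_AE) (auto elim: eventually_mono)
  ultimately show ?thesis using I(2) by (auto elim!: eventually_mono)
qed

section \<open>Convolution theorem\<close>

definition conv :: "(plane \<Rightarrow> complex) \<Rightarrow> (plane \<Rightarrow> complex) \<Rightarrow> plane \<Rightarrow> complex" where
  "conv F G \<z> = (\<integral>z. F (\<z> - z) * G z \<partial>lborel)"

lemma conv_measurable [measurable]:
  assumes [measurable]: "Borel F" "Borel G"
  shows "Borel (conv F G)"
proof -
  have "Borel (\<lambda>\<z>. \<integral>z. F (\<z> - z) * G z \<partial>lborel)" by measurable
  then show ?thesis by (simp add: conv_def[abs_def])
qed

lemma conv_integrable_point:
  assumes [measurable]: "Borel F" "Borel G"
    and "econv (cabs F) (cabs G) \<z> < \<infinity>"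
  shows "integrable lborel (\<lambda>z. F (\<z> - z) * G z)"
  using assms(3) by (intro integrableI_bounded) (auto simp: econv_def norm_mult ennreal_mult)

lemma cabs_conv_le:
  "cabs (conv F G) \<z> \<le> econv (cabs F) (cabs G) \<z>"
proof (cases "integrable lborel (\<lambda>z. F (\<z> - z) * G z)")
  case True
  show ?thesis unfolding conv_def
    using integral_norm_bound_ennreal[OF True] by (simp add: econv_def norm_mult ennreal_mult)
next
  case False
  \<comment> \<open>Where the integrand is not integrable, \<open>conv\<close> has the default value
    0.\<close>
  then show ?thesis by (simp add: conv_def not_integrable_integral_eq)
qed

lemma conv_cong_AE:
  assumes [measurable]: "Borel F" "Borel G" "Borel F'" "Borel G'"
    and "AE z in lborel. F z = F' z" "AE z in lborel. G z = G' z"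
  shows "conv F G = conv F' G'"
proof (rule ext)
  fix \<z>
  have "AE z in distr lborel borel (\<lambda>z. \<z> - z). F z = F' z"
    using assms(5) by (subst distr_reflect_lborel)
  then have "AE z in lborel. F (\<z> - z) = F' (\<z> - z)"
    by (subst (asm) AE_distr_iff) auto
  then have "AE z in lborel. F (\<z> - z) * G z = F' (\<z> - z) * G' z"
    using assms(6) by eventually_elim simp
  then show "conv F G \<z> = conv F' G' \<z>"
    unfolding conv_def by (intro integral_cong_AE) auto
qed

lemma integral_lborel_translate:
  fixes f :: "'a::euclidean_space \<Rightarrow> 'b::{banach, second_countable_topology}"
  assumes [measurable]: "Borel f"
  shows "(\<integral>x. f (c + x) \<partial>lborel) = (\<integral>x. f x \<partial>lborel)"
  by (subst (2) lborel_distr_plus[of c, symmetric]) (simp add: integral_distr)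

lemma fint_conv:
  assumes F: "integrable lborel F" and G: "integrable lborel G"
  shows "integrable lborel (conv F G)" and "fint (conv F G) \<z> = fint F \<z> * fint G \<z>"
proof -
  have [measurable]: "Borel F" "Borel G" using F G by auto
  have fin: "(\<integral>\<^sup>+\<z>. econv (cabs F) (cabs G) \<z> \<partial>lborel) < \<infinity>"
    using F G unfolding integrable_iff_bounded by (subst nn_integral_econv) (auto simp: ennreal_mult_less_top)
  show int: "integrable lborel (conv F G)"
    by (intro integrableI_bounded order.strict_trans1[OF nn_integral_mono fin] cabs_conv_le) measurable
  let ?H = "\<lambda>(z, x). F (x - z) * G z * cis (- (x \<bullet> \<z>))"
  have H: "integrable (lborel \<Otimes>\<^sub>M lborel) ?H"
  proof (rule integrableI_bounded)
    have "(\<integral>\<^sup>+p. ennreal (cmod (?H p)) \<partial>(lborel \<Otimes>\<^sub>M lborel)) = (\<integral>\<^sup>+x. \<integral>\<^sup>+z. cabs F (x - z) * cabs G z \<partial>lborel \<partial>lborel)"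
      by (subst lborel_pair.nn_integral_snd[symmetric]) (auto simp: norm_mult ennreal_mult)
    then show "(\<integral>\<^sup>+p. ennreal (cmod (?H p)) \<partial>(lborel \<Otimes>\<^sub>M lborel)) < \<infinity>"
      using fin by (simp add: econv_def)
  qed measurable
  have "fint (conv F G) \<z> = (\<integral>x. \<integral>z. F (x - z) * G z * cis (- (x \<bullet> \<z>)) \<partial>lborel \<partial>lborel)"
    unfolding fint_def conv_def by (simp only: integral_mult_left_zero)
  also have "\<dots> = (\<integral>z. \<integral>x. F (x - z) * G z * cis (- (x \<bullet> \<z>)) \<partial>lborel \<partial>lborel)"
    by (rule lborel_pair.Fubini_integral[OF H])
  also have "\<dots> = (\<integral>z. fint F \<z> * (G z * cis (- (z \<bullet> \<z>))) \<partial>lborel)"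
  proof (intro Bochner_Integration.integral_cong refl)
    fix z
    have "(\<integral>x. F (x - z) * G z * cis (- (x \<bullet> \<z>)) \<partial>lborel) = (\<integral>x. F x * G z * cis (- ((z + x) \<bullet> \<z>)) \<partial>lborel)"
      using integral_lborel_translate[of "\<lambda>x. F (x - z) * G z * cis (- (x \<bullet> \<z>))" z] by simp
    also have "\<dots> = (\<integral>x. (F x * cis (- (x \<bullet> \<z>))) * (G z * cis (- (z \<bullet> \<z>))) \<partial>lborel)"
    proof (intro Bochner_Integration.integral_cong refl)
      fix x
      have "cis (- ((z + x) \<bullet> \<z>)) = cis (- (x \<bullet> \<z>)) * cis (- (z \<bullet> \<z>))"
        by (simp add: cis_mult inner_add_left algebra_simps)
      then show "F x * G z * cis (- ((z + x) \<bullet> \<z>)) = (F x * cis (- (x \<bullet> \<z>))) * (G z * cis (- (z \<bullet> \<z>)))"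
        by (simp add: ac_simps)
    qed
    also have "\<dots> = fint F \<z> * (G z * cis (- (z \<bullet> \<z>)))"
      unfolding fint_def by (rule integral_mult_left_zero)
    finally show "(\<integral>x. F (x - z) * G z * cis (- (x \<bullet> \<z>)) \<partial>lborel) = fint F \<z> * (G z * cis (- (z \<bullet> \<z>)))" .
  qed
  also have "\<dots> = fint F \<z> * fint G \<z>"
    unfolding fint_def by (rule integral_mult_right_zero)
  finally show "fint (conv F G) \<z> = fint F \<z> * fint G \<z>" .
qed

text \<open>By \<open>fint_conv\<close> the product of two inversion integrals is the inversion
  integral of the convolution, so \<open>Fourier_inversion\<close> reads off the transform of the
  product.\<close>

lemma ft_product:
  assumes f: "sq_integrable f" "integrable lborel (ft f)" and h: "sq_integrable h" "integrable lborel (ft h)"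
  shows "is_l2_ft (\<lambda>x. f x * h x) (\<lambda>\<z>. complex_of_real cF * conv (ft f) (ft h) \<z>)"
proof (rule Fourier_inversion)
  have [measurable]: "Borel (ft f)" "Borel (ft h)"
    "Borel f" "Borel h"
    using f h by (auto simp: sq_integrable_def)
  show "integrable lborel (\<lambda>\<z>. complex_of_real cF * conv (ft f) (ft h) \<z>)"
    using fint_conv(1)[OF f(2) h(2)] by simp
  have "nrm 0 (cabs (\<lambda>\<z>. complex_of_real cF * conv (ft f) (ft h) \<z>)) \<le> nrm 0 (\<lambda>\<z>. ennreal cF * econv (cabs (ft f)) (cabs (ft h)) \<z>)"
    by (intro nrm_mono) (auto simp: norm_mult ennreal_mult abs_of_nonneg less_imp_le intro!: mult_left_mono cabs_conv_le)
  also have "\<dots> = (ennreal cF)\<^sup>2 * nrm 0 (econv (cabs (ft f)) (cabs (ft h)))" by (rule nrm_cmult) measurable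
  also have "\<dots> \<le> (ennreal cF)\<^sup>2 * ((\<integral>\<^sup>+z. cabs (ft f) z \<partial>lborel)\<^sup>2 * nrm 0 (cabs (ft h)))"
    by (intro mult_left_mono Young_L1_L2) auto
  also have "\<dots> < \<infinity>"
    using f(2) is_l2_ft_nrm_finite[OF ft_is_l2_ft[OF h(1)]] unfolding integrable_iff_bounded
    by (simp add: ennreal_mult_less_top power_less_top_ennreal)
  finally show "nrm 0 (cabs (\<lambda>\<z>. complex_of_real cF * conv (ft f) (ft h) \<z>)) < \<infinity>" .
  show "Borel (\<lambda>x. f x * h x)" by measurable
  show "AE x in lborel. complex_of_real (f x * h x) = complex_of_real cF * fint (\<lambda>\<z>. complex_of_real cF * conv (ft f) (ft h) \<z>) (- x)"
    using inversion_AE[OF f] inversion_AE[OF h]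
  proof eventually_elim
    case (elim x)
    have "fint (\<lambda>\<z>. complex_of_real cF * conv (ft f) (ft h) \<z>) (- x) = complex_of_real cF * fint (conv (ft f) (ft h)) (- x)"
      unfolding fint_def mult.assoc by (rule integral_mult_right_zero)
    then show ?case using elim by (simp add: fint_conv(2)[OF f(2) h(2)] ac_simps)
  qed
qed

text \<open>The majorants to come are suprema over time, possibly infinite on a null set; hence a
  dominating function with values in \<open>ennreal\<close>.\<close>

lemma integral_dominated_ennreal:
  fixes f :: "nat \<Rightarrow> 'a \<Rightarrow> complex"
  assumes [measurable]: "\<And>n. f n \<in> borel_measurable M" "g \<in> borel_measurable M" "W \<in> borel_measurable M"
    and lim: "AE x in M. (\<lambda>n. f n x) \<longlonglongrightarrow> g x"
    and bd: "\<And>n. AE x in M. ennreal (cmod (f n x)) \<le> W x"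
    and fin: "(\<integral>\<^sup>+x. W x \<partial>M) < \<infinity>"
  shows "(\<lambda>n. \<integral>x. f n x \<partial>M) \<longlonglongrightarrow> (\<integral>x. g x \<partial>M)"
proof (rule integral_dominated_convergence[where w="\<lambda>x. enn2real (W x)"])
  have ae: "AE x in M. W x \<noteq> \<infinity>" using fin by (intro nn_integral_PInf_AE) auto
  show "integrable M (\<lambda>x. enn2real (W x))"
  proof (rule integrableI_bounded)
    have "(\<integral>\<^sup>+x. ennreal (norm (enn2real (W x))) \<partial>M) = (\<integral>\<^sup>+x. W x \<partial>M)"
      using ae by (intro nn_integral_cong_AE) (auto elim!: eventually_mono simp: less_top)
    then show "(\<integral>\<^sup>+x. ennreal (norm (enn2real (W x))) \<partial>M) < \<infinity>" using fin by simp
  qed measurable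
  show "AE x in M. norm (f n x) \<le> enn2real (W x)" for n
    using ae bd[of n]
  proof eventually_elim
    case (elim x)
    then show ?case by (cases "W x") auto
  qed
qed (use lim in auto)

section \<open>Curves of Fourier transforms\<close>

text \<open>Continuity is required at each frequency and not in a norm. Once \<open>env\<close> has
  finite norm, dominated convergence turns it into continuity in that norm.\<close>

definition path :: "real \<Rightarrow> (real \<Rightarrow> plane \<Rightarrow> complex) \<Rightarrow> bool" where
  "path T u \<longleftrightarrow> (\<forall>t\<in>{0..T}. Borel (u t)) \<and> (\<forall>\<z>. continuous_on {0..T} (\<lambda>t. u t \<z>))"

definition env :: "real \<Rightarrow> (real \<Rightarrow> plane \<Rightarrow> complex) \<Rightarrow> plane \<Rightarrow> ennreal" where
  "env T u \<z> = (SUP t\<in>{0..T}. ennreal (cmod (u t \<z>)))"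

lemma pathI: "(\<And>t. t \<in> {0..T} \<Longrightarrow> Borel (u t)) \<Longrightarrow> (\<And>\<z>. continuous_on {0..T} (\<lambda>t. u t \<z>)) \<Longrightarrow> path T u"
  unfolding path_def by blast

lemma path_measurable: "path T u \<Longrightarrow> t \<in> {0..T} \<Longrightarrow> Borel (u t)"
  unfolding path_def by blast

lemma path_continuous: "path T u \<Longrightarrow> continuous_on {0..T} (\<lambda>t. u t \<z>)"
  unfolding path_def by blast

lemma env_upper: "t \<in> {0..T} \<Longrightarrow> ennreal (cmod (u t \<z>)) \<le> env T u \<z>"
  unfolding env_def by (rule SUP_upper)

lemma env_least: "(\<And>t. t \<in> {0..T} \<Longrightarrow> ennreal (cmod (u t \<z>)) \<le> B) \<Longrightarrow> env T u \<z> \<le> B"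
  unfolding env_def by (rule SUP_least)

text \<open>By continuity in time the supremum may be taken over a countable dense set of
  times.\<close>

lemma env_measurable [measurable]:
  assumes u: "path T u" shows "Borel (env T u)"
proof -
  obtain D where D: "countable D" "D \<subseteq> {0..T}" "{0..T} \<subseteq> closure D" using separable by blast
  have "env T u \<z> = (SUP t\<in>D. ennreal (cmod (u t \<z>)))" for \<z>
  proof (rule antisym)
    show "env T u \<z> \<le> (SUP t\<in>D. ennreal (cmod (u t \<z>)))"
    proof (rule env_least)
      fix t assume t: "t \<in> {0..T}"
      then obtain x where x: "\<And>n. x n \<in> D" "x \<longlonglongrightarrow> t" using D(3) closure_sequential by blast
      have "((\<lambda>t. u t \<z>) \<circ> x) \<longlonglongrightarrow> u t \<z>"
        using path_continuous[OF u, of \<z>] t x D(2) unfolding continuous_on_sequentially by blast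
      then have "(\<lambda>n. ennreal (cmod (u (x n) \<z>))) \<longlonglongrightarrow> ennreal (cmod (u t \<z>))"
        by (intro tendsto_ennrealI tendsto_norm) (simp add: o_def)
      then show "ennreal (cmod (u t \<z>)) \<le> (SUP t\<in>D. ennreal (cmod (u t \<z>)))"
        by (rule LIMSEQ_le_const2) (intro exI[of _ 0] allI impI SUP_upper x)
    qed
    show "(SUP t\<in>D. ennreal (cmod (u t \<z>))) \<le> env T u \<z>"
      using D(2) by (intro SUP_least env_upper) auto
  qed
  moreover have "Borel (\<lambda>\<z>. SUP t\<in>D. ennreal (cmod (u t \<z>)))"
  proof (rule borel_measurable_SUP[OF D(1)])
    fix t assume "t \<in> D"
    then have [measurable]: "Borel (u t)" using u D(2) by (auto intro: path_measurable)
    show "Borel (\<lambda>\<z>. ennreal (cmod (u t \<z>)))" by measurable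
  qed
  ultimately show ?thesis by (simp add: fun_eq_iff cong: measurable_cong)
qed

lemma path_const: "Borel F \<Longrightarrow> path T (\<lambda>t. F)"
  by (auto intro: pathI)

lemma env_const: "0 \<le> T \<Longrightarrow> env T (\<lambda>t. F) \<z> = cabs F \<z>"
  by (simp add: env_def)

lemma path_diff: "path T u \<Longrightarrow> path T v \<Longrightarrow> path T (\<lambda>t \<z>. u t \<z> - v t \<z>)"
  unfolding path_def by (auto intro!: borel_measurable_diff continuous_on_diff)

lemma path_add: "path T u \<Longrightarrow> path T v \<Longrightarrow> path T (\<lambda>t \<z>. u t \<z> + v t \<z>)"
  unfolding path_def by (auto intro!: borel_measurable_add continuous_on_add)

lemma path_mult: "Borel m \<Longrightarrow> path T u \<Longrightarrow> path T (\<lambda>t \<z>. m \<z> * u t \<z>)"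
  unfolding path_def by (auto intro!: borel_measurable_times continuous_on_mult)

lemma env_diff_le: "env T (\<lambda>t \<z>. u t \<z> - v t \<z>) \<z> \<le> env T u \<z> + env T v \<z>"
proof (rule env_least)
  fix t assume t: "t \<in> {0..T}"
  have "ennreal (cmod (u t \<z> - v t \<z>)) \<le> ennreal (cmod (u t \<z>)) + ennreal (cmod (v t \<z>))"
    by (simp add: ennreal_plus[symmetric] ennreal_leI norm_triangle_ineq4 del: ennreal_plus)
  also have "\<dots> \<le> env T u \<z> + env T v \<z>" using t by (intro add_mono env_upper)
  finally show "ennreal (cmod (u t \<z> - v t \<z>)) \<le> env T u \<z> + env T v \<z>" .
qed

lemma nrm_env_diff_le:
  assumes "path T u" "path T v"
  shows "nrm s (env T (\<lambda>t \<z>. u t \<z> - v t \<z>)) \<le> 2 * nrm s (env T u) + 2 * nrm s (env T v)"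
proof -
  have [measurable]: "Borel (env T u)" "Borel (env T v)" using assms by auto
  have "nrm s (env T (\<lambda>t \<z>. u t \<z> - v t \<z>)) \<le> nrm s (\<lambda>\<z>. env T u \<z> + env T v \<z>)"
    by (intro nrm_mono env_diff_le)
  also have "\<dots> \<le> 2 * nrm s (env T u) + 2 * nrm s (env T v)" by (rule nrm_add) auto
  finally show ?thesis .
qed

lemma env_mult_le: "env T (\<lambda>t \<z>. m \<z> * u t \<z>) \<z> \<le> ennreal (cmod (m \<z>)) * env T u \<z>"
  by (rule env_least) (auto simp: norm_mult ennreal_mult intro!: mult_left_mono env_upper)

lemma env_conv_le: "env T (\<lambda>t. conv (u t) (v t)) \<z> \<le> econv (env T u) (env T v) \<z>"
proof (rule env_least)
  fix t assume "t \<in> {0..T}"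
  then have "econv (cabs (u t)) (cabs (v t)) \<z> \<le> econv (env T u) (env T v) \<z>"
    by (intro econv_mono env_upper)
  with cabs_conv_le show "ennreal (cmod (conv (u t) (v t) \<z>)) \<le> econv (env T u) (env T v) \<z>"
    by (rule order_trans)
qed

lemma econv_L2_finite:
  assumes "Borel A" "Borel B" "nrm 0 A < \<infinity>" "nrm 0 B < \<infinity>"
  shows "econv A B \<z> < \<infinity>"
proof -
  have "(econv A B \<z>)\<^sup>2 < \<infinity>"
    using econv_sup[OF assms(1,2), of \<z>] assms(3,4) by (auto intro: order.strict_trans1 simp: ennreal_mult_less_top)
  then show ?thesis by (simp add: power_less_top_ennreal)
qed

lemma conv_continuous_on:
  assumes u: "path T u" and v: "path T v" and fin: "econv (env T u) (env T v) \<z> < \<infinity>"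
  shows "continuous_on {0..T} (\<lambda>t. conv (u t) (v t) \<z>)"
  unfolding continuous_on_sequentially
proof (intro allI ballI impI, elim conjE)
  fix x :: "nat \<Rightarrow> real" and t assume t: "t \<in> {0..T}" and x: "\<forall>n. x n \<in> {0..T}" "x \<longlonglongrightarrow> t"
  have [measurable]: "Borel (u t)" "Borel (v t)"
    "\<And>n. Borel (u (x n))" "\<And>n. Borel (v (x n))"
    using u v t x path_measurable by blast+
  have [measurable]: "Borel (env T u)" "Borel (env T v)" using u v by auto
  have lim: "(\<lambda>n. u (x n) z) \<longlonglongrightarrow> u t z" "(\<lambda>n. v (x n) z) \<longlonglongrightarrow> v t z" for z
    using path_continuous[OF u, of z] path_continuous[OF v, of z] t x
    unfolding continuous_on_sequentially o_def by blast+
  have "(\<lambda>n. \<integral>z. u (x n) (\<z> - z) * v (x n) z \<partial>lborel) \<longlonglongrightarrow> (\<integral>z. u t (\<z> - z) * v t z \<partial>lborel)"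
  proof (rule integral_dominated_ennreal[where W="\<lambda>z. env T u (\<z> - z) * env T v z"])
    show "AE z in lborel. (\<lambda>n. u (x n) (\<z> - z) * v (x n) z) \<longlonglongrightarrow> u t (\<z> - z) * v t z"
      by (intro AE_I2 tendsto_mult lim)
    show "AE z in lborel. ennreal (cmod (u (x n) (\<z> - z) * v (x n) z)) \<le> env T u (\<z> - z) * env T v z" for n
      using x by (intro AE_I2) (auto simp: norm_mult ennreal_mult intro!: mult_mono env_upper)
    show "(\<integral>\<^sup>+z. env T u (\<z> - z) * env T v z \<partial>lborel) < \<infinity>" using fin by (simp add: econv_def)
  qed measurable
  then show "((\<lambda>t. conv (u t) (v t) \<z>) \<circ> x) \<longlonglongrightarrow> conv (u t) (v t) \<z>" by (simp add: conv_def o_def)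
qed

lemma path_conv:
  assumes "path T u" "path T v" "nrm 0 (env T u) < \<infinity>" "nrm 0 (env T v) < \<infinity>"
  shows "path T (\<lambda>t. conv (u t) (v t))"
proof (rule pathI)
  show "Borel (conv (u t) (v t))" if "t \<in> {0..T}" for t
    using assms that by (intro conv_measurable path_measurable)
  show "continuous_on {0..T} (\<lambda>t. conv (u t) (v t) \<z>)" for \<z>
    using assms by (intro conv_continuous_on econv_L2_finite) auto
qed

section \<open>Differentiable curves\<close>

lemma has_vector_derivative_iff_quotient:
  fixes f :: "real \<Rightarrow> 'b::real_normed_vector"
  shows "(f has_vector_derivative d) (at t within S) \<longleftrightarrow> ((\<lambda>y. (f y - f t) /\<^sub>R (y - t)) \<longlongrightarrow> d) (at t within S)"
proof -
  have "(f has_vector_derivative d) (at t within S) \<longleftrightarrow>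
    ((\<lambda>y. (1 / norm (y - t)) *\<^sub>R (f y - (f t + (y - t) *\<^sub>R d))) \<longlongrightarrow> 0) (at t within S)"
    unfolding has_vector_derivative_def has_derivative_within by (simp add: bounded_linear_scaleR_left)
  also have "\<dots> \<longleftrightarrow> ((\<lambda>y. norm ((1 / norm (y - t)) *\<^sub>R (f y - (f t + (y - t) *\<^sub>R d)))) \<longlongrightarrow> 0) (at t within S)"
    by (simp only: tendsto_norm_zero_iff)
  also have "\<dots> \<longleftrightarrow> ((\<lambda>y. norm ((f y - f t) /\<^sub>R (y - t) - d)) \<longlongrightarrow> 0) (at t within S)"
  proof (rule tendsto_cong)
    show "\<forall>\<^sub>F y in at t within S. norm ((1 / norm (y - t)) *\<^sub>R (f y - (f t + (y - t) *\<^sub>R d))) = norm ((f y - f t) /\<^sub>R (y - t) - d)"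
      unfolding eventually_at
    proof (intro exI[of _ 1] conjI ballI impI)
      fix y assume "y \<noteq> t \<and> dist y t < 1"
      then have "(1 / (y - t)) *\<^sub>R ((y - t) *\<^sub>R d) = d" by simp
      then have "(f y - f t) /\<^sub>R (y - t) - d = (1 / (y - t)) *\<^sub>R (f y - f t) - (1 / (y - t)) *\<^sub>R ((y - t) *\<^sub>R d)"
        by (simp add: divide_inverse)
      then have "(f y - f t) /\<^sub>R (y - t) - d = (1 / (y - t)) *\<^sub>R (f y - (f t + (y - t) *\<^sub>R d))"
        by (simp only: scaleR_diff_right[symmetric] diff_diff_eq)
      then show "norm ((1 / norm (y - t)) *\<^sub>R (f y - (f t + (y - t) *\<^sub>R d))) = norm ((f y - f t) /\<^sub>R (y - t) - d)"
        by simp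
    qed simp
  qed
  also have "\<dots> \<longleftrightarrow> ((\<lambda>y. (f y - f t) /\<^sub>R (y - t)) \<longlongrightarrow> d) (at t within S)"
    by (simp only: tendsto_norm_zero_iff LIM_zero_iff)
  finally show ?thesis .
qed

lemma vector_derivative_bound:
  fixes f :: "real \<Rightarrow> 'b::real_normed_vector"
  assumes d: "\<And>t. t \<in> {0..T} \<Longrightarrow> (f has_vector_derivative f' t) (at t within {0..T})"
    and bd: "\<And>t. t \<in> {0..T} \<Longrightarrow> norm (f' t) \<le> B" and xy: "x \<in> {0..T}" "y \<in> {0..T}"
  shows "norm (f x - f y) \<le> B * \<bar>x - y\<bar>"
proof -
  have "norm (f x - f y) \<le> B * norm (x - y)"
  proof (rule differentiable_bound[of "{0..T}" f "\<lambda>t h. h *\<^sub>R f' t"])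
    show "(f has_derivative (\<lambda>h. h *\<^sub>R f' t)) (at t within {0..T})" if "t \<in> {0..T}" for t
      using d[OF that] by (simp add: has_vector_derivative_def)
    show "onorm (\<lambda>h. h *\<^sub>R f' t) \<le> B" if "t \<in> {0..T}" for t
    proof (rule onorm_le)
      fix h :: real
      show "norm (h *\<^sub>R f' t) \<le> B * norm h"
        using mult_right_mono[OF bd[OF that], of "\<bar>h\<bar>"] by (simp add: mult.commute)
    qed
  qed (use xy in auto)
  then show ?thesis by simp
qed

definition dpath :: "real \<Rightarrow> (real \<Rightarrow> plane \<Rightarrow> complex) \<Rightarrow> (real \<Rightarrow> plane \<Rightarrow> complex) \<Rightarrow> bool" where
  "dpath T u u' \<longleftrightarrow> path T u \<and> path T u' \<and>
     (\<forall>\<z>. \<forall>t\<in>{0..T}. ((\<lambda>t. u t \<z>) has_vector_derivative u' t \<z>) (at t within {0..T}))"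

lemma dpath_path: "dpath T u u' \<Longrightarrow> path T u" "dpath T u u' \<Longrightarrow> path T u'"
  unfolding dpath_def by blast+

lemma dpath_deriv: "dpath T u u' \<Longrightarrow> t \<in> {0..T} \<Longrightarrow> ((\<lambda>t. u t \<z>) has_vector_derivative u' t \<z>) (at t within {0..T})"
  unfolding dpath_def by blast+

text \<open>The mean value inequality makes \<open>env T u'\<close> a common majorant of all
  difference quotients; where it is infinite the bound is trivial.\<close>

lemma dpath_quotient_bound:
  assumes u: "dpath T u u'" and xy: "x \<in> {0..T}" "y \<in> {0..T}" "x \<noteq> y"
  shows "ennreal (cmod ((u x \<z> - u y \<z>) /\<^sub>R (x - y))) \<le> env T u' \<z>"
proof (cases "env T u' \<z>")
  case (real B)
  have "cmod (u x \<z> - u y \<z>) \<le> B * \<bar>x - y\<bar>"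
  proof (rule vector_derivative_bound)
    show "((\<lambda>t. u t \<z>) has_vector_derivative u' t \<z>) (at t within {0..T})" if "t \<in> {0..T}" for t
      using dpath_deriv[OF u that] .
    show "cmod (u' t \<z>) \<le> B" if "t \<in> {0..T}" for t
      using env_upper[OF that, of u' \<z>] real by simp
  qed (use xy in auto)
  then have "cmod ((u x \<z> - u y \<z>) /\<^sub>R (x - y)) \<le> B" using xy(3) by (simp add: divide_simps mult.commute)
  then show ?thesis using real by (simp add: ennreal_leI)
qed simp

text \<open>Differentiation under the integral with the majorant \<open>env T u'\<close>. Finiteness
  of the convolution with \<open>env T u\<close> allows the integral of a difference to be
  split.\<close>

lemma conv_has_vector_derivative:
  assumes [measurable]: "Borel F" and u: "dpath T u u'"
    and fin: "econv (cabs F) (env T u') \<z> < \<infinity>"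
    and fin2: "econv (cabs F) (env T u) \<z> < \<infinity>"
    and t: "t \<in> {0..T}"
  shows "((\<lambda>t. conv F (u t) \<z>) has_vector_derivative conv F (u' t) \<z>) (at t within {0..T})"
  unfolding has_vector_derivative_iff_quotient tendsto_at_iff_sequentially
proof (intro allI impI)
  fix x :: "nat \<Rightarrow> real" assume x: "\<forall>i. x i \<in> {0..T} - {t}" and xt: "x \<longlonglongrightarrow> t"
  have xT: "x i \<in> {0..T}" "x i \<noteq> t" for i using x by auto
  note pu = dpath_path[OF u]
  have [measurable]: "Borel (u t)" "Borel (u' t)"
    "\<And>n. Borel (u (x n))"
    using pu t xT path_measurable by blast+
  have [measurable]: "Borel (env T u')" "Borel (env T u)" using pu by auto
  have int: "integrable lborel (\<lambda>z. F (\<z> - z) * u \<tau> z)" if "\<tau> \<in> {0..T}" for \<tau>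
  proof (rule conv_integrable_point)
    show "Borel (u \<tau>)" using pu that path_measurable by blast
    have "econv (cabs F) (cabs (u \<tau>)) \<z> \<le> econv (cabs F) (env T u) \<z>"
      using that by (intro econv_mono env_upper) auto
    then show "econv (cabs F) (cabs (u \<tau>)) \<z> < \<infinity>" using fin2 by (rule order.strict_trans1)
  qed measurable
  have "(\<lambda>n. \<integral>z. F (\<z> - z) * ((u (x n) z - u t z) /\<^sub>R (x n - t)) \<partial>lborel) \<longlonglongrightarrow> (\<integral>z. F (\<z> - z) * u' t z \<partial>lborel)"
  proof (rule integral_dominated_ennreal[where W="\<lambda>z. cabs F (\<z> - z) * env T u' z"])
    have "(\<lambda>n. (u (x n) z - u t z) /\<^sub>R (x n - t)) \<longlonglongrightarrow> u' t z" for z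
      using dpath_deriv[OF u t, of z] x xt
      unfolding has_vector_derivative_iff_quotient tendsto_at_iff_sequentially o_def by blast
    then show "AE z in lborel. (\<lambda>n. F (\<z> - z) * ((u (x n) z - u t z) /\<^sub>R (x n - t))) \<longlonglongrightarrow> F (\<z> - z) * u' t z"
      by (intro AE_I2 tendsto_mult tendsto_const)
    show "AE z in lborel. ennreal (cmod (F (\<z> - z) * ((u (x n) z - u t z) /\<^sub>R (x n - t)))) \<le> cabs F (\<z> - z) * env T u' z" for n
      unfolding norm_mult using dpath_quotient_bound[OF u xT(1)[of n] t xT(2)[of n]]
      by (intro AE_I2) (auto simp: ennreal_mult intro!: mult_left_mono)
    show "(\<integral>\<^sup>+z. cabs F (\<z> - z) * env T u' z \<partial>lborel) < \<infinity>" using fin by (simp add: econv_def)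
  qed measurable
  moreover have "(\<integral>z. F (\<z> - z) * ((u (x n) z - u t z) /\<^sub>R (x n - t)) \<partial>lborel) = (conv F (u (x n)) \<z> - conv F (u t) \<z>) /\<^sub>R (x n - t)" for n
  proof -
    have "(\<integral>z. F (\<z> - z) * ((u (x n) z - u t z) /\<^sub>R (x n - t)) \<partial>lborel)
       = (\<integral>z. (F (\<z> - z) * u (x n) z - F (\<z> - z) * u t z) /\<^sub>R (x n - t) \<partial>lborel)"
      by (intro Bochner_Integration.integral_cong refl) (simp add: right_diff_distrib)
    also have "\<dots> = (\<integral>z. F (\<z> - z) * u (x n) z - F (\<z> - z) * u t z \<partial>lborel) /\<^sub>R (x n - t)"
      by (rule integral_scaleR_right)
    also have "(\<integral>z. F (\<z> - z) * u (x n) z - F (\<z> - z) * u t z \<partial>lborel) = conv F (u (x n)) \<z> - conv F (u t) \<z>"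
      unfolding conv_def by (intro Bochner_Integration.integral_diff int xT t)
    finally show ?thesis .
  qed
  ultimately show "((\<lambda>y. (conv F (u y) \<z> - conv F (u t) \<z>) /\<^sub>R (y - t)) \<circ> x) \<longlonglongrightarrow> conv F (u' t) \<z>"
    unfolding o_def conv_def[of F "u' t"] by (simp only:)
qed

section \<open>Oscillating scalar equations and Duhamel's formula\<close>

lemma cis_has_vector_derivative:
  "((\<lambda>t. cis (t * c)) has_vector_derivative (\<i> * complex_of_real c) * cis (t * c)) (at t within S)"
proof -
  have "((\<lambda>t. t * c) has_derivative (\<lambda>h. h * c)) (at t within S)" by (auto intro!: derivative_eq_intros)
  from has_derivative_cis[OF this] show ?thesis
    by (simp add: has_vector_derivative_def scaleR_conv_of_real mult_ac)
qed

text \<open>The integrating factor \<open>cis (t * c)\<close> has modulus 1 because \<open>c\<close>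
  is real, so the bound does not see the size of \<open>c\<close>, which is unbounded over the
  frequencies.\<close>

lemma dispersive_ode_bound:
  fixes y :: "real \<Rightarrow> complex"
  assumes y: "\<And>t. t \<in> {0..T} \<Longrightarrow> (y has_vector_derivative - \<i> * complex_of_real c * y t + g t) (at t within {0..T})"
    and g: "\<And>t. t \<in> {0..T} \<Longrightarrow> cmod (g t) \<le> M" and t: "t \<in> {0..T}"
  shows "cmod (y t) \<le> cmod (y 0) + T * M"
proof -
  have T: "0 \<in> {0..T}" using t by auto
  have d: "((\<lambda>t. cis (t * c) * y t) has_vector_derivative cis (t * c) * g t) (at t within {0..T})" if "t \<in> {0..T}" for t
  proof -
    have "((\<lambda>t. cis (t * c) * y t) has_vector_derivative
       cis (t * c) * (- \<i> * complex_of_real c * y t + g t) + (\<i> * complex_of_real c) * cis (t * c) * y t) (at t within {0..T})"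
      by (rule has_vector_derivative_mult[OF cis_has_vector_derivative y[OF that]])
    then show ?thesis by (simp add: algebra_simps)
  qed
  have "cmod (cis (t * c) * y t - cis (0 * c) * y 0) \<le> M * \<bar>t - 0\<bar>"
    by (rule vector_derivative_bound[OF d _ t T]) (use g in \<open>auto simp: norm_mult\<close>)
  then have "cmod (cis (t * c) * y t - y 0) \<le> M * t" using t by simp
  also have "\<dots> \<le> T * M" using t order_trans[OF norm_ge_zero g[OF t]] by (simp add: mult.commute mult_left_mono)
  finally have "cmod (cis (t * c) * y t) \<le> cmod (y 0) + T * M"
    using norm_triangle_sub[of "cis (t * c) * y t" "y 0"] by simp
  then show ?thesis by (simp add: norm_mult)
qed

text \<open>Integration by parts in time: \<open>z = i c y - h\<close> solves the same equation with forcing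
  \<open>i c g - h'\<close>, so the slowly varying part \<open>h\<close> of the forcing costs only a factor \<open>1/c\<close>.\<close>

lemma dispersive_ode_bound_slow:
  fixes y :: "real \<Rightarrow> complex"
  assumes y: "\<And>t. t \<in> {0..T} \<Longrightarrow> (y has_vector_derivative - \<i> * complex_of_real c * y t + (g t + h t)) (at t within {0..T})"
    and h: "\<And>t. t \<in> {0..T} \<Longrightarrow> (h has_vector_derivative h' t) (at t within {0..T})"
    and gb: "\<And>t. t \<in> {0..T} \<Longrightarrow> cmod (g t) \<le> M" and hb: "\<And>t. t \<in> {0..T} \<Longrightarrow> cmod (h t) \<le> H"
    and h'b: "\<And>t. t \<in> {0..T} \<Longrightarrow> cmod (h' t) \<le> H'"
    and t: "t \<in> {0..T}"
  shows "\<bar>c\<bar> * cmod (y t) \<le> \<bar>c\<bar> * cmod (y 0) + T * \<bar>c\<bar> * M + 2 * H + T * H'"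
proof -
  have T: "0 \<in> {0..T}" using t by auto
  define z where "z t = \<i> * complex_of_real c * y t - h t" for t
  have d: "(z has_vector_derivative - \<i> * complex_of_real c * z t + (\<i> * complex_of_real c * g t - h' t)) (at t within {0..T})" if "t \<in> {0..T}" for t
  proof -
    have "(z has_vector_derivative \<i> * complex_of_real c * (- \<i> * complex_of_real c * y t + (g t + h t)) - h' t) (at t within {0..T})"
      unfolding z_def
      by (intro has_vector_derivative_diff has_vector_derivative_mult_right y h that)
    then show ?thesis by (simp add: z_def algebra_simps)
  qed
  have "cmod (z t) \<le> cmod (z 0) + T * (\<bar>c\<bar> * M + H')"
  proof (rule dispersive_ode_bound[OF d _ t])
    fix t assume t: "t \<in> {0..T}"
    have "cmod (\<i> * complex_of_real c * g t - h' t) \<le> \<bar>c\<bar> * cmod (g t) + cmod (h' t)"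
      using norm_triangle_ineq4[of "\<i> * complex_of_real c * g t" "h' t"] by (simp add: norm_mult)
    also have "\<dots> \<le> \<bar>c\<bar> * M + H'" using gb[OF t] h'b[OF t] by (intro add_mono mult_left_mono) auto
    finally show "cmod (\<i> * complex_of_real c * g t - h' t) \<le> \<bar>c\<bar> * M + H'" .
  qed
  moreover have "\<bar>c\<bar> * cmod (y t) \<le> cmod (z t) + cmod (h t)"
    using norm_triangle_ineq[of "z t" "h t"] by (simp add: z_def norm_mult)
  moreover have "cmod (z 0) \<le> \<bar>c\<bar> * cmod (y 0) + cmod (h 0)"
    using norm_triangle_ineq4[of "\<i> * complex_of_real c * y 0" "h 0"] by (simp add: z_def norm_mult)
  ultimately show ?thesis using hb[OF t] hb[OF T] by (simp add: algebra_simps)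
qed

text \<open>Rounding the time down to multiples of 1/(n+1) leaves countably many measurable
  sections, and continuity in time makes the roundings converge.\<close>

lemma caratheodory_measurable:
  fixes f :: "real \<Rightarrow> 'b \<Rightarrow> complex"
  assumes m: "\<And>\<tau>. f \<tau> \<in> borel_measurable N" and c: "\<And>x. x \<in> space N \<Longrightarrow> continuous_on UNIV (\<lambda>\<tau>. f \<tau> x)"
  shows "(\<lambda>(x, \<tau>). f \<tau> x) \<in> borel_measurable (N \<Otimes>\<^sub>M borel)"
proof (rule borel_measurable_LIMSEQ_metric)
  define r where "r n \<tau> = real_of_int \<lfloor>real (Suc n) * \<tau>\<rfloor> / real (Suc n)" for n \<tau>
  show "(\<lambda>(x, \<tau>). f (r n \<tau>) x) \<in> borel_measurable (N \<Otimes>\<^sub>M borel)" for n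
  proof -
    have "(\<lambda>z. f (real_of_int \<lfloor>real (Suc n) * snd z\<rfloor> / real (Suc n)) (fst z)) \<in> borel_measurable (N \<Otimes>\<^sub>M borel)"
    proof (rule measurable_compose_countable[where f="\<lambda>i z. f (real_of_int i / real (Suc n)) (fst z)" and g="\<lambda>z. \<lfloor>real (Suc n) * snd z\<rfloor>"])
      show "(\<lambda>z. f (real_of_int i / real (Suc n)) (fst z)) \<in> borel_measurable (N \<Otimes>\<^sub>M borel)" for i
        using m by (rule measurable_compose[OF measurable_fst])
    qed measurable
    then show ?thesis by (simp add: r_def case_prod_beta)
  qed
  fix z assume "z \<in> space (N \<Otimes>\<^sub>M (borel :: real measure))"
  then obtain x \<tau> where z: "z = (x, \<tau>)" "x \<in> space N" by (auto simp: space_pair_measure)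
  have "(\<lambda>n. r n \<tau>) \<longlonglongrightarrow> \<tau>"
  proof (rule LIM_zero_cancel, rule Lim_null_comparison)
    show "\<forall>\<^sub>F n in sequentially. norm (r n \<tau> - \<tau>) \<le> 1 / real (Suc n)"
    proof (intro always_eventually allI)
      fix n
      have "\<bar>real_of_int \<lfloor>real (Suc n) * \<tau>\<rfloor> - real (Suc n) * \<tau>\<bar> \<le> 1" by linarith
      moreover have "r n \<tau> - \<tau> = (real_of_int \<lfloor>real (Suc n) * \<tau>\<rfloor> - real (Suc n) * \<tau>) / real (Suc n)"
        by (simp add: r_def field_simps)
      ultimately show "norm (r n \<tau> - \<tau>) \<le> 1 / real (Suc n)" by (simp add: divide_right_mono del: of_nat_Suc)
    qed
    show "(\<lambda>n. 1 / real (Suc n)) \<longlonglongrightarrow> 0" by (rule LIMSEQ_Suc[OF lim_1_over_n])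
  qed
  then have "(\<lambda>n. f (r n \<tau>) x) \<longlonglongrightarrow> f \<tau> x"
    using c[OF z(2)] unfolding continuous_on_sequentially o_def by blast
  then show "(\<lambda>n. case z of (x, \<tau>) \<Rightarrow> f (r n \<tau>) x) \<longlonglongrightarrow> (case z of (x, \<tau>) \<Rightarrow> f \<tau> x)" by (simp add: z)
qed

text \<open>With the group in front of the integral, the product rule and the fundamental theorem of
  calculus give the differential equation at each frequency.\<close>

definition duhamel :: "(plane \<Rightarrow> real) \<Rightarrow> (plane \<Rightarrow> complex) \<Rightarrow> (real \<Rightarrow> plane \<Rightarrow> complex) \<Rightarrow> real \<Rightarrow> plane \<Rightarrow> complex" where
  "duhamel c h G t \<z> = cis (- (t * c \<z>)) * (h \<z> + integral {0..t} (\<lambda>\<tau>. cis (\<tau> * c \<z>) * G \<tau> \<z>))"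

lemma duhamel_0 [simp]: "duhamel c h G 0 \<z> = h \<z>"
  by (simp add: duhamel_def)

lemma duhamel_deriv:
  assumes G: "path T G" and t: "t \<in> {0..T}"
  shows "((\<lambda>t. duhamel c h G t \<z>) has_vector_derivative - \<i> * complex_of_real (c \<z>) * duhamel c h G t \<z> + G t \<z>) (at t within {0..T})"
proof -
  let ?f = "\<lambda>\<tau>. cis (\<tau> * c \<z>) * G \<tau> \<z>"
  have cont: "continuous_on {0..T} ?f" by (intro continuous_intros path_continuous[OF G])
  have 1: "((\<lambda>t. h \<z> + integral {0..t} ?f) has_vector_derivative ?f t) (at t within {0..T})"
    using has_vector_derivative_add[OF has_vector_derivative_const integral_has_vector_derivative[OF cont t]] by simp
  have 2: "((\<lambda>t. cis (- (t * c \<z>))) has_vector_derivative (\<i> * complex_of_real (- c \<z>)) * cis (- (t * c \<z>))) (at t within {0..T})"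
    using cis_has_vector_derivative[of "- c \<z>" t "{0..T}"] by simp
  have e: "cis (- (t * c \<z>)) * ?f t = G t \<z>" by (simp add: mult.assoc[symmetric] cis_mult)
  have "cis (- (t * c \<z>)) * ?f t + \<i> * complex_of_real (- c \<z>) * cis (- (t * c \<z>)) * (h \<z> + integral {0..t} ?f)
     = - \<i> * complex_of_real (c \<z>) * duhamel c h G t \<z> + G t \<z>"
    unfolding e duhamel_def by (simp add: mult.assoc)
  then show ?thesis
    using has_vector_derivative_mult[OF 2 1] unfolding duhamel_def by (simp only:)
qed

lemma duhamel_measurable:
  assumes G: "path T G" and [measurable]: "Borel c" "Borel h" and t: "t \<in> {0..T}"
  shows "Borel (duhamel c h G t)"
proof -
  \<comment> \<open>Clamping the time to [0,T] makes the curve continuous on the whole line, as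
    \<open>caratheodory_measurable\<close> asks, without changing it on the range of
    integration.\<close>
  define Gc where "Gc \<tau> \<z> = G (max 0 (min T \<tau>)) \<z>" for \<tau> \<z>
  have cl: "max 0 (min T \<tau>) \<in> {0..T}" for \<tau> using t by auto
  have "(\<lambda>(\<z>, \<tau>). Gc \<tau> \<z>) \<in> borel_measurable (borel \<Otimes>\<^sub>M borel)"
  proof (rule caratheodory_measurable)
    show "Borel (Gc \<tau>)" for \<tau>
      unfolding Gc_def using path_measurable[OF G cl] by simp
    show "continuous_on UNIV (\<lambda>\<tau>. Gc \<tau> \<z>)" for \<z>
      unfolding Gc_def
      by (rule continuous_on_compose2[OF path_continuous[OF G]]) (use cl in \<open>auto intro!: continuous_intros\<close>)
  qed
  then have [measurable]: "(\<lambda>(\<z>, \<tau>). Gc \<tau> \<z>) \<in> borel_measurable (borel \<Otimes>\<^sub>M lborel)" by simp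
  have "integral {0..t} (\<lambda>\<tau>. cis (\<tau> * c \<z>) * G \<tau> \<z>) = (\<integral>\<tau>. indicator {0..t} \<tau> *\<^sub>R (cis (\<tau> * c \<z>) * Gc \<tau> \<z>) \<partial>lborel)" for \<z>
  proof -
    have eq: "cis (\<tau> * c \<z>) * G \<tau> \<z> = cis (\<tau> * c \<z>) * Gc \<tau> \<z>" if "\<tau> \<in> {0..t}" for \<tau>
    proof -
      have "max 0 (min T \<tau>) = \<tau>" using that t by auto
      then show ?thesis by (simp only: Gc_def)
    qed
    have "continuous_on {0..T} (\<lambda>\<tau>. cis (\<tau> * c \<z>) * G \<tau> \<z>)" by (intro continuous_intros path_continuous[OF G])
    then have "continuous_on {0..t} (\<lambda>\<tau>. cis (\<tau> * c \<z>) * G \<tau> \<z>)" using t by (auto elim: continuous_on_subset)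
    from set_borel_integral_eq_integral(2)[OF borel_integrable_atLeastAtMost'[OF this]]
    have "integral {0..t} (\<lambda>\<tau>. cis (\<tau> * c \<z>) * G \<tau> \<z>) = (\<integral>\<tau>. indicator {0..t} \<tau> *\<^sub>R (cis (\<tau> * c \<z>) * G \<tau> \<z>) \<partial>lborel)"
      by (simp add: set_lebesgue_integral_def)
    also have "\<dots> = (\<integral>\<tau>. indicator {0..t} \<tau> *\<^sub>R (cis (\<tau> * c \<z>) * Gc \<tau> \<z>) \<partial>lborel)"
      using eq by (intro Bochner_Integration.integral_cong refl) (auto simp: indicator_def)
    finally show ?thesis .
  qed
  then have "duhamel c h G t = (\<lambda>\<z>. cis (- (t * c \<z>)) * (h \<z> + (\<integral>\<tau>. indicator {0..t} \<tau> *\<^sub>R (cis (\<tau> * c \<z>) * Gc \<tau> \<z>) \<partial>lborel)))"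
    by (simp add: duhamel_def fun_eq_iff)
  moreover have "Borel \<dots>" by measurable
  ultimately show ?thesis by simp
qed

lemma path_duhamel:
  assumes "path T G" "Borel c" "Borel h"
  shows "path T (duhamel c h G)"
proof (rule pathI)
  show "Borel (duhamel c h G t)" if "t \<in> {0..T}" for t
    using assms that by (intro duhamel_measurable)
  show "continuous_on {0..T} (\<lambda>t. duhamel c h G t \<z>)" for \<z>
    unfolding continuous_on_eq_continuous_within
    using duhamel_deriv[OF assms(1)] has_vector_derivative_continuous by blast
qed

text \<open>With \<open>x\<close>, \<open>y\<close> the moduli of the coordinates this is \<open>(y/x) powr (3/8) * (1/y) powr (5/8)\<close>: an
  interpolation between \<open>y/x\<close> and \<open>1/y\<close> that is square integrable at the origin.\<close>

definition corner :: "plane \<Rightarrow> real" where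
  "corner \<z> = (if \<bar>fst \<z>\<bar> \<le> 1 \<and> \<bar>snd \<z>\<bar> \<le> 1 then \<bar>fst \<z>\<bar> powr (-3/8) * \<bar>snd \<z>\<bar> powr (-1/4) else 0)"

lemma fst_measurable_plane [measurable]: "Borel (fst :: plane \<Rightarrow> real)"
  by (intro borel_measurable_continuous_onI continuous_intros)

lemma snd_measurable_plane [measurable]: "Borel (snd :: plane \<Rightarrow> real)"
  by (intro borel_measurable_continuous_onI continuous_intros)

lemma corner_measurable [measurable]: "Borel corner"
  unfolding corner_def[abs_def] by measurable

lemma corner_nonneg [simp]: "0 \<le> corner \<z>"
  by (simp add: corner_def)

lemma nn_integral_abs_powr:
  assumes "-1 < a"
  shows "(\<integral>\<^sup>+x. ennreal (\<bar>x\<bar> powr a) * indicator {-1..1} x \<partial>lborel) < \<infinity>"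
proof -
  let ?f = "\<lambda>x::real. ennreal (x powr a) * indicator {0..1} x"
  have I: "(\<integral>\<^sup>+x. ?f x \<partial>lborel) = ennreal (1 powr (a + 1) / (a + 1))"
    by (rule nn_integral_has_integral_lebesgue') (use has_integral_powr_from_0[OF assms, of 1] in auto)
  have I2: "(\<integral>\<^sup>+x. ?f (-x) \<partial>lborel) = (\<integral>\<^sup>+x. ?f x \<partial>lborel)"
    using nn_integral_lborel_reflect[of ?f 0] by simp
  have "(\<integral>\<^sup>+x. ennreal (\<bar>x\<bar> powr a) * indicator {-1..1} x \<partial>lborel) \<le> (\<integral>\<^sup>+x. ?f x + ?f (-x) \<partial>lborel)"
    by (intro nn_integral_mono) (auto simp: indicator_def abs_if)
  also have "\<dots> = (\<integral>\<^sup>+x. ?f x \<partial>lborel) + (\<integral>\<^sup>+x. ?f x \<partial>lborel)"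
    by (subst nn_integral_add) (auto simp: I2)
  also have "\<dots> < \<infinity>" unfolding I by simp
  finally show ?thesis .
qed

text \<open>Interpolation with exponent t between y/x and 1/y gives x^(-t) y^(2t-1). Its square is
  integrable at the origin exactly for 1/4 < t < 1/2, and 3/8 is the midpoint of this range.\<close>

lemma nn_integral_corner: "(\<integral>\<^sup>+\<z>. ennreal ((corner \<z>)\<^sup>2) \<partial>lborel) < \<infinity>"
proof -
  let ?f = "\<lambda>a (x::real). ennreal (\<bar>x\<bar> powr a) * indicator {-1..1} x"
  have sq: "(\<bar>x\<bar> powr a)\<^sup>2 = \<bar>x\<bar> powr (2 * a)" for x a :: real
    by (simp add: power2_eq_square powr_add[symmetric])
  have "(\<integral>\<^sup>+\<z>. ennreal ((corner \<z>)\<^sup>2) \<partial>lborel) \<le> (\<integral>\<^sup>+\<z>. ?f (-3/4) (fst \<z>) * ?f (-1/2) (snd \<z>) \<partial>lborel)"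
    by (intro nn_integral_mono) (auto simp: corner_def indicator_def power_mult_distrib sq ennreal_mult abs_le_iff)
  also have "\<dots> = (\<integral>\<^sup>+x. ?f (-3/4) x \<partial>lborel) * (\<integral>\<^sup>+x. ?f (-1/2) x \<partial>lborel)"
    by (rule nn_integral_plane_product) measurable
  also have "\<dots> < \<infinity>" using nn_integral_abs_powr[of "-3/4"] nn_integral_abs_powr[of "-1/2"]
    by (simp add: ennreal_mult_less_top)
  finally show ?thesis .
qed

text \<open>A weighted geometric mean is at least the smaller of its two entries. Which one is
  smaller depends on whether \<open>y\<^sup>2 \<le> x\<close>.\<close>

lemma corner_interpolation:
  assumes "\<xi> \<noteq> 0" "\<eta> \<noteq> 0" "\<bar>\<xi>\<bar> \<le> 1" "\<bar>\<eta>\<bar> \<le> 1"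
  shows "\<bar>\<eta> / \<xi>\<bar> \<le> corner (\<xi>, \<eta>) \<or> 1 / \<bar>\<eta>\<bar> \<le> corner (\<xi>, \<eta>)"
proof -
  define x y where "x = \<bar>\<xi>\<bar>" and "y = \<bar>\<eta>\<bar>"
  have pos: "0 < x" "0 < y" using assms by (auto simp: x_def y_def)
  have q: "corner (\<xi>, \<eta>) = x powr (-3/8) * y powr (-1/4)" using assms by (simp add: corner_def x_def y_def)
  have sq: "(y\<^sup>2) powr a = y powr (2 * a)" for a
    using pos by (simp add: powr_powr flip: powr_numeral)
  show ?thesis
  proof (cases "y\<^sup>2 \<le> x")
    case True
    have "x powr (-5/8) \<le> (y\<^sup>2) powr (-5/8)"
      using True pos by (intro powr_mono2') auto
    then have "y * (x powr (-3/8) * x powr (-5/8)) \<le> y * (x powr (-3/8) * y powr (-5/4))"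
      using pos unfolding sq by (intro mult_left_mono) auto
    moreover have "x powr (-3/8) * x powr (-5/8) = 1 / x"
    proof -
      have "x powr (-3/8) * x powr (-5/8) = x powr (-1)" by (subst powr_add[symmetric]) simp
      then show ?thesis using pos by (simp add: powr_minus_divide)
    qed
    moreover have "y * y powr (-5/4) = y powr (-1/4)"
    proof -
      have "y powr 1 * y powr (-5/4) = y powr (-1/4)" by (subst powr_add[symmetric]) simp
      then show ?thesis using pos by simp
    qed
    ultimately have "y / x \<le> x powr (-3/8) * y powr (-1/4)"
      by (metis mult.left_commute mult_1_right times_divide_eq_right)
    then show ?thesis unfolding q by (simp add: x_def y_def abs_divide)
  next
    case False
    have "(y\<^sup>2) powr (-3/8) \<le> x powr (-3/8)"
      using False pos by (intro powr_mono2') auto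
    then have "y powr (-3/4) * y powr (-1/4) \<le> x powr (-3/8) * y powr (-1/4)"
      unfolding sq by (intro mult_right_mono) auto
    moreover have "y powr (-3/4) * y powr (-1/4) = 1 / y"
    proof -
      have "y powr (-3/4) * y powr (-1/4) = y powr (-1)" by (subst powr_add[symmetric]) simp
      then show ?thesis using pos by (simp add: powr_minus_divide)
    qed
    ultimately show ?thesis unfolding q by (simp add: y_def)
  qed
qed

text \<open>Everything happens at one frequency: \<open>d\<close> is the size of the solution and
  \<open>d0\<close> of its initial value, \<open>e\<close> bounds the nonlinear term,
  \<open>a\<close> the product with the coefficient and \<open>b\<close> the time derivative of that
  product. \<open>d1\<close> is the direct bound and \<open>d2\<close> the one integrated by parts.
  The former suffices where the quotient is at most 2. Elsewhere the phase does not vanish, and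
  dividing \<open>d2\<close> by it leaves 2/|eta|: decay of order one if |eta| is at least 1,
  whereas near the origin whichever bound is better is compared with \<open>corner\<close>.\<close>

lemma singular_weight_bound:
  fixes \<xi> \<eta> \<gamma> d d0 e a b T P :: real
  assumes \<gamma>: "\<gamma> = 1 \<or> \<gamma> = -1" and nn: "0 \<le> d0" "0 \<le> e" "0 \<le> a" "0 \<le> b" "0 \<le> T" "T \<le> 1" "1 \<le> P"
  defines "c \<equiv> (\<xi>\<^sup>2 + \<gamma> * \<eta>\<^sup>2) / (\<xi> * (1 + \<xi>\<^sup>2))" and "mn \<equiv> \<bar>\<xi> / (P * (1 + \<xi>\<^sup>2))\<bar>" and "ma \<equiv> 1 / (1 + \<xi>\<^sup>2)"
  assumes d1: "d \<le> d0 + T * (mn * e + ma * a)"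
    and d2: "\<bar>c\<bar> * d \<le> \<bar>c\<bar> * d0 + T * \<bar>c\<bar> * (mn * e) + 2 * (ma * a) + T * (ma * b)"
  shows "\<bar>\<eta> / \<xi>\<bar> * d \<le> \<bar>\<eta> / \<xi>\<bar> * d0 + T * (\<bar>\<eta>\<bar> * e) + 2 * T * a
    + 3 * sob_weight (-1/2) (\<xi>, \<eta>) * (2 * a + T * b) + 2 * corner (\<xi>, \<eta>) * (2 * a + T * b)"
proof (cases "\<xi> = 0 \<or> \<eta> = 0")
  case True
  \<comment> \<open>For \<open>\<xi> = 0\<close> this relies on division by 0 having the value
    0.\<close>
  then have z0: "\<bar>\<eta> / \<xi>\<bar> = 0" by auto
  have "0 \<le> T * (\<bar>\<eta>\<bar> * e) + 2 * T * a
    + 3 * sob_weight (-1/2) (\<xi>, \<eta>) * (2 * a + T * b) + 2 * corner (\<xi>, \<eta>) * (2 * a + T * b)"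
    using nn by (intro add_nonneg_nonneg mult_nonneg_nonneg) auto
  then show ?thesis unfolding z0 mult_zero_left add_0_left .
next
  case False
  then have nz: "\<xi> \<noteq> 0" "\<eta> \<noteq> 0" by auto
  define z where "z = \<bar>\<eta> / \<xi>\<bar>"
  have z: "0 < z" using nz by (simp add: z_def)
  have den: "1 \<le> 1 + \<xi>\<^sup>2" by simp
  then have ma: "0 < ma" "ma \<le> 1" by (auto simp: ma_def divide_le_eq_1 add_pos_nonneg)
  have mn0: "0 \<le> mn" by (simp add: mn_def)
  \<comment> \<open>The derivative in the nonlinear term supplies a factor xi that cancels the one
    in the denominator, so no oscillation is called for there.\<close>
  have zmn: "z * mn \<le> \<bar>\<eta>\<bar>"
  proof -
    have "1 * 1 \<le> P * (1 + \<xi>\<^sup>2)" using nn den by (intro mult_mono) auto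
    then have "\<bar>\<eta>\<bar> / (P * (1 + \<xi>\<^sup>2)) \<le> \<bar>\<eta>\<bar> / 1" by (intro divide_left_mono) auto
    moreover have "z * mn = \<bar>\<eta>\<bar> / (P * (1 + \<xi>\<^sup>2))"
      using nz nn den by (simp add: z_def mn_def abs_mult abs_divide)
    ultimately show ?thesis by simp
  qed
  have zmne: "T * (z * mn * e) \<le> T * (\<bar>\<eta>\<bar> * e)" using zmn nn by (intro mult_left_mono mult_right_mono) auto
  have B: "0 \<le> 2 * a + T * b" using nn by simp
  have rest: "0 \<le> 3 * sob_weight (-1/2) (\<xi>, \<eta>) * (2 * a + T * b)" "0 \<le> 2 * corner (\<xi>, \<eta>) * (2 * a + T * b)" "0 \<le> 2 * T * a"
    using B nn by auto
  have b1: "z * d \<le> z * d0 + T * (\<bar>\<eta>\<bar> * e) + z * (T * a)"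
  proof -
    have "z * d \<le> z * (d0 + T * (mn * e + ma * a))" using d1 z by (intro mult_left_mono) auto
    also have "\<dots> = z * d0 + T * (z * mn * e) + z * (T * (ma * a))" by (simp add: algebra_simps)
    also have "\<dots> \<le> z * d0 + T * (\<bar>\<eta>\<bar> * e) + z * (T * a)"
    proof -
      have "ma * a \<le> 1 * a" using ma nn by (intro mult_right_mono) auto
      then have "T * (ma * a) \<le> T * a" using nn by (intro mult_left_mono) auto
      then have "z * (T * (ma * a)) \<le> z * (T * a)" by (rule mult_left_mono) (use z in auto)
      then show ?thesis using zmne by linarith
    qed
    finally show ?thesis .
  qed
  show ?thesis
  proof (cases "\<bar>\<eta>\<bar> \<le> 2 * \<bar>\<xi>\<bar>")
    case True
    then have "z \<le> 2" using nz by (simp add: z_def abs_divide divide_le_eq)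
    then have "z * (T * a) \<le> 2 * (T * a)" using nn by (intro mult_right_mono) auto
    then show ?thesis using b1 rest unfolding z_def by linarith
  next
    case big: False
    have x2: "\<xi>\<^sup>2 \<le> \<eta>\<^sup>2 / 4"
      using big power_mono[of "2 * \<bar>\<xi>\<bar>" "\<bar>\<eta>\<bar>" 2] by (simp add: power_mult_distrib)
    \<comment> \<open>For \<open>\<gamma> = -1\<close> the numerator vanishes on the lines |xi| =
      |eta|. The condition |eta| > 2 |xi| stays away from them and keeps three quarters of
      eta^2.\<close>
    have D: "3/4 * \<eta>\<^sup>2 \<le> \<bar>\<xi>\<^sup>2 + \<gamma> * \<eta>\<^sup>2\<bar>"
      using \<gamma>
    proof
      assume "\<gamma> = 1"
      then show ?thesis using zero_le_power2[of \<xi>] zero_le_power2[of \<eta>] by simp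
    next
      assume "\<gamma> = -1"
      then show ?thesis using x2 abs_ge_minus_self[of "\<xi>\<^sup>2 - \<eta>\<^sup>2"] by simp
    qed
    have e2: "0 < \<eta>\<^sup>2" using nz by simp
    have Dpos: "0 < \<bar>\<xi>\<^sup>2 + \<gamma> * \<eta>\<^sup>2\<bar>" using D e2 by linarith
    have c: "\<bar>c\<bar> = \<bar>\<xi>\<^sup>2 + \<gamma> * \<eta>\<^sup>2\<bar> * ma / \<bar>\<xi>\<bar>"
      unfolding c_def ma_def using den by (simp add: abs_mult abs_divide)
    have cpos: "0 < \<bar>c\<bar>" unfolding c using Dpos ma nz by simp
    \<comment> \<open>The quotient and the phase share the denominator |xi|, and \<open>ma\<close>
      also cancels. What is left is |eta| over the numerator of the phase; 4/3 is rounded up to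
      2.\<close>
    have zc: "z * ma / \<bar>c\<bar> \<le> 2 / \<bar>\<eta>\<bar>"
    proof -
      have "z * ma / \<bar>c\<bar> = \<bar>\<eta>\<bar> / \<bar>\<xi>\<^sup>2 + \<gamma> * \<eta>\<^sup>2\<bar>"
        unfolding c z_def using nz ma by (simp add: abs_divide)
      also have "\<dots> \<le> \<bar>\<eta>\<bar> / (3/4 * \<eta>\<^sup>2)" using D e2 Dpos by (intro divide_left_mono) auto
      also have "\<dots> = (4/3) / \<bar>\<eta>\<bar>" using nz
      proof -
        have "x / (3/4 * (x * x)) = (4/3) / x" if "x \<noteq> 0" for x :: real using that by simp
        from this[of "\<bar>\<eta>\<bar>"] nz show ?thesis by (simp add: power2_eq_square)
      qed
      also have "\<dots> \<le> 2 / \<bar>\<eta>\<bar>" by (intro divide_right_mono) auto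
      finally show ?thesis .
    qed
    have b2: "z * d \<le> z * d0 + T * (\<bar>\<eta>\<bar> * e) + (2 / \<bar>\<eta>\<bar>) * (2 * a + T * b)"
    proof -
      have "d = \<bar>c\<bar> * d / \<bar>c\<bar>" using cpos by simp
      also have "\<dots> \<le> (\<bar>c\<bar> * d0 + T * \<bar>c\<bar> * (mn * e) + 2 * (ma * a) + T * (ma * b)) / \<bar>c\<bar>"
        using d2 cpos by (intro divide_right_mono) auto
      also have "\<dots> = d0 + T * (mn * e) + ma * (2 * a + T * b) / \<bar>c\<bar>"
        using cpos by (simp add: field_simps)
      finally have "z * d \<le> z * (d0 + T * (mn * e) + ma * (2 * a + T * b) / \<bar>c\<bar>)" using z by (intro mult_left_mono) auto
      also have "\<dots> = z * d0 + T * (z * mn * e) + (z * ma / \<bar>c\<bar>) * (2 * a + T * b)"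
        by (simp add: algebra_simps add_divide_distrib)
      also have "\<dots> \<le> z * d0 + T * (\<bar>\<eta>\<bar> * e) + (2 / \<bar>\<eta>\<bar>) * (2 * a + T * b)"
        using zmne mult_right_mono[OF zc B] by linarith
      finally show ?thesis .
    qed
    show ?thesis
    proof (cases "1 \<le> \<bar>\<eta>\<bar>")
      case True
      \<comment> \<open>Here 1 \<le> eta^2 and xi^2 \<le> eta^2 / 4, so the base of the weight is at
        most (3/2)^2 eta^2, whence the constant 3.\<close>
      have "2 / \<bar>\<eta>\<bar> \<le> 3 * sob_weight (-1/2) (\<xi>, \<eta>)"
      proof -
        have "1 \<le> \<eta>\<^sup>2" using True power_mono[of 1 "\<bar>\<eta>\<bar>" 2] by simp
        then have "1 + \<xi>\<^sup>2 + \<eta>\<^sup>2 \<le> (3/2 * \<bar>\<eta>\<bar>)\<^sup>2" using x2 by (simp add: power_mult_distrib power_divide)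
        moreover have b1: "1 \<le> 1 + \<xi>\<^sup>2 + \<eta>\<^sup>2" by (rule sob_weight_base_ge_1)
        moreover have "0 < 1 + \<xi>\<^sup>2 + \<eta>\<^sup>2" using b1 by linarith
        ultimately have "((3/2 * \<bar>\<eta>\<bar>)\<^sup>2) powr (-1/2) \<le> (1 + \<xi>\<^sup>2 + \<eta>\<^sup>2) powr (-1/2)"
          by (intro powr_mono2') auto
        moreover have "((3/2 * \<bar>\<eta>\<bar>)\<^sup>2) powr (-1/2) = 1 / (3/2 * \<bar>\<eta>\<bar>)"
        proof -
          have "(y\<^sup>2) powr (-1/2) = 1 / y" if y: "0 < y" for y :: real
          proof -
            have "(y\<^sup>2) powr (-1/2) = y powr (2 * (-1/2))"
              using y by (simp add: powr_powr flip: powr_numeral)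
            also have "\<dots> = y powr (-1)" by simp
            finally show ?thesis using y by (simp add: powr_minus_divide)
          qed
          from this[of "3/2 * \<bar>\<eta>\<bar>"] show ?thesis using nz by simp
        qed
        ultimately have "1 / (3/2 * \<bar>\<eta>\<bar>) \<le> sob_weight (-1/2) (\<xi>, \<eta>)" by (simp add: sob_weight_def)
        then show ?thesis by simp
      qed
      then have "(2 / \<bar>\<eta>\<bar>) * (2 * a + T * b) \<le> 3 * sob_weight (-1/2) (\<xi>, \<eta>) * (2 * a + T * b)"
        using B by (intro mult_right_mono) auto
      then show ?thesis using b2 rest unfolding z_def by linarith
    next
      case small: False
      have "\<bar>\<eta>\<bar> \<le> 1" "\<bar>\<xi>\<bar> \<le> 1" using small big by auto
      from corner_interpolation[OF nz this(2,1)] show ?thesis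
      proof
        assume "\<bar>\<eta> / \<xi>\<bar> \<le> corner (\<xi>, \<eta>)"
        then have "z \<le> 2 * corner (\<xi>, \<eta>)" using corner_nonneg[of "(\<xi>, \<eta>)"] unfolding z_def by linarith
        moreover have "T * a \<le> 2 * a + T * b" using nn mult_right_mono[of T 1 a] mult_nonneg_nonneg[of T b] by linarith
        ultimately have "z * (T * a) \<le> 2 * corner (\<xi>, \<eta>) * (2 * a + T * b)"
          using nn z by (intro mult_mono) auto
        then show ?thesis using b1 rest unfolding z_def by linarith
      next
        assume "1 / \<bar>\<eta>\<bar> \<le> corner (\<xi>, \<eta>)"
        then have "2 / \<bar>\<eta>\<bar> \<le> 2 * corner (\<xi>, \<eta>)" by simp
        then have "(2 / \<bar>\<eta>\<bar>) * (2 * a + T * b) \<le> 2 * corner (\<xi>, \<eta>) * (2 * a + T * b)"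
          using B by (intro mult_right_mono) auto
        then show ?thesis using b2 rest unfolding z_def by linarith
      qed
    qed
  qed
qed

lemma nrm_sum5:
  assumes [measurable]: "Borel A1" "Borel A2" "Borel A3"
    "Borel A4" "Borel A5"
  shows "nrm r (\<lambda>\<z>. A1 \<z> + A2 \<z> + A3 \<z> + A4 \<z> + A5 \<z>) \<le> 16 * (nrm r A1 + nrm r A2 + nrm r A3 + nrm r A4 + nrm r A5)"
proof -
  have "nrm r (\<lambda>\<z>. A1 \<z> + A2 \<z> + A3 \<z> + A4 \<z> + A5 \<z>) \<le> 2 * nrm r (\<lambda>\<z>. A1 \<z> + A2 \<z> + A3 \<z> + A4 \<z>) + 2 * nrm r A5"
    by (rule nrm_add) measurable
  also have "\<dots> \<le> 2 * (2 * nrm r (\<lambda>\<z>. A1 \<z> + A2 \<z> + A3 \<z>) + 2 * nrm r A4) + 2 * nrm r A5"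
    by (intro add_right_mono mult_left_mono nrm_add) auto
  also have "\<dots> \<le> 2 * (2 * (2 * nrm r (\<lambda>\<z>. A1 \<z> + A2 \<z>) + 2 * nrm r A3) + 2 * nrm r A4) + 2 * nrm r A5"
    by (intro add_right_mono mult_left_mono nrm_add) auto
  also have "\<dots> \<le> 2 * (2 * (2 * (2 * nrm r A1 + 2 * nrm r A2) + 2 * nrm r A3) + 2 * nrm r A4) + 2 * nrm r A5"
    by (intro add_right_mono mult_left_mono nrm_add) auto
  also have "\<dots> = 16 * nrm r A1 + 16 * nrm r A2 + 8 * nrm r A3 + 4 * nrm r A4 + 2 * nrm r A5"
    by (simp add: distrib_left mult.assoc[symmetric])
  also have "\<dots> \<le> 16 * nrm r A1 + 16 * nrm r A2 + 16 * nrm r A3 + 16 * nrm r A4 + 16 * nrm r A5"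
    by (intro add_mono mult_right_mono) auto
  finally show ?thesis by (simp add: distrib_left)
qed

section \<open>The linear problem\<close>

text \<open>\<open>cpow k\<close> corresponds to the power \<open>k + 1\<close> in physical space.\<close>

fun cpow :: "nat \<Rightarrow> (plane \<Rightarrow> complex) \<Rightarrow> plane \<Rightarrow> complex" where
  "cpow 0 F = F"
| "cpow (Suc k) F = (\<lambda>\<z>. complex_of_real cF * conv F (cpow k F) \<z>)"

text \<open>The phase of the free group. On the null line \<open>fst \<z> = 0\<close> it has the
  default value 0.\<close>

definition phi :: "real \<Rightarrow> plane \<Rightarrow> real" where
  "phi \<gamma> \<z> = ((fst \<z>)\<^sup>2 + \<gamma> * (snd \<z>)\<^sup>2) / (fst \<z> * (1 + (fst \<z>)\<^sup>2))"

definition mN :: "nat \<Rightarrow> plane \<Rightarrow> real" where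
  "mN p \<z> = fst \<z> / ((real p + 1) * (1 + (fst \<z>)\<^sup>2))"

definition mA :: "plane \<Rightarrow> real" where
  "mA \<z> = 1 / (1 + (fst \<z>)\<^sup>2)"

lemma phi_measurable [measurable]: "Borel (phi \<gamma>)"
  unfolding phi_def[abs_def] by measurable

lemma mN_measurable [measurable]: "Borel (mN p)"
  unfolding mN_def[abs_def] by measurable

lemma mA_measurable [measurable]: "Borel mA"
  unfolding mA_def[abs_def] by measurable

lemma mA_bounds: "0 < mA \<z>" "mA \<z> \<le> 1"
  by (auto simp: mA_def divide_le_eq_1 add_pos_nonneg)

lemma abs_le_one_plus_square: "\<bar>x\<bar> \<le> 1 + (x::real)\<^sup>2"
  using zero_le_power2[of "\<bar>x\<bar> - 1"] by (simp add: power2_diff)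

lemma mN_bound: "\<bar>mN p \<z>\<bar> \<le> 1"
proof -
  have "\<bar>fst \<z>\<bar> \<le> 1 * (1 + (fst \<z>)\<^sup>2)" using abs_le_one_plus_square by simp
  also have "\<dots> \<le> (real p + 1) * (1 + (fst \<z>)\<^sup>2)" by (intro mult_right_mono) auto
  finally show ?thesis
    by (simp add: mN_def abs_divide abs_mult divide_le_eq_1 add_pos_nonneg)
qed

text \<open>Up to a bounded part, the phase is one factor eta times the singular quotient. So the
  dispersive term costs one order beyond the norm of the quotient, which places u_t at order s -
  2.\<close>

lemma phi_bound: assumes "\<gamma> = 1 \<or> \<gamma> = -1" shows "\<bar>phi \<gamma> \<z>\<bar> \<le> 1 + \<bar>snd \<z>\<bar> * \<bar>snd \<z> / fst \<z>\<bar>"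
proof (cases "fst \<z> = 0")
  case False
  define \<xi> \<eta> where "\<xi> = fst \<z>" and "\<eta> = snd \<z>"
  have x: "\<xi> \<noteq> 0" using False by (simp add: \<xi>_def)
  have den: "1 \<le> 1 + \<xi>\<^sup>2" by simp
  have "\<bar>phi \<gamma> \<z>\<bar> = \<bar>\<xi>\<^sup>2 + \<gamma> * \<eta>\<^sup>2\<bar> / (\<bar>\<xi>\<bar> * (1 + \<xi>\<^sup>2))"
    by (simp add: phi_def \<xi>_def \<eta>_def abs_divide abs_mult)
  also have "\<dots> \<le> (\<xi>\<^sup>2 + \<eta>\<^sup>2) / (\<bar>\<xi>\<bar> * (1 + \<xi>\<^sup>2))"
    using assms by (intro divide_right_mono) (auto simp: abs_if)
  also have "\<dots> = \<bar>\<xi>\<bar> / (1 + \<xi>\<^sup>2) + \<bar>\<eta>\<bar> * \<bar>\<eta> / \<xi>\<bar> / (1 + \<xi>\<^sup>2)"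
  proof -
    have q: "(x * x + y * y) / (x * D) = x / D + y * (y / x) / D" if "x \<noteq> 0" "D \<noteq> 0" for x y D :: real
      using that by (simp add: field_simps)
    have "1 + \<xi>\<^sup>2 \<noteq> 0" by (simp add: add_nonneg_eq_0_iff)
    with q[of "\<bar>\<xi>\<bar>" "1 + \<xi>\<^sup>2" "\<bar>\<eta>\<bar>"] x
    have "(\<bar>\<xi>\<bar> * \<bar>\<xi>\<bar> + \<bar>\<eta>\<bar> * \<bar>\<eta>\<bar>) / (\<bar>\<xi>\<bar> * (1 + \<xi>\<^sup>2)) = \<bar>\<xi>\<bar> / (1 + \<xi>\<^sup>2) + \<bar>\<eta>\<bar> * (\<bar>\<eta>\<bar> / \<bar>\<xi>\<bar>) / (1 + \<xi>\<^sup>2)"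
      by simp
    then show ?thesis by (simp add: power2_eq_square abs_divide)
  qed
  also have "\<dots> \<le> 1 + \<bar>\<eta>\<bar> * \<bar>\<eta> / \<xi>\<bar>"
  proof (intro add_mono)
    show "\<bar>\<xi>\<bar> / (1 + \<xi>\<^sup>2) \<le> 1" using abs_le_one_plus_square[of \<xi>] by (simp add: divide_le_eq_1 add_pos_nonneg)
    have "\<bar>\<eta>\<bar> * \<bar>\<eta> / \<xi>\<bar> / (1 + \<xi>\<^sup>2) \<le> \<bar>\<eta>\<bar> * \<bar>\<eta> / \<xi>\<bar> / 1" by (intro divide_left_mono) (auto simp: add_pos_nonneg)
    then show "\<bar>\<eta>\<bar> * \<bar>\<eta> / \<xi>\<bar> / (1 + \<xi>\<^sup>2) \<le> \<bar>\<eta>\<bar> * \<bar>\<eta> / \<xi>\<bar>" by simp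
  qed
  finally show ?thesis by (simp add: \<xi>_def \<eta>_def)
qed (simp add: phi_def)

definition Zw :: "(plane \<Rightarrow> ennreal) \<Rightarrow> plane \<Rightarrow> ennreal" where
  "Zw A \<z> = ennreal \<bar>snd \<z> / fst \<z>\<bar> * A \<z>"

lemma Zw_measurable [measurable]: "Borel A \<Longrightarrow> Borel (Zw A)"
  unfolding Zw_def[abs_def] by measurable

text \<open>Only the second half of the squared norm of X^s; the first half is \<open>nrm s\<close>.
  The two are estimated by different means.\<close>

definition xnrm :: "real \<Rightarrow> (plane \<Rightarrow> ennreal) \<Rightarrow> ennreal" where
  "xnrm s A = nrm (s - 1) (Zw A)"

lemma conv_diff_left:
  assumes [measurable]: "Borel F" "Borel F'" "Borel G"
    and fin: "nrm 0 (cabs F) < \<infinity>" "nrm 0 (cabs F') < \<infinity>" "nrm 0 (cabs G) < \<infinity>"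
  shows "conv (\<lambda>z. F z - F' z) G \<z> = conv F G \<z> - conv F' G \<z>"
  unfolding conv_def left_diff_distrib
  by (rule Bochner_Integration.integral_diff)
     (intro conv_integrable_point econv_L2_finite fin; measurable)+

lemma conv_diff_right:
  assumes [measurable]: "Borel F" "Borel G'" "Borel G"
    and fin: "nrm 0 (cabs F) < \<infinity>" "nrm 0 (cabs G') < \<infinity>" "nrm 0 (cabs G) < \<infinity>"
  shows "conv F (\<lambda>z. G z - G' z) \<z> = conv F G \<z> - conv F G' \<z>"
  unfolding conv_def right_diff_distrib
  by (rule Bochner_Integration.integral_diff)
     (intro conv_integrable_point econv_L2_finite fin; measurable)+

lemma nrm_cabs_le_env: "t \<in> {0..T} \<Longrightarrow> nrm s (cabs (u t)) \<le> nrm s (env T u)"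
  by (intro nrm_mono env_upper)

lemma nrm_0_finite: "0 \<le> s \<Longrightarrow> nrm s A < \<infinity> \<Longrightarrow> nrm 0 A < \<infinity>"
  using nrm_mono_weight[of 0 s A] by (rule order.strict_trans1)

text \<open>Induction on the power by telescoping, with the algebra property for the norms. The
  bound at each frequency comes from Cauchy-Schwarz in a convolution, so it starts with
  \<open>k = 1\<close>, where there is one; it drives the pointwise convergence of the Picard
  iterates.\<close>

lemma cpow_Lipschitz:
  assumes s: "1 < s" and M: "0 \<le> M"
  shows "\<exists>L\<ge>1. \<forall>T u v. path T u \<longrightarrow> path T v \<longrightarrow> nrm s (env T u) \<le> ennreal M \<longrightarrow> nrm s (env T v) \<le> ennreal M \<longrightarrow>
     path T (\<lambda>t. cpow k (u t)) \<and> nrm s (env T (\<lambda>t. cpow k (u t))) \<le> ennreal L \<and>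
     nrm s (env T (\<lambda>t \<z>. cpow k (u t) \<z> - cpow k (v t) \<z>)) \<le> ennreal L * nrm s (env T (\<lambda>t \<z>. u t \<z> - v t \<z>)) \<and>
     (1 \<le> k \<longrightarrow> (\<forall>\<z>. (env T (\<lambda>t \<z>. cpow k (u t) \<z> - cpow k (v t) \<z>) \<z>)\<^sup>2 \<le> ennreal L * nrm s (env T (\<lambda>t \<z>. u t \<z> - v t \<z>))))"
proof (induction k)
  case 0
  show ?case by (rule exI[of _ "max 1 M"]) (auto simp: M intro: order_trans ennreal_leI intro!: order_trans[OF _ mult_right_mono[of 1 "ennreal (max 1 M)"]])
next
  case (Suc k)
  then obtain L where L: "1 \<le> L" "\<And>T u v. path T u \<Longrightarrow> path T v \<Longrightarrow> nrm s (env T u) \<le> ennreal M \<Longrightarrow> nrm s (env T v) \<le> ennreal M \<Longrightarrow>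
     path T (\<lambda>t. cpow k (u t)) \<and> nrm s (env T (\<lambda>t. cpow k (u t))) \<le> ennreal L \<and>
     nrm s (env T (\<lambda>t \<z>. cpow k (u t) \<z> - cpow k (v t) \<z>)) \<le> ennreal L * nrm s (env T (\<lambda>t \<z>. u t \<z> - v t \<z>))"
    by blast
  obtain K where K: "0 < K" "\<And>A B. Borel A \<Longrightarrow> Borel B \<Longrightarrow>
      nrm s (econv A B) \<le> ennreal K * nrm s A * nrm s B" using econv_algebra_ex[OF s] by blast
  define c where "c = cF\<^sup>2"
  have c: "0 < c" unfolding c_def by (intro zero_less_power cF_pos)
  \<comment> \<open>The three summands pay for the size, the Lipschitz bound in norm and the
    Lipschitz bound at each frequency.\<close>
  define L' where "L' = max 1 (c * (K * M * L) + c * (2 * K * L + 2 * K * M * L) + c * (2 * L + 2 * M * L))"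
  show ?case
  proof (rule exI[of _ L'], intro conjI allI impI)
    show "1 \<le> L'" by (simp add: L'_def)
    fix T u v assume u: "path T u" and v: "path T v" and uM: "nrm s (env T u) \<le> ennreal M" and vM: "nrm s (env T v) \<le> ennreal M"
    define d where "d t \<z> = u t \<z> - v t \<z>" for t \<z>
    define e where "e t \<z> = cpow k (u t) \<z> - cpow k (v t) \<z>" for t \<z>
    have d_eq: "d = (\<lambda>t \<z>. u t \<z> - v t \<z>)" by (intro ext) (simp add: d_def)
    note Lu = L(2)[OF u v uM vM] and Lv = L(2)[OF v u vM uM]
    have pu: "path T (\<lambda>t. cpow k (u t))" and pv: "path T (\<lambda>t. cpow k (v t))" using Lu Lv by auto
    have pd: "path T d" unfolding d_def by (rule path_diff[OF u v])
    have pe: "path T e" unfolding e_def by (rule path_diff[OF pu pv])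
    note [measurable] = env_measurable[OF u] env_measurable[OF v] env_measurable[OF pu] env_measurable[OF pv] env_measurable[OF pd] env_measurable[OF pe]
    have s0: "0 \<le> s" using s by simp
    have fM: "ennreal M < \<infinity>" "ennreal L < \<infinity>" by auto
    have fu: "nrm s (env T u) < \<infinity>" "nrm s (env T v) < \<infinity>" using uM vM by (auto intro: order.strict_trans1)
    have fc: "nrm s (env T (\<lambda>t. cpow k (u t))) < \<infinity>" "nrm s (env T (\<lambda>t. cpow k (v t))) < \<infinity>"
      using Lu Lv by (auto intro: order.strict_trans1)
    have fu0: "nrm 0 (env T u) < \<infinity>" "nrm 0 (env T v) < \<infinity>"
      "nrm 0 (env T (\<lambda>t. cpow k (u t))) < \<infinity>" "nrm 0 (env T (\<lambda>t. cpow k (v t))) < \<infinity>"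
      using fu fc nrm_0_finite[OF s0] by auto
    have L'nn: "0 \<le> c * (K * M * L)" "0 \<le> c * (2 * K * L + 2 * K * M * L)" "0 \<le> c * (2 * L + 2 * M * L)"
      using c K(1) L(1) M by auto
    have cc: "(ennreal cF)\<^sup>2 = ennreal c" by (simp add: ennreal_power c_def less_imp_le)
    have pc: "path T (\<lambda>t. cpow (Suc k) (u t))"
      unfolding cpow.simps using path_conv[OF u pu fu0(1,3)] by (rule path_mult[rotated]) simp
    then show "path T (\<lambda>t. cpow (Suc k) (u t))" .
    have "nrm s (env T (\<lambda>t. cpow (Suc k) (u t))) \<le> nrm s (\<lambda>\<z>. ennreal cF * econv (env T u) (env T (\<lambda>t. cpow k (u t))) \<z>)"
      unfolding cpow.simps
    proof (rule nrm_mono)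
      fix \<z>
      have "env T (\<lambda>t \<z>. complex_of_real cF * conv (u t) (cpow k (u t)) \<z>) \<z> \<le> ennreal (cmod (complex_of_real cF)) * env T (\<lambda>t. conv (u t) (cpow k (u t))) \<z>"
        by (rule env_mult_le)
      also have "\<dots> \<le> ennreal cF * econv (env T u) (env T (\<lambda>t. cpow k (u t))) \<z>"
        by (intro mult_mono env_conv_le) (auto simp: less_imp_le)
      finally show "env T (\<lambda>t \<z>. complex_of_real cF * conv (u t) (cpow k (u t)) \<z>) \<z> \<le> ennreal cF * econv (env T u) (env T (\<lambda>t. cpow k (u t))) \<z>" .
    qed
    also have "\<dots> = ennreal c * nrm s (econv (env T u) (env T (\<lambda>t. cpow k (u t))))" by (subst nrm_cmult) (auto simp: cc)
    also have "\<dots> \<le> ennreal c * (ennreal K * nrm s (env T u) * nrm s (env T (\<lambda>t. cpow k (u t))))"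
      by (intro mult_left_mono K) auto
    also have "\<dots> \<le> ennreal c * (ennreal K * ennreal M * ennreal L)"
      using Lu uM by (intro mult_left_mono mult_mono) auto
    also have "\<dots> = ennreal (c * (K * M * L))" using c K(1) L(1) M by (simp add: ennreal_mult)
    also have "\<dots> \<le> ennreal L'" unfolding L'_def using L'nn by (intro ennreal_leI) linarith
    finally show "nrm s (env T (\<lambda>t. cpow (Suc k) (u t))) \<le> ennreal L'" .
    define B where "B \<z> = ennreal cF * (econv (env T d) (env T (\<lambda>t. cpow k (u t))) \<z> + econv (env T v) (env T e) \<z>)" for \<z>
    have diff: "env T (\<lambda>t \<z>. cpow (Suc k) (u t) \<z> - cpow (Suc k) (v t) \<z>) \<z> \<le> B \<z>" for \<z>
    proof (rule env_least)
      fix t assume t: "t \<in> {0..T}"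
      note [measurable] = path_measurable[OF u t] path_measurable[OF v t] path_measurable[OF pu t] path_measurable[OF pv t]
      have f: "nrm 0 (cabs (u t)) < \<infinity>" "nrm 0 (cabs (v t)) < \<infinity>" "nrm 0 (cabs (cpow k (u t))) < \<infinity>" "nrm 0 (cabs (cpow k (v t))) < \<infinity>"
        using order.strict_trans1[OF nrm_cabs_le_env[OF t, of 0 u] fu0(1)]
          order.strict_trans1[OF nrm_cabs_le_env[OF t, of 0 v] fu0(2)]
          order.strict_trans1[OF nrm_cabs_le_env[OF t, of 0 "\<lambda>t. cpow k (u t)"] fu0(3)]
          order.strict_trans1[OF nrm_cabs_le_env[OF t, of 0 "\<lambda>t. cpow k (v t)"] fu0(4)] by auto
      \<comment> \<open>Telescoping: u U - v V = (u - v) U + v (U - V), with convolutions as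
        products and \<open>U\<close>, \<open>V\<close> the lower powers.\<close>
      have "conv (u t) (cpow k (u t)) \<z> - conv (v t) (cpow k (v t)) \<z> = conv (d t) (cpow k (u t)) \<z> + conv (v t) (e t) \<z>"
        unfolding d_def e_def using f by (subst conv_diff_left conv_diff_right; simp)+
      then have "cpow (Suc k) (u t) \<z> - cpow (Suc k) (v t) \<z> = complex_of_real cF * (conv (d t) (cpow k (u t)) \<z> + conv (v t) (e t) \<z>)"
        by (simp add: right_diff_distrib[symmetric])
      then have "ennreal (cmod (cpow (Suc k) (u t) \<z> - cpow (Suc k) (v t) \<z>)) \<le> ennreal (cF * (cmod (conv (d t) (cpow k (u t)) \<z>) + cmod (conv (v t) (e t) \<z>)))"
        by (intro ennreal_leI) (simp add: norm_mult less_imp_le mult_left_mono norm_triangle_ineq)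
      also have "\<dots> = ennreal cF * (cabs (conv (d t) (cpow k (u t))) \<z> + cabs (conv (v t) (e t)) \<z>)"
        by (simp add: ennreal_mult less_imp_le)
      also have "\<dots> \<le> B \<z>" unfolding B_def
        using env_conv_le[of T d "\<lambda>t. cpow k (u t)" \<z>] env_conv_le[of T v e \<z>]
          env_upper[OF t, of "\<lambda>t. conv (d t) (cpow k (u t))" \<z>] env_upper[OF t, of "\<lambda>t. conv (v t) (e t)" \<z>]
        by (intro mult_left_mono add_mono) auto
      finally show "ennreal (cmod (cpow (Suc k) (u t) \<z> - cpow (Suc k) (v t) \<z>)) \<le> B \<z>" .
    qed
    have eL: "nrm s (env T e) \<le> ennreal L * nrm s (env T d)" using Lu unfolding e_def d_def by blast
    have "nrm s (env T (\<lambda>t \<z>. cpow (Suc k) (u t) \<z> - cpow (Suc k) (v t) \<z>)) \<le> nrm s B" by (intro nrm_mono diff)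
    also have "\<dots> = ennreal c * nrm s (\<lambda>\<z>. econv (env T d) (env T (\<lambda>t. cpow k (u t))) \<z> + econv (env T v) (env T e) \<z>)"
      unfolding B_def by (subst nrm_cmult) (auto simp: cc)
    also have "\<dots> \<le> ennreal c * (2 * nrm s (econv (env T d) (env T (\<lambda>t. cpow k (u t)))) + 2 * nrm s (econv (env T v) (env T e)))"
      by (intro mult_left_mono nrm_add) auto
    also have "\<dots> \<le> ennreal c * (2 * (ennreal K * nrm s (env T d) * ennreal L) + 2 * (ennreal K * ennreal M * (ennreal L * nrm s (env T d))))"
    proof (intro mult_left_mono add_mono)
      show "nrm s (econv (env T d) (env T (\<lambda>t. cpow k (u t)))) \<le> ennreal K * nrm s (env T d) * ennreal L"
        using Lu by (intro order_trans[OF K(2)] mult_left_mono) auto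
      show "nrm s (econv (env T v) (env T e)) \<le> ennreal K * ennreal M * (ennreal L * nrm s (env T d))"
        using vM eL by (intro order_trans[OF K(2)] mult_mono) auto
    qed auto
    also have "\<dots> = ennreal (c * (2 * K * L + 2 * K * M * L)) * nrm s (env T d)"
      using c K(1) L(1) M by (simp add: ennreal_mult distrib_left distrib_right ac_simps)
    also have "\<dots> \<le> ennreal L' * nrm s (env T d)"
      unfolding L'_def using L'nn by (intro mult_right_mono ennreal_leI) (linarith, simp)
    finally show "nrm s (env T (\<lambda>t \<z>. cpow (Suc k) (u t) \<z> - cpow (Suc k) (v t) \<z>)) \<le> ennreal L' * nrm s (env T (\<lambda>t \<z>. u t \<z> - v t \<z>))"
      unfolding d_eq .
    fix \<z>
    have "(env T (\<lambda>t \<z>. cpow (Suc k) (u t) \<z> - cpow (Suc k) (v t) \<z>) \<z>)\<^sup>2 \<le> (B \<z>)\<^sup>2"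
      by (intro ennreal_square_mono diff)
    also have "\<dots> = ennreal c * (econv (env T d) (env T (\<lambda>t. cpow k (u t))) \<z> + econv (env T v) (env T e) \<z>)\<^sup>2"
      unfolding B_def by (simp add: power_mult_distrib cc)
    also have "\<dots> \<le> ennreal c * (2 * (econv (env T d) (env T (\<lambda>t. cpow k (u t))) \<z>)\<^sup>2 + 2 * (econv (env T v) (env T e) \<z>)\<^sup>2)"
      by (intro mult_left_mono ennreal_add_square_le) auto
    also have "\<dots> \<le> ennreal c * (2 * (nrm s (env T d) * ennreal L) + 2 * (ennreal M * (ennreal L * nrm s (env T d))))"
    proof (intro mult_left_mono add_mono)
      have "(econv (env T d) (env T (\<lambda>t. cpow k (u t))) \<z>)\<^sup>2 \<le> nrm 0 (env T d) * nrm 0 (env T (\<lambda>t. cpow k (u t)))"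
        by (rule econv_sup) measurable
      also have "\<dots> \<le> nrm s (env T d) * ennreal L"
        using Lu nrm_mono_weight[OF s0] by (intro mult_mono) (auto intro: order_trans)
      finally show "(econv (env T d) (env T (\<lambda>t. cpow k (u t))) \<z>)\<^sup>2 \<le> nrm s (env T d) * ennreal L" .
      have "(econv (env T v) (env T e) \<z>)\<^sup>2 \<le> nrm 0 (env T v) * nrm 0 (env T e)"
        by (rule econv_sup) measurable
      also have "\<dots> \<le> ennreal M * (ennreal L * nrm s (env T d))"
        using vM eL nrm_mono_weight[OF s0] by (intro mult_mono) (auto intro: order_trans)
      finally show "(econv (env T v) (env T e) \<z>)\<^sup>2 \<le> ennreal M * (ennreal L * nrm s (env T d))" .
    qed auto
    also have "\<dots> = ennreal (c * (2 * L + 2 * M * L)) * nrm s (env T d)"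
      using c L(1) M by (simp add: ennreal_mult distrib_left distrib_right ac_simps)
    also have "\<dots> \<le> ennreal L' * nrm s (env T d)"
      unfolding L'_def using L'nn by (intro mult_right_mono ennreal_leI) (linarith, simp)
    finally show "(env T (\<lambda>t \<z>. cpow (Suc k) (u t) \<z> - cpow (Suc k) (v t) \<z>) \<z>)\<^sup>2 \<le> ennreal L' * nrm s (env T (\<lambda>t \<z>. u t \<z> - v t \<z>))"
      unfolding d_eq .
  qed
qed

lemma sob_weight_absorb_snd: "sob_weight (r/2) \<z> * \<bar>snd \<z>\<bar> \<le> sob_weight ((r + 1)/2) \<z>"
proof -
  have "(snd \<z>)\<^sup>2 \<le> 1 + (fst \<z>)\<^sup>2 + (snd \<z>)\<^sup>2" by (smt (verit) zero_le_power2)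
  then have "sqrt ((snd \<z>)\<^sup>2) \<le> sqrt (1 + (fst \<z>)\<^sup>2 + (snd \<z>)\<^sup>2)" by (rule real_sqrt_le_mono)
  moreover have "sqrt (1 + (fst \<z>)\<^sup>2 + (snd \<z>)\<^sup>2) = sob_weight (1/2) \<z>"
    unfolding sob_weight_def using sob_weight_base_ge_1[of "fst \<z>" "snd \<z>"] by (intro powr_half_sqrt[symmetric]) linarith
  ultimately have "\<bar>snd \<z>\<bar> \<le> sob_weight (1/2) \<z>" by simp
  then have "sob_weight (r/2) \<z> * \<bar>snd \<z>\<bar> \<le> sob_weight (r/2) \<z> * sob_weight (1/2) \<z>" by (intro mult_left_mono) auto
  then show ?thesis by (simp add: sob_weight_add[symmetric] add_divide_distrib)
qed

text \<open>The coefficient enters through a transform \<open>ah\<close>. Its Hermitian symmetry is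
  assumed separately where real solutions are constructed.\<close>

locale bbm_kp =
  fixes s \<gamma> :: real and p :: nat and ah :: "plane \<Rightarrow> complex"
  assumes s: "3/2 < s" and \<gamma>: "\<gamma> = 1 \<or> \<gamma> = -1" and p: "1 \<le> p"
    and ah_meas [measurable]: "Borel ah"
    and ah_fin: "nrm s (cabs ah) < \<infinity>"
begin

abbreviation "aE \<equiv> \<lambda>B. econv (cabs ah) B"

lemma sob_weight_box:
  assumes "\<bar>fst \<z>\<bar> \<le> 1 \<and> \<bar>snd \<z>\<bar> \<le> 1"
  shows "sob_weight r \<z> \<le> 3 powr \<bar>r\<bar>"
proof -
  have b: "1 \<le> 1 + (fst \<z>)\<^sup>2 + (snd \<z>)\<^sup>2" by (rule sob_weight_base_ge_1)
  have "(fst \<z>)\<^sup>2 \<le> 1" "(snd \<z>)\<^sup>2 \<le> 1"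
    using assms power_mono[of "\<bar>fst \<z>\<bar>" 1 2] power_mono[of "\<bar>snd \<z>\<bar>" 1 2] by auto
  then have b2: "1 + (fst \<z>)\<^sup>2 + (snd \<z>)\<^sup>2 \<le> 3" by linarith
  have "sob_weight r \<z> \<le> (1 + (fst \<z>)\<^sup>2 + (snd \<z>)\<^sup>2) powr \<bar>r\<bar>"
    unfolding sob_weight_def using b by (intro powr_mono) auto
  also have "\<dots> \<le> 3 powr \<bar>r\<bar>" using b b2 by (intro powr_mono2) auto
  finally show ?thesis .
qed

text \<open>The last bound controls a product at a single frequency by the weak norm of order s - 2.
  It is confined to the unit box, where all weights are comparable to 1, and this is the region of
  the corner singularity.\<close>

lemma aE_bounds:
  obtains K :: real where "1 \<le> K"
    "\<And>B. Borel B \<Longrightarrow> nrm s (aE B) \<le> ennreal K * nrm s B"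
    "\<And>B. Borel B \<Longrightarrow> nrm (s - 2) (aE B) \<le> ennreal K * nrm (s - 2) B"
    "\<And>B \<z>. Borel B \<Longrightarrow> (aE B \<z>)\<^sup>2 \<le> ennreal K * nrm s B"
    "\<And>B \<z>. Borel B \<Longrightarrow> \<bar>fst \<z>\<bar> \<le> 1 \<and> \<bar>snd \<z>\<bar> \<le> 1 \<Longrightarrow> (aE B \<z>)\<^sup>2 \<le> ennreal K * nrm (s - 2) B"
proof -
  obtain N where N: "nrm s (cabs ah) = ennreal N" "0 \<le> N" using ah_fin by (cases "nrm s (cabs ah)") auto
  have s0: "0 \<le> s" "1 < s" using s by auto
  obtain K1 where K1: "0 < K1" "\<And>A B. Borel A \<Longrightarrow> Borel B \<Longrightarrow>
      nrm s (econv A B) \<le> ennreal K1 * nrm s A * nrm s B" using econv_algebra_ex[OF s0(2)] by blast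
  \<comment> \<open>This is the place where s > 3/2 is used in full: for s < 2 it reads 1 < 2 s -
    2.\<close>
  have "1 < s - \<bar>s - 2\<bar>" using s by (auto simp: abs_if)
  then obtain K2 where K2: "0 < K2" "\<And>A. Borel A \<Longrightarrow>
      (\<integral>\<^sup>+z. ennreal (sob_weight (\<bar>s - 2\<bar>/2) z) * A z \<partial>lborel)\<^sup>2 \<le> ennreal K2 * nrm s A"
    using L1_bound_ex by blast
  let ?r = "s - 2"
  define a where "a = 4 powr \<bar>?r\<bar>"
  define b where "b = 3 powr \<bar>?r\<bar>"
  have ab: "0 < a" "0 < b" by (auto simp: a_def b_def)
  define K where "K = 1 + K1 * N + a * K2 * N + N + b * a * N"
  have nn: "0 \<le> K1 * N" "0 \<le> a * K2 * N" "0 \<le> b * a * N" using K1 K2 N ab by auto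
  show ?thesis
  proof (rule that[of K])
    show "1 \<le> K" using nn N by (simp add: K_def)
    fix B :: "plane \<Rightarrow> ennreal" assume [measurable]: "Borel B"
    have "nrm s (aE B) \<le> ennreal K1 * nrm s (cabs ah) * nrm s B" by (intro K1) auto
    also have "\<dots> = ennreal (K1 * N) * nrm s B" using K1 N by (simp add: ennreal_mult)
    also have "\<dots> \<le> ennreal K * nrm s B" unfolding K_def using nn N by (intro mult_right_mono ennreal_leI) (linarith, simp)
    finally show "nrm s (aE B) \<le> ennreal K * nrm s B" .
    have "nrm ?r (aE B) \<le> ennreal a * (\<integral>\<^sup>+z. ennreal (sob_weight (\<bar>?r\<bar>/2) z) * cabs ah z \<partial>lborel)\<^sup>2 * nrm ?r B"
      unfolding a_def by (rule econv_product_nrm) auto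
    also have "\<dots> \<le> ennreal a * (ennreal K2 * nrm s (cabs ah)) * nrm ?r B" by (intro mult_right_mono mult_left_mono K2) auto
    also have "\<dots> = ennreal (a * K2 * N) * nrm ?r B" using K2 N ab by (simp add: ennreal_mult mult.assoc)
    also have "\<dots> \<le> ennreal K * nrm ?r B" unfolding K_def using nn N by (intro mult_right_mono ennreal_leI) (linarith, simp)
    finally show "nrm ?r (aE B) \<le> ennreal K * nrm ?r B" .
    fix \<z>
    have "(aE B \<z>)\<^sup>2 \<le> nrm 0 (cabs ah) * nrm 0 B" by (rule econv_sup) auto
    also have "\<dots> \<le> nrm s (cabs ah) * nrm s B" using s0 by (intro mult_mono nrm_mono_weight) auto
    also have "\<dots> \<le> ennreal K * nrm s B" unfolding N K_def using nn N by (intro mult_right_mono ennreal_leI) (linarith, simp)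
    finally show "(aE B \<z>)\<^sup>2 \<le> ennreal K * nrm s B" .
    assume box: "\<bar>fst \<z>\<bar> \<le> 1 \<and> \<bar>snd \<z>\<bar> \<le> 1"
    \<comment> \<open>On the unit box the base of the weights lies between 1 and 3, so the weight of
      order s - 2 can be inserted at the cost of a constant.\<close>
    have one: "1 \<le> 3 powr \<bar>?r\<bar> * (sob_weight (?r/2) \<z>)\<^sup>2"
    proof -
      have "sob_weight (-?r) \<z> * sob_weight ?r \<z> \<le> 3 powr \<bar>?r\<bar> * sob_weight ?r \<z>"
        using sob_weight_box[OF box, of "-?r"] by (intro mult_right_mono) (auto simp: abs_minus_commute)
      then show ?thesis by (simp add: sob_weight_add[symmetric] sob_weight_half_square)
    qed
    have "(aE B \<z>)\<^sup>2 = 1 * (aE B \<z>)\<^sup>2" by simp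
    also have "\<dots> \<le> ennreal (b * (sob_weight (?r/2) \<z>)\<^sup>2) * (aE B \<z>)\<^sup>2"
      using one by (intro mult_right_mono) (auto simp: b_def ennreal_1[symmetric] simp del: ennreal_1 intro!: ennreal_leI)
    also have "\<dots> = ennreal b * (ennreal (sob_weight (?r/2) \<z>) * aE B \<z>)\<^sup>2"
      using ab by (simp add: ennreal_mult power_mult_distrib ennreal_power mult.assoc)
    also have "\<dots> \<le> ennreal b * (ennreal (4 powr \<bar>?r\<bar>) * nrm \<bar>?r\<bar> (cabs ah) * nrm ?r B)"
      by (intro mult_left_mono econv_product_sup) auto
    also have "\<dots> \<le> ennreal b * (ennreal a * ennreal N * nrm ?r B)"
      unfolding N(1)[symmetric] a_def using s by (intro mult_left_mono mult_right_mono nrm_mono_weight) (auto simp: abs_if)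
    also have "\<dots> = ennreal (b * a * N) * nrm ?r B" using ab N by (simp add: ennreal_mult mult.assoc)
    also have "\<dots> \<le> ennreal K * nrm ?r B" unfolding K_def using nn N by (intro mult_right_mono ennreal_leI) (linarith, simp)
    finally show "(aE B \<z>)\<^sup>2 \<le> ennreal K * nrm ?r B" .
  qed
qed

lemma aE_finite:
  assumes [measurable]: "Borel B" and fin: "nrm (s - 2) B < \<infinity>"
  shows "aE B \<z> < \<infinity>"
proof -
  have "(ennreal (sob_weight ((s-2)/2) \<z>) * aE B \<z>)\<^sup>2 \<le> ennreal (4 powr \<bar>s-2\<bar>) * nrm \<bar>s-2\<bar> (cabs ah) * nrm (s-2) B"
    by (rule econv_product_sup) auto
  also have "\<dots> \<le> ennreal (4 powr \<bar>s-2\<bar>) * nrm s (cabs ah) * nrm (s-2) B"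
    using s by (intro mult_left_mono mult_right_mono nrm_mono_weight) (auto simp: abs_if)
  also have "\<dots> < \<infinity>" using fin ah_fin by (simp add: ennreal_mult_less_top)
  finally have "ennreal (sob_weight ((s-2)/2) \<z>) * aE B \<z> < \<infinity>" by (simp add: power_less_top_ennreal)
  then show ?thesis using sob_weight_pos[of "(s-2)/2" \<z>] by (auto simp: ennreal_mult_less_top)
qed

lemma nrm_s2_le: "nrm (s - 2) B \<le> nrm s B"
  by (intro nrm_mono_weight) auto

lemma aE_finite_s:
  assumes "Borel B" "nrm s B < \<infinity>"
  shows "aE B \<z> < \<infinity>"
  using aE_finite[OF assms(1) order.strict_trans1[OF nrm_s2_le assms(2)]] .

definition forcing :: "(plane \<Rightarrow> complex) \<Rightarrow> (plane \<Rightarrow> complex) \<Rightarrow> plane \<Rightarrow> complex" where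
  "forcing P E \<z> = - \<i> * complex_of_real (mN p \<z>) * P \<z> - complex_of_real (mA \<z>) * (complex_of_real cF * conv ah E \<z>)"

text \<open>\<open>P\<close> is the transform of the nonlinear term and \<open>E\<close> the function multiplied by \<open>a\<close>. They are kept
  independent of \<open>D\<close>, so that Picard iterates and differences of solutions are covered too.\<close>

definition linsys0 where
  "linsys0 T D D' P E \<longleftrightarrow> dpath T D D' \<and> path T P \<and> path T E \<and> nrm s (env T P) < \<infinity> \<and> nrm s (env T E) < \<infinity> \<and>
    (\<forall>t\<in>{0..T}. \<forall>\<z>. D' t \<z> = - \<i> * complex_of_real (phi \<gamma> \<z>) * D t \<z> + forcing (P t) (E t) \<z>)"

text \<open>What integration by parts needs in addition: the function multiplied by \<open>a\<close>
  is differentiable in time, with derivative of order s - 2 only.\<close>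

definition linsys where
  "linsys T D D' P E E' \<longleftrightarrow> linsys0 T D D' P E \<and> dpath T E E' \<and> nrm (s - 2) (env T E') < \<infinity>"

section \<open>A priori estimates for the linear problem\<close>

lemma conv_ah_bound:
  assumes E: "path T E" and t: "t \<in> {0..T}"
  shows "ennreal (cmod (conv ah (E t) \<z>)) \<le> aE (env T E) \<z>"
proof -
  have "cabs (conv ah (E t)) \<z> \<le> aE (cabs (E t)) \<z>" by (rule cabs_conv_le)
  also have "\<dots> \<le> aE (env T E) \<z>" using t by (intro econv_mono env_upper) auto
  finally show ?thesis .
qed

lemma forcing_bound:
  assumes E: "path T E" and t: "t \<in> {0..T}"
  shows "ennreal (cmod (forcing (P t) (E t) \<z>)) \<le> ennreal \<bar>mN p \<z>\<bar> * env T P \<z> + ennreal (mA \<z>) * (ennreal cF * aE (env T E) \<z>)"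
proof -
  have "cmod (forcing (P t) (E t) \<z>) \<le> \<bar>mN p \<z>\<bar> * cmod (P t \<z>) + mA \<z> * (cF * cmod (conv ah (E t) \<z>))"
    unfolding forcing_def by (rule order_trans[OF norm_triangle_ineq4]) (simp add: norm_mult abs_of_nonneg less_imp_le mA_bounds)
  then have "ennreal (cmod (forcing (P t) (E t) \<z>)) \<le> ennreal (\<bar>mN p \<z>\<bar> * cmod (P t \<z>) + mA \<z> * (cF * cmod (conv ah (E t) \<z>)))"
    by (rule ennreal_leI)
  also have "\<dots> = ennreal \<bar>mN p \<z>\<bar> * ennreal (cmod (P t \<z>)) + ennreal (mA \<z>) * (ennreal cF * ennreal (cmod (conv ah (E t) \<z>)))"
    using mA_bounds[of \<z>] by (simp add: ennreal_mult less_imp_le)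
  also have "\<dots> \<le> ennreal \<bar>mN p \<z>\<bar> * env T P \<z> + ennreal (mA \<z>) * (ennreal cF * aE (env T E) \<z>)"
    using t E by (intro add_mono mult_left_mono env_upper conv_ah_bound) auto
  finally show ?thesis .
qed

lemma linear_pointwise:
  assumes T: "0 < T" and L: "linsys0 T D D' P E"
  shows "env T D \<z> \<le> cabs (D 0) \<z> + ennreal T * (ennreal \<bar>mN p \<z>\<bar> * env T P \<z> + ennreal (mA \<z>) * (ennreal cF * aE (env T E) \<z>))"
proof -
  define M where "M = ennreal \<bar>mN p \<z>\<bar> * env T P \<z> + ennreal (mA \<z>) * (ennreal cF * aE (env T E) \<z>)"
  have E: "path T E" and D: "dpath T D D'" using L by (auto simp: linsys0_def)
  show ?thesis
  proof (cases M)
    case (real m)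
    have "cmod (D t \<z>) \<le> cmod (D 0 \<z>) + T * m" if t: "t \<in> {0..T}" for t
    proof (rule dispersive_ode_bound[where c="phi \<gamma> \<z>" and g="\<lambda>t. forcing (P t) (E t) \<z>", OF _ _ t])
      fix \<tau> assume \<tau>: "\<tau> \<in> {0..T}"
      show "((\<lambda>t. D t \<z>) has_vector_derivative - \<i> * complex_of_real (phi \<gamma> \<z>) * D \<tau> \<z> + forcing (P \<tau>) (E \<tau>) \<z>) (at \<tau> within {0..T})"
        using dpath_deriv[OF D \<tau>, of \<z>] L \<tau> unfolding linsys0_def by metis
      show "cmod (forcing (P \<tau>) (E \<tau>) \<z>) \<le> m"
        using forcing_bound[OF E \<tau>, of P \<z>] real unfolding M_def[symmetric] by simp
    qed
    then have "env T D \<z> \<le> ennreal (cmod (D 0 \<z>) + T * m)" by (intro env_least ennreal_leI)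
    also have "\<dots> = cabs (D 0) \<z> + ennreal T * M" using T real by (simp add: ennreal_mult)
    finally show ?thesis unfolding M_def .
  next
    case top
    then show ?thesis using T unfolding M_def[symmetric] by (simp add: ennreal_mult_top)
  qed
qed

lemma linear_pointwise_simple:
  assumes T: "0 < T" and L: "linsys0 T D D' P E"
  shows "env T D \<z> \<le> cabs (D 0) \<z> + ennreal T * (env T P \<z> + ennreal cF * aE (env T E) \<z>)"
proof -
  have "ennreal \<bar>mN p \<z>\<bar> * env T P \<z> \<le> 1 * env T P \<z>"
    using mN_bound[of p \<z>] by (intro mult_right_mono) (auto simp: ennreal_1[symmetric] simp del: ennreal_1 intro!: ennreal_leI)
  moreover have "ennreal (mA \<z>) * (ennreal cF * aE (env T E) \<z>) \<le> 1 * (ennreal cF * aE (env T E) \<z>)"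
    using mA_bounds[of \<z>] by (intro mult_right_mono) (auto simp: ennreal_1[symmetric] simp del: ennreal_1 intro!: ennreal_leI)
  ultimately show ?thesis
    using linear_pointwise[OF T L, of \<z>] by (auto intro!: order_trans[OF linear_pointwise[OF T L, of \<z>]] add_mono mult_left_mono)
qed

lemma linsys0_measurable:
  assumes "linsys0 T D D' P E" "0 \<le> T"
  shows "Borel (env T D)" "Borel (env T D')" "Borel (env T P)"
    "Borel (env T E)" "Borel (D 0)"
  using assms unfolding linsys0_def by (auto intro: env_measurable dpath_path path_measurable)

text \<open>Both multipliers of the forcing are at most 1, so order s is preserved, and time
  integration contributes T, squared here. The second estimate, for zero initial data, transfers
  smallness of the input to each frequency of the output.\<close>

lemma linear_Hs_estimate:
  "\<exists>K\<ge>1. \<forall>T D D' P E. 0 < T \<longrightarrow> linsys0 T D D' P E \<longrightarrow>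
    nrm s (env T D) \<le> 2 * nrm s (cabs (D 0)) + ennreal (K * T\<^sup>2) * (nrm s (env T P) + nrm s (env T E)) \<and>
    ((\<forall>\<z>. D 0 \<z> = 0) \<longrightarrow> (\<forall>\<z>. (env T D \<z>)\<^sup>2 \<le> ennreal (K * T\<^sup>2) * ((env T P \<z>)\<^sup>2 + nrm s (env T E))))"
proof -
  obtain K where K: "1 \<le> K" "\<And>B. Borel B \<Longrightarrow> nrm s (aE B) \<le> ennreal K * nrm s B"
    "\<And>B \<z>. Borel B \<Longrightarrow> (aE B \<z>)\<^sup>2 \<le> ennreal K * nrm s B"
    using aE_bounds by metis
  define c where "c = cF\<^sup>2"
  have c: "0 \<le> c" by (simp add: c_def)
  have cc: "(ennreal cF)\<^sup>2 = ennreal c" by (simp add: ennreal_power c_def less_imp_le)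
  define K' where "K' = 4 + 4 * (c * K)"
  have K': "4 \<le> K'" "4 * (c * K) \<le> K'" "0 \<le> c * K" using c K by (auto simp: K'_def)
  show ?thesis
  proof (intro exI[of _ K'] conjI allI impI)
    show "1 \<le> K'" using K' by linarith
    fix T D D' P E assume T: "0 < T" and L: "linsys0 T D D' P E"
    note [measurable] = linsys0_measurable[OF L less_imp_le[OF T]]
    have TT: "(ennreal T)\<^sup>2 = ennreal (T\<^sup>2)" using T by (simp add: ennreal_power)
    have sum: "2 * (2 * x + 2 * (ennreal c * (ennreal K * y))) \<le> ennreal K' * (x + y)" for x y :: ennreal
    proof -
      have "2 * (2 * x + 2 * (ennreal c * (ennreal K * y))) = ennreal 4 * x + ennreal (4 * (c * K)) * y"
        using c K by (simp add: ennreal_mult distrib_left mult.assoc[symmetric])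
      also have "\<dots> \<le> ennreal K' * x + ennreal K' * y" using K' by (intro add_mono mult_right_mono ennreal_leI) auto
      finally show ?thesis by (simp add: distrib_left)
    qed
    have "nrm s (env T D) \<le> nrm s (\<lambda>\<z>. cabs (D 0) \<z> + ennreal T * (env T P \<z> + ennreal cF * aE (env T E) \<z>))"
      by (intro nrm_mono linear_pointwise_simple[OF T L])
    also have "\<dots> \<le> 2 * nrm s (cabs (D 0)) + 2 * nrm s (\<lambda>\<z>. ennreal T * (env T P \<z> + ennreal cF * aE (env T E) \<z>))"
      by (rule nrm_add) auto
    also have "nrm s (\<lambda>\<z>. ennreal T * (env T P \<z> + ennreal cF * aE (env T E) \<z>)) = ennreal (T\<^sup>2) * nrm s (\<lambda>\<z>. env T P \<z> + ennreal cF * aE (env T E) \<z>)"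
      by (subst nrm_cmult) (auto simp: TT)
    also have "nrm s (\<lambda>\<z>. env T P \<z> + ennreal cF * aE (env T E) \<z>) \<le> 2 * nrm s (env T P) + 2 * nrm s (\<lambda>\<z>. ennreal cF * aE (env T E) \<z>)"
      by (rule nrm_add) auto
    also have "nrm s (\<lambda>\<z>. ennreal cF * aE (env T E) \<z>) = ennreal c * nrm s (aE (env T E))"
      by (subst nrm_cmult) (auto simp: cc)
    also have "nrm s (aE (env T E)) \<le> ennreal K * nrm s (env T E)" by (intro K) auto
    finally have "nrm s (env T D) \<le> 2 * nrm s (cabs (D 0)) + ennreal (T\<^sup>2) * (2 * (2 * nrm s (env T P) + 2 * (ennreal c * (ennreal K * nrm s (env T E)))))"
      by (simp only: mult.left_commute[of "ennreal (T\<^sup>2)" 2]) (auto simp: mult_left_mono add_left_mono)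
    also have "\<dots> \<le> 2 * nrm s (cabs (D 0)) + ennreal (T\<^sup>2) * (ennreal K' * (nrm s (env T P) + nrm s (env T E)))"
      by (intro add_left_mono mult_left_mono sum) auto
    finally show "nrm s (env T D) \<le> 2 * nrm s (cabs (D 0)) + ennreal (K' * T\<^sup>2) * (nrm s (env T P) + nrm s (env T E))"
      using K' by (simp add: ennreal_mult ac_simps)
    assume D0: "\<forall>\<z>. D 0 \<z> = 0"
    fix \<z>
    have "(env T D \<z>)\<^sup>2 \<le> (ennreal T * (env T P \<z> + ennreal cF * aE (env T E) \<z>))\<^sup>2"
      using linear_pointwise_simple[OF T L, of \<z>] D0 by (intro ennreal_square_mono) simp
    also have "\<dots> = ennreal (T\<^sup>2) * (env T P \<z> + ennreal cF * aE (env T E) \<z>)\<^sup>2" by (simp add: power_mult_distrib TT)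
    also have "\<dots> \<le> ennreal (T\<^sup>2) * (2 * (env T P \<z>)\<^sup>2 + 2 * (ennreal cF * aE (env T E) \<z>)\<^sup>2)"
      by (intro mult_left_mono ennreal_add_square_le) auto
    also have "\<dots> \<le> ennreal (T\<^sup>2) * (2 * (env T P \<z>)\<^sup>2 + 2 * (ennreal c * (ennreal K * nrm s (env T E))))"
      unfolding power_mult_distrib cc by (intro mult_left_mono add_left_mono K) auto
    also have "\<dots> \<le> ennreal (T\<^sup>2) * (ennreal K' * ((env T P \<z>)\<^sup>2 + nrm s (env T E)))"
    proof (intro mult_left_mono order_trans[OF _ sum])
      show "2 * (env T P \<z>)\<^sup>2 + 2 * (ennreal c * (ennreal K * nrm s (env T E))) \<le> 2 * (2 * (env T P \<z>)\<^sup>2 + 2 * (ennreal c * (ennreal K * nrm s (env T E))))"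
      proof -
        have "x \<le> 2 * x" for x :: ennreal using add_increasing[of x x x] by (simp add: mult_2)
        then show ?thesis by (metis distrib_left add_mono order_trans)
      qed
    qed auto
    finally show "(env T D \<z>)\<^sup>2 \<le> ennreal (K' * T\<^sup>2) * ((env T P \<z>)\<^sup>2 + nrm s (env T E))"
      using K' by (simp add: ennreal_mult ac_simps)
  qed
qed

text \<open>The two ways of bounding the scalar equation, direct and integrated by parts, are
  combined by \<open>singular_weight_bound\<close>; five terms remain, each suited to a different
  norm.\<close>

lemma linear_X_pointwise:
  assumes T: "0 < T" "T \<le> 1" and L: "linsys T D D' P E E'"
  shows "Zw (env T D) \<z> \<le> Zw (cabs (D 0)) \<z> + ennreal \<bar>snd \<z>\<bar> * env T P \<z> + 2 * (ennreal cF * aE (env T E) \<z>)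
    + ennreal (3 * sob_weight (-1/2) \<z>) * (ennreal cF * (2 * aE (env T E) \<z> + ennreal T * aE (env T E') \<z>))
    + ennreal (2 * corner \<z>) * (ennreal cF * (2 * aE (env T E) \<z> + ennreal T * aE (env T E') \<z>))"
proof -
  have L0: "linsys0 T D D' P E" and dE: "dpath T E E'" and fE': "nrm (s - 2) (env T E') < \<infinity>" using L by (auto simp: linsys_def)
  have E: "path T E" and D: "dpath T D D'" and fE: "nrm s (env T E) < \<infinity>" using L0 by (auto simp: linsys0_def)
  have E': "path T E'" using dpath_path[OF dE] by auto
  have fa: "aE (env T E) \<z> < \<infinity>" by (intro aE_finite_s env_measurable E fE)
  have fb: "aE (env T E') \<z> < \<infinity>" by (intro aE_finite env_measurable E' fE')
  obtain a0 where a0: "aE (env T E) \<z> = ennreal a0" "0 \<le> a0" using fa by (cases "aE (env T E) \<z>") auto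
  obtain b0 where b0: "aE (env T E') \<z> = ennreal b0" "0 \<le> b0" using fb by (cases "aE (env T E') \<z>") auto
  define a b where "a = cF * a0" and "b = cF * b0"
  have ab: "0 \<le> a" "0 \<le> b" using a0 b0 by (auto simp: a_def b_def less_imp_le)
  show ?thesis
  proof (cases "env T P \<z>")
    case (real e)
    have "env T D \<z> \<le> ennreal (cmod (D 0 \<z>) + T * (\<bar>mN p \<z>\<bar> * e + mA \<z> * a))"
    proof -
      have "env T D \<z> \<le> cabs (D 0) \<z> + ennreal T * (ennreal \<bar>mN p \<z>\<bar> * env T P \<z> + ennreal (mA \<z>) * (ennreal cF * aE (env T E) \<z>))"
        by (rule linear_pointwise[OF T(1) L0])
      also have "\<dots> = ennreal (cmod (D 0 \<z>) + T * (\<bar>mN p \<z>\<bar> * e + mA \<z> * a))"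
        using T real a0 mA_bounds[of \<z>] by (simp add: ennreal_mult a_def less_imp_le)
      finally show ?thesis .
    qed
    then obtain d where d: "env T D \<z> = ennreal d" "0 \<le> d" "d \<le> cmod (D 0 \<z>) + T * (\<bar>mN p \<z>\<bar> * e + mA \<z> * a)"
    proof -
      assume le: "env T D \<z> \<le> ennreal (cmod (D 0 \<z>) + T * (\<bar>mN p \<z>\<bar> * e + mA \<z> * a))"
        and that: "\<And>d. env T D \<z> = ennreal d \<Longrightarrow> 0 \<le> d \<Longrightarrow> d \<le> cmod (D 0 \<z>) + T * (\<bar>mN p \<z>\<bar> * e + mA \<z> * a) \<Longrightarrow> thesis"
      have nn: "0 \<le> cmod (D 0 \<z>) + T * (\<bar>mN p \<z>\<bar> * e + mA \<z> * a)"
        using T real ab mA_bounds[of \<z>] by (intro add_nonneg_nonneg mult_nonneg_nonneg) auto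
      show thesis
      proof (cases "env T D \<z>")
        case (real r)
        then show thesis using le nn that[of r] by simp
      next
        case top
        then show thesis using le by (simp add: top_unique)
      qed
    qed
    define c where "c = phi \<gamma> \<z>"
    have d2: "\<bar>c\<bar> * d \<le> \<bar>c\<bar> * cmod (D 0 \<z>) + T * \<bar>c\<bar> * (\<bar>mN p \<z>\<bar> * e) + 2 * (mA \<z> * a) + T * (mA \<z> * b)" (is "_ \<le> ?R")
    proof -
      have R0: "0 \<le> ?R" using T real ab mA_bounds[of \<z>] by (intro add_nonneg_nonneg mult_nonneg_nonneg) auto
      \<comment> \<open>Only the product with \<open>a\<close> is treated as slowly varying. The
        nonlinear term stays in \<open>g\<close>, as its multiplier compensates the
        singularity.\<close>
      have pt: "\<bar>c\<bar> * cmod (D t \<z>) \<le> ?R" if t: "t \<in> {0..T}" for t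
      proof (rule dispersive_ode_bound_slow[where g="\<lambda>t. - \<i> * complex_of_real (mN p \<z>) * P t \<z>"
            and h="\<lambda>t. - (complex_of_real (mA \<z>) * (complex_of_real cF * conv ah (E t) \<z>))"
            and h'="\<lambda>t. - (complex_of_real (mA \<z>) * (complex_of_real cF * conv ah (E' t) \<z>))", OF _ _ _ _ _ t])
        fix \<tau> assume \<tau>: "\<tau> \<in> {0..T}"
        have "D' \<tau> \<z> = - \<i> * complex_of_real c * D \<tau> \<z> + forcing (P \<tau>) (E \<tau>) \<z>" using L0 \<tau> unfolding linsys0_def c_def by blast
        then show "((\<lambda>t. D t \<z>) has_vector_derivative - \<i> * complex_of_real c * D \<tau> \<z>
            + (- \<i> * complex_of_real (mN p \<z>) * P \<tau> \<z> + - (complex_of_real (mA \<z>) * (complex_of_real cF * conv ah (E \<tau>) \<z>)))) (at \<tau> within {0..T})"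
          using dpath_deriv[OF D \<tau>, of \<z>] unfolding forcing_def by simp
        have fin: "econv (cabs ah) (env T E') \<z> < \<infinity>" "econv (cabs ah) (env T E) \<z> < \<infinity>" using fa fb by auto
        show "((\<lambda>t. - (complex_of_real (mA \<z>) * (complex_of_real cF * conv ah (E t) \<z>))) has_vector_derivative
            - (complex_of_real (mA \<z>) * (complex_of_real cF * conv ah (E' \<tau>) \<z>))) (at \<tau> within {0..T})"
          by (intro has_vector_derivative_minus has_vector_derivative_mult_right conv_has_vector_derivative[OF ah_meas dE fin \<tau>])
        show "cmod (- \<i> * complex_of_real (mN p \<z>) * P \<tau> \<z>) \<le> \<bar>mN p \<z>\<bar> * e"
          using env_upper[OF \<tau>, of P \<z>] real by (simp add: norm_mult mult_left_mono)
        have "cmod (conv ah (E \<tau>) \<z>) \<le> a0" using conv_ah_bound[OF E \<tau>, of \<z>] a0 by simp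
        then show "cmod (- (complex_of_real (mA \<z>) * (complex_of_real cF * conv ah (E \<tau>) \<z>))) \<le> mA \<z> * a"
          using mA_bounds[of \<z>] by (simp add: norm_mult a_def mult_left_mono less_imp_le)
        have "cmod (conv ah (E' \<tau>) \<z>) \<le> b0" using conv_ah_bound[OF E' \<tau>, of \<z>] b0 by simp
        then show "cmod (- (complex_of_real (mA \<z>) * (complex_of_real cF * conv ah (E' \<tau>) \<z>))) \<le> mA \<z> * b"
          using mA_bounds[of \<z>] by (simp add: norm_mult b_def mult_left_mono less_imp_le)
      qed
      \<comment> \<open>A vanishing phase makes the left-hand side 0. Otherwise division by |c|
        carries the bound from each time to the supremum \<open>d\<close>.\<close>
      show ?thesis
      proof (cases "c = 0")
        case True
        then show ?thesis using R0 by simp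
      next
        case False
        have "env T D \<z> \<le> ennreal (?R / \<bar>c\<bar>)"
          using pt False by (intro env_least ennreal_leI) (simp add: le_divide_eq mult.commute)
        then have "d \<le> ?R / \<bar>c\<bar>" using d R0 by (simp add: divide_nonneg_nonneg)
        then show ?thesis using False by (simp add: le_divide_eq mult.commute)
      qed
    qed
    have main: "\<bar>snd \<z> / fst \<z>\<bar> * d \<le> \<bar>snd \<z> / fst \<z>\<bar> * cmod (D 0 \<z>) + T * (\<bar>snd \<z>\<bar> * e) + 2 * T * a
      + 3 * sob_weight (-1/2) (fst \<z>, snd \<z>) * (2 * a + T * b) + 2 * corner (fst \<z>, snd \<z>) * (2 * a + T * b)"
    proof (rule singular_weight_bound[OF \<gamma>, where P="real p + 1"])
      show "d \<le> cmod (D 0 \<z>) + T * (\<bar>fst \<z> / ((real p + 1) * (1 + (fst \<z>)\<^sup>2))\<bar> * e + 1 / (1 + (fst \<z>)\<^sup>2) * a)"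
        using d(3) by (simp add: mN_def mA_def)
      show "\<bar>((fst \<z>)\<^sup>2 + \<gamma> * (snd \<z>)\<^sup>2) / (fst \<z> * (1 + (fst \<z>)\<^sup>2))\<bar> * d
        \<le> \<bar>((fst \<z>)\<^sup>2 + \<gamma> * (snd \<z>)\<^sup>2) / (fst \<z> * (1 + (fst \<z>)\<^sup>2))\<bar> * cmod (D 0 \<z>)
          + T * \<bar>((fst \<z>)\<^sup>2 + \<gamma> * (snd \<z>)\<^sup>2) / (fst \<z> * (1 + (fst \<z>)\<^sup>2))\<bar> * (\<bar>fst \<z> / ((real p + 1) * (1 + (fst \<z>)\<^sup>2))\<bar> * e)
          + 2 * (1 / (1 + (fst \<z>)\<^sup>2) * a) + T * (1 / (1 + (fst \<z>)\<^sup>2) * b)"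
        using d2 by (simp only: c_def phi_def mN_def mA_def)
    qed (use T real ab in auto)
    have "T * (\<bar>snd \<z>\<bar> * e) \<le> 1 * (\<bar>snd \<z>\<bar> * e)" using T real by (intro mult_right_mono) auto
    moreover have "2 * T * a \<le> 2 * 1 * a" using T ab by (intro mult_right_mono mult_left_mono) auto
    ultimately have main2: "\<bar>snd \<z> / fst \<z>\<bar> * d \<le> \<bar>snd \<z> / fst \<z>\<bar> * cmod (D 0 \<z>) + \<bar>snd \<z>\<bar> * e + 2 * a
      + 3 * sob_weight (-1/2) \<z> * (2 * a + T * b) + 2 * corner \<z> * (2 * a + T * b)"
      using main by simp
    have ea: "ennreal cF * aE (env T E) \<z> = ennreal a" using a0 by (simp add: a_def ennreal_mult less_imp_le)
    have eab: "ennreal cF * (2 * aE (env T E) \<z> + ennreal T * aE (env T E') \<z>) = ennreal (2 * a + T * b)"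
      using a0 b0 T by (simp add: a_def b_def ennreal_mult less_imp_le distrib_left ac_simps)
    have "Zw (env T D) \<z> = ennreal (\<bar>snd \<z> / fst \<z>\<bar> * d)"
      unfolding Zw_def d(1) by (rule ennreal_mult[symmetric]) (use d in auto)
    also have "\<dots> \<le> ennreal (\<bar>snd \<z> / fst \<z>\<bar> * cmod (D 0 \<z>) + \<bar>snd \<z>\<bar> * e + 2 * a
      + 3 * sob_weight (-1/2) \<z> * (2 * a + T * b) + 2 * corner \<z> * (2 * a + T * b))" by (rule ennreal_leI[OF main2])
    also have "\<dots> = ennreal (\<bar>snd \<z> / fst \<z>\<bar> * cmod (D 0 \<z>)) + ennreal (\<bar>snd \<z>\<bar> * e) + ennreal (2 * a)
      + ennreal (3 * sob_weight (-1/2) \<z> * (2 * a + T * b)) + ennreal (2 * corner \<z> * (2 * a + T * b))"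
      using T real ab by simp
    also have "\<dots> = Zw (cabs (D 0)) \<z> + ennreal \<bar>snd \<z>\<bar> * env T P \<z> + 2 * (ennreal cF * aE (env T E) \<z>)
    + ennreal (3 * sob_weight (-1/2) \<z>) * (ennreal cF * (2 * aE (env T E) \<z> + ennreal T * aE (env T E') \<z>))
    + ennreal (2 * corner \<z>) * (ennreal cF * (2 * aE (env T E) \<z> + ennreal T * aE (env T E') \<z>))"
      unfolding ea eab Zw_def real using T real ab
      by (simp only: ennreal_mult abs_ge_zero norm_ge_zero sob_weight_nonneg corner_nonneg ennreal_numeral
        add_nonneg_nonneg mult_nonneg_nonneg zero_le_numeral less_imp_le)
    finally show ?thesis .
  next
    case top
    \<comment> \<open>If \<open>env T P\<close> is infinite at this frequency, so is the second term
      on the right, except for \<open>snd \<z> = 0\<close>, where the left-hand side is 0.\<close>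
    show ?thesis
    proof (cases "snd \<z> = 0")
      case True
      then have "Zw (env T D) \<z> = 0" by (simp add: Zw_def)
      then show ?thesis by simp
    next
      case False
      then have "ennreal \<bar>snd \<z>\<bar> * env T P \<z> = \<infinity>" using top by (simp add: ennreal_mult_top)
      then show ?thesis by simp
    qed
  qed
qed

end

lemma ennreal_le_mult_self:
  assumes "1 \<le> k" shows "x \<le> ennreal k * x"
proof -
  have "1 \<le> ennreal k" using ennreal_leI[OF assms] by simp
  from mult_right_mono[OF this, of x] show ?thesis by simp
qed

context bbm_kp begin

text \<open>The factor \<open>T\<^sup>2\<close> before the norm of \<open>E'\<close> is the point:
  in the application \<open>E'\<close> is a time derivative that is itself estimated by the
  left-hand side, and smallness of \<open>T\<close> breaks this circle.\<close>

lemma linear_X_estimate: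
  "\<exists>K\<ge>1. \<forall>T D D' P E E'. 0 < T \<longrightarrow> T \<le> 1 \<longrightarrow> linsys T D D' P E E' \<longrightarrow>
    xnrm s (env T D) \<le> ennreal K * (xnrm s (cabs (D 0)) + nrm s (env T P) + nrm s (env T E)) + ennreal (K * T\<^sup>2) * nrm (s - 2) (env T E')"
proof -
  obtain K where K: "1 \<le> K" "\<And>B. Borel B \<Longrightarrow> nrm s (aE B) \<le> ennreal K * nrm s B"
    "\<And>B. Borel B \<Longrightarrow> nrm (s - 2) (aE B) \<le> ennreal K * nrm (s - 2) B"
    "\<And>B \<z>. Borel B \<Longrightarrow> (aE B \<z>)\<^sup>2 \<le> ennreal K * nrm s B"
    "\<And>B \<z>. Borel B \<Longrightarrow> \<bar>fst \<z>\<bar> \<le> 1 \<and> \<bar>snd \<z>\<bar> \<le> 1 \<Longrightarrow> (aE B \<z>)\<^sup>2 \<le> ennreal K * nrm (s - 2) B"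
    using aE_bounds by metis
  obtain J where J: "(\<integral>\<^sup>+\<z>. ennreal ((corner \<z>)\<^sup>2) \<partial>lborel) = ennreal J" "0 \<le> J"
    using nn_integral_corner by (cases "\<integral>\<^sup>+\<z>. ennreal ((corner \<z>)\<^sup>2) \<partial>lborel") auto
  define c where "c = cF\<^sup>2"
  have c: "0 \<le> c" by (simp add: c_def)
  have cc: "(ennreal cF)\<^sup>2 = ennreal c" by (simp add: ennreal_power c_def less_imp_le)
  define b where "b = 3 powr \<bar>s - 1\<bar>"
  have b: "0 < b" by (simp add: b_def)
  define H where "H = c * K"
  have H: "0 \<le> H" using c K by (simp add: H_def)
  \<comment> \<open>16 comes from \<open>nrm_sum5\<close>, while 76 = 4 + 9 * 8 and 32 = 4 * 8
    collect the coefficients of \<open>nE\<close> in \<open>n3\<close>, \<open>n4\<close> and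
    \<open>n5\<close>. Those of \<open>nE'\<close> are smaller.\<close>
  define K' where "K' = 16 * (1 + 76 * H + 32 * b * J * H)"
  have K'1: "1 \<le> K'" using H b J by (simp add: K'_def add_increasing2)
  show ?thesis
  proof (intro exI[of _ K'] conjI allI impI K'1)
    fix T D D' P E E' assume T: "0 < T" "T \<le> 1" and L: "linsys T D D' P E E'"
    have L0: "linsys0 T D D' P E" and dE: "dpath T E E'" using L by (auto simp: linsys_def)
    note [measurable] = linsys0_measurable[OF L0 less_imp_le[OF T(1)]]
    have [measurable]: "Borel (env T E')" using dpath_path[OF dE] by auto
    have TT: "(ennreal T)\<^sup>2 = ennreal (T\<^sup>2)" using T by (simp add: ennreal_power)
    define nE nE' nP where "nE = nrm s (env T E)" and "nE' = nrm (s-2) (env T E')" and "nP = nrm s (env T P)"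
    define W where "W \<z> = ennreal cF * (2 * aE (env T E) \<z> + ennreal T * aE (env T E') \<z>)" for \<z>
    have [measurable]: "Borel W" unfolding W_def by measurable
    define Q where "Q = ennreal (8 * H) * nE + ennreal (2 * H * T\<^sup>2) * nE'"
    have Qeq: "ennreal c * (2 * (4 * (ennreal K * nE)) + 2 * (ennreal (T\<^sup>2) * (ennreal K * nE'))) = Q"
      unfolding Q_def H_def using c K by (simp add: ennreal_mult distrib_left mult.assoc[symmetric]) (simp add: ac_simps)
    have W2: "(W \<z>)\<^sup>2 \<le> ennreal c * (2 * (4 * (aE (env T E) \<z>)\<^sup>2) + 2 * (ennreal (T\<^sup>2) * (aE (env T E') \<z>)\<^sup>2))" for \<z>
    proof -
      have "(W \<z>)\<^sup>2 = ennreal c * (2 * aE (env T E) \<z> + ennreal T * aE (env T E') \<z>)\<^sup>2" by (simp add: W_def power_mult_distrib cc)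
      also have "\<dots> \<le> ennreal c * (2 * (2 * aE (env T E) \<z>)\<^sup>2 + 2 * (ennreal T * aE (env T E') \<z>)\<^sup>2)"
        by (intro mult_left_mono ennreal_add_square_le) auto
      finally show ?thesis by (simp add: power_mult_distrib TT)
    qed
    have nW: "nrm (s - 2) W \<le> Q"
    proof -
      have "nrm (s - 2) W = ennreal c * nrm (s-2) (\<lambda>\<z>. 2 * aE (env T E) \<z> + ennreal T * aE (env T E') \<z>)"
        unfolding W_def by (subst nrm_cmult) (auto simp: cc)
      also have "\<dots> \<le> ennreal c * (2 * nrm (s-2) (\<lambda>\<z>. 2 * aE (env T E) \<z>) + 2 * nrm (s-2) (\<lambda>\<z>. ennreal T * aE (env T E') \<z>))"
        by (intro mult_left_mono nrm_add) auto
      also have "\<dots> = ennreal c * (2 * (4 * nrm (s-2) (aE (env T E))) + 2 * (ennreal (T\<^sup>2) * nrm (s-2) (aE (env T E'))))"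
        by (subst (1 2) nrm_cmult) (auto simp: TT)
      also have "\<dots> \<le> ennreal c * (2 * (4 * (ennreal K * nE)) + 2 * (ennreal (T\<^sup>2) * (ennreal K * nE')))"
      proof (intro mult_left_mono add_mono)
        show "nrm (s-2) (aE (env T E)) \<le> ennreal K * nE" unfolding nE_def by (rule order_trans[OF nrm_s2_le K(2)]) auto
        show "nrm (s-2) (aE (env T E')) \<le> ennreal K * nE'" unfolding nE'_def by (rule K(3)) auto
      qed auto
      finally show ?thesis unfolding Qeq .
    qed
    define A2 A3 A4 A5 where "A2 \<z> = ennreal \<bar>snd \<z>\<bar> * env T P \<z>" and "A3 \<z> = 2 * (ennreal cF * aE (env T E) \<z>)"
      and "A4 \<z> = ennreal (3 * sob_weight (-1/2) \<z>) * W \<z>" and "A5 \<z> = ennreal (2 * corner \<z>) * W \<z>" for \<z>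
    have [measurable]: "Borel A2" "Borel A3" "Borel A4" "Borel A5"
      unfolding A2_def A3_def A4_def A5_def by measurable
    have n2: "nrm (s - 1) A2 \<le> nP"
      unfolding nP_def nrm_def A2_def
    proof (intro nn_integral_mono ennreal_square_mono)
      fix \<z> :: "plane"
      have "ennreal (sob_weight ((s-1)/2) \<z>) * ennreal \<bar>snd \<z>\<bar> \<le> ennreal (sob_weight (s/2) \<z>)"
        using sob_weight_absorb_snd[of "s-1" \<z>] by (simp add: ennreal_mult[symmetric] ennreal_leI)
      then have "ennreal (sob_weight ((s-1)/2) \<z>) * ennreal \<bar>snd \<z>\<bar> * env T P \<z> \<le> ennreal (sob_weight (s/2) \<z>) * env T P \<z>"
        by (intro mult_right_mono) auto
      then show "ennreal (sob_weight ((s-1)/2) \<z>) * (ennreal \<bar>snd \<z>\<bar> * env T P \<z>) \<le> ennreal (sob_weight (s/2) \<z>) * env T P \<z>"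
        by (simp add: mult.assoc)
    qed
    have n3: "nrm (s - 1) A3 \<le> ennreal (4 * H) * nE"
    proof -
      have "nrm (s - 1) A3 \<le> nrm s A3" by (intro nrm_mono_weight) auto
      also have "\<dots> = 4 * (ennreal c * nrm s (aE (env T E)))" unfolding A3_def mult.assoc[symmetric]
        by (subst nrm_cmult) (auto simp: power_mult_distrib cc)
      also have "\<dots> \<le> 4 * (ennreal c * (ennreal K * nE))" unfolding nE_def by (intro mult_left_mono K) auto
      also have "\<dots> = ennreal (4 * H) * nE" unfolding H_def using c K by (simp add: ennreal_mult mult.assoc[symmetric])
      finally show ?thesis .
    qed
    \<comment> \<open>The decay of order one in \<open>A4\<close> lowers the order s - 1 to s - 2,
      at which the time derivative is controlled.\<close>
    have n4: "nrm (s - 1) A4 \<le> 9 * Q"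
    proof -
      have "nrm (s - 1) A4 = nrm (s - 2) (\<lambda>\<z>. 3 * W \<z>)"
        unfolding nrm_def A4_def
      proof (intro nn_integral_cong arg_cong[where f="\<lambda>x. x\<^sup>2"])
        fix \<z>
        have "sob_weight ((s-1)/2) \<z> * sob_weight (-1/2) \<z> = sob_weight ((s-2)/2) \<z>"
        proof -
          have "(s - 1)/2 + -1/2 = (s - 2)/2" by (simp add: diff_divide_distrib)
          then show ?thesis unfolding sob_weight_add[symmetric] by (simp only:)
        qed
        then have "ennreal (sob_weight ((s-1)/2) \<z>) * ennreal (3 * sob_weight (-1/2) \<z>) = ennreal (3 * sob_weight ((s-2)/2) \<z>)"
          by (subst ennreal_mult[symmetric]) (auto simp: mult.left_commute)
        moreover have ennreal3: "ennreal (3 * sob_weight ((s-2)/2) \<z>) = ennreal (sob_weight ((s-2)/2) \<z>) * 3"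
          by (subst ennreal_mult) (auto simp: mult.commute)
        ultimately show "ennreal (sob_weight ((s-1)/2) \<z>) * (ennreal (3 * sob_weight (-1/2) \<z>) * W \<z>) = ennreal (sob_weight ((s-2)/2) \<z>) * (3 * W \<z>)"
          by (simp only: mult.assoc[symmetric])
      qed
      also have "\<dots> = 9 * nrm (s - 2) W" by (subst nrm_cmult) auto
      finally show ?thesis using nW by (simp add: mult_left_mono)
    qed
    \<comment> \<open>\<open>corner\<close> is supported in the unit box. There the weight is at
      most \<open>b\<close> and \<open>(W \<z>)\<^sup>2\<close> at most \<open>Q\<close>, and the
      square integrability of \<open>corner\<close> does the rest.\<close>
    have n5: "nrm (s - 1) A5 \<le> ennreal (4 * b * J) * Q"
    proof -
      have "nrm (s - 1) A5 \<le> (\<integral>\<^sup>+\<z>. (ennreal (4 * b) * Q) * ennreal ((corner \<z>)\<^sup>2) \<partial>lborel)"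
        unfolding nrm_def
      proof (rule nn_integral_mono)
        fix \<z> :: "plane"
        show "(ennreal (sob_weight ((s-1)/2) \<z>) * A5 \<z>)\<^sup>2 \<le> (ennreal (4 * b) * Q) * ennreal ((corner \<z>)\<^sup>2)"
        proof (cases "\<bar>fst \<z>\<bar> \<le> 1 \<and> \<bar>snd \<z>\<bar> \<le> 1")
          case True
          have "(W \<z>)\<^sup>2 \<le> ennreal c * (2 * (4 * (ennreal K * nE)) + 2 * (ennreal (T\<^sup>2) * (ennreal K * nE')))"
          proof (rule order_trans[OF W2], intro mult_left_mono add_mono)
            show "(aE (env T E) \<z>)\<^sup>2 \<le> ennreal K * nE" unfolding nE_def by (rule K(4)) auto
            show "(aE (env T E') \<z>)\<^sup>2 \<le> ennreal K * nE'" unfolding nE'_def by (rule K(5)[OF _ True]) auto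
          qed auto
          then have WQ: "(W \<z>)\<^sup>2 \<le> Q" unfolding Qeq .
          have "(ennreal (sob_weight ((s-1)/2) \<z>) * A5 \<z>)\<^sup>2 = ennreal (sob_weight (s-1) \<z> * (4 * (corner \<z>)\<^sup>2)) * (W \<z>)\<^sup>2"
            unfolding A5_def by (simp add: power_mult_distrib ennreal_power ennreal_mult sob_weight_half_square mult.assoc)
          also have "\<dots> \<le> ennreal (b * (4 * (corner \<z>)\<^sup>2)) * Q"
            using sob_weight_box[OF True, of "s-1"] WQ
            by (intro mult_mono ennreal_leI mult_right_mono) (auto simp: b_def)
          also have "\<dots> = (ennreal (4 * b) * Q) * ennreal ((corner \<z>)\<^sup>2)" using b by (simp add: ennreal_mult ac_simps)
          finally show ?thesis .
        next
          case False
          then have "corner \<z> = 0" by (auto simp: corner_def)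
          then show ?thesis by (simp add: A5_def)
        qed
      qed
      also have "\<dots> = (ennreal (4 * b) * Q) * ennreal J" by (subst nn_integral_cmult) (auto simp: J)
      also have "\<dots> = ennreal (4 * b * J) * Q" using b J by (simp add: ennreal_mult ac_simps)
      finally show ?thesis .
    qed
    have "xnrm s (env T D) \<le> nrm (s - 1) (\<lambda>\<z>. Zw (cabs (D 0)) \<z> + A2 \<z> + A3 \<z> + A4 \<z> + A5 \<z>)"
      unfolding xnrm_def A2_def A3_def A4_def A5_def W_def by (intro nrm_mono linear_X_pointwise[OF T L])
    also have "\<dots> \<le> 16 * (nrm (s-1) (Zw (cabs (D 0))) + nrm (s-1) A2 + nrm (s-1) A3 + nrm (s-1) A4 + nrm (s-1) A5)"
      by (rule nrm_sum5) measurable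
    also have "\<dots> \<le> 16 * (xnrm s (cabs (D 0)) + nP + ennreal (4 * H) * nE + 9 * Q + ennreal (4 * b * J) * Q)"
      unfolding xnrm_def by (intro mult_left_mono add_mono n2 n3 n4 n5) auto
    also have "\<dots> = 16 * (xnrm s (cabs (D 0)) + nP + ennreal (76 * H + 32 * b * J * H) * nE + ennreal ((18 * H + 8 * b * J * H) * T\<^sup>2) * nE')"
    proof -
      have 1: "9 * Q = ennreal (72 * H) * nE + ennreal (18 * H * T\<^sup>2) * nE'"
        unfolding Q_def using H by (simp add: distrib_left mult.assoc[symmetric] ennreal_mult)
      have 2: "ennreal (4 * b * J) * Q = ennreal (32 * b * J * H) * nE + ennreal (8 * b * J * H * T\<^sup>2) * nE'"
        unfolding Q_def distrib_left mult.assoc[symmetric] using H b J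
        by (simp only: ennreal_mult[symmetric] mult_nonneg_nonneg zero_le_numeral less_imp_le zero_le_power2) (simp add: ac_simps)
      have nn: "0 \<le> 4 * H" "0 \<le> 72 * H" "0 \<le> 32 * b * J * H" "0 \<le> 18 * H * T\<^sup>2" "0 \<le> 8 * b * J * H * T\<^sup>2" using H b J by auto
      have 3: "ennreal (76 * H + 32 * b * J * H) = ennreal (4 * H) + ennreal (72 * H) + ennreal (32 * b * J * H)"
        using nn by (simp add: ennreal_plus[symmetric] del: ennreal_plus)
      have 4: "ennreal ((18 * H + 8 * b * J * H) * T\<^sup>2) = ennreal (18 * H * T\<^sup>2) + ennreal (8 * b * J * H * T\<^sup>2)"
        using nn by (simp add: ennreal_plus[symmetric] distrib_right del: ennreal_plus)
      show ?thesis unfolding 1 2 3 4 unfolding distrib_right by (simp only: ac_simps)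
    qed
    also have "\<dots> \<le> 16 * (ennreal (K'/16) * xnrm s (cabs (D 0)) + ennreal (K'/16) * nP + ennreal (K'/16) * nE + ennreal (K'/16 * T\<^sup>2) * nE')"
    proof -
      have k1: "1 \<le> K'/16" using H b J by (simp add: K'_def)
      have k2: "76 * H + 32 * b * J * H \<le> K'/16" by (simp add: K'_def)
      have k3: "18 * H + 8 * b * J * H \<le> K'/16" using H b J by (simp add: K'_def)
      have one: "x \<le> ennreal (K'/16) * x" for x
        using k1 by (rule ennreal_le_mult_self)
      show ?thesis using k2 k3 by (intro mult_left_mono add_mono one mult_right_mono ennreal_leI) auto
    qed
    also have "\<dots> = ennreal K' * (xnrm s (cabs (D 0)) + nP + nE) + ennreal (K' * T\<^sup>2) * nE'"
    proof -
      have e: "16 * ennreal (K'/16 * y) = ennreal (K' * y)" if "0 \<le> y" for y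
      proof -
        have "16 * ennreal (K'/16 * y) = ennreal 16 * ennreal (K'/16 * y)" by simp
        also have "\<dots> = ennreal (16 * (K'/16 * y))" using K'1 that by (intro ennreal_mult[symmetric]) auto
        finally show ?thesis by simp
      qed
      from e[of 1] e[of "T\<^sup>2"] show ?thesis by (simp add: distrib_left mult.assoc[symmetric])
    qed
    finally show "xnrm s (env T D) \<le> ennreal K' * (xnrm s (cabs (D 0)) + nrm s (env T P) + nrm s (env T E)) + ennreal (K' * T\<^sup>2) * nrm (s - 2) (env T E')"
      unfolding nP_def nE_def nE'_def .
  qed
qed

text \<open>Read off from the equation: by \<open>phi_bound\<close> the dispersive term is governed
  by the solution and by eta times its singular quotient, and the forcing is better than
  required.\<close>

lemma linear_derivative_estimate:
  "\<exists>K\<ge>1. \<forall>T D D' P E. 0 < T \<longrightarrow> linsys0 T D D' P E \<longrightarrow>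
    nrm (s - 2) (env T D') \<le> ennreal K * (nrm s (env T D) + xnrm s (env T D) + nrm s (env T P) + nrm s (env T E))"
proof -
  obtain K where K: "1 \<le> K" "\<And>B. Borel B \<Longrightarrow> nrm s (aE B) \<le> ennreal K * nrm s B"
    using aE_bounds by metis
  define c where "c = cF\<^sup>2"
  have c: "0 \<le> c" by (simp add: c_def)
  have cc: "(ennreal cF)\<^sup>2 = ennreal c" by (simp add: ennreal_power c_def less_imp_le)
  define K' where "K' = 16 * (1 + c * K)"
  have cK: "0 \<le> c * K" using c K by auto
  show ?thesis
  proof (intro exI[of _ K'] conjI allI impI)
    show "1 \<le> K'" using cK by (simp add: K'_def)
    fix T D D' P E assume T: "0 < T" and L0: "linsys0 T D D' P E"
    note [measurable] = linsys0_measurable[OF L0 less_imp_le[OF T]]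
    have E: "path T E" using L0 by (auto simp: linsys0_def)
    define A2 A4 where "A2 \<z> = ennreal \<bar>snd \<z>\<bar> * Zw (env T D) \<z>" and "A4 \<z> = ennreal cF * aE (env T E) \<z>" for \<z>
    have [measurable]: "Borel A2" "Borel A4"
      unfolding A2_def A4_def by measurable
    \<comment> \<open>The summand 0 gives the bound the shape of \<open>nrm_sum5\<close>.\<close>
    have pt: "env T D' \<z> \<le> env T D \<z> + A2 \<z> + env T P \<z> + A4 \<z> + 0" for \<z>
    proof (rule env_least)
      fix t assume t: "t \<in> {0..T}"
      have D': "D' t \<z> = - \<i> * complex_of_real (phi \<gamma> \<z>) * D t \<z> + forcing (P t) (E t) \<z>" using L0 t unfolding linsys0_def by blast
      have "ennreal (cmod (D' t \<z>)) \<le> ennreal (\<bar>phi \<gamma> \<z>\<bar> * cmod (D t \<z>) + cmod (forcing (P t) (E t) \<z>))"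
        unfolding D' by (intro ennreal_leI order_trans[OF norm_triangle_ineq]) (simp add: norm_mult)
      also have "\<dots> = ennreal \<bar>phi \<gamma> \<z>\<bar> * ennreal (cmod (D t \<z>)) + ennreal (cmod (forcing (P t) (E t) \<z>))"
        by (simp add: ennreal_mult)
      also have "\<dots> \<le> ennreal (1 + \<bar>snd \<z>\<bar> * \<bar>snd \<z> / fst \<z>\<bar>) * env T D \<z> + (ennreal \<bar>mN p \<z>\<bar> * env T P \<z> + ennreal (mA \<z>) * (ennreal cF * aE (env T E) \<z>))"
        by (intro add_mono mult_mono ennreal_leI phi_bound \<gamma> env_upper t forcing_bound E) auto
      also have "\<dots> \<le> (env T D \<z> + A2 \<z>) + (1 * env T P \<z> + 1 * A4 \<z>)"
      proof (intro add_mono)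
        show "ennreal (1 + \<bar>snd \<z>\<bar> * \<bar>snd \<z> / fst \<z>\<bar>) * env T D \<z> \<le> env T D \<z> + A2 \<z>"
          by (simp add: A2_def Zw_def ennreal_mult distrib_right mult.assoc del: abs_divide)
        show "ennreal \<bar>mN p \<z>\<bar> * env T P \<z> \<le> 1 * env T P \<z>"
          using mN_bound[of p \<z>] by (intro mult_right_mono) (auto simp: ennreal_1[symmetric] simp del: ennreal_1 intro!: ennreal_leI)
        show "ennreal (mA \<z>) * (ennreal cF * aE (env T E) \<z>) \<le> 1 * A4 \<z>"
          unfolding A4_def using mA_bounds[of \<z>] by (intro mult_right_mono) (auto simp: ennreal_1[symmetric] simp del: ennreal_1 intro!: ennreal_leI)
      qed
      finally show "ennreal (cmod (D' t \<z>)) \<le> env T D \<z> + A2 \<z> + env T P \<z> + A4 \<z> + 0" by (simp add: add.assoc)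
    qed
    have n2: "nrm (s - 2) A2 \<le> xnrm s (env T D)"
      unfolding xnrm_def nrm_def A2_def
    proof (intro nn_integral_mono ennreal_square_mono)
      fix \<z> :: "plane"
      have "ennreal (sob_weight ((s-2)/2) \<z>) * ennreal \<bar>snd \<z>\<bar> \<le> ennreal (sob_weight ((s-1)/2) \<z>)"
        using sob_weight_absorb_snd[of "s-2" \<z>] by (simp add: ennreal_mult[symmetric] ennreal_leI)
      then have "ennreal (sob_weight ((s-2)/2) \<z>) * ennreal \<bar>snd \<z>\<bar> * Zw (env T D) \<z> \<le> ennreal (sob_weight ((s-1)/2) \<z>) * Zw (env T D) \<z>"
        by (intro mult_right_mono) auto
      then show "ennreal (sob_weight ((s-2)/2) \<z>) * (ennreal \<bar>snd \<z>\<bar> * Zw (env T D) \<z>) \<le> ennreal (sob_weight ((s-1)/2) \<z>) * Zw (env T D) \<z>"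
        by (simp add: mult.assoc)
    qed
    have n4: "nrm (s - 2) A4 \<le> ennreal (c * K) * nrm s (env T E)"
    proof -
      have "nrm (s - 2) A4 \<le> nrm s A4" by (rule nrm_s2_le)
      also have "\<dots> = ennreal c * nrm s (aE (env T E))" unfolding A4_def by (subst nrm_cmult) (auto simp: cc)
      also have "\<dots> \<le> ennreal c * (ennreal K * nrm s (env T E))" by (intro mult_left_mono K) auto
      finally show ?thesis using c K by (simp add: ennreal_mult mult.assoc)
    qed
    have "nrm (s - 2) (env T D') \<le> nrm (s - 2) (\<lambda>\<z>. env T D \<z> + A2 \<z> + env T P \<z> + A4 \<z> + 0)" by (intro nrm_mono pt)
    also have "\<dots> \<le> 16 * (nrm (s-2) (env T D) + nrm (s-2) A2 + nrm (s-2) (env T P) + nrm (s-2) A4 + nrm (s-2) (\<lambda>_. 0))"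
      by (rule nrm_sum5) measurable
    also have "\<dots> \<le> 16 * (nrm s (env T D) + xnrm s (env T D) + nrm s (env T P) + ennreal (c * K) * nrm s (env T E) + 0)"
      by (intro mult_left_mono add_mono n2 n4 nrm_s2_le) (auto simp: nrm_def)
    also have "\<dots> \<le> 16 * (ennreal (1 + c * K) * nrm s (env T D) + ennreal (1 + c * K) * xnrm s (env T D) + ennreal (1 + c * K) * nrm s (env T P) + ennreal (1 + c * K) * nrm s (env T E) + 0)"
    proof -
      have one: "x \<le> ennreal (1 + c * K) * x" for x
        using cK by (intro ennreal_le_mult_self) simp
      show ?thesis using cK by (intro mult_left_mono add_mono one mult_right_mono ennreal_leI) auto
    qed
    also have "\<dots> = 16 * ennreal (1 + c * K) * (nrm s (env T D) + xnrm s (env T D) + nrm s (env T P) + nrm s (env T E))"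
      by (simp add: distrib_left mult.assoc)
    also have "16 * ennreal (1 + c * K) = ennreal K'"
    proof -
      have "16 * ennreal (1 + c * K) = ennreal 16 * ennreal (1 + c * K)" by simp
      also have "\<dots> = ennreal (16 * (1 + c * K))" using cK by (intro ennreal_mult[symmetric]) auto
      finally show ?thesis by (simp add: K'_def)
    qed
    finally show "nrm (s - 2) (env T D') \<le> ennreal K' * (nrm s (env T D) + xnrm s (env T D) + nrm s (env T P) + nrm s (env T E))" .
  qed
qed

section \<open>Solutions of the linear problem and their differences\<close>

lemma forcing_path:
  assumes P: "path T P" and E: "path T E" and fin: "nrm s (env T E) < \<infinity>"
  shows "path T (\<lambda>t. forcing (P t) (E t))"
proof -
  have s0: "0 \<le> s" using s by simp
  have conv: "path T (\<lambda>t. conv ah (E t))"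
  proof (rule pathI)
    show "Borel (conv ah (E t))" if "t \<in> {0..T}" for t
      using path_measurable[OF E that] by (intro conv_measurable ah_meas)
    show "continuous_on {0..T} (\<lambda>t. conv ah (E t) \<z>)" for \<z>
    proof (cases "0 \<le> T")
      case True
      have "econv (env T (\<lambda>t. ah)) (env T E) \<z> = aE (env T E) \<z>"
        using env_const[OF True, of ah] by (simp add: econv_def)
      then show ?thesis
        using conv_continuous_on[OF path_const[OF ah_meas] E, of \<z>] aE_finite_s[OF env_measurable[OF E] fin] by simp
    qed simp
  qed
  have 1: "path T (\<lambda>t \<z>. (- \<i> * complex_of_real (mN p \<z>)) * P t \<z>)" by (rule path_mult[OF _ P]) measurable
  have 2: "path T (\<lambda>t \<z>. (complex_of_real (mA \<z>) * complex_of_real cF) * conv ah (E t) \<z>)" by (rule path_mult[OF _ conv]) measurable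
  show ?thesis using path_diff[OF 1 2] unfolding forcing_def by (simp add: mult.assoc)
qed

text \<open>\<open>P\<close> and \<open>E\<close> are arbitrary inputs, so one application is one
  Picard step; the derivative is given by the equation itself.\<close>

lemma duhamel_linsys0:
  assumes P: "path T P" and E: "path T E" and fin: "nrm s (env T P) < \<infinity>" "nrm s (env T E) < \<infinity>"
    and [measurable]: "Borel h"
  defines "D \<equiv> duhamel (phi \<gamma>) h (\<lambda>t. forcing (P t) (E t))"
  shows "linsys0 T D (\<lambda>t \<z>. - \<i> * complex_of_real (phi \<gamma> \<z>) * D t \<z> + forcing (P t) (E t) \<z>) P E"
proof -
  have F: "path T (\<lambda>t. forcing (P t) (E t))" by (rule forcing_path[OF P E fin(2)])
  have D: "path T D" unfolding D_def by (rule path_duhamel[OF F]) measurable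
  have D': "path T (\<lambda>t \<z>. - \<i> * complex_of_real (phi \<gamma> \<z>) * D t \<z> + forcing (P t) (E t) \<z>)"
    by (intro path_add path_mult D F) measurable
  have "dpath T D (\<lambda>t \<z>. - \<i> * complex_of_real (phi \<gamma> \<z>) * D t \<z> + forcing (P t) (E t) \<z>)"
    unfolding dpath_def using D D' duhamel_deriv[OF F, where c="phi \<gamma>" and h=h] unfolding D_def by blast
  then show ?thesis using P E fin unfolding linsys0_def by blast
qed

lemma forcing_diff:
  assumes "Borel E1" "Borel E2" "nrm s (cabs E1) < \<infinity>" "nrm s (cabs E2) < \<infinity>"
  shows "forcing (\<lambda>z. P1 z - P2 z) (\<lambda>z. E1 z - E2 z) \<z> = forcing P1 E1 \<z> - forcing P2 E2 \<z>"
proof -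
  have s0: "0 \<le> s" using s by simp
  have e: "conv ah (\<lambda>z. E1 z - E2 z) \<z> = conv ah E1 \<z> - conv ah E2 \<z>"
    using assms by (intro conv_diff_right ah_meas nrm_0_finite[OF s0 ah_fin] nrm_0_finite[OF s0])
  show ?thesis unfolding forcing_def e by (simp add: algebra_simps)
qed

lemma linsys0_diff:
  assumes 1: "linsys0 T D1 D1' P1 E1" and 2: "linsys0 T D2 D2' P2 E2"
  shows "linsys0 T (\<lambda>t \<z>. D1 t \<z> - D2 t \<z>) (\<lambda>t \<z>. D1' t \<z> - D2' t \<z>) (\<lambda>t \<z>. P1 t \<z> - P2 t \<z>) (\<lambda>t \<z>. E1 t \<z> - E2 t \<z>)"
proof -
  have d: "dpath T D1 D1'" "dpath T D2 D2'" and P: "path T P1" "path T P2" and E: "path T E1" "path T E2"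
    and f: "nrm s (env T P1) < \<infinity>" "nrm s (env T P2) < \<infinity>" "nrm s (env T E1) < \<infinity>" "nrm s (env T E2) < \<infinity>"
    using 1 2 by (auto simp: linsys0_def)
  have "dpath T (\<lambda>t \<z>. D1 t \<z> - D2 t \<z>) (\<lambda>t \<z>. D1' t \<z> - D2' t \<z>)"
    unfolding dpath_def
    by (intro conjI path_diff dpath_path[OF d(1)] dpath_path[OF d(2)] allI ballI has_vector_derivative_diff dpath_deriv[OF d(1)] dpath_deriv[OF d(2)])
  moreover have "nrm s (env T (\<lambda>t \<z>. P1 t \<z> - P2 t \<z>)) < \<infinity>" "nrm s (env T (\<lambda>t \<z>. E1 t \<z> - E2 t \<z>)) < \<infinity>"
    using order.strict_trans1[OF nrm_env_diff_le[OF P] ennreal_twice_add_finite[OF f(1,2)]]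
      order.strict_trans1[OF nrm_env_diff_le[OF E] ennreal_twice_add_finite[OF f(3,4)]] by auto
  moreover have "D1' t \<z> - D2' t \<z> = - \<i> * complex_of_real (phi \<gamma> \<z>) * (D1 t \<z> - D2 t \<z>) + forcing (\<lambda>\<z>. P1 t \<z> - P2 t \<z>) (\<lambda>\<z>. E1 t \<z> - E2 t \<z>) \<z>"
    if t: "t \<in> {0..T}" for t \<z>
  proof -
    have eqs: "D1' t \<z> = - \<i> * complex_of_real (phi \<gamma> \<z>) * D1 t \<z> + forcing (P1 t) (E1 t) \<z>"
      "D2' t \<z> = - \<i> * complex_of_real (phi \<gamma> \<z>) * D2 t \<z> + forcing (P2 t) (E2 t) \<z>"
      using 1 2 t unfolding linsys0_def by blast+
    have "forcing (\<lambda>\<z>. P1 t \<z> - P2 t \<z>) (\<lambda>\<z>. E1 t \<z> - E2 t \<z>) \<z> = forcing (P1 t) (E1 t) \<z> - forcing (P2 t) (E2 t) \<z>"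
      by (intro forcing_diff path_measurable[OF E(1) t] path_measurable[OF E(2) t]
        order.strict_trans1[OF nrm_cabs_le_env[OF t] f(3)] order.strict_trans1[OF nrm_cabs_le_env[OF t] f(4)])
    then show ?thesis unfolding eqs by (simp add: right_diff_distrib)
  qed
  ultimately show ?thesis unfolding linsys0_def by (intro conjI path_diff P E) auto
qed

lemma linsys_diff:
  assumes 1: "linsys T D1 D1' P1 E1 E1'" and 2: "linsys T D2 D2' P2 E2 E2'"
  shows "linsys T (\<lambda>t \<z>. D1 t \<z> - D2 t \<z>) (\<lambda>t \<z>. D1' t \<z> - D2' t \<z>) (\<lambda>t \<z>. P1 t \<z> - P2 t \<z>) (\<lambda>t \<z>. E1 t \<z> - E2 t \<z>) (\<lambda>t \<z>. E1' t \<z> - E2' t \<z>)"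
proof -
  have d: "dpath T E1 E1'" "dpath T E2 E2'" and f: "nrm (s-2) (env T E1') < \<infinity>" "nrm (s-2) (env T E2') < \<infinity>"
    using 1 2 by (auto simp: linsys_def)
  have "dpath T (\<lambda>t \<z>. E1 t \<z> - E2 t \<z>) (\<lambda>t \<z>. E1' t \<z> - E2' t \<z>)"
    unfolding dpath_def
    by (intro conjI path_diff dpath_path[OF d(1)] dpath_path[OF d(2)] allI ballI has_vector_derivative_diff dpath_deriv[OF d(1)] dpath_deriv[OF d(2)])
  moreover have "nrm (s-2) (env T (\<lambda>t \<z>. E1' t \<z> - E2' t \<z>)) < \<infinity>"
    using order.strict_trans1[OF nrm_env_diff_le[OF dpath_path(2)[OF d(1)] dpath_path(2)[OF d(2)]] ennreal_twice_add_finite[OF f(1,2)]] by auto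
  ultimately show ?thesis using linsys0_diff[of T D1 D1' P1 E1 D2 D2' P2 E2] 1 2 by (simp add: linsys_def)
qed

end

section \<open>Existence and Lipschitz dependence on the Fourier side\<close>

text \<open>Scaling by a positive real and squaring is an increasing bijection of
  \<open>ennreal\<close>, so it passes through the lower limit: a level \<open>y\<close> is pulled
  back to \<open>z\<close> and pushed forward again.\<close>

lemma weighted_square_le_liminf:
  fixes a :: ennreal
  assumes w: "0 < w" and a: "a \<le> liminf b"
  shows "(ennreal w * a)\<^sup>2 \<le> liminf (\<lambda>n. (ennreal w * b n)\<^sup>2)"
  unfolding le_Liminf_iff
proof (intro allI impI)
  fix y assume y: "y < (ennreal w * a)\<^sup>2"
  then obtain r where r: "y = ennreal r" "0 \<le> r" by (cases y) auto
  define z where "z = ennreal (sqrt r / w)"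
  have z: "(ennreal w * z)\<^sup>2 = y"
  proof -
    have "ennreal w * z = ennreal (sqrt r)" unfolding z_def using w r by (subst ennreal_mult[symmetric]) auto
    then show ?thesis using r by (simp add: ennreal_power)
  qed
  have mono: "(ennreal w * c)\<^sup>2 \<le> (ennreal w * d)\<^sup>2" if "c \<le> d" for c d
    using that by (intro ennreal_square_mono mult_left_mono) auto
  have "z < a"
  proof (rule ccontr)
    assume "\<not> z < a"
    then have "(ennreal w * a)\<^sup>2 \<le> (ennreal w * z)\<^sup>2" by (intro mono) simp
    with y z show False by simp
  qed
  then have "\<forall>\<^sub>F n in sequentially. z < b n" using a unfolding le_Liminf_iff by blast
  then show "\<forall>\<^sub>F n in sequentially. y < (ennreal w * b n)\<^sup>2"
  proof eventually_elim
    case (elim n)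
    show ?case
    proof (rule ccontr)
      assume "\<not> y < (ennreal w * b n)\<^sup>2"
      then have "(ennreal w * b n)\<^sup>2 \<le> (ennreal w * z)\<^sup>2" using z by simp
      then have "ennreal w * b n \<le> ennreal w * z" by (rule ennreal_square_le_imp_le)
      then have "ennreal (1/w) * (ennreal w * b n) \<le> ennreal (1/w) * (ennreal w * z)" by (rule mult_left_mono) simp
      then have "b n \<le> z" using w by (simp add: mult.assoc[symmetric] ennreal_mult[symmetric])
      with elim show False by simp
    qed
  qed
qed

lemma nrm_le_liminf:
  assumes [measurable]: "\<And>n. Borel (B n)"
    and le: "\<And>\<z>. A \<z> \<le> liminf (\<lambda>n. B n \<z>)"
  shows "nrm s A \<le> liminf (\<lambda>n. nrm s (B n))"
proof -
  have "nrm s A \<le> (\<integral>\<^sup>+\<z>. liminf (\<lambda>n. (ennreal (sob_weight (s/2) \<z>) * B n \<z>)\<^sup>2) \<partial>lborel)"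
    unfolding nrm_def by (intro nn_integral_mono weighted_square_le_liminf le) simp
  also have "\<dots> \<le> liminf (\<lambda>n. nrm s (B n))"
    unfolding nrm_def by (rule nn_integral_liminf) measurable
  finally show ?thesis .
qed

lemma env_le_liminf:
  assumes "\<And>t. t \<in> {0..T} \<Longrightarrow> (\<lambda>n. U n t \<z>) \<longlonglongrightarrow> u t \<z>"
  shows "env T u \<z> \<le> liminf (\<lambda>n. env T (U n) \<z>)"
proof (rule env_least)
  fix t assume t: "t \<in> {0..T}"
  have "(\<lambda>n. ennreal (cmod (U n t \<z>))) \<longlonglongrightarrow> ennreal (cmod (u t \<z>))"
    by (intro tendsto_ennrealI tendsto_norm assms t)
  then have "ennreal (cmod (u t \<z>)) = liminf (\<lambda>n. ennreal (cmod (U n t \<z>)))"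
    by (intro lim_imp_Liminf[symmetric]) auto
  also have "\<dots> \<le> liminf (\<lambda>n. env T (U n) \<z>)"
    by (intro Liminf_mono always_eventually allI env_upper t)
  finally show "ennreal (cmod (u t \<z>)) \<le> liminf (\<lambda>n. env T (U n) \<z>)" .
qed

text \<open>Fatou's lemma for suprema over time: uniform bounds on the iterates survive convergence
  at each time and frequency, which is all the Picard scheme provides for the derivatives.\<close>

lemma nrm_env_le_limit:
  assumes p: "\<And>n. path T (U n)" and lim: "\<And>t \<z>. t \<in> {0..T} \<Longrightarrow> (\<lambda>n. U n t \<z>) \<longlonglongrightarrow> u t \<z>"
    and bd: "\<And>n. nrm s (env T (U n)) \<le> B"
  shows "nrm s (env T u) \<le> B"
proof -
  have "nrm s (env T u) \<le> liminf (\<lambda>n. nrm s (env T (U n)))"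
    using p lim by (intro nrm_le_liminf env_le_liminf env_measurable)
  also have "\<dots> \<le> B" by (intro Liminf_le always_eventually allI bd) auto
  finally show ?thesis .
qed

lemma path_cong: "(\<And>t \<z>. t \<in> {0..T} \<Longrightarrow> u t \<z> = v t \<z>) \<Longrightarrow> path T u \<Longrightarrow> path T v"
proof (rule pathI)
  assume eq: "\<And>t \<z>. t \<in> {0..T} \<Longrightarrow> u t \<z> = v t \<z>" and u: "path T u"
  show "Borel (v t)" if "t \<in> {0..T}" for t
  proof -
    have "u t = v t" using eq[OF that] by (rule ext)
    then show ?thesis using path_measurable[OF u that] by simp
  qed
  show "continuous_on {0..T} (\<lambda>t. v t \<z>)" for \<z>
    by (rule continuous_on_eq[OF path_continuous[OF u]]) (rule eq)
qed

lemma env_cong: "(\<And>t \<z>. t \<in> {0..T} \<Longrightarrow> u t \<z> = v t \<z>) \<Longrightarrow> env T u = env T v"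
  unfolding env_def by (intro ext SUP_cong refl) simp

text \<open>The error \<open>\<rho>\<close> is uniform in time, so continuity survives as in a
  uniform limit; measurability survives as in a pointwise one.\<close>

lemma path_limit:
  assumes p: "\<And>n. path T (U n)"
    and bd: "\<And>n t \<z>. t \<in> {0..T} \<Longrightarrow> cmod (u t \<z> - U n t \<z>) \<le> \<rho> n" and \<rho>: "\<rho> \<longlonglongrightarrow> 0"
  shows "path T u"
proof (rule pathI)
  have ul: "uniform_limit {0..T} (\<lambda>n t. U n t \<z>) (\<lambda>t. u t \<z>) sequentially" for \<z>
  proof (rule uniform_limitI)
    fix e :: real assume "0 < e"
    then have "\<forall>\<^sub>F n in sequentially. \<rho> n < e" using \<rho> by (rule order_tendstoD(2)[rotated])
    then show "\<forall>\<^sub>F n in sequentially. \<forall>t\<in>{0..T}. dist (U n t \<z>) (u t \<z>) < e"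
    proof eventually_elim
      case (elim n)
      show ?case
      proof
        fix t assume t: "t \<in> {0..T}"
        have "dist (U n t \<z>) (u t \<z>) \<le> \<rho> n" using bd[OF t, of \<z> n] by (simp add: dist_norm norm_minus_commute)
        then show "dist (U n t \<z>) (u t \<z>) < e" using elim by simp
      qed
    qed
  qed
  show "continuous_on {0..T} (\<lambda>t. u t \<z>)" for \<z>
    by (rule uniform_limit_theorem[OF _ ul]) (simp_all add: path_continuous[OF p])
  show "Borel (u t)" if t: "t \<in> {0..T}" for t
  proof (rule borel_measurable_LIMSEQ_metric)
    show "Borel (U n t)" for n by (rule path_measurable[OF p t])
    show "(\<lambda>n. U n t \<z>) \<longlonglongrightarrow> u t \<z>" for \<z> using tendsto_uniform_limitI[OF ul t] .
  qed
qed

lemma conv_hermitian: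
  assumes F: "\<And>\<z>. F (- \<z>) = cnj (F \<z>)" and G: "\<And>\<z>. G (- \<z>) = cnj (G \<z>)"
    and [measurable]: "Borel F" "Borel G"
  shows "conv F G (- \<z>) = cnj (conv F G \<z>)"
proof -
  have "cnj (conv F G \<z>) = (\<integral>z. F (- \<z> - (0 - z)) * G (0 - z) \<partial>lborel)"
  proof -
    have "cnj (F (\<z> - z) * G z) = F (- \<z> - (0 - z)) * G (0 - z)" for z
      using F[of "\<z> - z"] G[of z] by simp
    then show ?thesis unfolding conv_def
      by (subst Bochner_Integration.integral_cnj[symmetric]) (simp only:)
  qed
  also have "\<dots> = conv F G (- \<z>)"
    unfolding conv_def by (rule integral_lborel_reflect[of "\<lambda>z. F (- \<z> - z) * G z"]) measurable
  finally show ?thesis by simp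
qed

lemma cpow_measurable: "Borel F \<Longrightarrow> Borel (cpow k F)"
proof (induction k)
  case (Suc k)
  then have [measurable]: "Borel F" "Borel (cpow k F)" by auto
  have [measurable]: "Borel (conv F (cpow k F))" by (rule conv_measurable) measurable
  show ?case unfolding cpow.simps by measurable
qed simp

lemma cpow_hermitian:
  assumes F: "\<And>\<z>. F (- \<z>) = cnj (F \<z>)" "Borel F"
  shows "cpow k F (- \<z>) = cnj (cpow k F \<z>)"
proof (induction k arbitrary: \<z>)
  case (Suc k)
  have "conv F (cpow k F) (- \<z>) = cnj (conv F (cpow k F) \<z>)"
    by (rule conv_hermitian) (rule F Suc.IH cpow_measurable)+
  then show ?case by simp
qed (use F in simp)

context bbm_kp begin

definition rhsf :: "(plane \<Rightarrow> complex) \<Rightarrow> plane \<Rightarrow> complex" where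
  "rhsf F \<z> = - \<i> * complex_of_real (phi \<gamma> \<z>) * F \<z> + forcing (cpow p F) F \<z>"

text \<open>More than \<open>is_sol\<close> demands: the suprema over time have finite norms, and
  the equation holds at every frequency. The Lipschitz estimate is available in this class
  only.\<close>

definition fourier_sol where
  "fourier_sol T h u \<longleftrightarrow> (\<forall>\<z>. u 0 \<z> = h \<z>) \<and> linsys T u (\<lambda>t. rhsf (u t)) (\<lambda>t. cpow p (u t)) u (\<lambda>t. rhsf (u t))"

lemma linear_estimates:
  obtains K :: real where "1 \<le> K"
    "\<And>T D D' P E. 0 < T \<Longrightarrow> linsys0 T D D' P E \<Longrightarrow>
      nrm s (env T D) \<le> 2 * nrm s (cabs (D 0)) + ennreal (K * T\<^sup>2) * (nrm s (env T P) + nrm s (env T E))"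
    "\<And>T D D' P E \<z>. 0 < T \<Longrightarrow> linsys0 T D D' P E \<Longrightarrow> (\<And>\<z>. D 0 \<z> = 0) \<Longrightarrow>
      (env T D \<z>)\<^sup>2 \<le> ennreal (K * T\<^sup>2) * ((env T P \<z>)\<^sup>2 + nrm s (env T E))"
    "\<And>T D D' P E E'. 0 < T \<Longrightarrow> T \<le> 1 \<Longrightarrow> linsys T D D' P E E' \<Longrightarrow>
      xnrm s (env T D) \<le> ennreal K * (xnrm s (cabs (D 0)) + nrm s (env T P) + nrm s (env T E)) + ennreal (K * T\<^sup>2) * nrm (s - 2) (env T E')"
    "\<And>T D D' P E. 0 < T \<Longrightarrow> linsys0 T D D' P E \<Longrightarrow>
      nrm (s - 2) (env T D') \<le> ennreal K * (nrm s (env T D) + xnrm s (env T D) + nrm s (env T P) + nrm s (env T E))"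
proof -
  obtain K1 where K1: "1 \<le> K1" "\<And>T D D' P E. 0 < T \<Longrightarrow> linsys0 T D D' P E \<Longrightarrow>
      nrm s (env T D) \<le> 2 * nrm s (cabs (D 0)) + ennreal (K1 * T\<^sup>2) * (nrm s (env T P) + nrm s (env T E))"
    "\<And>T D D' P E \<z>. 0 < T \<Longrightarrow> linsys0 T D D' P E \<Longrightarrow> (\<And>\<z>. D 0 \<z> = 0) \<Longrightarrow>
      (env T D \<z>)\<^sup>2 \<le> ennreal (K1 * T\<^sup>2) * ((env T P \<z>)\<^sup>2 + nrm s (env T E))"
    using linear_Hs_estimate by blast
  obtain K2 where K2: "1 \<le> K2" "\<And>T D D' P E E'. 0 < T \<Longrightarrow> T \<le> 1 \<Longrightarrow> linsys T D D' P E E' \<Longrightarrow>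
      xnrm s (env T D) \<le> ennreal K2 * (xnrm s (cabs (D 0)) + nrm s (env T P) + nrm s (env T E)) + ennreal (K2 * T\<^sup>2) * nrm (s - 2) (env T E')"
    using linear_X_estimate by blast
  obtain K3 where K3: "1 \<le> K3" "\<And>T D D' P E. 0 < T \<Longrightarrow> linsys0 T D D' P E \<Longrightarrow>
      nrm (s - 2) (env T D') \<le> ennreal K3 * (nrm s (env T D) + xnrm s (env T D) + nrm s (env T P) + nrm s (env T E))"
    using linear_derivative_estimate by blast
  define K where "K = max K1 (max K2 K3)"
  have le: "K1 \<le> K" "K2 \<le> K" "K3 \<le> K" by (auto simp: K_def)
  have leT: "ennreal (K1 * T\<^sup>2) \<le> ennreal (K * T\<^sup>2)" "ennreal (K2 * T\<^sup>2) \<le> ennreal (K * T\<^sup>2)" for T :: real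
    using le by (auto intro!: ennreal_leI mult_right_mono)
  show ?thesis
  proof (rule that[of K])
    show "1 \<le> K" using K1(1) le by linarith
    fix T :: real and D D' P E assume T: "0 < T" and L: "linsys0 T D D' P E"
    show "nrm s (env T D) \<le> 2 * nrm s (cabs (D 0)) + ennreal (K * T\<^sup>2) * (nrm s (env T P) + nrm s (env T E))"
      by (rule order_trans[OF K1(2)[OF T L]]) (intro add_left_mono mult_right_mono leT, simp)
    show "nrm (s - 2) (env T D') \<le> ennreal K * (nrm s (env T D) + xnrm s (env T D) + nrm s (env T P) + nrm s (env T E))"
      by (rule order_trans[OF K3(2)[OF T L]]) (intro mult_right_mono ennreal_leI le, simp)
    fix \<z> assume D0: "\<And>\<z>. D 0 \<z> = 0"
    show "(env T D \<z>)\<^sup>2 \<le> ennreal (K * T\<^sup>2) * ((env T P \<z>)\<^sup>2 + nrm s (env T E))"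
      by (rule order_trans[OF K1(3)[OF T L D0]]) (intro mult_right_mono leT, simp)
  next
    fix T :: real and D D' P E E' assume T: "0 < T" "T \<le> 1" and L: "linsys T D D' P E E'"
    show "xnrm s (env T D) \<le> ennreal K * (xnrm s (cabs (D 0)) + nrm s (env T P) + nrm s (env T E)) + ennreal (K * T\<^sup>2) * nrm (s - 2) (env T E')"
      by (rule order_trans[OF K2(2)[OF T L]]) (intro add_mono mult_right_mono leT ennreal_leI le, simp_all)
  qed
qed

lemma forcing_hermitian:
  assumes P: "\<And>\<z>. P (- \<z>) = cnj (P \<z>)" and E: "\<And>\<z>. E (- \<z>) = cnj (E \<z>)" and [measurable]: "Borel E"
    and ah: "\<And>\<z>. ah (- \<z>) = cnj (ah \<z>)"
  shows "forcing P E (- \<z>) = cnj (forcing P E \<z>)"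
  using conv_hermitian[of ah E \<z>, OF ah E ah_meas] P unfolding forcing_def by (simp add: mN_def mA_def)

lemma duhamel_hermitian:
  assumes h: "\<And>\<z>. h (- \<z>) = cnj (h \<z>)" and G: "\<And>\<tau> \<z>. \<tau> \<in> {0..t} \<Longrightarrow> G \<tau> (- \<z>) = cnj (G \<tau> \<z>)"
  shows "duhamel (phi \<gamma>) h G t (- \<z>) = cnj (duhamel (phi \<gamma>) h G t \<z>)"
proof -
  have ph: "phi \<gamma> (- \<z>) = - phi \<gamma> \<z>" by (simp add: phi_def)
  have "integral {0..t} (\<lambda>\<tau>. cis (\<tau> * phi \<gamma> (- \<z>)) * G \<tau> (- \<z>)) = integral {0..t} (\<lambda>\<tau>. cnj (cis (\<tau> * phi \<gamma> \<z>) * G \<tau> \<z>))"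
    using G by (intro Henstock_Kurzweil_Integration.integral_cong) (simp add: ph cis_cnj)
  also have "\<dots> = cnj (integral {0..t} (\<lambda>\<tau>. cis (\<tau> * phi \<gamma> \<z>) * G \<tau> \<z>))"
    by (rule integral_cnj[symmetric])
  finally show ?thesis by (simp add: duhamel_def h ph cis_cnj)
qed

text \<open>\<open>T\<close>, \<open>M\<close> and \<open>C\<close> depend on the data only through
  \<open>M0\<close> and \<open>X0\<close>, because continuous dependence needs one interval for all
  nearby data. The contraction is in the norm of order s; its consequence at each frequency gives
  pointwise convergence, through which the limit is identified.\<close>

lemma fourier_sol_exists:
  assumes M0: "0 \<le> M0" and X0: "0 \<le> X0"
  obtains T M C :: real where "0 < T" "0 \<le> M" "0 \<le> C"
    "\<And>h. Borel h \<Longrightarrow> nrm s (cabs h) \<le> ennreal M0 \<Longrightarrow> xnrm s (cabs h) \<le> ennreal X0 \<Longrightarrow>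
      (\<And>\<z>. h (- \<z>) = cnj (h \<z>)) \<Longrightarrow> (\<And>\<z>. ah (- \<z>) = cnj (ah \<z>)) \<Longrightarrow>
      \<exists>u. fourier_sol T h u \<and> nrm s (env T u) \<le> ennreal M \<and> (\<forall>t\<in>{0..T}. \<forall>\<z>. u t (- \<z>) = cnj (u t \<z>))"
    "\<And>h k u v. fourier_sol T h u \<Longrightarrow> fourier_sol T k v \<Longrightarrow> nrm s (env T u) \<le> ennreal M \<Longrightarrow> nrm s (env T v) \<le> ennreal M \<Longrightarrow>
      nrm s (env T (\<lambda>t \<z>. u t \<z> - v t \<z>)) + xnrm s (env T (\<lambda>t \<z>. u t \<z> - v t \<z>))
        + nrm (s - 2) (env T (\<lambda>t \<z>. rhsf (u t) \<z> - rhsf (v t) \<z>))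
      \<le> ennreal C * (nrm s (cabs (\<lambda>\<z>. h \<z> - k \<z>)) + xnrm s (cabs (\<lambda>\<z>. h \<z> - k \<z>)))"
    "\<And>h u. fourier_sol T h u \<Longrightarrow> xnrm s (cabs h) < \<infinity> \<Longrightarrow> xnrm s (env T u) < \<infinity>"
proof -
  have s1: "1 < s" using s by simp
  obtain K where K: "1 \<le> K"
    "\<And>T D D' P E. 0 < T \<Longrightarrow> linsys0 T D D' P E \<Longrightarrow>
      nrm s (env T D) \<le> 2 * nrm s (cabs (D 0)) + ennreal (K * T\<^sup>2) * (nrm s (env T P) + nrm s (env T E))"
    "\<And>T D D' P E \<z>. 0 < T \<Longrightarrow> linsys0 T D D' P E \<Longrightarrow> (\<And>\<z>. D 0 \<z> = 0) \<Longrightarrow>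
      (env T D \<z>)\<^sup>2 \<le> ennreal (K * T\<^sup>2) * ((env T P \<z>)\<^sup>2 + nrm s (env T E))"
    "\<And>T D D' P E E'. 0 < T \<Longrightarrow> T \<le> 1 \<Longrightarrow> linsys T D D' P E E' \<Longrightarrow>
      xnrm s (env T D) \<le> ennreal K * (xnrm s (cabs (D 0)) + nrm s (env T P) + nrm s (env T E)) + ennreal (K * T\<^sup>2) * nrm (s - 2) (env T E')"
    "\<And>T D D' P E. 0 < T \<Longrightarrow> linsys0 T D D' P E \<Longrightarrow>
      nrm (s - 2) (env T D') \<le> ennreal K * (nrm s (env T D) + xnrm s (env T D) + nrm s (env T P) + nrm s (env T E))"
    using linear_estimates by blast
  \<comment> \<open>The linear estimate doubles the squared norm of the data, and smallness of
    \<open>T\<close> leaves at most 1 for the forcing.\<close>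
  define M1 where "M1 = 2 * M0 + 1"
  have M1: "0 \<le> M1" using M0 by (simp add: M1_def)
  obtain L where L: "1 \<le> L" "\<And>T u v. path T u \<Longrightarrow> path T v \<Longrightarrow> nrm s (env T u) \<le> ennreal M1 \<Longrightarrow> nrm s (env T v) \<le> ennreal M1 \<Longrightarrow>
     path T (\<lambda>t. cpow p (u t)) \<and> nrm s (env T (\<lambda>t. cpow p (u t))) \<le> ennreal L \<and>
     nrm s (env T (\<lambda>t \<z>. cpow p (u t) \<z> - cpow p (v t) \<z>)) \<le> ennreal L * nrm s (env T (\<lambda>t \<z>. u t \<z> - v t \<z>)) \<and>
     (\<forall>\<z>. (env T (\<lambda>t \<z>. cpow p (u t) \<z> - cpow p (v t) \<z>) \<z>)\<^sup>2 \<le> ennreal L * nrm s (env T (\<lambda>t \<z>. u t \<z> - v t \<z>)))"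
    using cpow_Lipschitz[OF s1 M1, of p] p by blast
  \<comment> \<open>\<open>M2\<close> bounds the singular part of the norm and \<open>M3\<close> the
    time derivative. Each is estimated by the other, so \<open>M2\<close> is fixed with 1 in place
    of \<open>K * T\<^sup>2 * M3\<close>, and \<open>T\<close> is chosen after \<open>M3\<close> to
    justify this.\<close>
  define M2 where "M2 = K * (X0 + L + M1) + 1"
  define M3 where "M3 = K * (M1 + M2 + L + M1)"
  have M23: "0 \<le> M2" "0 \<le> M3" using K(1) X0 L(1) M1 by (auto simp: M2_def M3_def)
  \<comment> \<open>\<open>Q\<close> dominates everything that \<open>T\<^sup>2\<close> has to
    compensate. As \<open>Q \<ge> 1\<close>, the choice \<open>T = 1 / Q\<close> gives
    \<open>T\<^sup>2 * Q \<le> 1\<close>.\<close>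
  define Q where "Q = 2 * K * (L + M1 + 1) + K * M3 + 2 * K * K + 1"
  have Qnn: "0 \<le> 2 * K * (L + M1 + 1)" "0 \<le> K * M3" "0 \<le> 2 * K * K" using K(1) L(1) M1 M23 by auto
  then have Q: "1 \<le> Q" by (simp add: Q_def)
  define T where "T = 1 / Q"
  have T: "0 < T" "T \<le> 1" using Q by (auto simp: T_def)
  have T2Q: "T\<^sup>2 * Q \<le> 1" using Q T by (simp add: T_def power2_eq_square)
  have T2: "y * T\<^sup>2 \<le> 1" if "y \<le> Q" for y
    using mult_left_mono[OF that, of "T\<^sup>2"] T2Q by (simp add: mult.commute)
  have small: "K * T\<^sup>2 * (L + M1) \<le> 1" "K * T\<^sup>2 * (L + 1) \<le> 1/2" "K * T\<^sup>2 * M3 \<le> 1" "K * (K * T\<^sup>2) \<le> 1/2"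
  proof -
    have q1: "K * (L + M1) \<le> Q" "2 * (K * (L + 1)) \<le> Q" "K * M3 \<le> Q" "2 * (K * K) \<le> Q"
    proof -
      have nn: "0 \<le> K * L" "0 \<le> K * M1" "0 \<le> K * K" "0 \<le> K * M3" using K(1) L(1) M1 M23 by auto
      have Q': "Q = 2 * (K * L) + 2 * (K * M1) + 2 * K + K * M3 + 2 * (K * K) + 1" by (simp add: Q_def algebra_simps)
      show "K * (L + M1) \<le> Q" using nn K(1) unfolding Q' distrib_left by linarith
      show "2 * (K * (L + 1)) \<le> Q" using nn K(1) unfolding Q' distrib_left by linarith
      show "K * M3 \<le> Q" using nn K(1) unfolding Q' by linarith
      show "2 * (K * K) \<le> Q" using nn K(1) unfolding Q' by linarith
    qed
    show "K * T\<^sup>2 * (L + M1) \<le> 1" using T2[OF q1(1)] by (simp add: ac_simps)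
    show "K * T\<^sup>2 * (L + 1) \<le> 1/2" using T2[OF q1(2)] by (simp only: ac_simps)
    show "K * T\<^sup>2 * M3 \<le> 1" using T2[OF q1(3)] by (simp add: ac_simps)
    show "K * (K * T\<^sup>2) \<le> 1/2" using T2[OF q1(4)] by (simp add: ac_simps)
  qed
  have contract: "ennreal (K * T\<^sup>2) * (ennreal L * x + x) \<le> ennreal (1/2) * x" for x :: ennreal
  proof -
    have "ennreal L * x + x = ennreal (L + 1) * x" using L(1) by (simp add: distrib_right)
    then have "ennreal (K * T\<^sup>2) * (ennreal L * x + x) = ennreal (K * T\<^sup>2 * (L + 1)) * x"
      using K(1) L(1) by (simp add: ennreal_mult mult.assoc)
    also have "\<dots> \<le> ennreal (1/2) * x" using small by (intro mult_right_mono ennreal_leI) auto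
    finally show ?thesis .
  qed
  have exist: "\<exists>u. fourier_sol T h u \<and> nrm s (env T u) \<le> ennreal M1 \<and> (\<forall>t\<in>{0..T}. \<forall>\<z>. u t (- \<z>) = cnj (u t \<z>))"
    if hm[measurable]: "Borel h" and hM: "nrm s (cabs h) \<le> ennreal M0" and hX: "xnrm s (cabs h) \<le> ennreal X0"
      and hh: "\<And>\<z>. h (- \<z>) = cnj (h \<z>)" and ahh: "\<And>\<z>. ah (- \<z>) = cnj (ah \<z>)" for h
  proof -
    define duh where "duh P E = duhamel (phi \<gamma>) h (\<lambda>t. forcing (P t) (E t))" for P E
    define Dd where "Dd P E = (\<lambda>t \<z>. - \<i> * complex_of_real (phi \<gamma> \<z>) * duh P E t \<z> + forcing (P t) (E t) \<z>)" for P E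
    have duh0: "duh P E 0 \<z> = h \<z>" for P E \<z> by (simp add: duh_def)
    have duhL: "linsys0 T (duh P E) (Dd P E) P E" if "path T P" "path T E" "nrm s (env T P) < \<infinity>" "nrm s (env T E) < \<infinity>" for P E
      unfolding duh_def Dd_def by (rule duhamel_linsys0[OF that hm])
    \<comment> \<open>One Picard step reproduces the bounds \<open>M1\<close> for the function and
      \<open>M3\<close> for its derivative. The bound \<open>M2\<close> for the singular part of the
      output lies between the two: it uses the derivative of the input and yields that of the
      output.\<close>
    have step: "linsys T (duh P E) (Dd P E) P E E' \<and> nrm s (env T (duh P E)) \<le> ennreal M1 \<and> nrm (s - 2) (env T (Dd P E)) \<le> ennreal M3"
      if P: "path T P" "nrm s (env T P) \<le> ennreal L" and E: "dpath T E E'" "nrm s (env T E) \<le> ennreal M1" "nrm (s - 2) (env T E') \<le> ennreal M3" for P E E'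
    proof -
      have fin: "nrm s (env T P) < \<infinity>" "nrm s (env T E) < \<infinity>" "nrm (s-2) (env T E') < \<infinity>"
        using P(2) E(2,3) by (auto intro: order.strict_trans1)
      have L0: "linsys0 T (duh P E) (Dd P E) P E" by (rule duhL[OF P(1) dpath_path(1)[OF E(1)] fin(1,2)])
      then have LL: "linsys T (duh P E) (Dd P E) P E E'" using E(1) fin(3) by (simp add: linsys_def)
      have D0: "cabs (duh P E 0) = cabs h" by (simp add: duh0)
      have "nrm s (env T (duh P E)) \<le> 2 * nrm s (cabs h) + ennreal (K * T\<^sup>2) * (nrm s (env T P) + nrm s (env T E))"
        using K(2)[OF T(1) L0] unfolding D0 .
      also have "\<dots> \<le> 2 * ennreal M0 + ennreal (K * T\<^sup>2) * (ennreal L + ennreal M1)"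
        by (intro add_mono mult_left_mono hM P(2) E(2)) auto
      also have "\<dots> = ennreal (2 * M0 + K * T\<^sup>2 * (L + M1))"
      proof -
        have "ennreal (2 * M0 + K * T\<^sup>2 * (L + M1)) = ennreal (2 * M0) + ennreal (K * T\<^sup>2 * (L + M1))"
          using M0 K(1) L(1) M1 by (intro ennreal_plus) auto
        also have "ennreal (2 * M0) = 2 * ennreal M0" using M0 by (simp add: ennreal_mult)
        also have "ennreal (K * T\<^sup>2 * (L + M1)) = ennreal (K * T\<^sup>2) * ennreal (L + M1)"
          using K(1) L(1) M1 by (intro ennreal_mult) auto
        also have "ennreal (L + M1) = ennreal L + ennreal M1" using L(1) M1 by (intro ennreal_plus) auto
        finally show ?thesis ..
      qed
      also have "\<dots> \<le> ennreal M1" unfolding M1_def[symmetric] using small(1) by (intro ennreal_leI) (simp add: M1_def)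
      finally have r1: "nrm s (env T (duh P E)) \<le> ennreal M1" .
      have "xnrm s (env T (duh P E)) \<le> ennreal K * (xnrm s (cabs h) + nrm s (env T P) + nrm s (env T E)) + ennreal (K * T\<^sup>2) * nrm (s - 2) (env T E')"
        using K(4)[OF T LL] unfolding D0 .
      also have "\<dots> \<le> ennreal K * (ennreal X0 + ennreal L + ennreal M1) + ennreal (K * T\<^sup>2) * ennreal M3"
        by (intro add_mono mult_left_mono hX P(2) E(2,3)) auto
      also have "\<dots> = ennreal (K * (X0 + L + M1) + K * T\<^sup>2 * M3)"
      proof -
        have "ennreal (K * (X0 + L + M1) + K * T\<^sup>2 * M3) = ennreal (K * (X0 + L + M1)) + ennreal (K * T\<^sup>2 * M3)"
          using K(1) X0 L(1) M1 M23 by (intro ennreal_plus) auto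
        also have "ennreal (K * T\<^sup>2 * M3) = ennreal (K * T\<^sup>2) * ennreal M3"
          using K(1) M23 by (intro ennreal_mult) auto
        also have "ennreal (K * (X0 + L + M1)) = ennreal K * ennreal (X0 + L + M1)"
          using K(1) X0 L(1) M1 by (intro ennreal_mult) auto
        also have "ennreal (X0 + L + M1) = ennreal X0 + ennreal L + ennreal M1"
          using X0 L(1) M1 by (simp add: ennreal_plus)
        finally show ?thesis ..
      qed
      also have "\<dots> \<le> ennreal M2" using small(3) by (intro ennreal_leI) (simp add: M2_def)
      finally have r2: "xnrm s (env T (duh P E)) \<le> ennreal M2" .
      have "nrm (s - 2) (env T (Dd P E)) \<le> ennreal K * (nrm s (env T (duh P E)) + xnrm s (env T (duh P E)) + nrm s (env T P) + nrm s (env T E))"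
        by (rule K(5)[OF T(1) L0])
      also have "\<dots> \<le> ennreal K * (ennreal M1 + ennreal M2 + ennreal L + ennreal M1)"
        by (intro add_mono mult_left_mono r1 r2 P(2) E(2)) auto
      also have "\<dots> = ennreal M3" unfolding M3_def
        using K(1) L(1) M1 M23 by (simp add: ennreal_mult ennreal_plus[symmetric] del: ennreal_plus)
      finally show ?thesis using LL r1 by blast
    qed
    \<comment> \<open>Zero input makes the first iterate the free evolution of
      \<open>h\<close>.\<close>
    define z0 :: "real \<Rightarrow> plane \<Rightarrow> complex" where "z0 = (\<lambda>t \<z>. 0)"
    define U where "U = rec_nat (duh z0 z0) (\<lambda>n v. duh (\<lambda>t. cpow p (v t)) v)"
    have U0: "U 0 = duh z0 z0" and US: "\<And>n. U (Suc n) = duh (\<lambda>t. cpow p (U n t)) (U n)" by (auto simp: U_def)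
    \<comment> \<open>\<open>Pn\<close> and \<open>En\<close> are the inputs from which the iterate
      \<open>U n\<close> is built, so that the derivative \<open>U'\<close> has one formula for all
      indices.\<close>
    define Pn where "Pn n = (case n of 0 \<Rightarrow> z0 | Suc m \<Rightarrow> (\<lambda>t. cpow p (U m t)))" for n
    define En where "En n = (case n of 0 \<Rightarrow> z0 | Suc m \<Rightarrow> U m)" for n
    define U' where "U' n = Dd (Pn n) (En n)" for n
    have Ueq: "U n = duh (Pn n) (En n)" for n by (cases n) (auto simp: Pn_def En_def U0 US)
    have envz: "env T z0 \<z> = 0" for \<z> using T by (simp add: env_def z0_def)
    have nz: "nrm r (env T z0) = 0" for r by (simp add: nrm_def envz)
    have pz: "path T z0" unfolding z0_def by (intro path_const) simp
    have dz: "dpath T z0 z0" unfolding dpath_def using pz by (auto simp: z0_def)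
    have inv: "dpath T (U n) (U' n) \<and> nrm s (env T (U n)) \<le> ennreal M1 \<and> nrm (s - 2) (env T (U' n)) \<le> ennreal M3" for n
    proof (induction n)
      case 0
      have "linsys T (duh z0 z0) (Dd z0 z0) z0 z0 z0 \<and> nrm s (env T (duh z0 z0)) \<le> ennreal M1 \<and> nrm (s - 2) (env T (Dd z0 z0)) \<le> ennreal M3"
        by (rule step) (auto simp: pz dz nz)
      then show ?case unfolding Ueq U'_def by (auto simp: Pn_def En_def linsys_def linsys0_def)
    next
      case (Suc n)
      note pU = dpath_path(1)[OF conjunct1[OF Suc]]
      have "linsys T (duh (\<lambda>t. cpow p (U n t)) (U n)) (Dd (\<lambda>t. cpow p (U n t)) (U n)) (\<lambda>t. cpow p (U n t)) (U n) (U' n)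
         \<and> nrm s (env T (duh (\<lambda>t. cpow p (U n t)) (U n))) \<le> ennreal M1 \<and> nrm (s - 2) (env T (Dd (\<lambda>t. cpow p (U n t)) (U n))) \<le> ennreal M3"
        using Suc L(2)[OF pU pU] by (intro step) auto
      then show ?case unfolding US U'_def by (auto simp: Pn_def En_def linsys_def linsys0_def)
    qed
    have pU: "path T (U n)" and nU: "nrm s (env T (U n)) \<le> ennreal M1" and pU': "path T (U' n)" for n
      using inv[of n] dpath_path by blast+
    have fU: "nrm s (env T (U n)) < \<infinity>" for n using nU[of n] by (auto intro: order.strict_trans1)
    have LS: "linsys0 T (U (Suc n)) (U' (Suc n)) (\<lambda>t. cpow p (U n t)) (U n)" for n
    proof -
      have "nrm s (env T (\<lambda>t. cpow p (U n t))) < \<infinity>" using L(2)[OF pU[of n] pU[of n] nU nU] by (auto intro: order.strict_trans1)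
      then show ?thesis unfolding US U'_def Pn_def En_def
        using duhL[of "\<lambda>t. cpow p (U n t)" "U n"] L(2)[OF pU[of n] pU[of n] nU nU] pU fU by simp
    qed
    \<comment> \<open>\<open>4 * M1\<close> bounds the squared distance of two iterates of squared
      norm at most \<open>M1\<close>; each step halves it.\<close>
    define B where "B n = (1/2) ^ n * (4 * M1)" for n
    have B: "0 \<le> B n" "ennreal (1/2) * ennreal (B n) = ennreal (B (Suc n))" for n
    proof -
      show "0 \<le> B n" using M1 by (simp add: B_def)
      then show "ennreal (1/2) * ennreal (B n) = ennreal (B (Suc n))"
        by (subst ennreal_mult[symmetric]) (simp_all add: B_def)
    qed
    have cau: "nrm s (env T (\<lambda>t \<z>. U (n + m) t \<z> - U n t \<z>)) \<le> ennreal (B n)" for n m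
    proof (induction n)
      case 0
      have "nrm s (env T (\<lambda>t \<z>. U (0 + m) t \<z> - U 0 t \<z>)) \<le> 2 * nrm s (env T (U (0 + m))) + 2 * nrm s (env T (U 0))"
        by (rule nrm_env_diff_le[OF pU pU])
      also have "\<dots> \<le> 2 * ennreal M1 + 2 * ennreal M1" by (intro add_mono mult_left_mono nU) auto
      also have "\<dots> = ennreal (B 0)" using M1 by (simp add: B_def ennreal_mult mult_2[symmetric] mult.assoc[symmetric] flip: distrib_right)
      finally show ?case .
    next
      case (Suc n)
      let ?d = "nrm s (env T (\<lambda>t \<z>. U (n + m) t \<z> - U n t \<z>))"
      have "nrm s (env T (\<lambda>t \<z>. U (Suc (n + m)) t \<z> - U (Suc n) t \<z>))
         \<le> 2 * nrm s (cabs (\<lambda>\<z>. U (Suc (n + m)) 0 \<z> - U (Suc n) 0 \<z>)) + ennreal (K * T\<^sup>2) * (nrm s (env T (\<lambda>t \<z>. cpow p (U (n + m) t) \<z> - cpow p (U n t) \<z>)) + ?d)"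
        by (rule K(2)[OF T(1) linsys0_diff[OF LS LS]])
      also have "nrm s (cabs (\<lambda>\<z>. U (Suc (n + m)) 0 \<z> - U (Suc n) 0 \<z>)) = 0" by (simp add: US duh0 nrm_def)
      also have "2 * 0 + ennreal (K * T\<^sup>2) * (nrm s (env T (\<lambda>t \<z>. cpow p (U (n + m) t) \<z> - cpow p (U n t) \<z>)) + ?d) \<le> 0 + ennreal (K * T\<^sup>2) * (ennreal L * ?d + ?d)"
        using L(2)[OF pU[of "n+m"] pU[of n] nU nU] by (intro add_mono mult_left_mono) auto
      also have "\<dots> \<le> ennreal (1/2) * ?d" using contract by simp
      also have "\<dots> \<le> ennreal (1/2) * ennreal (B n)" by (intro mult_left_mono Suc) auto
      finally show ?case using B(2)[of n] by simp
    qed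
    \<comment> \<open>A step bounds the new difference at each frequency by the norm of the old one,
      so the pointwise estimate begins with the index \<open>Suc n\<close>.\<close>
    have cau_sup: "(env T (\<lambda>t \<z>. U (Suc n + m) t \<z> - U (Suc n) t \<z>) \<z>)\<^sup>2 \<le> ennreal (B (Suc n))" for n m \<z>
    proof -
      let ?d = "nrm s (env T (\<lambda>t \<z>. U (n + m) t \<z> - U n t \<z>))"
      have "(env T (\<lambda>t \<z>. U (Suc (n + m)) t \<z> - U (Suc n) t \<z>) \<z>)\<^sup>2
         \<le> ennreal (K * T\<^sup>2) * ((env T (\<lambda>t \<z>. cpow p (U (n + m) t) \<z> - cpow p (U n t) \<z>) \<z>)\<^sup>2 + ?d)"
        by (rule K(3)[OF T(1) linsys0_diff[OF LS LS]]) (simp add: US duh0)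
      also have "\<dots> \<le> ennreal (K * T\<^sup>2) * (ennreal L * ?d + ?d)"
      proof -
        have "(env T (\<lambda>t \<z>. cpow p (U (n + m) t) \<z> - cpow p (U n t) \<z>) \<z>)\<^sup>2 \<le> ennreal L * ?d"
          using L(2)[OF pU[of "n+m"] pU[of n] nU nU] by blast
        then show ?thesis by (intro mult_left_mono add_right_mono) simp_all
      qed
      also have "\<dots> \<le> ennreal (1/2) * ?d" by (rule contract)
      also have "\<dots> \<le> ennreal (1/2) * ennreal (B n)" by (intro mult_left_mono cau) auto
      finally show ?thesis using B(2)[of n] by simp
    qed
    define \<rho> where "\<rho> n = sqrt (B (Suc n))" for n
    have \<rho>: "\<rho> \<longlonglongrightarrow> 0"
    proof -
      have "(\<lambda>n. (1/2::real) ^ n) \<longlonglongrightarrow> 0" by (rule LIMSEQ_realpow_zero) auto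
      then have "B \<longlonglongrightarrow> 0 * (4 * M1)" unfolding B_def[abs_def] by (rule tendsto_mult_right)
      then have "(\<lambda>n. B (Suc n)) \<longlonglongrightarrow> 0" using LIMSEQ_Suc by simp
      from tendsto_real_sqrt[OF this] show ?thesis by (simp add: \<rho>_def[abs_def])
    qed
    have pt: "cmod (U (Suc n + m) t \<z> - U (Suc n) t \<z>) \<le> \<rho> n" if t: "t \<in> {0..T}" for n m t \<z>
    proof -
      have "(ennreal (cmod (U (Suc n + m) t \<z> - U (Suc n) t \<z>)))\<^sup>2 \<le> ennreal (B (Suc n))"
        using order_trans[OF ennreal_square_mono[OF env_upper[OF t]] cau_sup] .
      then have "(cmod (U (Suc n + m) t \<z> - U (Suc n) t \<z>))\<^sup>2 \<le> B (Suc n)" using B(1)[of "Suc n"] by (simp add: ennreal_power)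
      then show ?thesis unfolding \<rho>_def by (rule real_le_rsqrt)
    qed
    define u where "u t \<z> = lim (\<lambda>n. U (Suc n) t \<z>)" for t \<z>
    have lim: "(\<lambda>n. U (Suc n) t \<z>) \<longlonglongrightarrow> u t \<z>" if t: "t \<in> {0..T}" for t \<z>
    proof -
      have "Cauchy (\<lambda>n. U (Suc n) t \<z>)"
      proof (rule metric_CauchyI)
        fix e :: real assume "0 < e"
        then have "\<forall>\<^sub>F n in sequentially. \<rho> n < e/2" by (intro order_tendstoD(2)[OF \<rho>]) simp
        then obtain N where N: "\<rho> N < e/2" by (auto simp: eventually_sequentially)
        have b: "cmod (U (Suc n) t \<z> - U (Suc N) t \<z>) < e/2" if "N \<le> n" for n
          using pt[OF t, of N "n - N" \<z>] N that by simp
        have "dist (U (Suc m) t \<z>) (U (Suc n) t \<z>) < e" if "N \<le> m" "N \<le> n" for m n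
          using b[OF that(1)] b[OF that(2)] dist_triangle_half_l[of "U (Suc m) t \<z>" "U (Suc N) t \<z>" e "U (Suc n) t \<z>"] by (simp add: dist_norm)
        then show "\<exists>M. \<forall>m\<ge>M. \<forall>n\<ge>M. dist (U (Suc m) t \<z>) (U (Suc n) t \<z>) < e" by blast
      qed
      then show ?thesis unfolding u_def using Cauchy_convergent convergent_LIMSEQ_iff by blast
    qed
    have ubd: "cmod (u t \<z> - U (Suc n) t \<z>) \<le> \<rho> n" if t: "t \<in> {0..T}" for n t \<z>
    proof (rule LIMSEQ_le_const2)
      show "(\<lambda>m. cmod (U (Suc (m + n)) t \<z> - U (Suc n) t \<z>)) \<longlonglongrightarrow> cmod (u t \<z> - U (Suc n) t \<z>)"
        by (intro tendsto_intros LIMSEQ_ignore_initial_segment[OF lim[OF t], of n])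
      show "\<exists>N. \<forall>m\<ge>N. cmod (U (Suc (m + n)) t \<z> - U (Suc n) t \<z>) \<le> \<rho> n"
        using pt[OF t, of n _ \<z>] by (auto simp: add.commute)
    qed
    have pu: "path T u" by (rule path_limit[OF pU ubd \<rho>])
    have nu: "nrm s (env T u) \<le> ennreal M1" by (rule nrm_env_le_limit[OF pU lim nU])
    have fu: "nrm s (env T u) < \<infinity>" using nu by (auto intro: order.strict_trans1)
    have udiff: "nrm s (env T (\<lambda>t \<z>. u t \<z> - U n t \<z>)) \<le> ennreal (B n)" for n
    proof (rule nrm_env_le_limit)
      show "path T (\<lambda>t \<z>. U (n + Suc m) t \<z> - U n t \<z>)" for m by (rule path_diff[OF pU pU])
      show "(\<lambda>m. U (n + Suc m) t \<z> - U n t \<z>) \<longlonglongrightarrow> u t \<z> - U n t \<z>" if t: "t \<in> {0..T}" for t \<z>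
        using LIMSEQ_ignore_initial_segment[OF lim[OF t], of n] by (intro tendsto_intros) (simp add: add.commute)
      show "nrm s (env T (\<lambda>t \<z>. U (n + Suc m) t \<z> - U n t \<z>)) \<le> ennreal (B n)" for m by (rule cau)
    qed
    have Cu: "path T (\<lambda>t. cpow p (u t))" "nrm s (env T (\<lambda>t. cpow p (u t))) \<le> ennreal L" using L(2)[OF pu pu nu nu] by auto
    have Cuf: "nrm s (env T (\<lambda>t. cpow p (u t))) < \<infinity>" using Cu(2) by (auto intro: order.strict_trans1)
    \<comment> \<open>Of the limit \<open>u\<close> only continuity in time is known. Its Duhamel
      image \<open>v\<close> satisfies the differential equation by construction, and on [0,T] it
      equals \<open>u\<close>, being a limit of the same iterates.\<close>
    define v where "v = duh (\<lambda>t. cpow p (u t)) u"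
    have Lv: "linsys0 T v (Dd (\<lambda>t. cpow p (u t)) u) (\<lambda>t. cpow p (u t)) u" unfolding v_def by (rule duhL[OF Cu(1) pu Cuf fu])
    have veq: "v t \<z> = u t \<z>" if t: "t \<in> {0..T}" for t \<z>
    proof -
      have le: "cmod (v t \<z> - U (Suc n) t \<z>) \<le> \<rho> n" for n
      proof -
        let ?d = "nrm s (env T (\<lambda>t \<z>. u t \<z> - U n t \<z>))"
        have "(env T (\<lambda>t \<z>. v t \<z> - U (Suc n) t \<z>) \<z>)\<^sup>2 \<le> ennreal (K * T\<^sup>2) * ((env T (\<lambda>t \<z>. cpow p (u t) \<z> - cpow p (U n t) \<z>) \<z>)\<^sup>2 + ?d)"
          by (rule K(3)[OF T(1) linsys0_diff[OF Lv LS]]) (simp add: US duh0 v_def)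
        also have "\<dots> \<le> ennreal (K * T\<^sup>2) * (ennreal L * ?d + ?d)"
        proof -
          have "(env T (\<lambda>t \<z>. cpow p (u t) \<z> - cpow p (U n t) \<z>) \<z>)\<^sup>2 \<le> ennreal L * ?d"
            using L(2)[OF pu pU[of n] nu nU] by blast
          then show ?thesis by (intro mult_left_mono add_right_mono) simp_all
        qed
        also have "\<dots> \<le> ennreal (1/2) * ?d" by (rule contract)
        also have "\<dots> \<le> ennreal (1/2) * ennreal (B n)" by (intro mult_left_mono udiff) auto
        finally have "(env T (\<lambda>t \<z>. v t \<z> - U (Suc n) t \<z>) \<z>)\<^sup>2 \<le> ennreal (B (Suc n))" using B(2)[of n] by simp
        then have "(ennreal (cmod (v t \<z> - U (Suc n) t \<z>)))\<^sup>2 \<le> ennreal (B (Suc n))"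
          by (rule order_trans[OF ennreal_square_mono[OF env_upper[OF t, of "\<lambda>t \<z>. v t \<z> - U (Suc n) t \<z>"]]])
        then have "(cmod (v t \<z> - U (Suc n) t \<z>))\<^sup>2 \<le> B (Suc n)" using B(1)[of "Suc n"] by (simp add: ennreal_power)
        then show ?thesis unfolding \<rho>_def by (rule real_le_rsqrt)
      qed
      have "(\<lambda>n. v t \<z> - U (Suc n) t \<z>) \<longlonglongrightarrow> 0" by (rule Lim_null_comparison[OF _ \<rho>]) (simp add: le)
      from tendsto_diff[OF tendsto_const[of "v t \<z>"] this] have "(\<lambda>n. U (Suc n) t \<z>) \<longlonglongrightarrow> v t \<z>" by simp
      then show ?thesis using LIMSEQ_unique lim[OF t] by blast
    qed
    have veq': "v t = u t" if "t \<in> {0..T}" for t using veq[OF that] by (intro ext)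
    have pv: "path T v" by (rule path_cong[OF _ pu]) (simp add: veq)
    have env_v: "env T v = env T u" by (rule env_cong) (rule veq)
    have rv: "Dd (\<lambda>t. cpow p (u t)) u t \<z> = rhsf (v t) \<z>" if "t \<in> {0..T}" for t \<z>
      unfolding Dd_def v_def[symmetric] rhsf_def by (simp add: veq'[OF that])
    have prv: "path T (\<lambda>t. rhsf (v t))"
      by (rule path_cong[OF rv]) (use Lv in \<open>auto simp: linsys0_def dpath_def\<close>)
    have cv: "env T (\<lambda>t. cpow p (v t)) = env T (\<lambda>t. cpow p (u t))" by (rule env_cong) (simp add: veq')
    have dv: "dpath T v (\<lambda>t. rhsf (v t))"
      unfolding dpath_def
    proof (intro conjI allI ballI pv prv)
      fix \<z> t assume t: "t \<in> {0..T}"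
      have "((\<lambda>t. v t \<z>) has_vector_derivative Dd (\<lambda>t. cpow p (u t)) u t \<z>) (at t within {0..T})"
        using Lv t dpath_deriv unfolding linsys0_def by blast
      then show "((\<lambda>t. v t \<z>) has_vector_derivative rhsf (v t) \<z>) (at t within {0..T})" using rv[OF t] by simp
    qed
    have L0v: "linsys0 T v (\<lambda>t. rhsf (v t)) (\<lambda>t. cpow p (v t)) v"
      unfolding linsys0_def cv env_v
      using dv pv Cuf fu path_cong[OF _ Cu(1), of "\<lambda>t. cpow p (v t)"] veq' by (auto simp: rhsf_def)
    \<comment> \<open>The bound for the derivatives passes to the limit by Fatou, once they converge
      at each frequency. The derivative of \<open>U (Suc (Suc n))\<close> has its forcing built from
      \<open>U (Suc n)\<close>, the index for which the limit was established.\<close>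
    have nv': "nrm (s - 2) (env T (\<lambda>t. rhsf (v t))) \<le> ennreal M3"
    proof (rule nrm_env_le_limit[where U="\<lambda>n. U' (Suc (Suc n))"])
      show "path T (U' (Suc (Suc n)))" for n by (rule pU')
      show "nrm (s - 2) (env T (U' (Suc (Suc n)))) \<le> ennreal M3" for n using inv by blast
      fix t \<z> assume t: "t \<in> {0..T}"
      have "(\<lambda>n. forcing (cpow p (U (Suc n) t)) (U (Suc n) t) \<z>) \<longlonglongrightarrow> forcing (cpow p (u t)) (u t) \<z>"
      proof -
        obtain Ka where Ka: "1 \<le> Ka" "\<And>B \<z>. Borel B \<Longrightarrow> (aE B \<z>)\<^sup>2 \<le> ennreal Ka * nrm s B"
          using aE_bounds by metis
        have 1: "(\<lambda>n. cpow p (u t) \<z> - cpow p (U (Suc n) t) \<z>) \<longlonglongrightarrow> 0"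
        proof (rule Lim_null_comparison[where g="\<lambda>n. sqrt L * \<rho> n"])
          have "cmod (cpow p (u t) \<z> - cpow p (U (Suc n) t) \<z>) \<le> sqrt L * \<rho> n" for n
          proof -
            have "(ennreal (cmod (cpow p (u t) \<z> - cpow p (U (Suc n) t) \<z>)))\<^sup>2 \<le> (env T (\<lambda>t \<z>. cpow p (u t) \<z> - cpow p (U (Suc n) t) \<z>) \<z>)\<^sup>2"
              by (intro ennreal_square_mono env_upper[OF t, of "\<lambda>t \<z>. cpow p (u t) \<z> - cpow p (U (Suc n) t) \<z>"])
            also have "\<dots> \<le> ennreal L * nrm s (env T (\<lambda>t \<z>. u t \<z> - U (Suc n) t \<z>))" using L(2)[OF pu pU[of "Suc n"] nu nU] by blast
            also have "\<dots> \<le> ennreal L * ennreal (B (Suc n))" by (intro mult_left_mono udiff) auto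
            finally have "(cmod (cpow p (u t) \<z> - cpow p (U (Suc n) t) \<z>))\<^sup>2 \<le> L * B (Suc n)"
              using B(1)[of "Suc n"] L(1) by (simp add: ennreal_power ennreal_mult[symmetric])
            then show ?thesis unfolding \<rho>_def by (simp add: real_sqrt_mult[symmetric] real_le_rsqrt)
          qed
          then show "\<forall>\<^sub>F n in sequentially. norm (cpow p (u t) \<z> - cpow p (U (Suc n) t) \<z>) \<le> sqrt L * \<rho> n" by simp
          show "(\<lambda>n. sqrt L * \<rho> n) \<longlonglongrightarrow> 0" using tendsto_mult_right_zero[OF \<rho>] by simp
        qed
        have 2: "(\<lambda>n. conv ah (\<lambda>\<z>. u t \<z> - U (Suc n) t \<z>) \<z>) \<longlonglongrightarrow> 0"
        proof (rule Lim_null_comparison[where g="\<lambda>n. sqrt Ka * \<rho> n"])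
          have "cmod (conv ah (\<lambda>\<z>. u t \<z> - U (Suc n) t \<z>) \<z>) \<le> sqrt Ka * \<rho> n" for n
          proof -
            have "(ennreal (cmod (conv ah (\<lambda>\<z>. u t \<z> - U (Suc n) t \<z>) \<z>)))\<^sup>2 \<le> (aE (env T (\<lambda>t \<z>. u t \<z> - U (Suc n) t \<z>)) \<z>)\<^sup>2"
              by (intro ennreal_square_mono conv_ah_bound[OF path_diff[OF pu pU] t, of "Suc n" \<z>])
            also have "\<dots> \<le> ennreal Ka * nrm s (env T (\<lambda>t \<z>. u t \<z> - U (Suc n) t \<z>))" by (intro Ka env_measurable path_diff pu pU)
            also have "\<dots> \<le> ennreal Ka * ennreal (B (Suc n))" by (intro mult_left_mono udiff) auto
            finally have "(cmod (conv ah (\<lambda>\<z>. u t \<z> - U (Suc n) t \<z>) \<z>))\<^sup>2 \<le> Ka * B (Suc n)"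
              using B(1)[of "Suc n"] Ka(1) by (simp add: ennreal_power ennreal_mult[symmetric])
            then show ?thesis unfolding \<rho>_def by (simp add: real_sqrt_mult[symmetric] real_le_rsqrt)
          qed
          then show "\<forall>\<^sub>F n in sequentially. norm (conv ah (\<lambda>\<z>. u t \<z> - U (Suc n) t \<z>) \<z>) \<le> sqrt Ka * \<rho> n" by simp
          show "(\<lambda>n. sqrt Ka * \<rho> n) \<longlonglongrightarrow> 0" using tendsto_mult_right_zero[OF \<rho>] by simp
        qed
        have fd: "forcing (\<lambda>\<z>. cpow p (u t) \<z> - cpow p (U (Suc n) t) \<z>) (\<lambda>\<z>. u t \<z> - U (Suc n) t \<z>) \<z>
           = forcing (cpow p (u t)) (u t) \<z> - forcing (cpow p (U (Suc n) t)) (U (Suc n) t) \<z>" for n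
          by (intro forcing_diff path_measurable[OF pu t] path_measurable[OF pU t]
            order.strict_trans1[OF nrm_cabs_le_env[OF t] fu] order.strict_trans1[OF nrm_cabs_le_env[OF t] fU])
        have "(\<lambda>n. forcing (\<lambda>\<z>. cpow p (u t) \<z> - cpow p (U (Suc n) t) \<z>) (\<lambda>\<z>. u t \<z> - U (Suc n) t \<z>) \<z>)
          \<longlonglongrightarrow> - \<i> * complex_of_real (mN p \<z>) * 0 - complex_of_real (mA \<z>) * (complex_of_real cF * 0)"
          unfolding forcing_def by (intro tendsto_intros 1 2)
        then have "(\<lambda>n. forcing (cpow p (u t)) (u t) \<z> - forcing (cpow p (U (Suc n) t)) (U (Suc n) t) \<z>) \<longlonglongrightarrow> 0"
          unfolding fd by simp
        from tendsto_diff[OF tendsto_const[of "forcing (cpow p (u t)) (u t) \<z>"] this] show ?thesis by simp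
      qed
      moreover have "(\<lambda>n. - \<i> * complex_of_real (phi \<gamma> \<z>) * U (Suc (Suc n)) t \<z>) \<longlonglongrightarrow> - \<i> * complex_of_real (phi \<gamma> \<z>) * u t \<z>"
        by (intro tendsto_intros LIMSEQ_Suc[OF lim[OF t]])
      ultimately have "(\<lambda>n. - \<i> * complex_of_real (phi \<gamma> \<z>) * U (Suc (Suc n)) t \<z> + forcing (cpow p (U (Suc n) t)) (U (Suc n) t) \<z>) \<longlonglongrightarrow> rhsf (v t) \<z>"
        unfolding rhsf_def veq'[OF t] by (rule tendsto_add[rotated])
      then show "(\<lambda>n. U' (Suc (Suc n)) t \<z>) \<longlonglongrightarrow> rhsf (v t) \<z>"
        by (simp add: U'_def Dd_def Pn_def En_def US)
    qed
    have "fourier_sol T h v"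
      unfolding fourier_sol_def linsys_def
      using L0v dv order.strict_trans1[OF nv'] by (auto simp: v_def duh0)
    \<comment> \<open>The data and \<open>ah\<close> are Hermitian and the phase is odd, so every
      iterate is Hermitian, and the limit inherits this.\<close>
    moreover have herm: "U n t (- \<z>) = cnj (U n t \<z>)" if "t \<in> {0..T}" for n t \<z>
      using that
    proof (induction n arbitrary: t \<z>)
      case 0
      have "conv ah (\<lambda>_. 0) \<z> = 0" for \<z> by (simp add: conv_def)
      then show ?case unfolding U0 duh_def by (intro duhamel_hermitian hh) (simp add: forcing_def z0_def)
    next
      case (Suc n)
      show ?case unfolding US duh_def
      proof (intro duhamel_hermitian hh forcing_hermitian ahh)
        fix \<tau> \<z> assume "\<tau> \<in> {0..t}"
        then have \<tau>: "\<tau> \<in> {0..T}" using Suc.prems by auto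
        show "U n \<tau> (- \<z>) = cnj (U n \<tau> \<z>)" using Suc.IH[OF \<tau>] .
        show "Borel (U n \<tau>)" by (rule path_measurable[OF pU \<tau>])
        show "cpow p (U n \<tau>) (- \<z>) = cnj (cpow p (U n \<tau>) \<z>)"
          using cpow_hermitian[of "U n \<tau>" p \<z>] Suc.IH[OF \<tau>] path_measurable[OF pU \<tau>] by blast
      qed
    qed
    have "v t (- \<z>) = cnj (v t \<z>)" if t: "t \<in> {0..T}" for t \<z>
    proof -
      have "(\<lambda>n. U (Suc n) t (- \<z>)) \<longlonglongrightarrow> cnj (u t \<z>)" unfolding herm[OF t] by (intro tendsto_cnj lim t)
      then show ?thesis using LIMSEQ_unique[OF lim[OF t, of "- \<z>"]] by (simp add: veq[OF t])
    qed
    ultimately show ?thesis using nu env_v by (intro exI[of _ v]) auto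
  qed
  have xfin: "xnrm s (env T u) < \<infinity>" if u: "fourier_sol T h u" and hx: "xnrm s (cabs h) < \<infinity>" for h u
  proof -
    have LL: "linsys T u (\<lambda>t. rhsf (u t)) (\<lambda>t. cpow p (u t)) u (\<lambda>t. rhsf (u t))" and u0: "cabs (u 0) = cabs h" using u by (auto simp: fourier_sol_def)
    have "xnrm s (env T u) \<le> ennreal K * (xnrm s (cabs h) + nrm s (env T (\<lambda>t. cpow p (u t))) + nrm s (env T u)) + ennreal (K * T\<^sup>2) * nrm (s - 2) (env T (\<lambda>t. rhsf (u t)))"
      using K(4)[OF T LL] unfolding u0 .
    also have "\<dots> < \<infinity>" using LL hx by (auto simp: linsys_def linsys0_def ennreal_mult_less_top)
    finally show ?thesis .
  qed
  \<comment> \<open>\<open>C2\<close> results from absorbing half of the singular part into the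
    left-hand side; \<open>C\<close> adds up the bounds for the three quantities to be
    estimated.\<close>
  define C2 where "C2 = 2 * K * (L + 1) + (L + 2)"
  define C where "C = 4 + (2 * K + C2 * 4) + K * ((L + 2) * 4 + (2 * K + C2 * 4))"
  have C2: "0 \<le> C2" using K(1) L(1) by (simp add: C2_def)
  have C: "0 < C" using K(1) L(1) C2 by (auto simp: C_def intro!: add_pos_nonneg)
  have dep: "nrm s (env T (\<lambda>t \<z>. u t \<z> - v t \<z>)) + xnrm s (env T (\<lambda>t \<z>. u t \<z> - v t \<z>))
        + nrm (s - 2) (env T (\<lambda>t \<z>. rhsf (u t) \<z> - rhsf (v t) \<z>))
      \<le> ennreal C * (nrm s (cabs (\<lambda>\<z>. h \<z> - k \<z>)) + xnrm s (cabs (\<lambda>\<z>. h \<z> - k \<z>)))"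
    if u: "fourier_sol T h u" and v: "fourier_sol T k v" and nu: "nrm s (env T u) \<le> ennreal M1" and nv: "nrm s (env T v) \<le> ennreal M1" for h k u v
  proof -
    have Lu: "linsys T u (\<lambda>t. rhsf (u t)) (\<lambda>t. cpow p (u t)) u (\<lambda>t. rhsf (u t))" and Lv: "linsys T v (\<lambda>t. rhsf (v t)) (\<lambda>t. cpow p (v t)) v (\<lambda>t. rhsf (v t))"
      and u0: "u 0 = h" and v0: "v 0 = k" using u v by (auto simp: fourier_sol_def)
    note LD = linsys_diff[OF Lu Lv]
    then have LD0: "linsys0 T (\<lambda>t \<z>. u t \<z> - v t \<z>) (\<lambda>t \<z>. rhsf (u t) \<z> - rhsf (v t) \<z>) (\<lambda>t \<z>. cpow p (u t) \<z> - cpow p (v t) \<z>) (\<lambda>t \<z>. u t \<z> - v t \<z>)"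
      by (simp add: linsys_def)
    have pu: "path T u" and pv: "path T v" using Lu Lv by (auto simp: linsys_def linsys0_def)
    define d x a' q d0 x0 where "d = nrm s (env T (\<lambda>t \<z>. u t \<z> - v t \<z>))" and "x = xnrm s (env T (\<lambda>t \<z>. u t \<z> - v t \<z>))"
      and "a' = nrm (s - 2) (env T (\<lambda>t \<z>. rhsf (u t) \<z> - rhsf (v t) \<z>))" and "q = nrm s (env T (\<lambda>t \<z>. cpow p (u t) \<z> - cpow p (v t) \<z>))"
      and "d0 = nrm s (cabs (\<lambda>\<z>. h \<z> - k \<z>))" and "x0 = xnrm s (cabs (\<lambda>\<z>. h \<z> - k \<z>))"
    have q: "q \<le> ennreal L * d" using L(2)[OF pu pv nu nv] unfolding q_def d_def by blast
    have A: "d \<le> 2 * d0 + ennreal (K * T\<^sup>2) * (q + d)"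
      using K(2)[OF T(1) LD0] unfolding d_def q_def d0_def u0 v0 .
    have Bx: "x \<le> ennreal K * (x0 + q + d) + ennreal (K * T\<^sup>2) * a'"
      using K(4)[OF T LD] unfolding d_def q_def x0_def x_def a'_def u0 v0 .
    have Ca: "a' \<le> ennreal K * (d + x + q + d)"
      using K(5)[OF T(1) LD0] unfolding d_def q_def x_def a'_def .
    have fin: "d < \<infinity>" "q < \<infinity>" "a' < \<infinity>"
      using LD unfolding d_def q_def a'_def linsys_def linsys0_def by auto
    show ?thesis
    proof (cases "d0 = \<infinity> \<or> x0 = \<infinity>")
      case True
      then have e: "d0 + x0 = top" by auto
      \<comment> \<open>Positivity of \<open>C\<close> matters here, since 0 times infinity would be
        0.\<close>
      have "ennreal C * (d0 + x0) = top" unfolding e using C by (simp add: ennreal_mult_eq_top_iff)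
      then show ?thesis by (simp only: d0_def[symmetric] x0_def[symmetric]) simp
    next
      case False
      obtain rd0 where rd0: "d0 = ennreal rd0" "0 \<le> rd0" using False by (cases d0) auto
      obtain rx0 where rx0: "x0 = ennreal rx0" "0 \<le> rx0" using False by (cases x0) auto
      obtain rd where rd: "d = ennreal rd" "0 \<le> rd" using fin by (cases d) auto
      obtain rq where rq: "q = ennreal rq" "0 \<le> rq" using fin by (cases q) auto
      obtain ra where ra: "a' = ennreal ra" "0 \<le> ra" using fin by (cases a') auto
      \<comment> \<open>A term can be absorbed into the left-hand side only if it is finite; this
        follows from the estimate itself, as the norm of the derivative is finite for both
        solutions.\<close>
      have "x < \<infinity>"
        using Bx rx0 rq rd ra by (auto intro!: order.strict_trans1[OF Bx] simp: ennreal_mult_less_top)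
      then obtain rx where rx: "x = ennreal rx" "0 \<le> rx" by (cases x) auto
      have KT: "0 \<le> K * T\<^sup>2" "0 \<le> K" using K(1) by auto
      have q': "rq \<le> L * rd" using q L(1) rd rq by (simp add: ennreal_mult[symmetric])
      have A': "rd \<le> 2 * rd0 + K * T\<^sup>2 * (rq + rd)"
      proof -
        have "ennreal rd \<le> ennreal (2 * rd0 + K * T\<^sup>2 * (rq + rd))"
          using A rd rd0 rq KT by (simp add: ennreal_mult)
        then show ?thesis using rd0 rq rd KT by (subst (asm) ennreal_le_iff) auto
      qed
      have B': "rx \<le> K * (rx0 + rq + rd) + K * T\<^sup>2 * ra"
      proof -
        have "ennreal rx \<le> ennreal (K * (rx0 + rq + rd) + K * T\<^sup>2 * ra)"
          using Bx rx rx0 rq rd ra KT by (simp add: ennreal_mult)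
        then show ?thesis using rx0 rq rd ra KT by (subst (asm) ennreal_le_iff) auto
      qed
      have C': "ra \<le> K * (rd + rx + rq + rd)"
      proof -
        have "ennreal ra \<le> ennreal (K * (rd + rx + rq + rd))"
        proof -
          have "ennreal (K * (rd + rx + rq + rd)) = ennreal K * ennreal (rd + rx + rq + rd)"
            using rx rq rd KT by (intro ennreal_mult) auto
          also have "ennreal (rd + rx + rq + rd) = d + x + q + d"
            using rx rq rd by (simp only: ennreal_plus add_nonneg_nonneg)
          finally show ?thesis using Ca ra by simp
        qed
        then show ?thesis using rx rq rd ra KT by (subst (asm) ennreal_le_iff) auto
      qed
      have d4: "rd \<le> 4 * rd0"
      proof -
        have "K * T\<^sup>2 * (rq + rd) \<le> K * T\<^sup>2 * (L * rd + rd)" using q' KT by (intro mult_left_mono) auto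
        also have "\<dots> = (K * T\<^sup>2 * (L + 1)) * rd" by (simp add: algebra_simps)
        also have "\<dots> \<le> 1/2 * rd" using small(2) rd by (intro mult_right_mono) auto
        finally show ?thesis using A' by linarith
      qed
      \<comment> \<open>The bound \<open>C'\<close> for the derivative is inserted into the bound
        \<open>B'\<close> for the singular part. Since \<open>K * (K * T\<^sup>2) \<le> 1/2\<close>,
        at most half of \<open>rx\<close> reappears and is absorbed.\<close>
      have x4: "rx \<le> 2 * K * rx0 + C2 * rd"
      proof -
        have "K * T\<^sup>2 * ra \<le> K * T\<^sup>2 * (K * (rd + rx + rq + rd))" using C' KT by (intro mult_left_mono) auto
        also have "\<dots> = (K * (K * T\<^sup>2)) * (rd + rx + rq + rd)" by (simp add: algebra_simps)
        also have "\<dots> \<le> 1/2 * (rd + rx + rq + rd)" using small(4) rd rx rq by (intro mult_right_mono) auto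
        also have "\<dots> \<le> 1/2 * (rd + rx + L * rd + rd)" using q' by simp
        finally have 1: "K * T\<^sup>2 * ra \<le> 1/2 * rx + 1/2 * ((L + 2) * rd)" by (simp add: algebra_simps)
        have "K * (rx0 + rq + rd) \<le> K * (rx0 + L * rd + rd)" using q' KT by (intro mult_left_mono) auto
        then have "rx \<le> K * (rx0 + L * rd + rd) + (1/2 * rx + 1/2 * ((L + 2) * rd))" using B' 1 by linarith
        then show ?thesis by (simp add: C2_def algebra_simps)
      qed
      have x5: "rx \<le> (2 * K + C2 * 4) * (rd0 + rx0)"
      proof -
        have "C2 * rd \<le> C2 * (4 * rd0)" using d4 C2 by (intro mult_left_mono) auto
        moreover have "0 \<le> K * rd0" "0 \<le> C2 * rx0" using KT C2 rd0 rx0 by auto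
        ultimately show ?thesis using x4 by (simp add: algebra_simps)
      qed
      have d5: "rd \<le> 4 * (rd0 + rx0)" using d4 rx0 by simp
      have a5: "ra \<le> K * ((L + 2) * 4 + (2 * K + C2 * 4)) * (rd0 + rx0)"
      proof -
        have "rd + rx + rq + rd \<le> (L + 2) * rd + rx" using q' by (simp add: algebra_simps)
        also have "\<dots> \<le> (L + 2) * (4 * (rd0 + rx0)) + (2 * K + C2 * 4) * (rd0 + rx0)"
          using d5 x5 L(1) by (intro add_mono mult_left_mono) auto
        also have "\<dots> = ((L + 2) * 4 + (2 * K + C2 * 4)) * (rd0 + rx0)" by (simp add: algebra_simps)
        finally have "K * (rd + rx + rq + rd) \<le> K * (((L + 2) * 4 + (2 * K + C2 * 4)) * (rd0 + rx0))" using KT by (intro mult_left_mono) auto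
        then show ?thesis using C' by (simp add: mult.assoc)
      qed
      have "rd + rx + ra \<le> C * (rd0 + rx0)"
        using d5 x5 a5 unfolding C_def by (simp only: distrib_right)
      then have "ennreal (rd + rx + ra) \<le> ennreal (C * (rd0 + rx0))" by (rule ennreal_leI)
      then have "d + x + a' \<le> ennreal C * (d0 + x0)"
        using rd rx ra rd0 rx0 C by (simp add: ennreal_mult)
      then show ?thesis unfolding d_def x_def a'_def d0_def x0_def .
    qed
  qed
  show ?thesis by (rule that[OF T(1) M1 less_imp_le[OF C] exist dep xfin])
qed

end

section \<open>Return to physical space\<close>

lemma is_l2_ft_cong_AE:
  assumes f: "is_l2_ft f F" and [measurable]: "Borel G" and ae: "AE \<z> in lborel. F \<z> = G \<z>"
  shows "is_l2_ft f G"
proof -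
  have "(\<integral>\<^sup>+\<z>. ennreal ((cmod (G \<z> - trunc_ft f R \<z>))\<^sup>2) \<partial>lborel) = (\<integral>\<^sup>+\<z>. ennreal ((cmod (F \<z> - trunc_ft f R \<z>))\<^sup>2) \<partial>lborel)" for R
    using ae by (intro nn_integral_cong_AE) (auto elim!: eventually_mono)
  moreover have "(\<integral>\<^sup>+\<z>. ennreal ((cmod (G \<z>))\<^sup>2) \<partial>lborel) = (\<integral>\<^sup>+\<z>. ennreal ((cmod (F \<z>))\<^sup>2) \<partial>lborel)"
    using ae by (intro nn_integral_cong_AE) (auto elim!: eventually_mono)
  ultimately show ?thesis using f unfolding is_l2_ft_def by simp
qed

lemma is_l2_ft_sq_integrable: "is_l2_ft f F \<Longrightarrow> sq_integrable f"
  by (simp add: is_l2_ft_def)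

lemma integrable_of_nrm:
  assumes s: "1 < s" and [measurable]: "Borel F" and fin: "nrm s (cabs F) < \<infinity>"
  shows "integrable lborel F"
proof -
  have "1 < s - 0" using s by simp
  then obtain K where K: "0 < K" "\<And>A. Borel A \<Longrightarrow>
      (\<integral>\<^sup>+z. ennreal (sob_weight (0/2) z) * A z \<partial>lborel)\<^sup>2 \<le> ennreal K * nrm s A"
    using L1_bound_ex by blast
  have "(\<integral>\<^sup>+z. cabs F z \<partial>lborel)\<^sup>2 \<le> ennreal K * nrm s (cabs F)"
    using K(2)[of "cabs F"] by simp
  also have "\<dots> < \<infinity>" using fin by (simp add: ennreal_mult_less_top)
  finally have "(\<integral>\<^sup>+z. cabs F z \<partial>lborel) < \<infinity>" by (auto simp: power2_eq_square ennreal_mult_less_top)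
  then show ?thesis by (simp add: integrable_iff_bounded)
qed

lemma conv_nrm_finite:
  assumes s: "1 < s" and [measurable]: "Borel F" "Borel G"
    and fin: "nrm s (cabs F) < \<infinity>" "nrm s (cabs G) < \<infinity>"
  shows "nrm s (cabs (\<lambda>\<z>. complex_of_real c * conv F G \<z>)) < \<infinity>"
proof -
  obtain K where K: "0 < K" "\<And>A B. Borel A \<Longrightarrow> Borel B \<Longrightarrow>
      nrm s (econv A B) \<le> ennreal K * nrm s A * nrm s B"
    using econv_algebra_ex[OF s] by blast
  have "nrm s (cabs (\<lambda>\<z>. complex_of_real c * conv F G \<z>)) \<le> nrm s (\<lambda>\<z>. ennreal \<bar>c\<bar> * econv (cabs F) (cabs G) \<z>)"
  proof (rule nrm_mono)
    fix \<z>
    have "ennreal (cmod (complex_of_real c * conv F G \<z>)) = ennreal \<bar>c\<bar> * ennreal (cmod (conv F G \<z>))"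
      by (simp add: norm_mult ennreal_mult)
    then show "ennreal (cmod (complex_of_real c * conv F G \<z>)) \<le> ennreal \<bar>c\<bar> * econv (cabs F) (cabs G) \<z>"
      using cabs_conv_le[of F G \<z>] by (simp add: mult_left_mono)
  qed
  also have "\<dots> = (ennreal \<bar>c\<bar>)\<^sup>2 * nrm s (econv (cabs F) (cabs G))" by (rule nrm_cmult) measurable
  also have "\<dots> \<le> (ennreal \<bar>c\<bar>)\<^sup>2 * (ennreal K * nrm s (cabs F) * nrm s (cabs G))"
    by (intro mult_left_mono K) auto
  also have "\<dots> < \<infinity>" using fin by (simp add: ennreal_mult_less_top ennreal_power)
  finally show ?thesis .
qed

text \<open>For s > 1 a finite norm makes the transforms integrable, so the convolution theorem
  applies; the convolution is the same for any choice of representatives.\<close>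

lemma ft_product_nrm:
  assumes s: "1 < s" and f: "is_l2_ft f F" "nrm s (cabs F) < \<infinity>" and h: "is_l2_ft h H" "nrm s (cabs H) < \<infinity>"
  shows "is_l2_ft (\<lambda>x. f x * h x) (\<lambda>\<z>. complex_of_real cF * conv F H \<z>)"
proof -
  have [measurable]: "Borel F" "Borel H"
    using f h is_l2_ft_measurable by auto
  note sq = is_l2_ft_sq_integrable[OF f(1)] is_l2_ft_sq_integrable[OF h(1)]
  have [measurable]: "Borel (ft f)" "Borel (ft h)"
    using sq[THEN ft_is_l2_ft] is_l2_ft_measurable by auto
  note ae = ft_unique[OF f(1)] ft_unique[OF h(1)]
  have "integrable lborel (ft f)"
    using integrable_of_nrm[OF s _ f(2)] by (subst integrable_cong_AE[OF _ _ ae(1)]) auto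
  moreover have "integrable lborel (ft h)"
    using integrable_of_nrm[OF s _ h(2)] by (subst integrable_cong_AE[OF _ _ ae(2)]) auto
  ultimately have "is_l2_ft (\<lambda>x. f x * h x) (\<lambda>\<z>. complex_of_real cF * conv (ft f) (ft h) \<z>)"
    using sq by (intro ft_product)
  moreover have "conv (ft f) (ft h) = conv F H" by (rule conv_cong_AE) (use ae in measurable)
  ultimately show ?thesis by simp
qed

lemma ft_power:
  assumes s: "1 < s" and f: "is_l2_ft f F" "nrm s (cabs F) < \<infinity>"
  shows "is_l2_ft (\<lambda>x. f x ^ (k + 1)) (cpow k F) \<and> nrm s (cabs (cpow k F)) < \<infinity>"
proof (induction k)
  case (Suc k)
  have "is_l2_ft (\<lambda>x. f x * f x ^ (k + 1)) (\<lambda>\<z>. complex_of_real cF * conv F (cpow k F) \<z>)"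
    using Suc by (intro ft_product_nrm[OF s f]) auto
  moreover have "nrm s (cabs (\<lambda>\<z>. complex_of_real cF * conv F (cpow k F) \<z>)) < \<infinity>"
    using Suc is_l2_ft_measurable[OF f(1)] by (intro conv_nrm_finite[OF s] f cpow_measurable) auto
  ultimately show ?case by simp
qed (use f in simp)

section \<open>The notions of the statement in terms of any representative of the transform\<close>

lemma dxinv_dy_measurable [measurable]: "Borel F \<Longrightarrow> Borel (dxinv_dy F)"
  unfolding dxinv_dy_def[abs_def] by measurable

lemma Zw_cabs: "Zw (cabs F) = cabs (dxinv_dy F)"
  by (rule ext) (simp add: Zw_def dxinv_dy_def norm_mult norm_divide ennreal_mult[symmetric])

lemma xnrm_cabs: "xnrm s (cabs F) = nrm (s - 1) (cabs (dxinv_dy F))"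
  by (simp add: xnrm_def Zw_cabs)

lemma xs_dist2_eq:
  assumes f: "is_l2_ft f F" and g: "is_l2_ft g G"
  shows "xs_dist2 s f g = nrm s (cabs (\<lambda>\<z>. F \<z> - G \<z>)) + xnrm s (cabs (\<lambda>\<z>. F \<z> - G \<z>))"
proof -
  have "wdist2 s (ft f) (ft g) = nrm s (cabs (\<lambda>\<z>. F \<z> - G \<z>))"
    unfolding wdist2_eq_nrm
  proof (rule nrm_cong_AE)
    show "AE \<z> in lborel. cabs (\<lambda>\<z>. ft f \<z> - ft g \<z>) \<z> = cabs (\<lambda>\<z>. F \<z> - G \<z>) \<z>"
      using ft_unique[OF f] ft_unique[OF g] by eventually_elim simp
  qed
  moreover have "wdist2 (s - 1) (dxinv_dy (ft f)) (dxinv_dy (ft g)) = nrm (s - 1) (cabs (dxinv_dy (\<lambda>\<z>. F \<z> - G \<z>)))"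
    unfolding wdist2_eq_nrm
  proof (rule nrm_cong_AE)
    show "AE \<z> in lborel. cabs (\<lambda>\<z>. dxinv_dy (ft f) \<z> - dxinv_dy (ft g) \<z>) \<z> = cabs (dxinv_dy (\<lambda>\<z>. F \<z> - G \<z>)) \<z>"
      using ft_unique[OF f] ft_unique[OF g] by eventually_elim (simp add: dxinv_dy_def right_diff_distrib)
  qed
  ultimately show ?thesis by (simp add: xs_dist2_def xnrm_cabs)
qed

lemma wL2_cong_AE:
  assumes [measurable]: "Borel F" "Borel G" and ae: "AE \<z> in lborel. F \<z> = G \<z>"
  shows "wL2 s F \<longleftrightarrow> nrm s (cabs G) < \<infinity>"
proof -
  have "wdist2 s F (\<lambda>_. 0) = nrm s (cabs G)"
    unfolding wdist2_eq_nrm using ae by (intro nrm_cong_AE) (auto elim!: eventually_mono)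
  then show ?thesis by (simp add: wL2_def)
qed

lemma in_Hs_iff:
  assumes f: "is_l2_ft f F" shows "in_Hs s f \<longleftrightarrow> nrm s (cabs F) < \<infinity>"
proof -
  have sq: "sq_integrable f" by (rule is_l2_ft_sq_integrable[OF f])
  show ?thesis
    using wL2_cong_AE[OF is_l2_ft_measurable[OF ft_is_l2_ft[OF sq]] is_l2_ft_measurable[OF f] ft_unique[OF f]] sq
    by (simp add: in_Hs_def)
qed

lemma in_Xs_iff:
  assumes f: "is_l2_ft f F" shows "in_Xs s f \<longleftrightarrow> nrm s (cabs F) < \<infinity> \<and> xnrm s (cabs F) < \<infinity>"
proof -
  have sq: "sq_integrable f" by (rule is_l2_ft_sq_integrable[OF f])
  have m: "Borel (ft f)" "Borel F"
    using is_l2_ft_measurable[OF ft_is_l2_ft[OF sq]] is_l2_ft_measurable[OF f] by auto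
  have "AE \<z> in lborel. dxinv_dy (ft f) \<z> = dxinv_dy F \<z>"
    using ft_unique[OF f] by eventually_elim (simp add: dxinv_dy_def)
  then have "wL2 (s - 1) (dxinv_dy (ft f)) \<longleftrightarrow> xnrm s (cabs F) < \<infinity>"
    unfolding xnrm_cabs by (intro wL2_cong_AE dxinv_dy_measurable m)
  then show ?thesis using wL2_cong_AE[OF m ft_unique[OF f]] sq by (simp add: in_Xs_def)
qed

lemma nrm_dominated:
  assumes [measurable]: "\<And>n. Borel (X n)" "Borel W"
    and bd: "\<And>n \<z>. ennreal (cmod (X n \<z>)) \<le> W \<z>" and fin: "nrm s W < \<infinity>"
    and lim: "\<And>\<z>. (\<lambda>n. X n \<z>) \<longlonglongrightarrow> 0"
  shows "(\<lambda>n. nrm s (cabs (X n))) \<longlonglongrightarrow> 0"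
proof -
  have "(\<lambda>n. \<integral>\<^sup>+\<z>. (ennreal (sob_weight (s/2) \<z>) * cabs (X n) \<z>)\<^sup>2 \<partial>lborel) \<longlonglongrightarrow> (\<integral>\<^sup>+\<z>. 0 \<partial>(lborel :: plane measure))"
  proof (rule nn_integral_dominated_convergence[where w="\<lambda>\<z>. (ennreal (sob_weight (s/2) \<z>) * W \<z>)\<^sup>2"])
    show "AE \<z> in lborel. (ennreal (sob_weight (s/2) \<z>) * cabs (X n) \<z>)\<^sup>2 \<le> (ennreal (sob_weight (s/2) \<z>) * W \<z>)\<^sup>2" for n
      by (intro AE_I2 ennreal_square_mono mult_left_mono bd) simp
    show "(\<integral>\<^sup>+\<z>. (ennreal (sob_weight (s/2) \<z>) * W \<z>)\<^sup>2 \<partial>lborel) < \<infinity>" using fin by (simp add: nrm_def)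
    show "AE \<z> in lborel. (\<lambda>n. (ennreal (sob_weight (s/2) \<z>) * cabs (X n) \<z>)\<^sup>2) \<longlonglongrightarrow> 0"
    proof (rule AE_I2)
      fix \<z> :: "plane"
      have "(\<lambda>n. (sob_weight (s/2) \<z> * cmod (X n \<z>))\<^sup>2) \<longlonglongrightarrow> (sob_weight (s/2) \<z> * cmod 0)\<^sup>2"
        by (intro tendsto_intros lim)
      then have "(\<lambda>n. ennreal ((sob_weight (s/2) \<z> * cmod (X n \<z>))\<^sup>2)) \<longlonglongrightarrow> ennreal 0"
        by (intro tendsto_ennrealI) simp
      then show "(\<lambda>n. (ennreal (sob_weight (s/2) \<z>) * cabs (X n) \<z>)\<^sup>2) \<longlonglongrightarrow> 0"
        by (simp add: ennreal_mult[symmetric] ennreal_power)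
    qed
  qed measurable
  then show ?thesis by (simp add: nrm_def)
qed

lemma nrm_path_tendsto:
  assumes u: "path T u" and fin: "nrm s (env T u) < \<infinity>" and t: "t \<in> {0..T}"
  shows "((\<lambda>\<tau>. nrm s (cabs (\<lambda>\<z>. u \<tau> \<z> - u t \<z>))) \<longlongrightarrow> 0) (at t within {0..T})"
  unfolding tendsto_at_iff_sequentially comp_def
proof (intro allI impI)
  fix X :: "nat \<Rightarrow> real" assume X: "\<forall>i. X i \<in> {0..T} - {t}" and lim: "X \<longlonglongrightarrow> t"
  show "(\<lambda>n. nrm s (cabs (\<lambda>\<z>. u (X n) \<z> - u t \<z>))) \<longlonglongrightarrow> 0"
  proof (rule nrm_dominated[where W="\<lambda>\<z>. 2 * env T u \<z>"])
    show "Borel (\<lambda>\<z>. u (X n) \<z> - u t \<z>)" for n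
      using X by (intro borel_measurable_diff path_measurable[OF u] t) auto
    show "Borel (\<lambda>\<z>. 2 * env T u \<z>)" using u by simp
    show "nrm s (\<lambda>\<z>. 2 * env T u \<z>) < \<infinity>"
      using fin u by (subst nrm_cmult) (auto simp: ennreal_mult_less_top)
    show "ennreal (cmod (u (X n) \<z> - u t \<z>)) \<le> 2 * env T u \<z>" for n \<z>
    proof -
      have "ennreal (cmod (u (X n) \<z> - u t \<z>)) \<le> ennreal (cmod (u (X n) \<z>)) + ennreal (cmod (u t \<z>))"
        by (simp add: ennreal_plus[symmetric] norm_triangle_ineq4 del: ennreal_plus)
      also have "\<dots> \<le> env T u \<z> + env T u \<z>" using X by (intro add_mono env_upper t) auto
      finally show ?thesis by (simp add: mult_2)
    qed
    show "(\<lambda>n. u (X n) \<z> - u t \<z>) \<longlonglongrightarrow> 0" for \<z>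
    proof -
      have "((\<lambda>\<tau>. u \<tau> \<z>) \<longlongrightarrow> u t \<z>) (at t within {0..T})"
        using path_continuous[OF u] t by (auto simp: continuous_on_def)
      then have "(\<lambda>n. u (X n) \<z>) \<longlonglongrightarrow> u t \<z>" unfolding tendsto_at_iff_sequentially comp_def using X lim by blast
      from tendsto_diff[OF this tendsto_const[of "u t \<z>"]] show ?thesis by simp
    qed
  qed
qed

lemma xnrm_path_tendsto:
  assumes u: "path T u" and fin: "xnrm s (env T u) < \<infinity>" and t: "t \<in> {0..T}"
  shows "((\<lambda>\<tau>. xnrm s (cabs (\<lambda>\<z>. u \<tau> \<z> - u t \<z>))) \<longlongrightarrow> 0) (at t within {0..T})"
proof -
  have eq: "dxinv_dy (\<lambda>\<z>. u \<tau> \<z> - u t \<z>) = (\<lambda>\<z>. dxinv_dy (u \<tau>) \<z> - dxinv_dy (u t) \<z>)" for \<tau>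
    by (rule ext) (simp add: dxinv_dy_def right_diff_distrib)
  have p: "path T (\<lambda>t. dxinv_dy (u t))"
    unfolding dxinv_dy_def[abs_def] by (intro path_mult u) measurable
  have "nrm (s - 1) (env T (\<lambda>t. dxinv_dy (u t))) \<le> xnrm s (env T u)"
    unfolding xnrm_def
  proof (rule nrm_mono)
    show "env T (\<lambda>t. dxinv_dy (u t)) \<z> \<le> Zw (env T u) \<z>" for \<z>
      using env_mult_le[of T "\<lambda>\<z>. complex_of_real (snd \<z> / fst \<z>)" u \<z>]
      unfolding dxinv_dy_def[abs_def] Zw_def norm_of_real .
  qed
  then have "nrm (s - 1) (env T (\<lambda>t. dxinv_dy (u t))) < \<infinity>" using fin by (rule order.strict_trans1)
  from nrm_path_tendsto[OF p this t] show ?thesis unfolding xnrm_cabs eq .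
qed

lemma nrm_quotient_tendsto:
  assumes u: "dpath T u u'" and fin: "nrm s (env T u') < \<infinity>" and t: "t \<in> {0..T}"
  shows "((\<lambda>\<tau>. nrm s (cabs (\<lambda>\<z>. (u \<tau> \<z> - u t \<z>) / complex_of_real (\<tau> - t) - u' t \<z>))) \<longlongrightarrow> 0) (at t within {0..T})"
  unfolding tendsto_at_iff_sequentially comp_def
proof (intro allI impI)
  note p = dpath_path[OF u]
  have sc: "(u \<tau> \<z> - u t \<z>) / complex_of_real (\<tau> - t) = (u \<tau> \<z> - u t \<z>) /\<^sub>R (\<tau> - t)" for \<tau> \<z>
    by (simp add: scaleR_conv_of_real divide_inverse mult.commute)
  fix X :: "nat \<Rightarrow> real" assume X: "\<forall>i. X i \<in> {0..T} - {t}" and lim: "X \<longlonglongrightarrow> t"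
  then have X': "X n \<in> {0..T}" "X n \<noteq> t" for n by auto
  show "(\<lambda>n. nrm s (cabs (\<lambda>\<z>. (u (X n) \<z> - u t \<z>) / complex_of_real (X n - t) - u' t \<z>))) \<longlonglongrightarrow> 0"
  proof (rule nrm_dominated[where W="\<lambda>\<z>. 2 * env T u' \<z>"])
    show "Borel (\<lambda>\<z>. (u (X n) \<z> - u t \<z>) / complex_of_real (X n - t) - u' t \<z>)" for n
      using X'(1) by (intro borel_measurable_diff borel_measurable_divide borel_measurable_const path_measurable[OF p(1)] path_measurable[OF p(2)] t)
    show "Borel (\<lambda>\<z>. 2 * env T u' \<z>)" using p by simp
    show "nrm s (\<lambda>\<z>. 2 * env T u' \<z>) < \<infinity>"
      using fin p by (subst nrm_cmult) (auto simp: ennreal_mult_less_top)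
    show "ennreal (cmod ((u (X n) \<z> - u t \<z>) / complex_of_real (X n - t) - u' t \<z>)) \<le> 2 * env T u' \<z>" for n \<z>
    proof -
      have "ennreal (cmod ((u (X n) \<z> - u t \<z>) /\<^sub>R (X n - t) - u' t \<z>)) \<le> ennreal (cmod ((u (X n) \<z> - u t \<z>) /\<^sub>R (X n - t))) + ennreal (cmod (u' t \<z>))"
        using ennreal_leI[OF norm_triangle_ineq4[of "(u (X n) \<z> - u t \<z>) /\<^sub>R (X n - t)" "u' t \<z>"]]
        by (simp only: ennreal_plus norm_ge_zero)
      also have "\<dots> \<le> env T u' \<z> + env T u' \<z>"
        by (intro add_mono env_upper t dpath_quotient_bound[OF u X'(1) t X'(2)])
      finally show ?thesis unfolding sc by (simp add: mult_2)
    qed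
    show "(\<lambda>n. (u (X n) \<z> - u t \<z>) / complex_of_real (X n - t) - u' t \<z>) \<longlonglongrightarrow> 0" for \<z>
    proof -
      have "((\<lambda>\<tau>. (u \<tau> \<z> - u t \<z>) /\<^sub>R (\<tau> - t)) \<longlongrightarrow> u' t \<z>) (at t within {0..T})"
        using dpath_deriv[OF u t] unfolding has_vector_derivative_iff_quotient .
      then have "(\<lambda>n. (u (X n) \<z> - u t \<z>) /\<^sub>R (X n - t)) \<longlonglongrightarrow> u' t \<z>" unfolding tendsto_at_iff_sequentially comp_def using X lim by blast
      from tendsto_diff[OF this tendsto_const[of "u' t \<z>"]] show ?thesis unfolding sc by simp
    qed
  qed
qed

context bbm_kp begin

text \<open>The two transforms of products in \<open>eq_rhs\<close> become convolutions almost
  everywhere, which ties the equation in physical space to the system on the Fourier side.\<close>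

lemma eq_rhs_AE:
  assumes a: "is_l2_ft a ah" and w: "is_l2_ft w F" "nrm s (cabs F) < \<infinity>"
  shows "AE \<z> in lborel. eq_rhs p \<gamma> a w \<z> = rhsf F \<z>"
proof -
  have s1: "1 < s" using s by simp
  have "AE \<z> in lborel. ft (\<lambda>x. a x * w x) \<z> = complex_of_real cF * conv ah F \<z>"
    by (rule ft_unique[OF ft_product_nrm[OF s1 a ah_fin w]])
  moreover have "AE \<z> in lborel. ft (\<lambda>x. w x ^ (p + 1)) \<z> = cpow p F \<z>"
    using ft_power[OF s1 w, of p] by (intro ft_unique) auto
  ultimately show ?thesis using ft_unique[OF w(1)]
  proof eventually_elim
    case (elim \<z>)
    have "complex_of_real (mA \<z>) * (complex_of_real cF * conv ah F \<z>) = complex_of_real cF * conv ah F \<z> / complex_of_real (1 + (fst \<z>)\<^sup>2)"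
      by (simp add: mA_def of_real_divide)
    then show ?case unfolding eq_rhs_def Let_def elim rhsf_def forcing_def phi_def mN_def by (simp only: add_diff_eq)  simp
  qed
qed

text \<open>By the Hermitian symmetry \<open>inv_ft (u t)\<close> is a real function with transform
  \<open>u t\<close>, so each clause of \<open>is_sol\<close> can be checked on \<open>u t\<close>,
  up to null sets of frequencies.\<close>

lemma fourier_sol_is_sol:
  assumes T: "0 < T" and u: "fourier_sol T h u" and fx: "xnrm s (env T u) < \<infinity>"
    and herm: "\<And>t \<z>. t \<in> {0..T} \<Longrightarrow> u t (- \<z>) = cnj (u t \<z>)"
    and a: "is_l2_ft a ah" and u0: "is_l2_ft u0 h"
  shows "is_sol s p \<gamma> a u0 T (\<lambda>t. inv_ft (u t)) (\<lambda>t. rhsf (u t))"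
    and "\<And>t. t \<in> {0..T} \<Longrightarrow> is_l2_ft (inv_ft (u t)) (u t)"
proof -
  have s1: "1 < s" using s by simp
  have d: "dpath T u (\<lambda>t. rhsf (u t))" and fin: "nrm s (env T u) < \<infinity>" and fin': "nrm (s - 2) (env T (\<lambda>t. rhsf (u t))) < \<infinity>"
    and u00: "u 0 = h"
    using u by (auto simp: fourier_sol_def linsys_def linsys0_def)
  note p = dpath_path[OF d]
  have ft_fin: "nrm s (cabs (u t)) < \<infinity>" if "t \<in> {0..T}" for t
    using nrm_cabs_le_env[OF that] fin by (rule order.strict_trans1)
  have ft_X: "xnrm s (cabs (u t)) < \<infinity>" if t: "t \<in> {0..T}" for t
  proof -
    have "xnrm s (cabs (u t)) \<le> xnrm s (env T u)"
      unfolding xnrm_def Zw_def by (intro nrm_mono mult_left_mono env_upper t) simp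
    then show ?thesis using fx by (rule order.strict_trans1)
  qed
  show l2: "is_l2_ft (inv_ft (u t)) (u t)" if t: "t \<in> {0..T}" for t
    using ft_fin[OF t] s1 by (intro inv_ft_is_l2_ft herm[OF t] integrable_of_nrm[OF s1] path_measurable[OF p(1) t] nrm_0_finite[of s]) auto
  have zero: "0 \<in> {0..T}" using T by simp
  show "is_sol s p \<gamma> a u0 T (\<lambda>t. inv_ft (u t)) (\<lambda>t. rhsf (u t))"
    unfolding is_sol_def
  proof (intro conjI ballI)
    fix t assume t: "t \<in> {0..T}"
    show "in_Xs s (inv_ft (u t))" using ft_fin[OF t] ft_X[OF t] by (simp add: in_Xs_iff[OF l2[OF t]])
    have ev: "\<forall>\<^sub>F \<tau> in at t within {0..T}. \<tau> \<in> {0..T}" by (simp add: eventually_at_filter)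
    have "((\<lambda>\<tau>. nrm s (cabs (\<lambda>\<z>. u \<tau> \<z> - u t \<z>)) + xnrm s (cabs (\<lambda>\<z>. u \<tau> \<z> - u t \<z>))) \<longlongrightarrow> 0 + 0) (at t within {0..T})"
      by (intro tendsto_add nrm_path_tendsto xnrm_path_tendsto p fin fx t)
    moreover have "\<forall>\<^sub>F \<tau> in at t within {0..T}. nrm s (cabs (\<lambda>\<z>. u \<tau> \<z> - u t \<z>)) + xnrm s (cabs (\<lambda>\<z>. u \<tau> \<z> - u t \<z>)) = xs_dist2 s (inv_ft (u \<tau>)) (inv_ft (u t))"
      using ev by eventually_elim (rule xs_dist2_eq[symmetric, OF l2 l2[OF t]])
    ultimately show "((\<lambda>\<tau>. xs_dist2 s (inv_ft (u \<tau>)) (inv_ft (u t))) \<longlongrightarrow> 0) (at t within {0..T})"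
      by (simp add: tendsto_cong)
    have m: "Borel (rhsf (u t))" by (rule path_measurable[OF p(2) t])
    show "wL2 (s - 2) (rhsf (u t))"
      using wL2_cong_AE[OF m m] order.strict_trans1[OF nrm_cabs_le_env[OF t] fin'] by simp
    show "((\<lambda>\<tau>. wdist2 (s - 2) (rhsf (u \<tau>)) (rhsf (u t))) \<longlongrightarrow> 0) (at t within {0..T})"
      unfolding wdist2_eq_nrm by (rule nrm_path_tendsto[OF p(2) fin' t])
    have "((\<lambda>\<tau>. nrm (s - 2) (cabs (\<lambda>\<z>. (u \<tau> \<z> - u t \<z>) / complex_of_real (\<tau> - t) - rhsf (u t) \<z>))) \<longlongrightarrow> 0) (at t within {0..T})"
      by (rule nrm_quotient_tendsto[OF d fin' t])
    moreover have "\<forall>\<^sub>F \<tau> in at t within {0..T}. nrm (s - 2) (cabs (\<lambda>\<z>. (u \<tau> \<z> - u t \<z>) / complex_of_real (\<tau> - t) - rhsf (u t) \<z>))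
        = wdist2 (s - 2) (\<lambda>\<z>. (ft (inv_ft (u \<tau>)) \<z> - ft (inv_ft (u t)) \<z>) / complex_of_real (\<tau> - t)) (rhsf (u t))"
      using ev
    proof eventually_elim
      case (elim \<tau>)
      have "AE \<z> in lborel. ennreal (cmod ((u \<tau> \<z> - u t \<z>) / complex_of_real (\<tau> - t) - rhsf (u t) \<z>))
        = ennreal (cmod ((ft (inv_ft (u \<tau>)) \<z> - ft (inv_ft (u t)) \<z>) / complex_of_real (\<tau> - t) - rhsf (u t) \<z>))"
        using ft_unique[OF l2[OF elim]] ft_unique[OF l2[OF t]] by eventually_elim simp
      then show ?case unfolding wdist2_eq_nrm by (rule nrm_cong_AE)
    qed
    ultimately show "((\<lambda>\<tau>. wdist2 (s - 2) (\<lambda>\<z>. (ft (inv_ft (u \<tau>)) \<z> - ft (inv_ft (u t)) \<z>) / complex_of_real (\<tau> - t)) (rhsf (u t))) \<longlongrightarrow> 0) (at t within {0..T})"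
      by (subst (asm) tendsto_cong) assumption+
    show "AE \<z> in lborel. rhsf (u t) \<z> = eq_rhs p \<gamma> a (inv_ft (u t)) \<z>"
      using eq_rhs_AE[OF a l2[OF t] ft_fin[OF t]] by eventually_elim simp
  next
    show "AE x in lborel. inv_ft (u 0) x = u0 x"
      using ft_eq_imp_AE_eq[OF l2[OF zero] u0] by (simp add: u00)
  qed
qed

end

section \<open>Uniqueness\<close>

lemma L2_square_integrable:
  assumes [measurable]: "Borel F" and fin: "nrm 0 (cabs F) < \<infinity>"
  shows "integrable lborel (\<lambda>\<z>. (cmod (F \<z>))\<^sup>2)" and "ennreal (\<integral>\<z>. (cmod (F \<z>))\<^sup>2 \<partial>lborel) = nrm 0 (cabs F)"
proof -
  show i: "integrable lborel (\<lambda>\<z>. (cmod (F \<z>))\<^sup>2)"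
    using fin by (simp add: integrable_iff_bounded nrm_0_cabs)
  show "ennreal (\<integral>\<z>. (cmod (F \<z>))\<^sup>2 \<partial>lborel) = nrm 0 (cabs F)"
    unfolding nrm_0_cabs by (rule nn_integral_eq_integral[symmetric, OF i]) simp
qed

lemma nrm_cabs_add_le:
  assumes [measurable]: "Borel F" "Borel G"
  shows "nrm s (cabs (\<lambda>\<z>. F \<z> + G \<z>)) \<le> 2 * nrm s (cabs F) + 2 * nrm s (cabs G)"
proof -
  have "nrm s (cabs (\<lambda>\<z>. F \<z> + G \<z>)) \<le> nrm s (\<lambda>\<z>. cabs F \<z> + cabs G \<z>)"
  proof (rule nrm_mono)
    show "ennreal (cmod (F \<z> + G \<z>)) \<le> ennreal (cmod (F \<z>)) + ennreal (cmod (G \<z>))" for \<z>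
      using ennreal_leI[OF norm_triangle_ineq[of "F \<z>" "G \<z>"]] by (simp only: ennreal_plus norm_ge_zero)
  qed
  also have "\<dots> \<le> 2 * nrm s (cabs F) + 2 * nrm s (cabs G)" by (rule nrm_add) measurable
  finally show ?thesis .
qed

lemma nrm_cabs_cmult:
  assumes [measurable]: "Borel F"
  shows "nrm s (cabs (\<lambda>\<z>. c * F \<z>)) = ennreal ((cmod c)\<^sup>2) * nrm s (cabs F)"
proof -
  have "nrm s (cabs (\<lambda>\<z>. c * F \<z>)) = nrm s (\<lambda>\<z>. ennreal (cmod c) * cabs F \<z>)"
    by (simp add: norm_mult ennreal_mult)
  also have "\<dots> = (ennreal (cmod c))\<^sup>2 * nrm s (cabs F)" by (rule nrm_cmult) measurable
  finally show ?thesis by (simp add: ennreal_power)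
qed

lemma nrm_cabs_diff_le:
  assumes [measurable]: "Borel F" "Borel G"
  shows "nrm s (cabs (\<lambda>\<z>. F \<z> - G \<z>)) \<le> 2 * nrm s (cabs F) + 2 * nrm s (cabs G)"
  using nrm_cabs_add_le[of F "\<lambda>\<z>. - G \<z>" s] by simp

text \<open>With time step \<open>h\<close> and difference quotient \<open>Q\<close>, the identity
  |X + hQ|^2 = |X|^2 + 2h Re (Q cnj X) + h^2 |Q|^2 is exact. After division by \<open>h\<close> the
  middle term converges by the L^2 pairing, and the last one vanishes because \<open>Q\<close> stays
  bounded in L^2.\<close>

lemma energy_derivative:
  assumes Xm: "\<And>\<tau>. \<tau> \<in> {0..T} \<Longrightarrow> Borel (X \<tau>)" and Ym[measurable]: "Borel Y"
    and Xf: "\<And>\<tau>. \<tau> \<in> {0..T} \<Longrightarrow> nrm 0 (cabs (X \<tau>)) < \<infinity>" and Yf: "nrm 0 (cabs Y) < \<infinity>"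
    and lim: "((\<lambda>\<tau>. nrm 0 (cabs (\<lambda>\<z>. (X \<tau> \<z> - X t \<z>) / complex_of_real (\<tau> - t) - Y \<z>))) \<longlongrightarrow> 0) (at t within {0..T})"
    and t: "t \<in> {0..T}"
  shows "((\<lambda>\<tau>. \<integral>\<z>. (cmod (X \<tau> \<z>))\<^sup>2 \<partial>lborel) has_real_derivative 2 * Re (\<integral>\<z>. Y \<z> * cnj (X t \<z>) \<partial>lborel)) (at t within {0..T})"
  unfolding has_field_derivative_iff tendsto_at_iff_sequentially comp_def
proof (intro allI impI)
  fix Z :: "nat \<Rightarrow> real" assume Z: "\<forall>i. Z i \<in> {0..T} - {t}" and Zlim: "Z \<longlonglongrightarrow> t"
  have Z': "Z n \<in> {0..T}" "Z n \<noteq> t" for n using Z by auto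
  define h where "h n = Z n - t" for n
  have h0: "h n \<noteq> 0" for n using Z'(2) by (simp add: h_def)
  have hlim: "h \<longlonglongrightarrow> 0" using tendsto_diff[OF Zlim tendsto_const[of t]] by (simp add: h_def[abs_def])
  define Q where "Q n \<z> = (X (Z n) \<z> - X t \<z>) / complex_of_real (h n)" for n \<z>
  note Xt[measurable] = Xm[OF t]
  note XZ[measurable] = Xm[OF Z'(1)]
  have wd: "wdist2 0 Y G = nrm 0 (cabs (\<lambda>\<z>. G \<z> - Y \<z>))" for G
    unfolding wdist2_commute[of 0 Y] by (rule wdist2_eq_nrm)
  have Qm[measurable]: "Borel (Q n)" for n unfolding Q_def[abs_def] by measurable
  have Qf: "nrm 0 (cabs (Q n)) < \<infinity>" for n
  proof -
    have "cabs (Q n) = cabs (\<lambda>\<z>. (1 / complex_of_real (h n)) * (X (Z n) \<z> - X t \<z>))"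
      by (rule ext) (simp add: Q_def)
    then have "nrm 0 (cabs (Q n)) = ennreal ((cmod (1 / complex_of_real (h n)))\<^sup>2) * nrm 0 (cabs (\<lambda>\<z>. X (Z n) \<z> - X t \<z>))"
      by (simp only:) (rule nrm_cabs_cmult, measurable)
    then show ?thesis
      using nrm_cabs_diff_finite[OF XZ Xt Xf[OF Z'(1)] Xf[OF t]] by (simp add: ennreal_mult_less_top)
  qed
  have Qlim: "(\<lambda>n. nrm 0 (cabs (\<lambda>\<z>. Q n \<z> - Y \<z>))) \<longlonglongrightarrow> 0"
    using lim Z Zlim unfolding tendsto_at_iff_sequentially comp_def Q_def h_def by blast
  have cf: "nrm 0 (cabs (\<lambda>\<z>. cnj (X t \<z>))) < \<infinity>" using Xf[OF t] by simp
  have cm[measurable]: "Borel (\<lambda>\<z>. cnj (X t \<z>))" by measurable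
  have l1: "(\<lambda>n. \<integral>\<z>. Q n \<z> * cnj (X t \<z>) \<partial>lborel) \<longlonglongrightarrow> (\<integral>\<z>. Y \<z> * cnj (X t \<z>) \<partial>lborel)"
    by (rule L2_pairing_tendsto[OF Qm Ym cm Qf Yf cf]) (unfold wd, rule Qlim)
  obtain y where y: "nrm 0 (cabs Y) = ennreal y" "0 \<le> y" using Yf by (cases "nrm 0 (cabs Y)") auto
  have l2: "(\<lambda>n. h n * (\<integral>\<z>. (cmod (Q n \<z>))\<^sup>2 \<partial>lborel)) \<longlonglongrightarrow> 0"
  proof (rule Lim_null_comparison)
    have "\<forall>\<^sub>F n in sequentially. nrm 0 (cabs (\<lambda>\<z>. Q n \<z> - Y \<z>)) < 1"
      using Qlim by (rule order_tendstoD(2)) simp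
    then show "\<forall>\<^sub>F n in sequentially. norm (h n * (\<integral>\<z>. (cmod (Q n \<z>))\<^sup>2 \<partial>lborel)) \<le> \<bar>h n\<bar> * (2 + 2 * y)"
    proof eventually_elim
      case (elim n)
      have "ennreal (\<integral>\<z>. (cmod (Q n \<z>))\<^sup>2 \<partial>lborel) = nrm 0 (cabs (\<lambda>\<z>. (Q n \<z> - Y \<z>) + Y \<z>))"
        using L2_square_integrable(2)[OF Qm Qf] by simp
      also have "\<dots> \<le> 2 * nrm 0 (cabs (\<lambda>\<z>. Q n \<z> - Y \<z>)) + 2 * nrm 0 (cabs Y)" by (rule nrm_cabs_add_le) measurable
      also have "\<dots> \<le> 2 * 1 + 2 * ennreal y" using elim y by (intro add_mono mult_left_mono) auto
      also have "\<dots> = ennreal (2 + 2 * y)" using y by (simp add: ennreal_mult)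
      finally have "(\<integral>\<z>. (cmod (Q n \<z>))\<^sup>2 \<partial>lborel) \<le> 2 + 2 * y" using y by (subst (asm) ennreal_le_iff) auto
      then show ?case by (simp add: abs_mult mult_left_mono)
    qed
    have "(\<lambda>n. \<bar>h n\<bar> * (2 + 2 * y)) \<longlonglongrightarrow> \<bar>0\<bar> * (2 + 2 * y)" by (intro tendsto_intros hlim)
    then show "(\<lambda>n. \<bar>h n\<bar> * (2 + 2 * y)) \<longlonglongrightarrow> 0" by simp
  qed
  have "(\<lambda>n. 2 * Re (\<integral>\<z>. Q n \<z> * cnj (X t \<z>) \<partial>lborel) + h n * (\<integral>\<z>. (cmod (Q n \<z>))\<^sup>2 \<partial>lborel)) \<longlonglongrightarrow> 2 * Re (\<integral>\<z>. Y \<z> * cnj (X t \<z>) \<partial>lborel) + 0"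
    by (intro tendsto_add tendsto_mult tendsto_const tendsto_Re l1 l2)
  moreover have "((\<integral>\<z>. (cmod (X (Z n) \<z>))\<^sup>2 \<partial>lborel) - (\<integral>\<z>. (cmod (X t \<z>))\<^sup>2 \<partial>lborel)) / (Z n - t)
      = 2 * Re (\<integral>\<z>. Q n \<z> * cnj (X t \<z>) \<partial>lborel) + h n * (\<integral>\<z>. (cmod (Q n \<z>))\<^sup>2 \<partial>lborel)" for n
  proof -
    note ip = L2_pairing(1)[OF Qm[of n] cm Qf[of n] cf]
    note iq = L2_square_integrable(1)[OF Qm[of n] Qf[of n]]
    note it = L2_square_integrable(1)[OF Xt Xf[OF t]]
    have "(cmod (X (Z n) \<z>))\<^sup>2 = (cmod (X t \<z>))\<^sup>2 + (2 * h n * Re (Q n \<z> * cnj (X t \<z>)) + (h n)\<^sup>2 * (cmod (Q n \<z>))\<^sup>2)" for \<z>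
    proof -
      have "X (Z n) \<z> = X t \<z> + complex_of_real (h n) * Q n \<z>" using h0[of n] by (simp add: Q_def)
      then show ?thesis by (simp only: cmod_power2) (simp add: power2_eq_square algebra_simps)
    qed
    then have "(\<integral>\<z>. (cmod (X (Z n) \<z>))\<^sup>2 \<partial>lborel) = (\<integral>\<z>. (cmod (X t \<z>))\<^sup>2 + (2 * h n * Re (Q n \<z> * cnj (X t \<z>)) + (h n)\<^sup>2 * (cmod (Q n \<z>))\<^sup>2) \<partial>lborel)"
      by (simp only:)
    also have "\<dots> = (\<integral>\<z>. (cmod (X t \<z>))\<^sup>2 \<partial>lborel) + ((\<integral>\<z>. 2 * h n * Re (Q n \<z> * cnj (X t \<z>)) \<partial>lborel) + (\<integral>\<z>. (h n)\<^sup>2 * (cmod (Q n \<z>))\<^sup>2 \<partial>lborel))"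
      using it integrable_Re[OF ip] iq
      by (subst Bochner_Integration.integral_add Bochner_Integration.integrable_add; (intro Bochner_Integration.integrable_add integrable_mult_right | simp))+
    also have "\<dots> = (\<integral>\<z>. (cmod (X t \<z>))\<^sup>2 \<partial>lborel) + (2 * h n * Re (\<integral>\<z>. Q n \<z> * cnj (X t \<z>) \<partial>lborel) + (h n)\<^sup>2 * (\<integral>\<z>. (cmod (Q n \<z>))\<^sup>2 \<partial>lborel))"
      using integral_Re[OF ip] by (simp only: integral_mult_right_zero)
    finally show ?thesis using h0[of n] by (simp add: h_def[symmetric] power2_eq_square field_simps)
  qed
  ultimately show "(\<lambda>n. ((\<integral>\<z>. (cmod (X (Z n) \<z>))\<^sup>2 \<partial>lborel) - (\<integral>\<z>. (cmod (X t \<z>))\<^sup>2 \<partial>lborel)) / (Z n - t)) \<longlonglongrightarrow> 2 * Re (\<integral>\<z>. Y \<z> * cnj (X t \<z>) \<partial>lborel)"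
    by simp
qed

text \<open>The exponential weight is tuned to the halving scheme: integrating
  \<open>K * exp (2 * K * t)\<close> gains the factor 1/2.\<close>

lemma energy_comparison:
  fixes E :: "real \<Rightarrow> real"
  assumes d: "\<And>t. t \<in> {0..T} \<Longrightarrow> (E has_real_derivative E' t) (at t within {0..T})"
    and le: "\<And>t. t \<in> {0..T} \<Longrightarrow> E' t \<le> K * (B * exp (2 * K * t))" and E0: "E 0 = 0" and B: "0 \<le> B" and t: "t \<in> {0..T}"
  shows "E t \<le> B / 2 * exp (2 * K * t)"
proof -
  define g where "g \<tau> = E \<tau> - B / 2 * exp (2 * K * \<tau>)" for \<tau>
  have dg: "(g has_real_derivative (E' \<tau> - K * (B * exp (2 * K * \<tau>)))) (at \<tau> within {0..T})" if "\<tau> \<in> {0..T}" for \<tau>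
    unfolding g_def[abs_def] by (rule derivative_eq_intros d[OF that] refl)+ (simp add: algebra_simps)
  have "g t \<le> g 0"
  proof (rule DERIV_nonpos_imp_decreasing_open[of 0 t g])
    show "0 \<le> t" using t by simp
    fix x assume x: "0 < x" "x < t"
    then have "at x within {0..T} = at x" using t by (intro at_within_Icc_at) auto
    then show "\<exists>y. DERIV g x :> y \<and> y \<le> 0" using dg[of x] le[of x] x t by auto
  next
    have "continuous_on {0..T} g" using dg by (intro DERIV_continuous_on)
    then show "continuous_on {0..t} g" by (rule continuous_on_subset) (use t in auto)
  qed
  then show ?thesis using E0 B by (simp add: g_def)
qed

text \<open>On a ball all weights are comparable, so convergence at order s - 2 becomes convergence
  in L^2 after cutting off. This makes the time derivatives of solutions accessible to the energy
  method.\<close>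

lemma nrm_localize:
  "nrm 0 (\<lambda>\<z>. indicator (ball 0 R) \<z> * A \<z>) \<le> ennreal ((1 + R\<^sup>2) powr \<bar>r\<bar>) * nrm r A"
  if [measurable]: "Borel A"
proof -
  have "nrm 0 (\<lambda>\<z>. indicator (ball 0 R) \<z> * A \<z>) \<le> (\<integral>\<^sup>+\<z>. ennreal ((1 + R\<^sup>2) powr \<bar>r\<bar>) * (ennreal (sob_weight (r/2) \<z>) * A \<z>)\<^sup>2 \<partial>lborel)"
    unfolding nrm_0
  proof (rule nn_integral_mono)
    fix \<z> :: "plane"
    show "(indicator (ball 0 R) \<z> * A \<z>)\<^sup>2 \<le> ennreal ((1 + R\<^sup>2) powr \<bar>r\<bar>) * (ennreal (sob_weight (r/2) \<z>) * A \<z>)\<^sup>2"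
    proof (cases "\<z> \<in> ball 0 R")
      case True
      define b where "b = 1 + (fst \<z>)\<^sup>2 + (snd \<z>)\<^sup>2"
      have b1: "1 \<le> b" unfolding b_def by (rule sob_weight_base_ge_1)
      have "norm \<z> < R" using True by simp
      then have "(norm \<z>)\<^sup>2 \<le> R\<^sup>2" by (intro power_mono) auto
      then have bR: "b \<le> 1 + R\<^sup>2" by (simp add: b_def norm_prod_def)
      have "1 = b powr (\<bar>r\<bar> + - \<bar>r\<bar>)" using b1 by simp
      also have "\<dots> = b powr \<bar>r\<bar> * b powr (- \<bar>r\<bar>)" by (rule powr_add)
      also have "\<dots> \<le> (1 + R\<^sup>2) powr \<bar>r\<bar> * b powr r"
        using b1 bR by (intro mult_mono powr_mono2 powr_mono) auto
      finally have 1: "1 \<le> (1 + R\<^sup>2) powr \<bar>r\<bar> * sob_weight r \<z>" by (simp add: sob_weight_def b_def)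
      have "(A \<z>)\<^sup>2 = ennreal 1 * (A \<z>)\<^sup>2" by simp
      also have "\<dots> \<le> ennreal ((1 + R\<^sup>2) powr \<bar>r\<bar> * sob_weight r \<z>) * (A \<z>)\<^sup>2"
        by (intro mult_right_mono ennreal_leI 1) simp
      also have "\<dots> = ennreal ((1 + R\<^sup>2) powr \<bar>r\<bar>) * (ennreal (sob_weight (r/2) \<z>) * A \<z>)\<^sup>2"
        by (simp add: power_mult_distrib ennreal_power sob_weight_half_square ennreal_mult mult.assoc)
      finally show ?thesis using True by simp
    qed simp
  qed
  also have "\<dots> = ennreal ((1 + R\<^sup>2) powr \<bar>r\<bar>) * nrm r A"
    unfolding nrm_def by (rule nn_integral_cmult) measurable
  finally show ?thesis .
qed

section \<open>Lipschitz bounds in L^2\<close>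

lemma conv_L1_L2:
  assumes [measurable]: "Borel F" "Borel G"
  shows "nrm 0 (cabs (conv F G)) \<le> (\<integral>\<^sup>+z. cabs F z \<partial>lborel)\<^sup>2 * nrm 0 (cabs G)"
    and "nrm 0 (cabs (conv G F)) \<le> (\<integral>\<^sup>+z. cabs F z \<partial>lborel)\<^sup>2 * nrm 0 (cabs G)"
proof -
  have Y: "nrm 0 (econv (cabs F) (cabs G)) \<le> (\<integral>\<^sup>+z. cabs F z \<partial>lborel)\<^sup>2 * nrm 0 (cabs G)"
    by (rule Young_L1_L2) measurable
  show "nrm 0 (cabs (conv F G)) \<le> (\<integral>\<^sup>+z. cabs F z \<partial>lborel)\<^sup>2 * nrm 0 (cabs G)"
    by (rule order_trans[OF nrm_mono Y]) (rule cabs_conv_le)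
  have "econv (cabs F) (cabs G) = econv (cabs G) (cabs F)" by (rule ext, rule econv_commute) measurable
  then show "nrm 0 (cabs (conv G F)) \<le> (\<integral>\<^sup>+z. cabs F z \<partial>lborel)\<^sup>2 * nrm 0 (cabs G)"
    by (intro order_trans[OF nrm_mono Y]) (simp only: cabs_conv_le)
qed

lemma conv_bound_ex:
  assumes s: "1 < s"
  obtains K where "0 < K" "\<And>F G. Borel F \<Longrightarrow> Borel G \<Longrightarrow>
      nrm 0 (cabs (conv F G)) \<le> ennreal K * nrm s (cabs F) * nrm 0 (cabs G)"
    "\<And>F G. Borel F \<Longrightarrow> Borel G \<Longrightarrow>
      nrm 0 (cabs (conv G F)) \<le> ennreal K * nrm s (cabs F) * nrm 0 (cabs G)"
proof -
  have "1 < s - 0" using s by simp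
  then obtain K where K: "0 < K" "\<And>A. Borel A \<Longrightarrow>
      (\<integral>\<^sup>+z. ennreal (sob_weight (0/2) z) * A z \<partial>lborel)\<^sup>2 \<le> ennreal K * nrm s A"
    using L1_bound_ex by blast
  have K': "(\<integral>\<^sup>+z. cabs F z \<partial>lborel)\<^sup>2 \<le> ennreal K * nrm s (cabs F)" if [measurable]: "Borel F" for F
    using K(2)[of "cabs F"] by simp
  show thesis
    by (rule that[OF K(1)]; rule order_trans[OF conv_L1_L2(1)] order_trans[OF conv_L1_L2(2)]; (assumption | intro mult_right_mono K'; simp))
qed

text \<open>Telescoping as in \<open>cpow_Lipschitz\<close>, but differences are measured in L^2,
  while the factors beside them have bounded norm of order s. It compares functions at a fixed time,
  as arbitrary solutions require.\<close>

lemma cpow_L2_Lipschitz: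
  assumes s: "1 < s" and M: "0 \<le> M"
  shows "\<exists>L>0. \<forall>F G. Borel F \<longrightarrow> Borel G \<longrightarrow> nrm s (cabs F) \<le> ennreal M \<longrightarrow> nrm s (cabs G) \<le> ennreal M \<longrightarrow>
     nrm 0 (cabs (\<lambda>\<z>. cpow k F \<z> - cpow k G \<z>)) \<le> ennreal L * nrm 0 (cabs (\<lambda>\<z>. F \<z> - G \<z>))"
proof (induction k)
  case 0
  show ?case by (intro exI[of _ 1]) simp
next
  case (Suc k)
  then obtain L where L: "0 < L" "\<And>F G. Borel F \<Longrightarrow> Borel G \<Longrightarrow> nrm s (cabs F) \<le> ennreal M \<Longrightarrow> nrm s (cabs G) \<le> ennreal M \<Longrightarrow>
     nrm 0 (cabs (\<lambda>\<z>. cpow k F \<z> - cpow k G \<z>)) \<le> ennreal L * nrm 0 (cabs (\<lambda>\<z>. F \<z> - G \<z>))" by blast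
  obtain K where K: "0 < K" "\<And>F G. Borel F \<Longrightarrow> Borel G \<Longrightarrow>
      nrm 0 (cabs (conv F G)) \<le> ennreal K * nrm s (cabs F) * nrm 0 (cabs G)"
    "\<And>F G. Borel F \<Longrightarrow> Borel G \<Longrightarrow>
      nrm 0 (cabs (conv G F)) \<le> ennreal K * nrm s (cabs F) * nrm 0 (cabs G)"
    using conv_bound_ex[OF s] by blast
  obtain B where B: "1 \<le> B" "\<And>T u v. path T u \<Longrightarrow> path T v \<Longrightarrow> nrm s (env T u) \<le> ennreal M \<Longrightarrow> nrm s (env T v) \<le> ennreal M \<Longrightarrow>
     nrm s (env T (\<lambda>t. cpow k (u t))) \<le> ennreal B"
    using cpow_Lipschitz[OF s M, of k] by blast
  \<comment> \<open>On the degenerate interval with \<open>T = 0\<close> the supremum over time is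
    the modulus itself, so bounds for curves specialise to single functions.\<close>
  have env0: "env 0 (\<lambda>t. F) = cabs F" for F by (rule ext) (simp add: env_const)
  have Bk: "nrm s (cabs (cpow k F)) \<le> ennreal B" if "Borel F" "nrm s (cabs F) \<le> ennreal M" for F
    using B(2)[of 0 "\<lambda>t. F" "\<lambda>t. F"] that by (simp add: env0 path_const)
  define L' where "L' = cF\<^sup>2 * (2 * (K * B) + 2 * (K * M * L))"
  have L': "0 < L'"
    unfolding L'_def using K(1) L(1) B(1) M by (intro mult_pos_pos add_pos_nonneg zero_less_power cF_pos) auto
  show ?case
  proof (intro exI[of _ L'] conjI allI impI L')
    fix F G assume Fm[measurable]: "Borel F" and Gm[measurable]: "Borel G"
      and FM: "nrm s (cabs F) \<le> ennreal M" and GM: "nrm s (cabs G) \<le> ennreal M"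
    note cm[measurable] = cpow_measurable[OF Fm, of k] cpow_measurable[OF Gm, of k]
    have s0: "0 \<le> s" using s by simp
    have f0: "nrm 0 (cabs F) < \<infinity>" "nrm 0 (cabs G) < \<infinity>" "nrm 0 (cabs (cpow k F)) < \<infinity>" "nrm 0 (cabs (cpow k G)) < \<infinity>"
      by (rule nrm_0_finite[OF s0 order.strict_trans1[OF FM]] nrm_0_finite[OF s0 order.strict_trans1[OF GM]]
        nrm_0_finite[OF s0 order.strict_trans1[OF Bk[OF Fm FM]]] nrm_0_finite[OF s0 order.strict_trans1[OF Bk[OF Gm GM]]]; simp)+
    let ?d = "nrm 0 (cabs (\<lambda>\<z>. F \<z> - G \<z>))"
    have eq: "cpow (Suc k) F \<z> - cpow (Suc k) G \<z> = complex_of_real cF * (conv (\<lambda>z. F z - G z) (cpow k F) \<z> + conv G (\<lambda>z. cpow k F z - cpow k G z) \<z>)" for \<z>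
      by (simp add: conv_diff_left[OF Fm Gm cm(1) f0(1,2,3)] conv_diff_right[OF Gm cm(2) cm(1) f0(2) f0(4) f0(3)] algebra_simps)
    have "nrm 0 (cabs (\<lambda>\<z>. cpow (Suc k) F \<z> - cpow (Suc k) G \<z>))
       = ennreal (cF\<^sup>2) * nrm 0 (cabs (\<lambda>\<z>. conv (\<lambda>z. F z - G z) (cpow k F) \<z> + conv G (\<lambda>z. cpow k F z - cpow k G z) \<z>))"
      unfolding eq by (subst nrm_cabs_cmult) auto
    also have "\<dots> \<le> ennreal (cF\<^sup>2) * (2 * nrm 0 (cabs (conv (\<lambda>z. F z - G z) (cpow k F))) + 2 * nrm 0 (cabs (conv G (\<lambda>z. cpow k F z - cpow k G z))))"
      by (intro mult_left_mono nrm_cabs_add_le) auto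
    also have "\<dots> \<le> ennreal (cF\<^sup>2) * (2 * (ennreal K * ennreal B * ?d) + 2 * (ennreal K * ennreal M * (ennreal L * ?d)))"
    proof (intro mult_left_mono add_mono)
      show "nrm 0 (cabs (conv (\<lambda>z. F z - G z) (cpow k F))) \<le> ennreal K * ennreal B * ?d"
        by (rule order_trans[OF K(3)]) (measurable, intro mult_right_mono mult_left_mono Bk Fm FM, simp_all)
      show "nrm 0 (cabs (conv G (\<lambda>z. cpow k F z - cpow k G z))) \<le> ennreal K * ennreal M * (ennreal L * ?d)"
        by (rule order_trans[OF K(2)]) (measurable, intro mult_mono L(2) Fm Gm FM GM, simp_all add: GM mult_left_mono)
    qed auto
    also have "\<dots> = ennreal L' * ?d"
    proof -
      have "ennreal L' = ennreal (cF\<^sup>2) * (2 * (ennreal K * ennreal B) + 2 * (ennreal K * ennreal M * ennreal L))"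
        unfolding L'_def using K(1) L(1) B(1) M by (simp add: ennreal_mult)
      then show ?thesis by (simp only: distrib_left distrib_right mult.assoc)
    qed
    finally show "nrm 0 (cabs (\<lambda>\<z>. cpow (Suc k) F \<z> - cpow (Suc k) G \<z>)) \<le> ennreal L' * ?d" .
  qed
qed

context bbm_kp begin

text \<open>\<open>forcing\<close> is linear in its two arguments jointly and both multipliers are
  at most 1. Hence the power and the product with \<open>a\<close> may be estimated separately in
  L^2.\<close>

lemma forcing_L2_ex:
  assumes M: "0 \<le> M"
  shows "\<exists>C>0. \<forall>F G. Borel F \<longrightarrow> Borel G \<longrightarrow> nrm s (cabs F) \<le> ennreal M \<longrightarrow> nrm s (cabs G) \<le> ennreal M \<longrightarrow>
    nrm 0 (cabs (\<lambda>\<z>. forcing (cpow p F) F \<z> - forcing (cpow p G) G \<z>)) \<le> ennreal C * nrm 0 (cabs (\<lambda>\<z>. F \<z> - G \<z>))"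
proof -
  have s1: "1 < s" using s by simp
  obtain L where L: "0 < L" "\<And>F G. Borel F \<Longrightarrow> Borel G \<Longrightarrow> nrm s (cabs F) \<le> ennreal M \<Longrightarrow> nrm s (cabs G) \<le> ennreal M \<Longrightarrow>
     nrm 0 (cabs (\<lambda>\<z>. cpow p F \<z> - cpow p G \<z>)) \<le> ennreal L * nrm 0 (cabs (\<lambda>\<z>. F \<z> - G \<z>))"
    using cpow_L2_Lipschitz[OF s1 M, of p] by blast
  obtain K where K: "0 < K" "\<And>F G. Borel F \<Longrightarrow> Borel G \<Longrightarrow>
      nrm 0 (cabs (conv F G)) \<le> ennreal K * nrm s (cabs F) * nrm 0 (cabs G)"
    "\<And>F G. Borel F \<Longrightarrow> Borel G \<Longrightarrow>
      nrm 0 (cabs (conv G F)) \<le> ennreal K * nrm s (cabs F) * nrm 0 (cabs G)"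
    using conv_bound_ex[OF s1] by blast
  obtain b where b: "nrm s (cabs ah) = ennreal b" "0 \<le> b" using ah_fin by (cases "nrm s (cabs ah)") auto
  define C where "C = 2 * L + 2 * (cF\<^sup>2 * (K * b))"
  have C: "0 < C" unfolding C_def using L(1) K(1) b(2) by (intro add_pos_nonneg) auto
  show ?thesis
  proof (intro exI[of _ C] conjI allI impI C)
    fix F G assume Fm[measurable]: "Borel F" and Gm[measurable]: "Borel G"
      and FM: "nrm s (cabs F) \<le> ennreal M" and GM: "nrm s (cabs G) \<le> ennreal M"
    note cm[measurable] = cpow_measurable[OF Fm, of p] cpow_measurable[OF Gm, of p]
    have fin: "nrm s (cabs F) < \<infinity>" "nrm s (cabs G) < \<infinity>"
      using order.strict_trans1[OF FM] order.strict_trans1[OF GM] by simp_all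
    let ?d = "nrm 0 (cabs (\<lambda>\<z>. F \<z> - G \<z>))"
    let ?P = "\<lambda>\<z>. cpow p F \<z> - cpow p G \<z>" and ?C = "\<lambda>\<z>. complex_of_real cF * conv ah (\<lambda>\<z>. F \<z> - G \<z>) \<z>"
    have fd: "forcing (cpow p F) F \<z> - forcing (cpow p G) G \<z> = forcing ?P (\<lambda>\<z>. F \<z> - G \<z>) \<z>" for \<z>
      by (intro forcing_diff[symmetric] Fm Gm fin)
    have "nrm 0 (cabs (\<lambda>\<z>. forcing (cpow p F) F \<z> - forcing (cpow p G) G \<z>)) \<le> nrm 0 (\<lambda>\<z>. cabs ?P \<z> + cabs ?C \<z>)"
    proof (rule nrm_mono)
      fix \<z>
      have "cmod (forcing ?P (\<lambda>\<z>. F \<z> - G \<z>) \<z>) \<le> cmod (\<i> * complex_of_real (mN p \<z>) * ?P \<z>) + cmod (complex_of_real (mA \<z>) * ?C \<z>)"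
        unfolding forcing_def
        using norm_triangle_ineq4[of "- \<i> * complex_of_real (mN p \<z>) * ?P \<z>" "complex_of_real (mA \<z>) * ?C \<z>"]
        by (simp only: minus_mult_left[symmetric] norm_minus_cancel)
      also have "\<dots> \<le> cmod (?P \<z>) + cmod (?C \<z>)"
      proof (rule add_mono)
        have "cmod (\<i> * complex_of_real (mN p \<z>) * ?P \<z>) = \<bar>mN p \<z>\<bar> * cmod (?P \<z>)" by (simp add: norm_mult)
        also have "\<dots> \<le> 1 * cmod (?P \<z>)" by (intro mult_right_mono mN_bound) simp
        finally show "cmod (\<i> * complex_of_real (mN p \<z>) * ?P \<z>) \<le> cmod (?P \<z>)" by simp
        have "cmod (complex_of_real (mA \<z>) * ?C \<z>) = mA \<z> * cmod (?C \<z>)" using mA_bounds(1)[of \<z>] by (simp add: norm_mult)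
        also have "\<dots> \<le> 1 * cmod (?C \<z>)" by (intro mult_right_mono mA_bounds) simp
        finally show "cmod (complex_of_real (mA \<z>) * ?C \<z>) \<le> cmod (?C \<z>)" by simp
      qed
      finally have "ennreal (cmod (forcing ?P (\<lambda>\<z>. F \<z> - G \<z>) \<z>)) \<le> ennreal (cmod (?P \<z>) + cmod (?C \<z>))" by (rule ennreal_leI)
      then show "ennreal (cmod (forcing (cpow p F) F \<z> - forcing (cpow p G) G \<z>)) \<le> cabs ?P \<z> + cabs ?C \<z>"
        unfolding fd by (simp only: ennreal_plus norm_ge_zero)
    qed
    also have "\<dots> \<le> 2 * nrm 0 (cabs ?P) + 2 * nrm 0 (cabs ?C)" by (rule nrm_add) measurable
    also have "\<dots> \<le> 2 * (ennreal L * ?d) + 2 * (ennreal (cF\<^sup>2) * (ennreal K * ennreal b * ?d))"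
    proof (intro add_mono mult_left_mono)
      show "nrm 0 (cabs ?P) \<le> ennreal L * ?d" by (rule L(2)[OF Fm Gm FM GM])
      have "nrm 0 (cabs ?C) = ennreal (cF\<^sup>2) * nrm 0 (cabs (conv ah (\<lambda>\<z>. F \<z> - G \<z>)))"
        by (subst nrm_cabs_cmult) auto
      also have "\<dots> \<le> ennreal (cF\<^sup>2) * (ennreal K * ennreal b * ?d)"
        unfolding b(1)[symmetric] by (intro mult_left_mono K(2)) auto
      finally show "nrm 0 (cabs ?C) \<le> ennreal (cF\<^sup>2) * (ennreal K * ennreal b * ?d)" .
    qed auto
    also have "\<dots> = ennreal C * ?d"
    proof -
      have "ennreal C = 2 * ennreal L + 2 * (ennreal (cF\<^sup>2) * (ennreal K * ennreal b))"
        unfolding C_def using K(1) L(1) b(2) by (simp add: ennreal_mult)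
      then show ?thesis by (simp only: distrib_left distrib_right mult.assoc)
    qed
    finally show "nrm 0 (cabs (\<lambda>\<z>. forcing (cpow p F) F \<z> - forcing (cpow p G) G \<z>)) \<le> ennreal C * ?d" .
  qed
qed

text \<open>Continuity in norm on a compact interval. Bisection by \<open>Bolzano\<close> avoids
  turning the \<open>ennreal\<close> valued norm into a real function: boundedness on intervals is
  additive and holds near every point.\<close>

lemma sol_bounded:
  assumes T: "0 \<le> T" and u: "is_sol s p \<gamma> a u0 T u V"
  shows "\<exists>M\<ge>0. \<forall>t\<in>{0..T}. nrm s (cabs (ft (u t))) \<le> ennreal M"
proof -
  have l2: "is_l2_ft (u t) (ft (u t))" and fin: "nrm s (cabs (ft (u t))) < \<infinity>" if "t \<in> {0..T}" for t
  proof -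
    have X: "in_Xs s (u t)" using u that by (simp add: is_sol_def)
    then show l: "is_l2_ft (u t) (ft (u t))" by (intro ft_is_l2_ft) (simp add: in_Xs_def)
    show "nrm s (cabs (ft (u t))) < \<infinity>" using X in_Xs_iff[OF l] by simp
  qed
  define P where "P c d \<longleftrightarrow> (\<exists>M\<ge>0. \<forall>t\<in>{0..T} \<inter> {c..d}. nrm s (cabs (ft (u t))) \<le> ennreal M)" for c d
  have "P 0 T"
  proof (rule Bolzano[OF T])
    fix c d e assume "P c d" "P d e"
    then obtain M N where M: "0 \<le> M" "\<And>t. t \<in> {0..T} \<inter> {c..d} \<Longrightarrow> nrm s (cabs (ft (u t))) \<le> ennreal M"
      and N: "0 \<le> N" "\<And>t. t \<in> {0..T} \<inter> {d..e} \<Longrightarrow> nrm s (cabs (ft (u t))) \<le> ennreal N" unfolding P_def by blast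
    have "nrm s (cabs (ft (u t))) \<le> ennreal (max M N)" if "t \<in> {0..T} \<inter> {c..e}" for t
    proof (cases "t \<le> d")
      case True
      then have "nrm s (cabs (ft (u t))) \<le> ennreal M" using that by (intro M(2)) auto
      also have "\<dots> \<le> ennreal (max M N)" by (intro ennreal_leI) simp
      finally show ?thesis .
    next
      case False
      then have "nrm s (cabs (ft (u t))) \<le> ennreal N" using that by (intro N(2)) auto
      also have "\<dots> \<le> ennreal (max M N)" by (intro ennreal_leI) simp
      finally show ?thesis .
    qed
    then show "P c e" unfolding P_def using M(1) by (intro exI[of _ "max M N"]) auto
  next
    fix x assume x: "0 \<le> x" "x \<le> T"
    then have xI: "x \<in> {0..T}" by simp
    have "((\<lambda>\<tau>. xs_dist2 s (u \<tau>) (u x)) \<longlongrightarrow> 0) (at x within {0..T})" using u xI by (simp add: is_sol_def)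
    then have "\<forall>\<^sub>F \<tau> in at x within {0..T}. xs_dist2 s (u \<tau>) (u x) < 1" by (rule order_tendstoD(2)) simp
    then obtain r where r: "0 < r" "\<And>\<tau>. \<tau> \<in> {0..T} \<Longrightarrow> \<tau> \<noteq> x \<Longrightarrow> dist \<tau> x < r \<Longrightarrow> xs_dist2 s (u \<tau>) (u x) < 1"
      unfolding eventually_at by blast
    obtain m where m: "nrm s (cabs (ft (u x))) = ennreal m" "0 \<le> m" using fin[OF xI] by (cases "nrm s (cabs (ft (u x)))") auto
    have b: "nrm s (cabs (ft (u \<tau>))) \<le> ennreal (2 + 2 * m)" if \<tau>: "\<tau> \<in> {0..T}" "dist \<tau> x < r" for \<tau>
    proof (cases "\<tau> = x")
      case True
      then show ?thesis using m by (simp only: m(1)) (rule ennreal_leI, simp)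
    next
      case False
      note mm = is_l2_ft_measurable[OF l2[OF \<tau>(1)]] is_l2_ft_measurable[OF l2[OF xI]]
      have "nrm s (cabs (\<lambda>\<z>. ft (u \<tau>) \<z> - ft (u x) \<z>)) \<le> xs_dist2 s (u \<tau>) (u x)"
        unfolding xs_dist2_eq[OF l2[OF \<tau>(1)] l2[OF xI]] by simp
      then have 1: "nrm s (cabs (\<lambda>\<z>. ft (u \<tau>) \<z> - ft (u x) \<z>)) \<le> 1" using r(2)[OF \<tau>(1) False \<tau>(2)] by (meson less_imp_le order_trans)
      have "nrm s (cabs (ft (u \<tau>))) = nrm s (cabs (\<lambda>\<z>. (ft (u \<tau>) \<z> - ft (u x) \<z>) + ft (u x) \<z>))" by simp
      also have "\<dots> \<le> 2 * nrm s (cabs (\<lambda>\<z>. ft (u \<tau>) \<z> - ft (u x) \<z>)) + 2 * nrm s (cabs (ft (u x)))"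
        by (intro nrm_cabs_add_le borel_measurable_diff mm)
      also have "\<dots> \<le> 2 * 1 + 2 * ennreal m" using 1 m by (intro add_mono mult_left_mono) auto
      also have "\<dots> = ennreal (2 + 2 * m)" using m by (simp add: ennreal_mult)
      finally show ?thesis .
    qed
    show "\<exists>d>0. \<forall>c e. c \<le> x \<and> x \<le> e \<and> e - c < d \<longrightarrow> P c e"
    proof (intro exI[of _ r] conjI allI impI r(1))
      fix c e assume ce: "c \<le> x \<and> x \<le> e \<and> e - c < r"
      have "nrm s (cabs (ft (u \<tau>))) \<le> ennreal (2 + 2 * m)" if "\<tau> \<in> {0..T} \<inter> {c..e}" for \<tau>
        using that ce by (intro b) (auto simp: dist_real_def)
      then show "P c e" unfolding P_def using m(2) by (intro exI[of _ "2 + 2 * m"]) auto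
    qed
  qed
  then show ?thesis by (auto simp: P_def)
qed

end

lemma ennreal_halving_zero:
  fixes x :: ennreal
  assumes "\<And>n. x \<le> ennreal (b / 2 ^ n)" shows "x = 0"
proof -
  have "(\<lambda>n. b * (1/2) ^ n) \<longlonglongrightarrow> b * 0" by (intro tendsto_mult_left LIMSEQ_realpow_zero) auto
  moreover have "b * (1/2) ^ n = b / 2 ^ n" for n :: nat by (simp add: power_divide)
  ultimately have "(\<lambda>n. b / 2 ^ n) \<longlonglongrightarrow> 0" by simp
  then have "(\<lambda>n. ennreal (b / 2 ^ n)) \<longlonglongrightarrow> ennreal 0" by (rule tendsto_ennrealI)
  then have "x \<le> ennreal 0" by (rule LIMSEQ_le_const) (use assms in auto)
  then show ?thesis by simp
qed

text \<open>Fatou's lemma along growing balls; it carries bounds for localised energies back to the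
  whole plane of frequencies.\<close>

lemma nrm_exhaust:
  assumes [measurable]: "Borel A"
    and bd: "\<And>n. nrm s (\<lambda>\<z>. indicator (ball 0 (real n)) \<z> * A \<z>) \<le> B"
  shows "nrm s A \<le> B"
proof -
  have im: "Borel (indicator (ball (0::real\<times>real) (real n)))" for n :: nat
    by (rule borel_measurable_indicator) simp
  have "nrm s A \<le> liminf (\<lambda>n. nrm s (\<lambda>\<z>. indicator (ball 0 (real n)) \<z> * A \<z>))"
  proof (rule nrm_le_liminf)
    show "Borel (\<lambda>\<z>. indicator (ball 0 (real n)) \<z> * A \<z>)" for n
      using im by (intro borel_measurable_times_ennreal) auto
    fix \<z> :: "plane"
    obtain N :: nat where N: "norm \<z> < real N" using reals_Archimedean2 by blast
    have "(\<lambda>n. indicator (ball 0 (real n)) \<z> * A \<z>) \<longlonglongrightarrow> A \<z>"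
    proof (rule tendsto_eventually)
      show "\<forall>\<^sub>F n in sequentially. indicator (ball 0 (real n)) \<z> * A \<z> = A \<z>"
        using eventually_ge_at_top[of N]
      proof eventually_elim
        case (elim n)
        then have "\<z> \<in> ball 0 (real n)" using N by simp
        then show ?case by simp
      qed
    qed
    then have "liminf (\<lambda>n. indicator (ball 0 (real n)) \<z> * A \<z>) = A \<z>" by (intro lim_imp_Liminf) auto
    then show "A \<z> \<le> liminf (\<lambda>n. indicator (ball 0 (real n)) \<z> * A \<z>)" by simp
  qed
  also have "\<dots> \<le> B" by (intro Liminf_le always_eventually allI bd) auto
  finally show ?thesis .
qed

lemma is_solD:
  assumes "is_sol s p \<gamma> a u0 T u V" and "t \<in> {0..T}"
  shows "in_Xs s (u t)" "wL2 (s - 2) (V t)"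
    "((\<lambda>\<tau>. wdist2 (s - 2) (\<lambda>\<z>. (ft (u \<tau>) \<z> - ft (u t) \<z>) / complex_of_real (\<tau> - t)) (V t)) \<longlongrightarrow> 0) (at t within {0..T})"
    "AE x in lborel. u 0 x = u0 x" "AE \<z> in lborel. V t \<z> = eq_rhs p \<gamma> a (u t) \<z>"
  using assms unfolding is_sol_def by blast+

context bbm_kp begin

text \<open>The energy of the difference over a ball is differentiable, but its growth is bounded by
  the full energy, so Gronwall's lemma does not close on a single ball. A bound for the full energy
  improves that on each ball by a factor 1/2, uniformly in the radius, and hence the full bound;
  iteration leaves 0.\<close>

lemma sol_unique:
  assumes T: "0 < T" and a: "is_l2_ft a ah" and u0: "sq_integrable u0"
    and u: "is_sol s p \<gamma> a u0 T u V" and v: "is_sol s p \<gamma> a u0 T v W" and t: "t \<in> {0..T}"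
  shows "AE x in lborel. v t x = u t x"
proof -
  have s0: "0 \<le> s" using s by simp
  define F G where "F t = ft (u t)" and "G t = ft (v t)" for t
  have lu: "is_l2_ft (u t) (F t)" and lv: "is_l2_ft (v t) (G t)" if "t \<in> {0..T}" for t
    using is_solD(1)[OF u that] is_solD(1)[OF v that] by (auto simp: in_Xs_def F_def G_def intro: ft_is_l2_ft)
  have Fm: "Borel (F t)" and Gm: "Borel (G t)" if "t \<in> {0..T}" for t
    using is_l2_ft_measurable lu[OF that] lv[OF that] by auto
  obtain M1 where M1: "0 \<le> M1" "\<And>t. t \<in> {0..T} \<Longrightarrow> nrm s (cabs (F t)) \<le> ennreal M1"
    using sol_bounded[OF less_imp_le[OF T] u] unfolding F_def by blast
  obtain M2 where M2: "\<And>t. t \<in> {0..T} \<Longrightarrow> nrm s (cabs (G t)) \<le> ennreal M2"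
    using sol_bounded[OF less_imp_le[OF T] v] unfolding G_def by blast
  define M where "M = max M1 M2"
  have FM: "nrm s (cabs (F t)) \<le> ennreal M" and GM: "nrm s (cabs (G t)) \<le> ennreal M" if "t \<in> {0..T}" for t
    using order_trans[OF M1(2)[OF that], of "ennreal M"] order_trans[OF M2[OF that], of "ennreal M"]
    by (auto simp: M_def ennreal_leI)
  have M0: "0 \<le> M" using M1(1) by (simp add: M_def)
  have Ff: "nrm s (cabs (F t)) < \<infinity>" and Gf: "nrm s (cabs (G t)) < \<infinity>" if "t \<in> {0..T}" for t
    using order.strict_trans1[OF FM[OF that]] order.strict_trans1[OF GM[OF that]] by auto
  obtain C where C: "0 < C" "\<And>F G. Borel F \<Longrightarrow> Borel G \<Longrightarrow> nrm s (cabs F) \<le> ennreal M \<Longrightarrow> nrm s (cabs G) \<le> ennreal M \<Longrightarrow>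
    nrm 0 (cabs (\<lambda>\<z>. forcing (cpow p F) F \<z> - forcing (cpow p G) G \<z>)) \<le> ennreal C * nrm 0 (cabs (\<lambda>\<z>. F \<z> - G \<z>))"
    using forcing_L2_ex[OF M0] by blast
  define D where "D t \<z> = F t \<z> - G t \<z>" for t \<z>
  define \<Delta> where "\<Delta> t \<z> = forcing (cpow p (F t)) (F t) \<z> - forcing (cpow p (G t)) (G t) \<z>" for t \<z>
  have Dm: "Borel (D t)" if "t \<in> {0..T}" for t
    unfolding D_def[abs_def] by (intro borel_measurable_diff Fm Gm that)
  have forc_m: "Borel (forcing (cpow p H) H)" if [measurable]: "Borel H" for H
  proof -
    note [measurable] = cpow_measurable[OF that, of p]
    show ?thesis unfolding forcing_def[abs_def] by measurable
  qed
  have \<Delta>m: "Borel (\<Delta> t)" if "t \<in> {0..T}" for t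
    unfolding \<Delta>_def[abs_def] by (intro borel_measurable_diff forc_m Fm Gm that)
  have Dbd: "nrm 0 (cabs (D t)) \<le> ennreal (4 * M)" if t: "t \<in> {0..T}" for t
  proof -
    have "nrm 0 (cabs (D t)) \<le> nrm s (cabs (D t))" by (rule nrm_mono_weight[OF s0])
    also have "\<dots> \<le> 2 * nrm s (cabs (F t)) + 2 * nrm s (cabs (G t))"
      unfolding D_def[abs_def] by (intro nrm_cabs_diff_le Fm Gm t)
    also have "\<dots> \<le> 2 * ennreal M + 2 * ennreal M" by (intro add_mono mult_left_mono FM GM t) auto
    also have "\<dots> = ennreal (4 * M)" using M0 by (simp add: ennreal_mult distrib_right[symmetric])
    finally show ?thesis .
  qed
  have Df: "nrm 0 (cabs (D t)) < \<infinity>" if "t \<in> {0..T}" for t using order.strict_trans1[OF Dbd[OF that]] by simp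
  have \<Delta>D: "nrm 0 (cabs (\<Delta> t)) \<le> ennreal C * nrm 0 (cabs (D t))" if t: "t \<in> {0..T}" for t
    unfolding \<Delta>_def[abs_def] D_def[abs_def] by (intro C(2) Fm Gm FM GM t)
  have \<Delta>f: "nrm 0 (cabs (\<Delta> t)) < \<infinity>" if "t \<in> {0..T}" for t
    using order.strict_trans1[OF \<Delta>D[OF that]] Df[OF that] by (simp add: ennreal_mult_less_top)
  have Vm: "Borel (V t)" and Wm: "Borel (W t)" if "t \<in> {0..T}" for t
    using is_solD(2)[OF u that] is_solD(2)[OF v that] by (auto simp: wL2_def)
  have VW: "AE \<z> in lborel. V t \<z> - W t \<z> = - \<i> * complex_of_real (phi \<gamma> \<z>) * D t \<z> + \<Delta> t \<z>" if t: "t \<in> {0..T}" for t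
  proof -
    show ?thesis
      using is_solD(5)[OF u t] is_solD(5)[OF v t] eq_rhs_AE[OF a lu[OF t] Ff[OF t]] eq_rhs_AE[OF a lv[OF t] Gf[OF t]]
    proof eventually_elim
      case (elim \<z>)
      show ?case unfolding elim rhsf_def D_def \<Delta>_def by (simp add: algebra_simps)
    qed
  qed
  \<comment> \<open>From 2 Re (x cnj y) \<le> |x|^2 + |y|^2: \<open>C\<close> stands for the
    difference of the forcing terms, 1 for \<open>D\<close> itself.\<close>
  define K where "K = 1 + C"
  have K: "0 < K" using C(1) by (simp add: K_def)
  define S where "S n t \<z> = indicator (ball 0 (real n)) \<z> * D t \<z>" for n :: nat and t \<z>
  \<comment> \<open>The phase is unbounded even on a ball, near xi = 0. Local square integrability
    of the derivative is therefore taken from the class of solutions, through \<open>V\<close> and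
    \<open>W\<close> at order s - 2, and not from the equation.\<close>
  define Y where "Y n t \<z> = indicator (ball 0 (real n)) \<z> * (V t \<z> - W t \<z>)" for n :: nat and t \<z>
  have im: "Borel (\<lambda>\<z>. indicator (ball (0::real\<times>real) (real n)) \<z> :: complex)" for n :: nat
    by (rule borel_measurable_indicator) simp
  have Sm: "Borel (S n t)" if "t \<in> {0..T}" for n t
    unfolding S_def[abs_def] by (intro borel_measurable_times im Dm that)
  have Ym: "Borel (Y n t)" if "t \<in> {0..T}" for n t
    unfolding Y_def[abs_def] by (intro borel_measurable_times im borel_measurable_diff Vm Wm that)
  have ci: "cabs (\<lambda>\<z>. indicator (ball 0 (real n)) \<z> * H \<z>) = (\<lambda>\<z>. indicator (ball 0 (real n)) \<z> * cabs H \<z>)" for n :: nat and H :: "plane \<Rightarrow> complex"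
    by (rule ext) (simp add: indicator_def)
  have S_le: "nrm 0 (cabs (S n t)) \<le> nrm 0 (cabs (D t))" for n t
    by (rule nrm_mono) (simp add: S_def indicator_def)
  have Sf: "nrm 0 (cabs (S n t)) < \<infinity>" if "t \<in> {0..T}" for n t
    by (rule order.strict_trans1[OF S_le Df[OF that]])
  have Yf: "nrm 0 (cabs (Y n t)) < \<infinity>" if t: "t \<in> {0..T}" for n t
  proof -
    have "nrm (s - 2) (cabs (V t)) < \<infinity>" "nrm (s - 2) (cabs (W t)) < \<infinity>"
      using is_solD(2)[OF u t] is_solD(2)[OF v t] wL2_cong_AE[OF Vm[OF t] Vm[OF t]] wL2_cong_AE[OF Wm[OF t] Wm[OF t]] by simp_all
    then have f: "nrm (s - 2) (cabs (\<lambda>\<z>. V t \<z> - W t \<z>)) < \<infinity>" by (intro nrm_cabs_diff_finite Vm Wm t)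
    have "nrm 0 (cabs (Y n t)) \<le> ennreal ((1 + (real n)\<^sup>2) powr \<bar>s - 2\<bar>) * nrm (s - 2) (cabs (\<lambda>\<z>. V t \<z> - W t \<z>))"
      unfolding Y_def[abs_def] ci by (rule nrm_localize) (use Vm[OF t] Wm[OF t] in measurable)
    also have "\<dots> < \<infinity>" using f by (simp add: ennreal_mult_less_top)
    finally show ?thesis .
  qed
  have lim: "((\<lambda>\<tau>. nrm 0 (cabs (\<lambda>\<z>. (S n \<tau> \<z> - S n t \<z>) / complex_of_real (\<tau> - t) - Y n t \<z>))) \<longlongrightarrow> 0) (at t within {0..T})"
    if t: "t \<in> {0..T}" for n t
  proof -
    define c where "c = ennreal ((1 + (real n)\<^sup>2) powr \<bar>s - 2\<bar>)"
    have c: "c < top" by (simp add: c_def)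
    define q r where "q \<tau> = nrm (s - 2) (cabs (\<lambda>\<z>. (F \<tau> \<z> - F t \<z>) / complex_of_real (\<tau> - t) - V t \<z>))"
      and "r \<tau> = nrm (s - 2) (cabs (\<lambda>\<z>. (G \<tau> \<z> - G t \<z>) / complex_of_real (\<tau> - t) - W t \<z>))" for \<tau>
    have q: "(q \<longlongrightarrow> 0) (at t within {0..T})" and r: "(r \<longlongrightarrow> 0) (at t within {0..T})"
      using is_solD(3)[OF u t] is_solD(3)[OF v t] unfolding q_def[abs_def] r_def[abs_def] F_def G_def wdist2_eq_nrm by simp_all
    have qr: "((\<lambda>\<tau>. 2 * q \<tau> + 2 * r \<tau>) \<longlongrightarrow> 0) (at t within {0..T})"
    proof -
      have "((\<lambda>\<tau>. 2 * q \<tau>) \<longlongrightarrow> 2 * 0) (at t within {0..T})" by (rule ennreal_tendsto_cmult[OF _ q]) simp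
      moreover have "((\<lambda>\<tau>. 2 * r \<tau>) \<longlongrightarrow> 2 * 0) (at t within {0..T})" by (rule ennreal_tendsto_cmult[OF _ r]) simp
      ultimately have "((\<lambda>\<tau>. 2 * q \<tau> + 2 * r \<tau>) \<longlongrightarrow> 2 * 0 + 2 * 0) (at t within {0..T})" by (rule tendsto_add)
      then show ?thesis by simp
    qed
    have "((\<lambda>\<tau>. c * (2 * q \<tau> + 2 * r \<tau>)) \<longlongrightarrow> c * 0) (at t within {0..T})" by (rule ennreal_tendsto_cmult[OF c qr])
    then have "((\<lambda>\<tau>. c * (2 * q \<tau> + 2 * r \<tau>)) \<longlongrightarrow> 0) (at t within {0..T})" by simp
    then show ?thesis
    proof (rule ennreal_tendsto_0_le)
      have "\<forall>\<^sub>F \<tau> in at t within {0..T}. \<tau> \<in> {0..T}" by (simp add: eventually_at_filter)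
      then show "\<forall>\<^sub>F \<tau> in at t within {0..T}. nrm 0 (cabs (\<lambda>\<z>. (S n \<tau> \<z> - S n t \<z>) / complex_of_real (\<tau> - t) - Y n t \<z>)) \<le> c * (2 * q \<tau> + 2 * r \<tau>)"
      proof eventually_elim
        case (elim \<tau>)
        define A where "A \<z> = (F \<tau> \<z> - F t \<z>) / complex_of_real (\<tau> - t) - V t \<z>" for \<z>
        define B where "B \<z> = (G \<tau> \<z> - G t \<z>) / complex_of_real (\<tau> - t) - W t \<z>" for \<z>
        have Am: "Borel A" and Bm: "Borel B"
          unfolding A_def[abs_def] B_def[abs_def]
          by (intro borel_measurable_diff borel_measurable_divide borel_measurable_const Fm Gm Vm Wm t elim)+
        have eq: "(S n \<tau> \<z> - S n t \<z>) / complex_of_real (\<tau> - t) - Y n t \<z> = indicator (ball 0 (real n)) \<z> * (A \<z> - B \<z>)" for \<z>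
          by (simp only: S_def Y_def D_def A_def B_def divide_inverse) (simp only: algebra_simps)
        have "nrm 0 (cabs (\<lambda>\<z>. (S n \<tau> \<z> - S n t \<z>) / complex_of_real (\<tau> - t) - Y n t \<z>)) \<le> c * nrm (s - 2) (cabs (\<lambda>\<z>. A \<z> - B \<z>))"
          unfolding eq ci c_def by (rule nrm_localize) (use Am Bm in measurable)
        also have "\<dots> \<le> c * (2 * nrm (s - 2) (cabs A) + 2 * nrm (s - 2) (cabs B))"
          by (intro mult_left_mono nrm_cabs_diff_le Am Bm) simp
        finally show ?case unfolding q_def r_def A_def[symmetric] B_def[symmetric] .
      qed
    qed
  qed
  define E where "E n t = (\<integral>\<z>. (cmod (S n t \<z>))\<^sup>2 \<partial>lborel)" for n t
  define E' where "E' n t = 2 * Re (\<integral>\<z>. Y n t \<z> * cnj (S n t \<z>) \<partial>lborel)" for n t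
  have dE: "(E n has_real_derivative E' n t) (at t within {0..T})" if t: "t \<in> {0..T}" for n t
    unfolding E_def[abs_def] E'_def by (intro energy_derivative Sm Ym Sf Yf lim t)
  \<comment> \<open>The full \<open>D\<close> appears on the right, since the forcing at one
    frequency depends on all the others. The bound is independent of \<open>n\<close>.\<close>
  have E'_le: "E' n t \<le> K * (\<integral>\<z>. (cmod (D t \<z>))\<^sup>2 \<partial>lborel)" if t: "t \<in> {0..T}" for n t
  proof -
    have cm: "Borel (\<lambda>\<z>. cnj (S n t \<z>))" using Sm[OF t] by measurable
    have cf: "nrm 0 (cabs (\<lambda>\<z>. cnj (S n t \<z>))) < \<infinity>" using Sf[OF t] by simp
    note ip = L2_pairing(1)[OF Ym[OF t] cm Yf[OF t] cf]
    note i\<Delta> = L2_square_integrable[OF \<Delta>m[OF t] \<Delta>f[OF t]]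
    note iD = L2_square_integrable[OF Dm[OF t] Df[OF t]]
    have "2 * Re (\<integral>\<z>. Y n t \<z> * cnj (S n t \<z>) \<partial>lborel) = (\<integral>\<z>. 2 * Re (Y n t \<z> * cnj (S n t \<z>)) \<partial>lborel)"
      using integral_Re[OF ip] by (simp only: integral_mult_right_zero)
    also have "\<dots> \<le> (\<integral>\<z>. (cmod (\<Delta> t \<z>))\<^sup>2 + (cmod (D t \<z>))\<^sup>2 \<partial>lborel)"
    proof (rule integral_mono_AE)
      show "integrable lborel (\<lambda>\<z>. 2 * Re (Y n t \<z> * cnj (S n t \<z>)))" by (intro integrable_mult_right integrable_Re ip)
      show "integrable lborel (\<lambda>\<z>. (cmod (\<Delta> t \<z>))\<^sup>2 + (cmod (D t \<z>))\<^sup>2)" by (intro Bochner_Integration.integrable_add i\<Delta> iD)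
      show "AE \<z> in lborel. 2 * Re (Y n t \<z> * cnj (S n t \<z>)) \<le> (cmod (\<Delta> t \<z>))\<^sup>2 + (cmod (D t \<z>))\<^sup>2"
        using VW[OF t]
      proof eventually_elim
        case (elim \<z>)
        have skew: "Re ((- \<i> * complex_of_real (phi \<gamma> \<z>) * D t \<z> + \<Delta> t \<z>) * cnj (D t \<z>)) = Re (\<Delta> t \<z> * cnj (D t \<z>))"
          by (simp add: algebra_simps)
        have "Re (\<Delta> t \<z> * cnj (D t \<z>)) \<le> cmod (\<Delta> t \<z>) * cmod (D t \<z>)"
          using complex_Re_le_cmod[of "\<Delta> t \<z> * cnj (D t \<z>)"] by (simp add: norm_mult)
        moreover have "2 * (cmod (\<Delta> t \<z>) * cmod (D t \<z>)) \<le> (cmod (\<Delta> t \<z>))\<^sup>2 + (cmod (D t \<z>))\<^sup>2"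
          using sum_squares_bound[of "cmod (\<Delta> t \<z>)" "cmod (D t \<z>)"] by simp
        ultimately have 1: "2 * Re ((V t \<z> - W t \<z>) * cnj (D t \<z>)) \<le> (cmod (\<Delta> t \<z>))\<^sup>2 + (cmod (D t \<z>))\<^sup>2"
          unfolding elim skew by linarith
        show ?case
        proof (cases "\<z> \<in> ball 0 (real n)")
          case True
          then show ?thesis using 1 by (simp only: Y_def S_def indicator_simps mult_1)
        next
          case False
          then show ?thesis by (simp only: Y_def S_def indicator_simps) simp
        qed
      qed
    qed
    also have "\<dots> = (\<integral>\<z>. (cmod (\<Delta> t \<z>))\<^sup>2 \<partial>lborel) + (\<integral>\<z>. (cmod (D t \<z>))\<^sup>2 \<partial>lborel)"
      by (rule Bochner_Integration.integral_add[OF i\<Delta>(1) iD(1)])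
    also have "(\<integral>\<z>. (cmod (\<Delta> t \<z>))\<^sup>2 \<partial>lborel) \<le> C * (\<integral>\<z>. (cmod (D t \<z>))\<^sup>2 \<partial>lborel)"
    proof -
      have n: "0 \<le> (\<integral>\<z>. (cmod (D t \<z>))\<^sup>2 \<partial>lborel)" by (rule Bochner_Integration.integral_nonneg) simp
      have "ennreal (\<integral>\<z>. (cmod (\<Delta> t \<z>))\<^sup>2 \<partial>lborel) \<le> ennreal (C * (\<integral>\<z>. (cmod (D t \<z>))\<^sup>2 \<partial>lborel))"
        using \<Delta>D[OF t] unfolding i\<Delta>(2)[symmetric] iD(2)[symmetric] using C(1) n by (simp only: ennreal_mult less_imp_le)
      then show ?thesis using C(1) n by (subst (asm) ennreal_le_iff) auto
    qed
    finally show ?thesis by (simp add: E'_def K_def algebra_simps)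
  qed
  have zero: "0 \<in> {0..T}" using T by simp
  \<comment> \<open>The solutions agree with \<open>u0\<close> initially only up to null sets in
    space, but \<open>ft\<close> then returns identical functions.\<close>
  have D0: "D 0 \<z> = 0" for \<z>
  proof -
    have m: "Borel u0" "Borel (u 0)" "Borel (v 0)"
      using u0 is_l2_ft_sq_integrable[OF lu[OF zero]] is_l2_ft_sq_integrable[OF lv[OF zero]] by (auto simp: sq_integrable_def)
    have "ft (u 0) = ft u0" "ft (v 0) = ft u0"
      by (rule ft_cong_AE[OF m(2,1) is_solD(4)[OF u zero]], rule ft_cong_AE[OF m(3,1) is_solD(4)[OF v zero]])
    then show ?thesis by (simp add: D_def F_def G_def)
  qed
  \<comment> \<open>The induction hypothesis at all times enters the derivative of each local
    energy; \<open>energy_comparison\<close> gains the factor 1/2, and \<open>nrm_exhaust\<close>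
    returns to the full energy. The induction starts from the boundedness of both solutions.\<close>
  have halving: "nrm 0 (cabs (D t)) \<le> ennreal (4 * M / 2 ^ n * exp (2 * K * t))" if "t \<in> {0..T}" for n t
    using that
  proof (induction n arbitrary: t)
    case 0
    have "4 * M * 1 \<le> 4 * M * exp (2 * K * t)" using 0 K M0 by (intro mult_left_mono) auto
    then show ?case by (intro order_trans[OF Dbd[OF 0]] ennreal_leI) simp
  next
    case (Suc n)
    define B where "B = 4 * M / 2 ^ n"
    have B: "0 \<le> B" using M0 by (simp add: B_def)
    have IH: "(\<integral>\<z>. (cmod (D \<tau> \<z>))\<^sup>2 \<partial>lborel) \<le> B * exp (2 * K * \<tau>)" if \<tau>: "\<tau> \<in> {0..T}" for \<tau>
      using Suc.IH[OF \<tau>] B unfolding L2_square_integrable(2)[OF Dm[OF \<tau>] Df[OF \<tau>], symmetric] B_def[symmetric]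
      by (subst (asm) ennreal_le_iff) auto
    have "E m t \<le> B / 2 * exp (2 * K * t)" for m
    proof (rule energy_comparison[OF dE _ _ B Suc.prems])
      show "E' m \<tau> \<le> K * (B * exp (2 * K * \<tau>))" if \<tau>: "\<tau> \<in> {0..T}" for \<tau>
        using E'_le[OF \<tau>, of m] mult_left_mono[OF IH[OF \<tau>], of K] K by linarith
      show "E m 0 = 0" by (simp add: E_def S_def D0)
    qed
    then have "nrm 0 (cabs (S m t)) \<le> ennreal (B / 2 * exp (2 * K * t))" for m
      unfolding L2_square_integrable(2)[OF Sm[OF Suc.prems] Sf[OF Suc.prems], symmetric] E_def[symmetric] by (intro ennreal_leI)
    then have bd: "nrm 0 (\<lambda>\<z>. indicator (ball 0 (real m)) \<z> * cabs (D t) \<z>) \<le> ennreal (B / 2 * exp (2 * K * t))" for m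
      unfolding S_def[abs_def] ci .
    have "Borel (cabs (D t))" using Dm[OF Suc.prems] by measurable
    then have "nrm 0 (cabs (D t)) \<le> ennreal (B / 2 * exp (2 * K * t))" using bd by (rule nrm_exhaust)
    then show ?case by (simp add: B_def mult.commute)
  qed
  have N0: "nrm 0 (cabs (D t)) = 0"
    by (rule ennreal_halving_zero[of _ "4 * M * exp (2 * K * t)"]) (use halving[OF t] in \<open>simp add: mult.commute\<close>)
  have "wdist2 0 (G t) (F t) = nrm 0 (cabs (D t))"
    by (simp add: wdist2_eq_nrm D_def norm_minus_commute)
  then have "wdist2 0 (G t) (F t) = 0" using N0 by simp
  then have "AE \<z> in lborel. G t \<z> = F t \<z>" by (rule wdist2_eq_0[OF Gm[OF t] Fm[OF t]])
  then show ?thesis by (rule ft_eq_imp_AE_eq[OF lv[OF t] lu[OF t]])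
qed

end

section \<open>Well-posedness\<close>

lemma is_l2_ft_sym_ft: "sq_integrable f \<Longrightarrow> is_l2_ft f (sym_ft f)"
  by (rule is_l2_ft_cong_AE[OF ft_is_l2_ft sym_ft_measurable], assumption, assumption)
    (drule sym_ft_AE, erule eventually_mono, simp)

lemma xnrm_cabs_add_le:
  assumes [measurable]: "Borel F" "Borel G"
  shows "xnrm s (cabs (\<lambda>\<z>. F \<z> + G \<z>)) \<le> 2 * xnrm s (cabs F) + 2 * xnrm s (cabs G)"
proof -
  have "dxinv_dy (\<lambda>\<z>. F \<z> + G \<z>) = (\<lambda>\<z>. dxinv_dy F \<z> + dxinv_dy G \<z>)"
    by (rule ext) (simp add: dxinv_dy_def distrib_left)
  then show ?thesis unfolding xnrm_cabs by (simp only:) (rule nrm_cabs_add_le, measurable)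
qed

lemma xnrm_mono: "(\<And>\<z>. A \<z> \<le> B \<z>) \<Longrightarrow> xnrm s A \<le> xnrm s B"
  unfolding xnrm_def Zw_def by (intro nrm_mono mult_left_mono) auto

context bbm_kp begin

text \<open>Continuous dependence is claimed for an arbitrary solution \<open>u\<close> with
  derivative \<open>V\<close>. Uniqueness replaces it by the constructed one, to which the Lipschitz
  estimate applies.\<close>

lemma sol_representation:
  assumes T: "0 < T" and a: "is_l2_ft a ah" and u0: "sq_integrable u0"
    and u: "is_sol s p \<gamma> a u0 T u V" and w: "is_sol s p \<gamma> a u0 T (\<lambda>t. inv_ft (\<mu> t)) W"
    and l2: "\<And>t. t \<in> {0..T} \<Longrightarrow> is_l2_ft (inv_ft (\<mu> t)) (\<mu> t)" and t: "t \<in> {0..T}"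
  shows "is_l2_ft (u t) (\<mu> t)" and "AE \<z> in lborel. V t \<z> = rhsf (\<mu> t) \<z>"
proof -
  have sq: "sq_integrable (u t)" using is_solD(1)[OF u t] by (simp add: in_Xs_def)
  have "ft (u t) = ft (inv_ft (\<mu> t))"
    using sq is_l2_ft_sq_integrable[OF l2[OF t]] sol_unique[OF T a u0 w u t] by (intro ft_cong_AE) (auto simp: sq_integrable_def)
  then have "AE \<z> in lborel. ft (u t) \<z> = \<mu> t \<z>" using ft_unique[OF l2[OF t]] by simp
  then show l: "is_l2_ft (u t) (\<mu> t)"
    by (rule is_l2_ft_cong_AE[OF ft_is_l2_ft[OF sq] is_l2_ft_measurable[OF l2[OF t]]])
  have "nrm s (cabs (\<mu> t)) < \<infinity>" using is_solD(1)[OF u t] by (simp add: in_Xs_iff[OF l])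
  from is_solD(5)[OF u t] eq_rhs_AE[OF a l this] show "AE \<z> in lborel. V t \<z> = rhsf (\<mu> t) \<z>"
    by eventually_elim simp
qed

text \<open>The interval is chosen for a ball of data around \<open>u0\<close>, so perturbed data
  have solutions on the same interval and the Lipschitz estimate compares them there.\<close>

lemma local_well_posedness:
  assumes a: "is_l2_ft a ah" and ahh: "\<And>\<z>. ah (- \<z>) = cnj (ah \<z>)" and u0: "in_Xs s u0"
  shows "\<exists>T>0.
    (\<exists>u V. is_sol s p \<gamma> a u0 T u V) \<and>
    (\<forall>u V v W. is_sol s p \<gamma> a u0 T u V \<longrightarrow> is_sol s p \<gamma> a u0 T v W \<longrightarrow>
        (\<forall>t\<in>{0..T}. AE x in lborel. v t x = u t x)) \<and>
    (\<forall>u V. is_sol s p \<gamma> a u0 T u V \<longrightarrow>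
       (\<forall>\<epsilon>>0. \<exists>\<delta>>0. \<forall>v0. in_Xs s v0 \<and> xs_dist2 s v0 u0 < ennreal \<delta> \<longrightarrow>
          (\<exists>v W. is_sol s p \<gamma> a v0 T v W \<and>
             (\<forall>t\<in>{0..T}. xs_dist2 s (v t) (u t) < ennreal \<epsilon> \<and>
                          wdist2 (s - 2) (W t) (V t) < ennreal \<epsilon>))))"
proof -
  define h where "h = sym_ft u0"
  have sq: "sq_integrable u0" using u0 by (simp add: in_Xs_def)
  have lh: "is_l2_ft u0 h" unfolding h_def by (rule is_l2_ft_sym_ft[OF sq])
  have hm: "Borel h" by (rule is_l2_ft_measurable[OF lh])
  have hfin: "nrm s (cabs h) < \<infinity>" "xnrm s (cabs h) < \<infinity>" using u0 in_Xs_iff[OF lh] by auto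
  obtain n0 where n0: "nrm s (cabs h) = ennreal n0" "0 \<le> n0" using hfin by (cases "nrm s (cabs h)") auto
  obtain x0 where x0: "xnrm s (cabs h) = ennreal x0" "0 \<le> x0" using hfin by (cases "xnrm s (cabs h)") auto
  \<comment> \<open>Data at squared distance at most 1 from \<open>u0\<close> have squared norms at
    most 2 plus twice those of \<open>u0\<close>, so one pair of constants covers them all.\<close>
  define M0 X0 where "M0 = 2 + 2 * n0" and "X0 = 2 + 2 * x0"
  have M0: "0 \<le> M0" "ennreal M0 = 2 * 1 + 2 * nrm s (cabs h)" using n0 by (simp_all add: M0_def ennreal_mult)
  have X0: "0 \<le> X0" "ennreal X0 = 2 * 1 + 2 * xnrm s (cabs h)" using x0 by (simp_all add: X0_def ennreal_mult)
  show ?thesis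
  proof (rule fourier_sol_exists[OF M0(1) X0(1)])
    fix T M C :: real assume T: "0 < T" and C: "0 \<le> C" and
      ex: "\<And>h. Borel h \<Longrightarrow> nrm s (cabs h) \<le> ennreal M0 \<Longrightarrow> xnrm s (cabs h) \<le> ennreal X0 \<Longrightarrow>
        (\<And>\<z>. h (- \<z>) = cnj (h \<z>)) \<Longrightarrow> (\<And>\<z>. ah (- \<z>) = cnj (ah \<z>)) \<Longrightarrow>
        \<exists>u. fourier_sol T h u \<and> nrm s (env T u) \<le> ennreal M \<and> (\<forall>t\<in>{0..T}. \<forall>\<z>. u t (- \<z>) = cnj (u t \<z>))" and
      dep: "\<And>h k u v. fourier_sol T h u \<Longrightarrow> fourier_sol T k v \<Longrightarrow> nrm s (env T u) \<le> ennreal M \<Longrightarrow> nrm s (env T v) \<le> ennreal M \<Longrightarrow>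
        nrm s (env T (\<lambda>t \<z>. u t \<z> - v t \<z>)) + xnrm s (env T (\<lambda>t \<z>. u t \<z> - v t \<z>))
          + nrm (s - 2) (env T (\<lambda>t \<z>. rhsf (u t) \<z> - rhsf (v t) \<z>))
        \<le> ennreal C * (nrm s (cabs (\<lambda>\<z>. h \<z> - k \<z>)) + xnrm s (cabs (\<lambda>\<z>. h \<z> - k \<z>)))" and
      xf: "\<And>h u. fourier_sol T h u \<Longrightarrow> xnrm s (cabs h) < \<infinity> \<Longrightarrow> xnrm s (env T u) < \<infinity>"
    have core: "\<exists>\<mu>. fourier_sol T (sym_ft w) \<mu> \<and> nrm s (env T \<mu>) \<le> ennreal M \<and>
        is_sol s p \<gamma> a w T (\<lambda>t. inv_ft (\<mu> t)) (\<lambda>t. rhsf (\<mu> t)) \<and> (\<forall>t\<in>{0..T}. is_l2_ft (inv_ft (\<mu> t)) (\<mu> t))"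
      if w: "sq_integrable w" and wM: "nrm s (cabs (sym_ft w)) \<le> ennreal M0" and wX: "xnrm s (cabs (sym_ft w)) \<le> ennreal X0" for w
    proof -
      obtain \<mu> where \<mu>: "fourier_sol T (sym_ft w) \<mu>" "nrm s (env T \<mu>) \<le> ennreal M" "\<And>t \<z>. t \<in> {0..T} \<Longrightarrow> \<mu> t (- \<z>) = cnj (\<mu> t \<z>)"
        using ex[OF sym_ft_measurable[OF w] wM wX sym_ft_hermitian ahh] by blast
      have "xnrm s (cabs (sym_ft w)) < \<infinity>" using order.strict_trans1[OF wX] by simp
      then have fx: "xnrm s (env T \<mu>) < \<infinity>" by (rule xf[OF \<mu>(1)])
      show ?thesis using \<mu>(1,2) fourier_sol_is_sol[OF T \<mu>(1) fx \<mu>(3) a is_l2_ft_sym_ft[OF w]] by blast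
    qed
    have le_self: "x \<le> 2 * 1 + 2 * x" for x :: ennreal
    proof -
      have "x \<le> x + x" by simp
      then show ?thesis by (simp add: mult_2 add_increasing)
    qed
    have hM: "nrm s (cabs (sym_ft u0)) \<le> ennreal M0" "xnrm s (cabs (sym_ft u0)) \<le> ennreal X0"
      unfolding M0(2) X0(2) h_def[symmetric] by (rule le_self)+
    obtain \<mu> where \<mu>: "fourier_sol T h \<mu>" "nrm s (env T \<mu>) \<le> ennreal M"
      "is_sol s p \<gamma> a u0 T (\<lambda>t. inv_ft (\<mu> t)) (\<lambda>t. rhsf (\<mu> t))" "\<And>t. t \<in> {0..T} \<Longrightarrow> is_l2_ft (inv_ft (\<mu> t)) (\<mu> t)"
      using core[OF sq hM] unfolding h_def[symmetric] by blast
    show ?thesis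
    proof (intro exI[of _ T] conjI T)
      show "\<exists>u V. is_sol s p \<gamma> a u0 T u V" using \<mu>(3) by blast
      show "\<forall>u V v W. is_sol s p \<gamma> a u0 T u V \<longrightarrow> is_sol s p \<gamma> a u0 T v W \<longrightarrow> (\<forall>t\<in>{0..T}. AE x in lborel. v t x = u t x)"
        using sol_unique[OF T a sq] by blast
      show "\<forall>u V. is_sol s p \<gamma> a u0 T u V \<longrightarrow>
         (\<forall>\<epsilon>>0. \<exists>\<delta>>0. \<forall>v0. in_Xs s v0 \<and> xs_dist2 s v0 u0 < ennreal \<delta> \<longrightarrow>
            (\<exists>v W. is_sol s p \<gamma> a v0 T v W \<and>
               (\<forall>t\<in>{0..T}. xs_dist2 s (v t) (u t) < ennreal \<epsilon> \<and> wdist2 (s - 2) (W t) (V t) < ennreal \<epsilon>)))"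
      proof (intro allI impI)
        fix u V and \<epsilon> :: real
        assume u: "is_sol s p \<gamma> a u0 T u V" and \<epsilon>: "0 < \<epsilon>"
        \<comment> \<open>\<open>\<delta> \<le> 1\<close> keeps \<open>v0\<close> among the data for
          which \<open>T\<close> was chosen. The denominator \<open>C + 1\<close> admits
          \<open>C = 0\<close> and makes \<open>C * \<delta> < \<epsilon>\<close> strict.\<close>
        define \<delta> where "\<delta> = min 1 (\<epsilon> / (C + 1))"
        have \<delta>: "0 < \<delta>" "\<delta> \<le> 1" using \<epsilon> C by (auto simp: \<delta>_def)
        have C\<delta>: "C * \<delta> < \<epsilon>"
        proof -
          have "C * \<delta> \<le> C * (\<epsilon> / (C + 1))" using C by (intro mult_left_mono) (auto simp: \<delta>_def)
          also have "\<dots> < \<epsilon>" using C \<epsilon> by (simp add: field_simps)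
          finally show ?thesis .
        qed
        show "\<exists>\<delta>>0. \<forall>v0. in_Xs s v0 \<and> xs_dist2 s v0 u0 < ennreal \<delta> \<longrightarrow>
            (\<exists>v W. is_sol s p \<gamma> a v0 T v W \<and>
               (\<forall>t\<in>{0..T}. xs_dist2 s (v t) (u t) < ennreal \<epsilon> \<and> wdist2 (s - 2) (W t) (V t) < ennreal \<epsilon>))"
        proof (intro exI[of _ \<delta>] conjI \<delta>(1) allI impI)
          fix v0 assume v0: "in_Xs s v0 \<and> xs_dist2 s v0 u0 < ennreal \<delta>"
          define k where "k = sym_ft v0"
          have sqv: "sq_integrable v0" using v0 by (simp add: in_Xs_def)
          have lk: "is_l2_ft v0 k" unfolding k_def by (rule is_l2_ft_sym_ft[OF sqv])
          have km: "Borel k" by (rule is_l2_ft_measurable[OF lk])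
          define d where "d = nrm s (cabs (\<lambda>\<z>. k \<z> - h \<z>)) + xnrm s (cabs (\<lambda>\<z>. k \<z> - h \<z>))"
          have d: "d < ennreal \<delta>" using v0 unfolding d_def xs_dist2_eq[OF lk lh, symmetric] by blast
          then have "d < ennreal 1" using ennreal_leI[OF \<delta>(2)] by (rule order.strict_trans2)
          then have d1: "d \<le> 1" by simp
          have dm: "Borel (\<lambda>\<z>. k \<z> - h \<z>)" by (intro borel_measurable_diff km hm)
          have "nrm s (cabs k) \<le> 2 * nrm s (cabs (\<lambda>\<z>. k \<z> - h \<z>)) + 2 * nrm s (cabs h)"
            using nrm_cabs_add_le[OF dm hm] by simp
          also have "\<dots> \<le> ennreal M0" unfolding M0(2)
            using d1 by (intro add_mono mult_left_mono order_refl) (auto simp: d_def intro: order_trans[rotated])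
          finally have kM: "nrm s (cabs (sym_ft v0)) \<le> ennreal M0" by (simp add: k_def)
          have "xnrm s (cabs k) \<le> 2 * xnrm s (cabs (\<lambda>\<z>. k \<z> - h \<z>)) + 2 * xnrm s (cabs h)"
            using xnrm_cabs_add_le[OF dm hm] by simp
          also have "\<dots> \<le> ennreal X0" unfolding X0(2)
            using d1 by (intro add_mono mult_left_mono order_refl) (auto simp: d_def intro: order_trans[rotated])
          finally have kX: "xnrm s (cabs (sym_ft v0)) \<le> ennreal X0" by (simp add: k_def)
          obtain \<nu> where \<nu>: "fourier_sol T k \<nu>" "nrm s (env T \<nu>) \<le> ennreal M"
            "is_sol s p \<gamma> a v0 T (\<lambda>t. inv_ft (\<nu> t)) (\<lambda>t. rhsf (\<nu> t))" "\<And>t. t \<in> {0..T} \<Longrightarrow> is_l2_ft (inv_ft (\<nu> t)) (\<nu> t)"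
            using core[OF sqv kM kX] unfolding k_def[symmetric] by blast
          define e where "e = nrm s (env T (\<lambda>t \<z>. \<nu> t \<z> - \<mu> t \<z>)) + xnrm s (env T (\<lambda>t \<z>. \<nu> t \<z> - \<mu> t \<z>))"
          define e' where "e' = nrm (s - 2) (env T (\<lambda>t \<z>. rhsf (\<nu> t) \<z> - rhsf (\<mu> t) \<z>))"
          have "e + e' \<le> ennreal C * d" using dep[OF \<nu>(1) \<mu>(1) \<nu>(2) \<mu>(2)] by (simp add: e_def e'_def d_def)
          also have "\<dots> \<le> ennreal C * ennreal \<delta>" by (rule mult_left_mono[OF less_imp_le[OF d]]) simp
          also have "\<dots> = ennreal (C * \<delta>)" using C \<delta> by (simp add: ennreal_mult)
          also have "\<dots> < ennreal \<epsilon>" using C\<delta> \<epsilon> by (rule ennreal_lessI[rotated])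
          finally have ee: "e + e' < ennreal \<epsilon>" .
          have e: "e < ennreal \<epsilon>" by (rule order.strict_trans1[OF _ ee]) simp
          have e': "e' < ennreal \<epsilon>" by (rule order.strict_trans1[OF _ ee]) simp
          have "xs_dist2 s (inv_ft (\<nu> t)) (u t) < ennreal \<epsilon> \<and> wdist2 (s - 2) (rhsf (\<nu> t)) (V t) < ennreal \<epsilon>" if t: "t \<in> {0..T}" for t
          proof
            have rep: "is_l2_ft (u t) (\<mu> t)" "AE \<z> in lborel. V t \<z> = rhsf (\<mu> t) \<z>"
              by (rule sol_representation[OF T a sq u \<mu>(3) _ t]; erule \<mu>(4))+
            have "xs_dist2 s (inv_ft (\<nu> t)) (u t) \<le> e"
              unfolding xs_dist2_eq[OF \<nu>(4)[OF t] rep(1)] e_def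
              by (intro add_mono nrm_mono xnrm_mono env_upper[OF t, of "\<lambda>t \<z>. \<nu> t \<z> - \<mu> t \<z>"])
            then show "xs_dist2 s (inv_ft (\<nu> t)) (u t) < ennreal \<epsilon>" using e by (rule order.strict_trans1)
            have "wdist2 (s - 2) (rhsf (\<nu> t)) (V t) \<le> e'"
              unfolding wdist2_eq_nrm e'_def
            proof (rule nrm_mono_AE)
              show "AE \<z> in lborel. ennreal (cmod (rhsf (\<nu> t) \<z> - V t \<z>)) \<le> env T (\<lambda>t \<z>. rhsf (\<nu> t) \<z> - rhsf (\<mu> t) \<z>) \<z>"
                using rep(2)
              proof eventually_elim
                case (elim \<z>)
                show ?case unfolding elim by (rule env_upper[OF t, of "\<lambda>t \<z>. rhsf (\<nu> t) \<z> - rhsf (\<mu> t) \<z>"])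
              qed
            qed
            then show "wdist2 (s - 2) (rhsf (\<nu> t)) (V t) < ennreal \<epsilon>" using e' by (rule order.strict_trans1)
          qed
          with \<nu>(3) show "\<exists>v W. is_sol s p \<gamma> a v0 T v W \<and>
               (\<forall>t\<in>{0..T}. xs_dist2 s (v t) (u t) < ennreal \<epsilon> \<and> wdist2 (s - 2) (W t) (V t) < ennreal \<epsilon>)" by blast
        qed
      qed
    qed
  qed
qed

end

theorem theorem2p4:
  fixes s \<gamma> :: real and p :: nat and a u0 :: "real \<times> real \<Rightarrow> real"
  assumes "s > 3/2" and "p \<ge> 1" and "\<gamma> = 1 \<or> \<gamma> = -1"
    and "in_Hs s a" and "in_Xs s u0"
  shows "\<exists>T>0.
    (\<exists>u V. is_sol s p \<gamma> a u0 T u V) \<and>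
    (\<forall>u V v W. is_sol s p \<gamma> a u0 T u V \<longrightarrow> is_sol s p \<gamma> a u0 T v W \<longrightarrow>
        (\<forall>t\<in>{0..T}. AE x in lborel. v t x = u t x)) \<and>
    (\<forall>u V. is_sol s p \<gamma> a u0 T u V \<longrightarrow>
       (\<forall>\<epsilon>>0. \<exists>\<delta>>0. \<forall>v0. in_Xs s v0 \<and> xs_dist2 s v0 u0 < ennreal \<delta> \<longrightarrow>
          (\<exists>v W. is_sol s p \<gamma> a v0 T v W \<and>
             (\<forall>t\<in>{0..T}. xs_dist2 s (v t) (u t) < ennreal \<epsilon> \<and>
                          wdist2 (s - 2) (W t) (V t) < ennreal \<epsilon>))))"
proof -
  have la: "is_l2_ft a (sym_ft a)" using assms(4) by (intro is_l2_ft_sym_ft) (simp add: in_Hs_def)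
  \<comment> \<open>Among the representatives of the transform of \<open>a\<close>,
    \<open>sym_ft a\<close> is Hermitian at every frequency, as the construction of real solutions
    demands.\<close>
  interpret bbm_kp s \<gamma> p "sym_ft a"
    using assms(1-4) is_l2_ft_measurable[OF la] in_Hs_iff[OF la] by unfold_locales auto
  show ?thesis by (rule local_well_posedness[OF la sym_ft_hermitian assms(5)])
qed

end
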